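(* Let $n$ be a power of two, and let $M^{n}$ and $M^{2n}$ be the small cover ($d=1$) and the quasitoric manifold ($d=2$) over a properly $n$-colored simple polytope $P^n$ constructed from the characteristic pair $(P^n,\Lambda)$ described in the context. Then $$N(M^{n})\geq 4n-1,\qquad N(M^{2n})\geq 8n-3 .$$
   Context: Totally skew embeddings: a smooth manifold $M$ is totally skew embedded in $\mathbb{R}^N$ if it is smoothly embedded and any two tangent lines at different points of $M$ are skew lines in $\mathbb{R}^N$ (neither intersecting nor parallel). $N(M)$ denotes the smallest dimension $N$ of a Euclidean space for which there is a totally skew embedding of $M$ in $\mathbb{R}^N$. Construction of $M^{dn}$, $d=1,2$. Let $R_1=\mathbb{Z}_2$, $R_2=\mathbb{Z}$, $G_1=S^0=\{\pm1\}$, $G_2=S^1\subset\mathbb{C}$. Let $P^n$ be a simple $n$-polytope (exactly $n$ facets meet at each vertex) with a proper coloring $h$ of its facets $F_1,\dots,F_m$ in $n$ colors, i.e. $h:\{F_1,\dots,F_m\}\to\{1,\dots,n\}$ and $h(F)\ne h(F')$ for distinct intersecting facets. Put $\mathcal{F}_i=h^{-1}(i)$. Fix a vertex $V=H_1\cap\cdots\cap H_n$ with $h(H_i)=i$. Assign to $H_i$ the vector $\lambda_{H_i}=(0,\dots,0,1,\dots,1)^t\in R_d^n$ with $i-1$ zeros followed by $n-i+1$ ones, and to every $F\in\mathcal{F}_i\setminus\{H_i\}$ the $i$-th standard basis vector $\lambda_F=e_i\in R_d^n$. Let $\Lambda$ be the matrix whose columns are these vectors. For $\lambda=(\lambda_1,\dots,\lambda_n)$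 let $G_\lambda=\{(1,\dots,1),((-1)^{\lambda_1},\dots,(-1)^{\lambda_n})\}$ if $d=1$ and $G_\lambda=\{(e^{2\pi i\lambda_1 t},\dots,e^{2\pi i\lambda_n t}): t\in\mathbb{R}\}$ if $d=2$. For $q\in P^n$ let $G(q)\subset G_d^n$ be the subgroup generated by the $G_{\lambda_F}$ for the facets $F$ containing $q$. Then $M^{dn}=M(P^n,\Lambda)=G_d^n\times P^n/\sim$, where $(t_1,p)\sim(t_2,q)$ iff $p=q$ and $t_1t_2^{-1}\in G(q)$. It is a smooth closed $dn$-manifold with locally standard $G_d^n$-action (locally modelled, up to an automorphism of $G_d^n$, on the coordinatewise action on $\mathbb{R}^n$ for $d=1$, $\mathbb{C}^n$ for $d=2$) and orbit space $P^n$, determined by $(P^n,\Lambda)$ up to weakly equivariant diffeomorphism; it is a small cover over $P^n$ if $d=1$ and a quasitoric manifold over $P^n$ if $d=2$. *)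

theory Defs
  imports "HOL-Analysis.Analysis" "HOL-Algebra.Generated_Groups" "HOL-Library.Extended_Nat"
begin

section \<open>Smooth maps on open subsets of a Euclidean space\<close>

text \<open>
  On an open subset of a finite-dimensional space, being of class \<open>C\<^sup>k\<close> amounts to differentiability
  with all directional derivatives of class \<open>C\<^sup>k\<^sup>-\<^sup>1\<close>.
\<close>

fun Ck_on :: "nat \<Rightarrow> ('e::euclidean_space \<Rightarrow> real) \<Rightarrow> 'e set \<Rightarrow> bool" where
  "Ck_on 0 g S \<longleftrightarrow> continuous_on S g"
| "Ck_on (Suc k) g S \<longleftrightarrow> (\<forall>x\<in>S. g differentiable (at x)) \<and>
     (\<forall>v. Ck_on k (\<lambda>x. frechet_derivative g (at x) v) S)"

definition smooth_on :: "('e::euclidean_space \<Rightarrow> real) \<Rightarrow> 'e set \<Rightarrow> bool" where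
  "smooth_on g S \<longleftrightarrow> (\<forall>k. Ck_on k g S)"


section \<open>Totally skew embeddings\<close>

text \<open>
  A chart is a pair \<open>(U, \<phi>)\<close> of a coordinate domain and a coordinate map, and a smooth structure is
  given by an atlas of such pairs.  The target \<open>\<real>\<^sup>N\<close> is \<^term>\<open>Euclidean_space N\<close>, the sequences
  vanishing from index \<open>N\<close> on, so that \<open>N\<close> may be quantified over.
\<close>

type_synonym ('m, 'e) chart = "'m set \<times> ('m \<Rightarrow> 'e)"

definition chart_expr :: "('m, 'e) chart \<Rightarrow> ('m \<Rightarrow> nat \<Rightarrow> real) \<Rightarrow> nat \<Rightarrow> 'e \<Rightarrow> real" where
  "chart_expr c f i = (\<lambda>z. f (inv_into (fst c) (snd c) z) i)"

definition chart_deriv ::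
    "('m, 'e::euclidean_space) chart \<Rightarrow> ('m \<Rightarrow> nat \<Rightarrow> real) \<Rightarrow> 'm \<Rightarrow> 'e \<Rightarrow> nat \<Rightarrow> real" where
  "chart_deriv c f x v = (\<lambda>i. frechet_derivative (chart_expr c f i) (at (snd c x)) v)"

definition smooth_embedding ::
    "'m topology \<Rightarrow> ('m, 'e::euclidean_space) chart set \<Rightarrow> nat \<Rightarrow> ('m \<Rightarrow> nat \<Rightarrow> real) \<Rightarrow> bool" where
  "smooth_embedding X \<A> N f \<longleftrightarrow>
     embedding_map X (Euclidean_space N) f \<and>
     (\<forall>c\<in>\<A>. (\<forall>i<N. smooth_on (chart_expr c f i) (snd c ` fst c)) \<and>
            (\<forall>x\<in>fst c. inj (chart_deriv c f x)))"

definition tangent_space ::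
    "('m, 'e::euclidean_space) chart set \<Rightarrow> ('m \<Rightarrow> nat \<Rightarrow> real) \<Rightarrow> 'm \<Rightarrow> (nat \<Rightarrow> real) set" where
  "tangent_space \<A> f x = (\<Union>c\<in>{c\<in>\<A>. x \<in> fst c}. range (chart_deriv c f x))"

definition affine_line :: "(nat \<Rightarrow> real) \<Rightarrow> (nat \<Rightarrow> real) \<Rightarrow> (nat \<Rightarrow> real) set" where
  "affine_line p u = range (\<lambda>r. (\<lambda>i. p i + r * u i))"

text \<open>For nonzero \<open>u\<close> and \<open>w\<close>, these are the lines through \<open>p\<close> and \<open>q\<close> in the directions \<open>u\<close> and \<open>w\<close>.\<close>

definition skew_lines ::
    "(nat \<Rightarrow> real) \<Rightarrow> (nat \<Rightarrow> real) \<Rightarrow> (nat \<Rightarrow> real) \<Rightarrow> (nat \<Rightarrow> real) \<Rightarrow> bool" where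
  "skew_lines p u q w \<longleftrightarrow>
     affine_line p u \<inter> affine_line q w = {} \<and> \<not> (\<exists>r. w = (\<lambda>i. r * u i))"

definition totally_skew_embedding ::
    "'m topology \<Rightarrow> ('m, 'e::euclidean_space) chart set \<Rightarrow> nat \<Rightarrow> ('m \<Rightarrow> nat \<Rightarrow> real) \<Rightarrow> bool" where
  "totally_skew_embedding X \<A> N f \<longleftrightarrow>
     smooth_embedding X \<A> N f \<and>
     (\<forall>x\<in>topspace X. \<forall>y\<in>topspace X. x \<noteq> y \<longrightarrow>
        (\<forall>u\<in>tangent_space \<A> f x - {\<lambda>i. 0}. \<forall>w\<in>tangent_space \<A> f y - {\<lambda>i. 0}.
           skew_lines (f x) u (f y) w))"

text \<open>The number \<open>N(M)\<close>; the value would be \<open>\<infinity>\<close> if there were no totally skew embedding at all.\<close>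

definition skew_dim :: "'m topology \<Rightarrow> ('m, 'e::euclidean_space) chart set \<Rightarrow> enat" where
  "skew_dim X \<A> = Inf {enat N |N. \<exists>f. totally_skew_embedding X \<A> N f}"


section \<open>Properly colored simple polytopes\<close>

definition simple_polytope :: "nat \<Rightarrow> 'a::euclidean_space set \<Rightarrow> bool" where
  "simple_polytope n P \<longleftrightarrow> polytope P \<and> aff_dim P = int n \<and>
     (\<forall>v. v extreme_point_of P \<longrightarrow> card {F. F facet_of P \<and> v \<in> F} = n)"

definition proper_coloring :: "'a::euclidean_space set \<Rightarrow> ('a set \<Rightarrow> 'c) \<Rightarrow> bool" where
  "proper_coloring P h \<longleftrightarrow>
     (\<forall>F F'. F facet_of P \<and> F' facet_of P \<and> F \<noteq> F' \<and> F \<inter> F' \<noteq> {} \<longrightarrow> h F \<noteq> h F')"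

text \<open>
  The finite linearly ordered index type \<open>'n\<close> stands for \<open>{1,\<dots>,n}\<close>.  The vectors have entries \<open>0\<close>
  and \<open>1\<close> only, so the same integer vectors serve as representatives for \<open>R\<^sub>1 = \<int>/2\<close> and
  \<open>R\<^sub>2 = \<int>\<close>.
\<close>

definition char_vector ::
    "('a set \<Rightarrow> 'n) \<Rightarrow> ('n \<Rightarrow> 'a set) \<Rightarrow> 'a set \<Rightarrow> int ^ 'n::{finite,linorder}" where
  "char_vector h H F =
     (if F = H (h F) then (\<chi> j. if h F \<le> j then 1 else 0) else axis (h F) 1)"


section \<open>The quotient of \<open>G\<^sup>n \<times> P\<close>\<close>

text \<open>
  The scalar type \<open>'k\<close> is \<^typ>\<open>real\<close> for \<open>d = 1\<close> and \<^typ>\<open>complex\<close> for \<open>d = 2\<close>.  In both cases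
  \<open>G\<^sub>d\<close> is the group of scalars of norm one.
\<close>

definition torus :: "('k::{real_normed_field,euclidean_space} ^ 'n::finite) monoid" where
  "torus = \<lparr>carrier = {t. \<forall>j. norm (t $ j) = 1}, monoid.mult = (*), one = 1\<rparr>"

lemma group_torus: "group (torus :: ('k::{real_normed_field,euclidean_space} ^ 'n::finite) monoid)"
proof (rule groupI)
  fix t :: "'k ^ 'n"
  assume t: "t \<in> carrier torus"
  then have "norm (t $ j) = 1" for j by (simp add: torus_def)
  then have "t $ j \<noteq> 0" for j by (metis norm_zero zero_neq_one)
  then show "\<exists>s\<in>carrier (torus :: ('k ^ 'n) monoid). s \<otimes>\<^bsub>torus\<^esub> t = \<one>\<^bsub>torus\<^esub>"
    using t by (intro bexI[of _ "\<chi> j. inverse (t $ j)"])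
      (auto simp: torus_def norm_inverse vec_eq_iff)
qed (auto simp: torus_def norm_mult mult.assoc)

definition circle_subgroup ::
    "int ^ 'n \<Rightarrow> ('k::{real_normed_field,euclidean_space} ^ 'n::finite) set" where
  "circle_subgroup l = {(\<chi> j. g powi (l $ j)) |g. norm g = 1}"

lemma circle_subgroup_real:
  "(circle_subgroup l :: (real ^ 'n) set) = {1, (\<chi> j. (- 1) powi (l $ j))}"
proof -
  have "norm g = 1 \<longleftrightarrow> g = 1 \<or> g = - 1" for g :: real by auto
  then have "(circle_subgroup l :: (real ^ 'n) set) =
      (\<lambda>g. (\<chi> j. g powi (l $ j))) ` {1, - 1}"
    unfolding circle_subgroup_def by blast
  then show ?thesis by (simp add: one_vec_def)
qed

lemma circle_subgroup_complex:
  "(circle_subgroup l :: (complex ^ 'n) set) =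
     range (\<lambda>t::real. (\<chi> j. exp (2 * of_real pi * \<i> * of_int (l $ j) * of_real t)))"
proof -
  have e: "exp (2 * of_real pi * \<i> * of_int (l $ j) * of_real t) =
      exp (2 * of_real pi * \<i> * of_real t) powi (l $ j)" for t :: real and j
    by (simp add: exp_power_int mult_ac)
  have "norm g = 1 \<longleftrightarrow> (\<exists>t::real. g = exp (2 * of_real pi * \<i> * of_real t))" for g :: complex
  proof
    assume "norm g = 1"
    then obtain a where "g = exp (\<i> * of_real a)"
      using complex_norm_eq_1_exp by metis
    then have "g = exp (2 * of_real pi * \<i> * of_real (a / (2 * pi)))" by simp
    then show "\<exists>t::real. g = exp (2 * of_real pi * \<i> * of_real t)" ..
  next
    assume "\<exists>t::real. g = exp (2 * of_real pi * \<i> * of_real t)"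
    then show "norm g = 1" by auto
  qed
  then show ?thesis unfolding circle_subgroup_def e by auto
qed

definition isotropy ::
    "'a::euclidean_space set \<Rightarrow> ('a set \<Rightarrow> int ^ 'n::finite) \<Rightarrow> 'a \<Rightarrow>
     ('k::{real_normed_field,euclidean_space} ^ 'n) set" where
  "isotropy P \<Lambda> q = generate torus (\<Union>F\<in>{F. F facet_of P \<and> q \<in> F}. circle_subgroup (\<Lambda> F))"

definition orbit_rel ::
    "'a::euclidean_space set \<Rightarrow> ('a set \<Rightarrow> int ^ 'n::finite) \<Rightarrow>
     (('k::{real_normed_field,euclidean_space} ^ 'n) \<times> 'a) rel" where
  "orbit_rel P \<Lambda> = {((t1, p), (t2, q)). t1 \<in> carrier torus \<and> t2 \<in> carrier torus \<and> p \<in> P \<and> q \<in> P \<and>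
     p = q \<and> t1 \<otimes>\<^bsub>torus\<^esub> inv\<^bsub>torus\<^esub> t2 \<in> isotropy P \<Lambda> q}"

definition quotient_topology :: "'b topology \<Rightarrow> ('b \<Rightarrow> 'c) \<Rightarrow> 'c topology" where
  "quotient_topology X f =
     topology (\<lambda>U. U \<subseteq> f ` topspace X \<and> openin X {x \<in> topspace X. f x \<in> U})"

lemma openin_quotient_topology:
  "openin (quotient_topology X f) U \<longleftrightarrow>
     U \<subseteq> f ` topspace X \<and> openin X {x \<in> topspace X. f x \<in> U}"
proof -
  have 1: "{x \<in> topspace X. f x \<in> S \<inter> T} =
      {x \<in> topspace X. f x \<in> S} \<inter> {x \<in> topspace X. f x \<in> T}" for S T by auto
  have 2: "{x \<in> topspace X. f x \<in> \<Union> K} = (\<Union>S\<in>K. {x \<in> topspace X. f x \<in> S})" for K by auto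
  have "istopology (\<lambda>U. U \<subseteq> f ` topspace X \<and> openin X {x \<in> topspace X. f x \<in> U})"
    unfolding istopology_def 1 2 by (auto intro!: openin_Int openin_Union)
  then show ?thesis by (simp add: quotient_topology_def)
qed

lemma quotient_map_quotient_topology: "quotient_map X (quotient_topology X f) f"
proof -
  have "{x \<in> topspace X. f x \<in> f ` topspace X} = topspace X" by auto
  then have "openin (quotient_topology X f) (f ` topspace X)"
    by (simp add: openin_quotient_topology)
  then have "topspace (quotient_topology X f) = f ` topspace X"
    by (metis openin_quotient_topology openin_subset openin_topspace subset_antisym)
  then show ?thesis by (simp add: quotient_map_def openin_quotient_topology)
qed

definition torus_quotient ::
    "'a::euclidean_space set \<Rightarrow> ('a set \<Rightarrow> int ^ 'n::finite) \<Rightarrow>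
     (('k::{real_normed_field,euclidean_space} ^ 'n) \<times> 'a) set topology" where
  "torus_quotient P \<Lambda> =
     quotient_topology (prod_topology (top_of_set (carrier torus)) (top_of_set P))
       (\<lambda>x. orbit_rel P \<Lambda> `` {x})"


section \<open>The smooth structure\<close>

definition facet_at :: "'a::euclidean_space set \<Rightarrow> ('a set \<Rightarrow> 'n) \<Rightarrow> 'a \<Rightarrow> 'n \<Rightarrow> 'a set" where
  "facet_at P h v i = (THE F. F facet_of P \<and> v \<in> F \<and> h F = i)"

text \<open>
  The columns are the characteristic vectors of the facets at \<open>v\<close>, indexed by color.
\<close>

definition vertex_matrix ::
    "'a::euclidean_space set \<Rightarrow> ('a set \<Rightarrow> 'n) \<Rightarrow> ('a set \<Rightarrow> int ^ 'n::finite) \<Rightarrow> 'a \<Rightarrow> int ^ 'n ^ 'n" where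
  "vertex_matrix P h \<Lambda> v = (\<chi> j i. \<Lambda> (facet_at P h v i) $ j)"

text \<open>
  The matrix \<open>A\<close> at the vertex \<open>v\<close> is unimodular.  The automorphism of \<open>G\<^sup>n\<close> with matrix \<open>A\<^sup>-\<^sup>1\<close>
  carries \<open>t\<close> to \<open>s\<close>, \<open>s\<^sub>i = \<Prod>\<^sub>j t\<^sub>j ^ (A\<^sup>-\<^sup>1)\<^sub>i\<^sub>j\<close>, and takes the subgroup attached to the facet
  \<open>F\<^sub>i\<close> at \<open>v\<close> to the \<open>i\<close>-th coordinate subgroup.  The point \<open>[t, p]\<close> gets the coordinates
  \<open>z\<^sub>i = s\<^sub>i * sqrt (l\<^sub>i p)\<close>, where \<open>l\<^sub>i\<close> is the distance to the hyperplane of \<open>F\<^sub>i\<close>, which is an affine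
  function on \<open>P\<close>.  Thus the orbit map is \<open>z \<mapsto> (\<bar>z\<^sub>1\<bar>\<^sup>2, \<dots>, \<bar>z\<^sub>n\<bar>\<^sup>2)\<close> in affine coordinates of \<open>P\<close>.  With
  the square root the coordinate changes are smooth; using \<open>l\<^sub>i\<close> itself they would not be.
\<close>

definition chart_coords ::
    "'a::euclidean_space set \<Rightarrow> ('a set \<Rightarrow> 'n) \<Rightarrow> ('a set \<Rightarrow> int ^ 'n::finite) \<Rightarrow> 'a \<Rightarrow>
     ('k::{real_normed_field,euclidean_space} ^ 'n) \<times> 'a \<Rightarrow> 'k ^ 'n" where
  "chart_coords P h \<Lambda> v = (\<lambda>(t, p).
     (\<chi> i. (\<Prod>j\<in>UNIV. t $ j powi (matrix_inv (vertex_matrix P h \<Lambda> v) $ i $ j)) *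
           of_real (sqrt (infdist p (affine hull facet_at P h v i)))))"

definition vertex_nbhd ::
    "'a::euclidean_space set \<Rightarrow> ('a set \<Rightarrow> int ^ 'n::finite) \<Rightarrow> 'a \<Rightarrow>
     (('k::{real_normed_field,euclidean_space} ^ 'n) \<times> 'a) set set" where
  "vertex_nbhd P \<Lambda> v = {x \<in> topspace (torus_quotient P \<Lambda>).
     \<forall>(t, p)\<in>x. \<forall>F. F facet_of P \<and> p \<in> F \<longrightarrow> v \<in> F}"

text \<open>
  Points of the quotient are equivalence classes; \<^term>\<open>chart_coords P h \<Lambda> v\<close> is constant on the
  classes that belong to \<^term>\<open>vertex_nbhd P \<Lambda> v\<close>.
\<close>

definition standard_atlas ::
    "'a::euclidean_space set \<Rightarrow> ('a set \<Rightarrow> 'n) \<Rightarrow> ('a set \<Rightarrow> int ^ 'n::finite) \<Rightarrow>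
     ((('k::{real_normed_field,euclidean_space} ^ 'n) \<times> 'a) set, 'k ^ 'n) chart set" where
  "standard_atlas P h \<Lambda> =
     (\<lambda>v. (vertex_nbhd P \<Lambda> v, \<lambda>x. the_elem (chart_coords P h \<Lambda> v ` x))) `
       {v. v extreme_point_of P}"

end

theory Submission
  imports Defs "HOL-Library.Poly_Mapping" "HOL-Library.Z2"
begin

text \<open>
  For a totally skew embedding \<open>f\<close> of \<open>M\<close> and points \<open>x \<noteq> y\<close>, the linear map
  \<open>(u, w, r) \<mapsto> df\<^sub>x u + df\<^sub>y w + r (f x - f y)\<close> is injective on \<open>T\<^sub>xM \<times> T\<^sub>yM \<times> \<real>\<close>.  Two disjoint facets
  of the same color have preimages in \<open>M\<close> that are disjoint, so these maps form a family over all
  of their product \<open>B\<close>.  On the projectivization of \<open>TM \<times> TM \<times> \<real>\<close> over \<open>B\<close> one thus gets \<open>N\<close>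
  sections of the dual tautological line bundle without a common zero, and its class \<open>x\<close> satisfies
  \<open>x\<^sup>N = 0\<close> modulo two.  But \<open>x\<^sup>m\<close> with \<open>m = 4dn - 2d\<close> is the product of the top dual Stiefel-Whitney
  classes of the two factors; if \<open>n\<close> is a power of two, these are the fundamental classes, so that
  \<open>N > m\<close>.

  Cohomology enters only through evaluations of top products.  The points of \<open>M\<close> are
  lifted to a moment-angle space, a real locus on which a group \<open>\<Gamma>\<close> of sign changes acts freely, and
  the normal directions of \<open>TM\<close> and of the orbits are cut out by further odd functions.  The quotient
  by \<open>\<Gamma>\<close> has a fundamental cycle of small simplices, and a product of characters of \<open>\<Gamma>\<close> is evaluated on
  it: the product is zero if odd functions with these characters have no common zero, and coordinate
  characters are evaluated by restriction to the zero locus of the coordinate, down to a vertex.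
\<close>

section \<open>Chains and cochains modulo two\<close>

text \<open>The preimage of a facet has dimension d(n-1), so \<open>B\<close> has dimension 2dn -
  2d; the fibre is a projective space of dimension 2dn, and the sum is m. Hence N >= m + 1, which is
  4n - 1 for d = 1 and 8n - 3 for d = 2. The tangent bundle enters only stably: together with a
  trivial bundle of rank d(r - n), r the number of facets, it is a sum of r real or complex line
  bundles, one for each facet, with explicit sign characters. The trivial part is removed by d(r -
  n) functions for each of the two points, and this raises the power of x accordingly. The obstacle
  is that the embedding is given in charts only, and the extension of its differential to
  non-tangent vectors depends on the chart. So the vanishing argument admits functions that jump, as
  long as at each point one of them keeps its sign nearby. The dual classes are complete symmetric
  polynomials in the classes of the colors; the power of two enters through the parity of a binomial
  coefficient.\<close>

declare add_bit_eq_xor [simp del] mult_bit_eq_and [simp del] power_bit_unfold [simp del]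
  modulo_bit_unfold [simp del]

lemma bit_add_self [simp]: "a + a = 0" "a + (a + b) = b" for a b :: bit
  by (cases a; cases b; simp)+

lemma bit_add_eq_0_iff: "a + b = 0 \<longleftrightarrow> a = b" for a b :: bit
  by (cases a; cases b) simp_all

text \<open>
  A cochain is a function of finite tuples of points. The coboundary is augmented: the
  coboundary of \<open>\<beta>\<close> has the value \<open>\<beta> []\<close> at a single point.
\<close>

fun cobd :: "('p list \<Rightarrow> bit) \<Rightarrow> 'p list \<Rightarrow> bit" where
  "cobd \<beta> [] = 0"
| "cobd \<beta> (v # vs) = \<beta> vs + cobd (\<lambda>us. \<beta> (v # us)) vs"

lemma cobd_add: "cobd (\<lambda>us. \<beta> us + \<gamma> us) vs = cobd \<beta> vs + cobd \<gamma> vs"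
  by (induction vs arbitrary: \<beta> \<gamma>) (auto simp: algebra_simps)

lemma cobd_scale: "cobd (\<lambda>us. a * \<beta> us) vs = a * cobd \<beta> vs"
  by (induction vs arbitrary: \<beta>) (auto simp: algebra_simps)

lemma cobd_0 [simp]: "cobd (\<lambda>us. 0) vs = 0"
  using cobd_scale[of 0 "\<lambda>us. 0" vs] by simp

lemma cobd_map: "cobd \<beta> (map g vs) = cobd (\<lambda>us. \<beta> (map g us)) vs"
  by (induction vs arbitrary: \<beta>) auto

lemma cobd_replicate: "cobd \<beta> (replicate (Suc k) a) = of_nat (Suc k) * \<beta> (replicate k a)"
proof (induction k arbitrary: \<beta>)
  case (Suc k)
  have "cobd (\<lambda>us. \<beta> (a # us)) (replicate (Suc k) a) = of_nat (Suc k) * \<beta> (replicate (Suc k) a)"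
    using Suc[of "\<lambda>us. \<beta> (a # us)"] by simp
  then show ?case by (simp add: algebra_simps)
qed simp

lemma cobd_cong:
  assumes "\<And>us. set us \<subseteq> set vs \<Longrightarrow> Suc (length us) = length vs \<Longrightarrow> \<beta> us = \<gamma> us"
  shows "cobd \<beta> vs = cobd \<gamma> vs"
  using assms
proof (induction vs arbitrary: \<beta> \<gamma>)
  case (Cons v vs)
  have "cobd (\<lambda>us. \<beta> (v # us)) vs = cobd (\<lambda>us. \<gamma> (v # us)) vs"
    by (intro Cons.IH Cons.prems) auto
  moreover have "\<beta> vs = \<gamma> vs" by (rule Cons.prems) auto
  ultimately show ?case by simp
qed simp

text \<open>The prism operator of two vertex maps, written on cochains: the simplices follow
  \<open>g\<close> up to some vertex and \<open>h\<close> from it on, that vertex occurring twice.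
  By \<open>prism_cobd\<close> it is a chain homotopy.\<close>

fun prism :: "('p \<Rightarrow> 'p) \<Rightarrow> ('p \<Rightarrow> 'p) \<Rightarrow> ('p list \<Rightarrow> bit) \<Rightarrow> 'p list \<Rightarrow> bit" where
  "prism g h \<beta> [] = 0"
| "prism g h \<beta> (v # vs) = \<beta> (g v # h v # map h vs) + prism g h (\<lambda>us. \<beta> (g v # us)) vs"

lemma prism_add: "prism g h (\<lambda>us. \<beta> us + \<gamma> us) vs = prism g h \<beta> vs + prism g h \<gamma> vs"
  by (induction vs arbitrary: \<beta> \<gamma>) (auto simp: algebra_simps)

lemma prism_cobd:
  "prism g h (cobd \<beta>) vs + cobd (prism g h \<beta>) vs = \<beta> (map h vs) + \<beta> (map g vs)"
proof (induction vs arbitrary: \<beta>)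
  case (Cons v vs)
  let ?b = "\<lambda>us. \<beta> (g v # us)"
  have 1: "prism g h (cobd \<beta>) (v # vs) = \<beta> (h v # map h vs) + \<beta> (g v # map h vs) +
      cobd (\<lambda>us. ?b (h v # us)) (map h vs) + prism g h \<beta> vs + prism g h (cobd ?b) vs"
    by (simp add: prism_add algebra_simps)
  have 2: "cobd (prism g h \<beta>) (v # vs) = prism g h \<beta> vs +
      cobd (\<lambda>us. ?b (h v # us)) (map h vs) + cobd (prism g h ?b) vs"
    by (simp add: cobd_add cobd_map algebra_simps)
  have "prism g h (cobd \<beta>) (v # vs) + cobd (prism g h \<beta>) (v # vs) =
      \<beta> (h v # map h vs) + \<beta> (g v # map h vs) + (prism g h (cobd ?b) vs + cobd (prism g h ?b) vs)"
    unfolding 1 2 by (simp add: algebra_simps)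
  also have "\<dots> = \<beta> (map h (v # vs)) + \<beta> (map g (v # vs))"
    using Cons[of ?b] by (simp add: algebra_simps)
  finally show ?case .
qed simp

lemma prism_eq_0:
  assumes "\<And>us. set us \<subseteq> g ` set vs \<union> h ` set vs \<Longrightarrow> length us = Suc (length vs) \<Longrightarrow> \<beta> us = 0"
  shows "prism g h \<beta> vs = 0"
  using assms
proof (induction vs arbitrary: \<beta>)
  case (Cons v vs)
  have "prism g h (\<lambda>us. \<beta> (g v # us)) vs = 0"
    by (intro Cons.IH Cons.prems) auto
  moreover have "\<beta> (g v # h v # map h vs) = 0" by (rule Cons.prems) auto
  ultimately show ?case by simp
qed simp

text \<open>A chain is a linear functional on cochains that only depends on the values on \<open>T\<close>.\<close>

definition chain :: "'p list set \<Rightarrow> (('p list \<Rightarrow> bit) \<Rightarrow> bit) \<Rightarrow> bool" where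
  "chain T z \<longleftrightarrow> (\<forall>\<beta> \<gamma>. z (\<lambda>vs. \<beta> vs + \<gamma> vs) = z \<beta> + z \<gamma>) \<and>
     (\<forall>\<beta>. (\<forall>vs\<in>T. \<beta> vs = 0) \<longrightarrow> z \<beta> = 0)"

lemma chain_add: "chain T z \<Longrightarrow> z (\<lambda>vs. \<beta> vs + \<gamma> vs) = z \<beta> + z \<gamma>"
  by (simp add: chain_def)

lemma chain_eq_0: "chain T z \<Longrightarrow> (\<And>vs. vs \<in> T \<Longrightarrow> \<beta> vs = 0) \<Longrightarrow> z \<beta> = 0"
  by (simp add: chain_def)

lemma chain_scale: "chain T z \<Longrightarrow> z (\<lambda>vs. a * \<beta> vs) = a * z \<beta>"
  by (cases a) (auto intro: chain_eq_0)

lemma chain_cong: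
  assumes "chain T z" "\<And>vs. vs \<in> T \<Longrightarrow> \<beta> vs = \<gamma> vs"
  shows "z \<beta> = z \<gamma>"
proof -
  have "z (\<lambda>vs. \<beta> vs + \<gamma> vs) = 0" using assms by (intro chain_eq_0[OF assms(1)]) auto
  then show ?thesis using chain_add[OF assms(1), of \<beta> \<gamma>] by (simp add: bit_add_eq_0_iff)
qed

lemma chain_mono: "chain T z \<Longrightarrow> T \<subseteq> T' \<Longrightarrow> chain T' z"
  unfolding chain_def by blast

lemma chain_0: "chain T (\<lambda>\<beta>. 0)"
  by (auto simp: chain_def)

lemma chain_sum:
  assumes "\<And>j. j \<in> A \<Longrightarrow> chain T (z j)"
  shows "chain T (\<lambda>\<beta>. \<Sum>j\<in>A. z j \<beta>)"
  using assms by (auto simp: chain_def sum.distrib intro!: sum.neutral)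

lemma chain_prism:
  assumes "chain T z"
    and "\<And>vs us. vs \<in> T \<Longrightarrow> set us \<subseteq> g ` set vs \<union> h ` set vs \<Longrightarrow> length us = Suc (length vs) \<Longrightarrow> us \<in> T'"
  shows "chain T' (\<lambda>\<beta>. z (prism g h \<beta>))"
proof -
  have "prism g h (\<lambda>vs. \<beta> vs + \<gamma> vs) = (\<lambda>vs. prism g h \<beta> vs + prism g h \<gamma> vs)" for \<beta> \<gamma>
    by (auto simp: prism_add)
  then show ?thesis unfolding chain_def
    using assms chain_add[OF assms(1)]
    by (auto intro!: chain_eq_0[OF assms(1)] prism_eq_0)
qed

text \<open>\<open>k\<close> counts vertices, so these are simplices of dimension
  \<open>k - 1\<close>, of mesh \<open>\<epsilon>\<close> in the maximum norm.\<close>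

definition tuples :: "nat \<Rightarrow> ('i \<Rightarrow> real) set \<Rightarrow> real \<Rightarrow> ('i \<Rightarrow> real) list set" where
  "tuples k K \<epsilon> = {vs. length vs = k \<and> set vs \<subseteq> K \<and>
     (\<forall>p\<in>set vs. \<forall>q\<in>set vs. \<forall>i. \<bar>p i - q i\<bar> \<le> \<epsilon>)}"

lemma tuples_mono: "K \<subseteq> K' \<Longrightarrow> \<epsilon> \<le> \<epsilon>' \<Longrightarrow> tuples k K \<epsilon> \<subseteq> tuples k K' \<epsilon>'"
  unfolding tuples_def by clarsimp (meson order_trans)

definition convex_fun :: "('i \<Rightarrow> real) set \<Rightarrow> bool" where
  "convex_fun K \<longleftrightarrow> (\<forall>p\<in>K. \<forall>q\<in>K. \<forall>t. 0 \<le> t \<longrightarrow> t \<le> 1 \<longrightarrow> (\<lambda>i. p i + t * (q i - p i)) \<in> K)"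

text \<open>
  A cycle in a convex set is contracted to a point in many small steps, so that the filling chain
  is as fine as the cycle up to a factor of two.
\<close>

lemma fill_cycle:
  fixes K :: "('i \<Rightarrow> real) set"
  assumes K: "convex_fun K" and B: "\<And>p i. p \<in> K \<Longrightarrow> \<bar>p i\<bar> \<le> B" and e: "\<epsilon> > 0"
    and z: "chain (tuples (Suc k) K \<epsilon>) z" and cyc: "\<And>\<beta>. z (cobd \<beta>) = 0"
  shows "\<exists>w. chain (tuples (Suc (Suc k)) K (2 * \<epsilon>)) w \<and> (\<forall>\<beta>. w (cobd \<beta>) = z \<beta>)"
proof (cases "K = {}")
  case True
  then have "tuples (Suc k) K \<epsilon> = {}" by (auto simp: tuples_def length_Suc_conv)
  then have "z \<beta> = 0" for \<beta> using chain_eq_0[OF z] by auto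
  then show ?thesis by (intro exI[of _ "\<lambda>_. 0"]) (auto simp: chain_0)
next
  case False
  then obtain a where a: "a \<in> K" by auto
  \<comment> \<open>Points of \<open>K\<close> are at most \<open>2 * B\<close> away from
    \<open>a\<close> in each coordinate, so one of \<open>m\<close> equal steps moves them by at
    most \<open>\<epsilon>\<close>; with the spread of the simplex this gives the factor
    two.\<close>
  obtain m :: nat where m: "m > 0" "2 * B < of_nat m * \<epsilon>"
  proof -
    obtain m :: nat where "2 * B < of_nat m * \<epsilon>" using reals_Archimedean3[OF e] by blast
    then have "2 * B < of_nat (Suc m) * \<epsilon>" using e by (auto simp: algebra_simps)
    then show ?thesis by (rule that[rotated]) simp
  qed
  define h where "h j v = (\<lambda>i. a i + (real j / m) * (v i - a i))" for j and v :: "'i \<Rightarrow> real"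
  have hK: "h j v \<in> K" if "j \<le> m" "v \<in> K" for j v
  proof -
    have "0 \<le> real j / m" "real j / m \<le> 1" using that m by auto
    then show ?thesis using K a that unfolding convex_fun_def h_def by blast
  qed
  have same: "\<bar>h j v i - h j w i\<bar> \<le> 2 * \<epsilon>" if "j \<le> m" "\<bar>v i - w i\<bar> \<le> \<epsilon>" for j v w i
  proof -
    have "(a i + r * (v i - a i)) - (a i + r * (w i - a i)) = r * (v i - w i)" for r :: real
      by (simp add: algebra_simps)
    then have "h j v i - h j w i = (real j / m) * (v i - w i)" unfolding h_def .
    then have "\<bar>h j v i - h j w i\<bar> = (real j / m) * \<bar>v i - w i\<bar>" by (simp add: abs_mult)
    also have "\<dots> \<le> 1 * \<epsilon>" using that m e by (intro mult_mono) auto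
    finally show ?thesis using e by simp
  qed
  have diff: "\<bar>h j v i - h (Suc j) w i\<bar> \<le> 2 * \<epsilon>"
    if "j < m" "v \<in> K" "w \<in> K" "\<bar>v i - w i\<bar> \<le> \<epsilon>" for j v w i
  proof -
    have "h j v i - h (Suc j) w i = (real j / m) * (v i - w i) - (w i - a i) / m"
      using m by (simp add: h_def field_simps)
    then have "\<bar>h j v i - h (Suc j) w i\<bar> \<le> (real j / m) * \<bar>v i - w i\<bar> + \<bar>w i - a i\<bar> / m"
      using abs_triangle_ineq4[of "(real j / m) * (v i - w i)" "(w i - a i) / m"] by (simp add: abs_mult)
    moreover have "(real j / m) * \<bar>v i - w i\<bar> \<le> 1 * \<epsilon>" using that m e by (intro mult_mono) auto
    moreover have "\<bar>w i - a i\<bar> \<le> 2 * B" using B[OF \<open>w \<in> K\<close>, of i] B[OF a, of i] by linarith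
    then have "\<bar>w i - a i\<bar> / m \<le> \<epsilon>" using m by (simp add: field_simps)
    ultimately show ?thesis by linarith
  qed
  have diff': "\<bar>h (Suc j) w i - h j v i\<bar> \<le> 2 * \<epsilon>"
    if "j < m" "v \<in> K" "w \<in> K" "\<bar>w i - v i\<bar> \<le> \<epsilon>" for j v w i
    using diff[of j v w i] that by (simp add: abs_minus_commute)
  let ?T = "tuples (Suc k) K \<epsilon>" and ?T' = "tuples (Suc (Suc k)) K (2 * \<epsilon>)"
  have step: "chain ?T' (\<lambda>\<beta>. z (prism (h j) (h (Suc j)) \<beta>))" if j: "j < m" for j
  proof (rule chain_prism[OF z])
    fix vs us assume vs: "vs \<in> ?T" and us: "set us \<subseteq> h j ` set vs \<union> h (Suc j) ` set vs"
      and len: "length us = Suc (length vs)"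
    have vK: "set vs \<subseteq> K" using vs by (auto simp: tuples_def)
    have vd: "\<bar>v i - w i\<bar> \<le> \<epsilon>" if "v \<in> set vs" "w \<in> set vs" for v w i
      using vs that by (auto simp: tuples_def)
    have "set us \<subseteq> K" using us vK j hK by fastforce
    moreover have "\<bar>p i - q i\<bar> \<le> 2 * \<epsilon>" if p: "p \<in> set us" and q: "q \<in> set us" for p q i
    proof -
      obtain v where v: "v \<in> set vs" "p = h j v \<or> p = h (Suc j) v" using us p by auto
      obtain w where w: "w \<in> set vs" "q = h j w \<or> q = h (Suc j) w" using us q by auto
      show ?thesis using v w j vK vd[of v w i] same[of j v i w] same[of "Suc j" v i w]
        diff[of j v w i] diff'[of j w v i] by (auto simp: subset_iff)
    qed
    ultimately show "us \<in> ?T'" using len vs by (auto simp: tuples_def)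
  qed
  define N where "N = z (\<lambda>_. 1)"
  \<comment> \<open>The telescoping prisms leave \<open>N\<close> copies of the degenerate simplex
    at \<open>a\<close>, where \<open>N\<close> is the parity of the number of simplices of
    \<open>z\<close>. For odd \<open>k\<close> this simplex is the boundary of the degenerate one
    with one more vertex; for even \<open>k\<close> the parity \<open>N\<close> is zero, since
    \<open>z\<close> vanishes on the coboundary of the constant cochain.\<close>
  let ?c = "\<lambda>\<beta>. N * of_nat k * \<beta> (replicate (Suc (Suc k)) a)"
  have c: "chain ?T' ?c"
  proof -
    have "replicate (Suc (Suc k)) a \<in> ?T'" using a e by (auto simp: tuples_def)
    then show ?thesis by (auto simp: chain_def algebra_simps simp del: replicate_Suc)
  qed
  define w where "w \<beta> = (\<Sum>j<m. z (prism (h j) (h (Suc j)) \<beta>)) + ?c \<beta>" for \<beta>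
  have "chain ?T' w"
  proof -
    have "chain ?T' (\<lambda>\<beta>. \<Sum>j\<in>{..<m}. z (prism (h j) (h (Suc j)) \<beta>))"
      by (rule chain_sum) (use step in auto)
    then show ?thesis using c unfolding w_def chain_def by (auto simp: algebra_simps)
  qed
  moreover have "w (cobd \<beta>) = z \<beta>" for \<beta>
  proof -
    have p: "z (prism (h j) (h (Suc j)) (cobd \<beta>)) =
        z (\<lambda>vs. \<beta> (map (h (Suc j)) vs)) + z (\<lambda>vs. \<beta> (map (h j) vs))" for j
    proof -
      have "prism (h j) (h (Suc j)) (cobd \<beta>) = (\<lambda>vs. (\<beta> (map (h (Suc j)) vs) + \<beta> (map (h j) vs)) +
          cobd (prism (h j) (h (Suc j)) \<beta>) vs)"
        using prism_cobd[of "h j" "h (Suc j)" \<beta>] by (simp add: fun_eq_iff flip: prism_cobd) 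
      then show ?thesis by (simp add: chain_add[OF z] cyc)
    qed
    have tel: "(\<Sum>j<l. z (\<lambda>vs. \<beta> (map (h (Suc j)) vs)) + z (\<lambda>vs. \<beta> (map (h j) vs))) =
        z (\<lambda>vs. \<beta> (map (h l) vs)) + z (\<lambda>vs. \<beta> (map (h 0) vs))" for l
      by (induction l) (auto simp: algebra_simps)
    have hm: "h m = id" using m by (auto simp: h_def)
    have h0: "z (\<lambda>vs. \<beta> (map (h 0) vs)) = N * \<beta> (replicate (Suc k) a)"
    proof -
      have "z (\<lambda>vs. \<beta> (map (h 0) vs)) = z (\<lambda>vs. \<beta> (replicate (Suc k) a) * 1)"
      proof (rule chain_cong[OF z])
        fix vs :: "('i \<Rightarrow> real) list" assume "vs \<in> ?T"
        then have "length vs = Suc k" by (simp add: tuples_def)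
        moreover have "h 0 = (\<lambda>v. a)" by (auto simp: h_def)
        ultimately show "\<beta> (map (h 0) vs) = \<beta> (replicate (Suc k) a) * 1"
          by (simp add: map_replicate_const del: replicate_Suc)
      qed
      also have "\<dots> = \<beta> (replicate (Suc k) a) * z (\<lambda>_. 1)" by (rule chain_scale[OF z])
      finally show ?thesis by (simp add: N_def mult.commute)
    qed
    have N0: "N = 0" if "even k"
    proof -
      have "z (cobd (\<lambda>_. 1)) = z (\<lambda>_. 1)"
      proof (rule chain_cong[OF z])
        fix vs :: "('i \<Rightarrow> real) list" assume "vs \<in> ?T"
        then have "length vs = Suc k" by (simp add: tuples_def)
        moreover have "cobd (\<lambda>_. 1) us = of_nat (length us)" for us :: "('i \<Rightarrow> real) list"
          by (induction us) auto
        ultimately show "cobd (\<lambda>_. 1) vs = 1" using that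
          by (metis even_of_nat_iff even_Suc even_zero bit_not_zero_iff)
      qed
      then show ?thesis using cyc unfolding N_def by simp
    qed
    have k1: "of_nat (Suc (Suc k)) = (of_nat k :: bit)" by (simp add: algebra_simps)
    have "w (cobd \<beta>) = z \<beta> + N * \<beta> (replicate (Suc k) a) + N * of_nat k * (of_nat k * \<beta> (replicate (Suc k) a))"
      unfolding w_def p tel hm h0 cobd_replicate k1 by simp
    also have "\<dots> = z \<beta>"
    proof (cases "even k")
      case True then show ?thesis using N0 by simp
    next
      case False
      then have "(of_nat k :: bit) = 1" by (metis even_of_nat_iff even_zero bit_not_zero_iff)
      then show ?thesis by (simp add: add.assoc)
    qed
    finally show ?thesis .
  qed
  ultimately show ?thesis by blast
qed

section \<open>Simple systems\<close>

definition face :: "('i \<Rightarrow> real) set \<Rightarrow> 'i set \<Rightarrow> ('i \<Rightarrow> real) set" where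
  "face \<Omega> S = {p \<in> \<Omega>. \<forall>c\<in>S. p c = 0}"

lemma face_mono: "S \<subseteq> T \<Longrightarrow> face \<Omega> T \<subseteq> face \<Omega> S"
  by (auto simp: face_def)

text \<open>
  A coordinate model of a simple \<open>D\<close>-polytope, the facets being among the loci \<open>p c = 0\<close>:
  the last condition says that an edge has an even number of end points.
\<close>

locale simple_system =
  fixes I :: "'i set" and \<Omega> :: "('i \<Rightarrow> real) set" and D :: nat
  assumes finite_I: "finite I"
    and convex_Om: "convex_fun \<Omega>"
    and bounded_Om: "\<exists>B. \<forall>p\<in>\<Omega>. \<forall>i. \<bar>p i\<bar> \<le> B"
    and nonneg_Om: "p \<in> \<Omega> \<Longrightarrow> 0 \<le> p i"
    and supp_Om: "p \<in> \<Omega> \<Longrightarrow> i \<notin> I \<Longrightarrow> p i = 0"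
    and closed_Om: "(\<And>m. q m \<in> \<Omega>) \<Longrightarrow> (\<And>i. (\<lambda>m. q m i) \<longlonglongrightarrow> p i) \<Longrightarrow> p \<in> \<Omega>"
    and face_empty: "S \<subseteq> I \<Longrightarrow> card S = Suc D \<Longrightarrow> face \<Omega> S = {}"
    and edge_even: "S \<subseteq> I \<Longrightarrow> Suc (card S) = D \<Longrightarrow> even (card {c \<in> I - S. face \<Omega> (insert c S) \<noteq> {}})"
begin

lemma convex_face: "convex_fun (face \<Omega> S)"
  using convex_Om unfolding convex_fun_def face_def by auto

lemma finite_sub: "S \<subseteq> I \<Longrightarrow> finite S"
  using finite_I finite_subset by blast

lemma face_empty': "S \<subseteq> I \<Longrightarrow> card S > D \<Longrightarrow> face \<Omega> S = {}"
proof -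
  assume S: "S \<subseteq> I" "card S > D"
  then obtain T where T: "T \<subseteq> S" "card T = Suc D"
    by (meson Suc_leI obtain_subset_with_card_n)
  then have "face \<Omega> T = {}" using face_empty S by auto
  then show "face \<Omega> S = {}" using face_mono[OF T(1)] by auto
qed

end

text \<open>Every unordered pair is counted twice. This is the reason why the boundary of a boundary
  vanishes in a simple polytope, where a face of codimension two lies in two facets.\<close>

lemma sum_symmetric_pairs:
  fixes g :: "'c \<Rightarrow> 'c \<Rightarrow> bit"
  assumes "finite A" "\<And>c d. c \<in> A \<Longrightarrow> d \<in> A \<Longrightarrow> g c d = g d c"
  shows "(\<Sum>c\<in>A. \<Sum>d\<in>A - {c}. g c d) = 0"
  using assms
proof (induction A rule: finite_induct)
  case (insert a A)
  have "(\<Sum>d\<in>insert a A - {c}. g c d) = g c a + (\<Sum>d\<in>A - {c}. g c d)" if "c \<in> A" for c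
  proof -
    have "insert a A - {c} = insert a (A - {c})" using that insert.hyps by auto
    then show ?thesis using insert.hyps by simp
  qed
  moreover have "insert a A - {a} = A" using insert.hyps by auto
  moreover have "(\<Sum>c\<in>A. g c a) = (\<Sum>d\<in>A. g a d)" using insert.prems by (intro sum.cong) auto
  ultimately show ?case using insert by (simp add: sum.distrib)
qed simp

context simple_system
begin

text \<open>Fundamental chains modulo two of all faces, compatible with boundaries:
  \<open>z S\<close> lives on the face \<open>S\<close> of dimension \<open>D - card S\<close>, and
  a vertex has total weight one. An empty face carries the zero chain, since it contains no
  tuples.\<close>

definition chain_system :: "real \<Rightarrow> ('i set \<Rightarrow> (('i \<Rightarrow> real) list \<Rightarrow> bit) \<Rightarrow> bit) \<Rightarrow> bool" where
  "chain_system \<epsilon> z \<longleftrightarrow> (\<forall>S\<subseteq>I. card S \<le> D \<longrightarrow>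
     chain (tuples (Suc (D - card S)) (face \<Omega> S) \<epsilon>) (z S) \<and>
     (card S < D \<longrightarrow> (\<forall>\<beta>. z S (cobd \<beta>) = (\<Sum>c\<in>I - S. z (insert c S) \<beta>))) \<and>
     (card S = D \<longrightarrow> face \<Omega> S \<noteq> {} \<longrightarrow> z S (\<lambda>_. 1) = 1))"

text \<open>The prescribed boundary is a cycle: in positive dimension each face of codimension two
  occurs twice, and for an edge the augmented coboundary counts the end points, whose number is
  even. So \<open>fill_cycle\<close> applies.\<close>

lemma chain_system_step:
  assumes e: "\<epsilon> > 0" and S: "S \<subseteq> I" "card S + Suc k = D"
    and ch: "\<And>T. T \<subseteq> I \<Longrightarrow> card T \<le> D \<Longrightarrow> D \<le> card T + k \<Longrightarrow>
      chain (tuples (Suc (D - card T)) (face \<Omega> T) \<epsilon>) (z T) \<and>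
      (card T < D \<longrightarrow> (\<forall>\<beta>. z T (cobd \<beta>) = (\<Sum>c\<in>I - T. z (insert c T) \<beta>))) \<and>
      (card T = D \<longrightarrow> face \<Omega> T \<noteq> {} \<longrightarrow> z T (\<lambda>_. 1) = 1)"
  shows "\<exists>w. chain (tuples (Suc (D - card S)) (face \<Omega> S) (2 * \<epsilon>)) w \<and>
      (\<forall>\<beta>. w (cobd \<beta>) = (\<Sum>c\<in>I - S. z (insert c S) \<beta>))"
proof -
  obtain B where B: "\<And>p i. p \<in> \<Omega> \<Longrightarrow> \<bar>p i\<bar> \<le> B" using bounded_Om by blast
  define y where "y \<beta> = (\<Sum>c\<in>I - S. z (insert c S) \<beta>)" for \<beta>
  have ins: "insert c S \<subseteq> I" "card (insert c S) + k = D" if "c \<in> I - S" for c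
    using that S finite_sub[OF S(1)] by auto
  have chc: "chain (tuples (Suc k) (face \<Omega> (insert c S)) \<epsilon>) (z (insert c S))" if "c \<in> I - S" for c
  proof -
    have "D - card (insert c S) = k" using ins[OF that] by linarith
    then show ?thesis using ch[of "insert c S"] ins[OF that] by auto
  qed
  have "chain (tuples (Suc k) (face \<Omega> S) \<epsilon>) (z (insert c S))" if "c \<in> I - S" for c
    by (rule chain_mono[OF chc[OF that]], rule tuples_mono) (auto intro!: face_mono)
  then have y: "chain (tuples (Suc k) (face \<Omega> S) \<epsilon>) y"
    unfolding y_def by (rule chain_sum)
  have "y (cobd \<beta>) = 0" for \<beta>
  proof (cases "k = 0")
    case True
    have *: "z (insert c S) (cobd \<beta>) = \<beta> [] * of_bool (face \<Omega> (insert c S) \<noteq> {})" if c: "c \<in> I - S" for c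
    proof -
      have "z (insert c S) (cobd \<beta>) = z (insert c S) (\<lambda>_. \<beta> [] * 1)"
        by (rule chain_cong[OF chc[OF c]]) (auto simp: tuples_def True length_Suc_conv)
      also have "\<dots> = \<beta> [] * z (insert c S) (\<lambda>_. 1)" by (rule chain_scale[OF chc[OF c]])
      also have "z (insert c S) (\<lambda>_. 1) = of_bool (face \<Omega> (insert c S) \<noteq> {})"
      proof (cases "face \<Omega> (insert c S) = {}")
        case True
        then have "tuples (Suc k) (face \<Omega> (insert c S)) \<epsilon> = {}"
          by (auto simp: tuples_def length_Suc_conv)
        then show ?thesis using chain_eq_0[OF chc[OF c]] True by auto
      next
        case False
        then show ?thesis using ch[of "insert c S"] ins[OF c] True by auto
      qed
      finally show ?thesis .
    qed
    have "y (cobd \<beta>) = \<beta> [] * (\<Sum>c\<in>I - S. of_bool (face \<Omega> (insert c S) \<noteq> {}))"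
      unfolding y_def sum_distrib_left using * by (intro sum.cong) auto
    also have "(\<Sum>c\<in>I - S. of_bool (face \<Omega> (insert c S) \<noteq> {})) =
        (of_nat (card {c \<in> I - S. face \<Omega> (insert c S) \<noteq> {}}) :: bit)"
      using finite_I by (simp add: of_bool_def sum.If_cases Int_def)
    also have "\<dots> = 0" using edge_even[OF S(1)] S(2) True by (auto elim!: evenE)
    finally show ?thesis by simp
  next
    case False
    have "y (cobd \<beta>) = (\<Sum>c\<in>I - S. \<Sum>d\<in>(I - S) - {c}. z (insert c (insert d S)) \<beta>)"
      unfolding y_def
    proof (rule sum.cong[OF refl])
      fix c assume c: "c \<in> I - S"
      have "z (insert c S) (cobd \<beta>) = (\<Sum>d\<in>I - insert c S. z (insert d (insert c S)) \<beta>)"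
        using ch[of "insert c S"] ins[OF c] False by auto
      then show "z (insert c S) (cobd \<beta>) = (\<Sum>d\<in>(I - S) - {c}. z (insert c (insert d S)) \<beta>)"
        by (simp add: insert_commute flip: Diff_insert Diff_insert2)
    qed
    also have "\<dots> = 0"
      by (rule sum_symmetric_pairs) (auto simp: finite_I insert_commute)
    finally show ?thesis .
  qed
  moreover have "\<bar>p i\<bar> \<le> B" if "p \<in> face \<Omega> S" for p i using B that by (auto simp: face_def)
  ultimately have "\<exists>w. chain (tuples (Suc (Suc k)) (face \<Omega> S) (2 * \<epsilon>)) w \<and> (\<forall>\<beta>. w (cobd \<beta>) = y \<beta>)"
    using fill_cycle[OF convex_face _ e y] by blast
  moreover have "D - card S = Suc k" using S by linarith
  ultimately show ?thesis unfolding y_def by simp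
qed

text \<open>Faces are filled by increasing dimension. Each filling doubles the mesh, so the faces of
  smaller dimension are taken at half of it.\<close>

lemma chain_system_exists:
  assumes "\<epsilon> > 0"
  shows "\<exists>z. chain_system \<epsilon> z"
proof -
  let ?Q = "\<lambda>z S \<epsilon>. chain (tuples (Suc (D - card S)) (face \<Omega> S) \<epsilon>) (z S) \<and>
     (card S < D \<longrightarrow> (\<forall>\<beta>. z S (cobd \<beta>) = (\<Sum>c\<in>I - S. z (insert c S) \<beta>))) \<and>
     (card S = D \<longrightarrow> face \<Omega> S \<noteq> {} \<longrightarrow> z S (\<lambda>_. 1) = 1)"
  have "\<exists>z. \<forall>S\<subseteq>I. card S \<le> D \<longrightarrow> D \<le> card S + k \<longrightarrow> ?Q z S \<epsilon>" for k
    using assms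
  proof (induction k arbitrary: \<epsilon>)
    case 0
    define z :: "'i set \<Rightarrow> (('i \<Rightarrow> real) list \<Rightarrow> bit) \<Rightarrow> bit" where
      "z S \<beta> = (if face \<Omega> S = {} then 0 else \<beta> [SOME p. p \<in> face \<Omega> S])" for S \<beta>
    have "chain (tuples (Suc 0) (face \<Omega> S) \<epsilon>) (z S)" for S
    proof (cases "face \<Omega> S = {}")
      case True then show ?thesis by (auto simp: z_def chain_def)
    next
      case False
      then have "(SOME p. p \<in> face \<Omega> S) \<in> face \<Omega> S" by (simp add: some_in_eq)
      then have "[SOME p. p \<in> face \<Omega> S] \<in> tuples (Suc 0) (face \<Omega> S) \<epsilon>"
        using \<open>\<epsilon> > 0\<close> by (auto simp: tuples_def)
      then show ?thesis using False by (auto simp: z_def chain_def)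
    qed
    then have "\<forall>S\<subseteq>I. card S \<le> D \<longrightarrow> D \<le> card S + 0 \<longrightarrow> ?Q z S \<epsilon>"
      by (auto simp: z_def)
    then show ?case by blast
  next
    case (Suc k)
    obtain z where z: "\<And>S. S \<subseteq> I \<Longrightarrow> card S \<le> D \<Longrightarrow> D \<le> card S + k \<Longrightarrow> ?Q z S (\<epsilon> / 2)"
      using Suc.IH[of "\<epsilon> / 2"] \<open>\<epsilon> > 0\<close> by auto
    define good where "good S w \<longleftrightarrow> chain (tuples (Suc (D - card S)) (face \<Omega> S) (2 * (\<epsilon> / 2))) w \<and>
      (\<forall>\<beta>. w (cobd \<beta>) = (\<Sum>c\<in>I - S. z (insert c S) \<beta>))" for S w
    have "\<exists>w. good S w" if "S \<subseteq> I" "card S + Suc k = D" for S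
      unfolding good_def using that z \<open>\<epsilon> > 0\<close> by (intro chain_system_step[of "\<epsilon> / 2" S k z]) auto
    then obtain w where w: "\<And>S. S \<subseteq> I \<Longrightarrow> card S + Suc k = D \<Longrightarrow> good S (w S)" by metis
    define z' where "z' S = (if card S + Suc k = D then w S else z S)" for S
    have "?Q z' S \<epsilon>" if S: "S \<subseteq> I" "card S \<le> D" "D \<le> card S + Suc k" for S
    proof -
      have ins: "z' (insert c S) = z (insert c S)" if "c \<in> I - S" for c
        using that S finite_sub[OF S(1)] by (auto simp: z'_def)
      show ?thesis
      proof (cases "card S + Suc k = D")
        case True
        then show ?thesis using w[OF S(1) True] ins by (auto simp: z'_def good_def)
      next
        case False
        then have "?Q z S (\<epsilon> / 2)" using z S by auto
        moreover have "z' S = z S" using False by (simp add: z'_def)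
        moreover have "chain (tuples (Suc (D - card S)) (face \<Omega> S) \<epsilon>) (z S)"
          by (rule chain_mono[of "tuples (Suc (D - card S)) (face \<Omega> S) (\<epsilon> / 2)"])
            (use calculation(1) \<open>\<epsilon> > 0\<close> tuples_mono[of "face \<Omega> S" "face \<Omega> S" "\<epsilon> / 2" \<epsilon>] in auto)
        ultimately show ?thesis using ins by auto
      qed
    qed
    then show ?case by blast
  qed
  from this[of D] show ?thesis by (auto simp: chain_system_def)
qed

end

lemma bounded_subsequence:
  fixes a :: "nat \<Rightarrow> 'i \<Rightarrow> real"
  assumes "finite I" "\<And>m i. \<bar>a m i\<bar> \<le> B"
  shows "\<exists>r l. strict_mono (r :: nat \<Rightarrow> nat) \<and> (\<forall>i\<in>I. (\<lambda>m. a (r m) i) \<longlonglongrightarrow> l i)"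
  using assms(1)
proof (induction I rule: finite_induct)
  case empty
  show ?case by (intro exI[of _ id] exI[of _ "\<lambda>_. 0"]) (auto simp: strict_mono_def)
next
  case (insert i I)
  then obtain r l where r: "strict_mono (r :: nat \<Rightarrow> nat)" "\<forall>i\<in>I. (\<lambda>m. a (r m) i) \<longlonglongrightarrow> l i" by blast
  have "bounded (range (\<lambda>m. a (r m) i))" using assms(2) by (auto simp: bounded_iff)
  then obtain x s where s: "strict_mono (s :: nat \<Rightarrow> nat)" "((\<lambda>m. a (r m) i) \<circ> s) \<longlonglongrightarrow> x"
    using bounded_imp_convergent_subsequence by blast
  have "strict_mono (r \<circ> s)" using r s strict_mono_o by blast
  moreover have "(\<lambda>m. a ((r \<circ> s) m) j) \<longlonglongrightarrow> (l(i := x)) j" if "j \<in> insert i I" for j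
  proof (cases "j = i")
    case True then show ?thesis using s by (simp add: o_def)
  next
    case False
    then have "((\<lambda>m. a (r m) j) \<circ> s) \<longlonglongrightarrow> l j"
      using that r(2) s(1) by (intro LIMSEQ_subseq_LIMSEQ) auto
    then show ?thesis using False by (simp add: o_def)
  qed
  ultimately show ?case by blast
qed

section \<open>Sign changes\<close>

text \<open>A sign change is encoded by the set of coordinates that it negates; composition is then
  the symmetric difference.\<close>

definition sd :: "'i set \<Rightarrow> 'i set \<Rightarrow> 'i set" where
  "sd a b = (a - b) \<union> (b - a)"

definition flip :: "'i set \<Rightarrow> ('i \<Rightarrow> real) \<Rightarrow> 'i \<Rightarrow> real" where
  "flip g x = (\<lambda>i. if i \<in> g then - x i else x i)"

text \<open>The branch of the coordinatewise square root with sign pattern \<open>b\<close>; these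
  branches are the sheets over \<Omega>.\<close>

definition lift :: "'i set \<Rightarrow> ('i \<Rightarrow> real) \<Rightarrow> 'i \<Rightarrow> real" where
  "lift b p = flip b (\<lambda>i. sqrt (p i))"

lemma flip_flip: "flip g (flip h x) = flip (sd g h) x"
  by (auto simp: flip_def sd_def)

lemma flip_empty [simp]: "flip {} x = x"
  by (simp add: flip_def)

text \<open>
  The points \<open>\<omega>\<close> with \<open>(\<omega> i)\<^sup>2\<close> in \<open>\<Omega>\<close> form a space on which all sign changes act; \<open>\<Gamma>\<close> is a
  subgroup that acts freely.
\<close>

locale gauge = simple_system +
  fixes \<Gamma> :: "'a set set"
  assumes Gam_sub: "g \<in> \<Gamma> \<Longrightarrow> g \<subseteq> I"
    and Gam_empty: "{} \<in> \<Gamma>"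
    and Gam_sd: "g \<in> \<Gamma> \<Longrightarrow> h \<in> \<Gamma> \<Longrightarrow> sd g h \<in> \<Gamma>"
    and Gam_free: "g \<in> \<Gamma> \<Longrightarrow> g \<noteq> {} \<Longrightarrow> face \<Omega> g = {}"
begin

definition X :: "('a \<Rightarrow> real) set" where
  "X = {x. (\<lambda>i. (x i)\<^sup>2) \<in> \<Omega>}"

lemma lift_X: "p \<in> \<Omega> \<Longrightarrow> lift b p \<in> X"
proof -
  assume p: "p \<in> \<Omega>"
  have "(\<lambda>i. (lift b p i)\<^sup>2) = p" using nonneg_Om[OF p] by (auto simp: lift_def flip_def)
  then show ?thesis using p by (simp add: X_def)
qed

lemma X_supp: "x \<in> X \<Longrightarrow> i \<notin> I \<Longrightarrow> x i = 0"
  using supp_Om by (force simp: X_def)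

lemma X_free: "x \<in> X \<Longrightarrow> g \<in> \<Gamma> \<Longrightarrow> flip g x = x \<Longrightarrow> g = {}"
proof (rule ccontr)
  assume x: "x \<in> X" "g \<in> \<Gamma>" "flip g x = x" "g \<noteq> {}"
  have "x i = 0" if "i \<in> g" for i using fun_cong[OF x(3), of i] that by (simp add: flip_def)
  then have "(\<lambda>i. (x i)\<^sup>2) \<in> face \<Omega> g" using x(1) by (simp add: face_def X_def)
  then show False using Gam_free x by blast
qed

text \<open>On the face \<open>S\<close> the coordinates in \<open>S\<close> vanish and have no
  sign, so these are the pairs of sign patterns that give the same sheet of the quotient
  there.\<close>

definition rel :: "'a set \<Rightarrow> 'a set \<Rightarrow> 'a set \<Rightarrow> bool" where
  "rel S a b \<longleftrightarrow> (\<exists>g\<in>\<Gamma>. sd (sd a b) g \<subseteq> S)"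

lemma rel_refl: "rel S a a"
  unfolding rel_def using Gam_empty by (auto simp: sd_def)

lemma rel_sym: "rel S a b \<Longrightarrow> rel S b a"
  unfolding rel_def sd_def by (simp add: Un_commute)

lemma rel_trans:
  assumes "rel S a b" "rel S b c"
  shows "rel S a c"
proof -
  obtain g h where gh: "g \<in> \<Gamma>" "h \<in> \<Gamma>" "sd (sd a b) g \<subseteq> S" "sd (sd b c) h \<subseteq> S"
    using assms by (auto simp: rel_def)
  then have "sd (sd a c) (sd g h) \<subseteq> S" unfolding sd_def by blast
  then show ?thesis using Gam_sd gh unfolding rel_def by blast
qed

lemma rel_mono: "rel S a b \<Longrightarrow> S \<subseteq> T \<Longrightarrow> rel T a b"
  unfolding rel_def by blast

lemma lift_rel:
  assumes "sd (sd a b) g \<subseteq> S" "p \<in> face \<Omega> S"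
  shows "lift b p = flip g (lift a p)"
proof
  fix i
  show "lift b p i = flip g (lift a p) i"
    using assms unfolding lift_def flip_def face_def sd_def by (cases "i \<in> S") auto
qed

definition inv_cochain :: "(('a \<Rightarrow> real) list \<Rightarrow> bit) \<Rightarrow> bool" where
  "inv_cochain B \<longleftrightarrow> (\<forall>g\<in>\<Gamma>. \<forall>vs. set vs \<subseteq> X \<longrightarrow> B (map (flip g) vs) = B vs)"

text \<open>One sign pattern for each sheet of the quotient over the face \<open>S\<close>.\<close>

definition transv :: "'a set \<Rightarrow> 'a set set \<Rightarrow> bool" where
  "transv S \<B> \<longleftrightarrow> \<B> \<subseteq> Pow I \<and> (\<forall>a\<in>Pow I. \<exists>!b. b \<in> \<B> \<and> rel S a b)"

lemma transv_unique: "transv S \<B> \<Longrightarrow> a \<in> \<B> \<Longrightarrow> b \<in> \<B> \<Longrightarrow> rel S a b \<Longrightarrow> a = b"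
proof -
  assume tr: "transv S \<B>" and ab: "a \<in> \<B>" "b \<in> \<B>" "rel S a b"
  then have "a \<in> Pow I" by (auto simp: transv_def)
  then have "\<exists>!b. b \<in> \<B> \<and> rel S a b" using tr unfolding transv_def by (rule_tac bspec) auto
  then show "a = b" using ab rel_refl[of S a] by (auto elim!: ex1E)
qed

lemma transv_ex:
  assumes "transv S \<B>" "a \<subseteq> I"
  shows "\<exists>b\<in>\<B>. rel S a b"
proof -
  have "\<exists>!b. b \<in> \<B> \<and> rel S a b" using assms unfolding transv_def by (rule_tac bspec) auto
  then show ?thesis by (auto elim!: ex1E)
qed

text \<open>Representatives can be drawn from any set that meets all classes. This yields nested
  systems when \<open>S\<close> grows, and systems that avoid a given coordinate.\<close>

lemma transv_exists:
  assumes "\<C> \<subseteq> Pow I" "\<And>a. a \<subseteq> I \<Longrightarrow> \<exists>b\<in>\<C>. rel S a b"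
  shows "\<exists>\<B>\<subseteq>\<C>. transv S \<B>"
proof -
  define \<rho> where "\<rho> a = (SOME b. b \<in> \<C> \<and> rel S a b)" for a
  have r: "\<rho> a \<in> \<C> \<and> rel S a (\<rho> a)" if "a \<subseteq> I" for a
    using someI_ex[of "\<lambda>b. b \<in> \<C> \<and> rel S a b"] assms(2)[OF that] unfolding \<rho>_def by blast
  have same: "\<rho> a = \<rho> b" if "rel S a b" for a b
  proof -
    have "(\<lambda>c. c \<in> \<C> \<and> rel S a c) = (\<lambda>c. c \<in> \<C> \<and> rel S b c)"
      using that rel_sym rel_trans by blast
    then show ?thesis by (simp add: \<rho>_def)
  qed
  have "transv S (\<rho> ` Pow I)"
    unfolding transv_def
  proof (intro conjI ballI)
    show "\<rho> ` Pow I \<subseteq> Pow I" using r assms(1) by blast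
    fix a assume a: "a \<in> Pow I"
    show "\<exists>!b. b \<in> \<rho> ` Pow I \<and> rel S a b"
    proof (rule ex1I[of _ "\<rho> a"])
      show "\<rho> a \<in> \<rho> ` Pow I \<and> rel S a (\<rho> a)" using r a by auto
      fix b assume b: "b \<in> \<rho> ` Pow I \<and> rel S a b"
      then obtain c where c: "c \<subseteq> I" "b = \<rho> c" by auto
      then have "rel S a c" using r[OF c(1)] b rel_sym[of S c b] rel_trans[of S a b c] by simp
      then show "b = \<rho> a" using same c by simp
    qed
  qed
  moreover have "\<rho> ` Pow I \<subseteq> \<C>" using r by auto
  ultimately show ?thesis by blast
qed

lemma finite_transv: "transv S \<B> \<Longrightarrow> finite \<B>"
  using finite_subset[of \<B> "Pow I"] finite_I by (simp add: transv_def)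

text \<open>
  Enlarging \<open>S\<close> by \<open>c\<close> identifies the classes of \<open>b\<close> and \<open>b + c\<close>, which are different as long as
  the face is nonempty.
\<close>

lemma transv_halves:
  fixes \<phi> :: "'a set \<Rightarrow> bit"
  assumes tr: "transv S \<B>" and tr': "transv (insert c S) \<B>'" and sub: "\<B>' \<subseteq> \<B>"
    and c: "c \<in> I - S" and ne: "face \<Omega> (insert c S) \<noteq> {}"
    and psi: "\<And>b b' g. b \<in> \<B>' \<Longrightarrow> b' \<in> \<B> \<Longrightarrow> g \<in> \<Gamma> \<Longrightarrow> sd (sd (sd b {c}) b') g \<subseteq> S \<Longrightarrow>
      \<phi> b + \<phi> b' = \<psi> b"
  shows "(\<Sum>b\<in>\<B>. \<phi> b) = (\<Sum>b\<in>\<B>'. \<psi> b)"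
proof -
  \<comment> \<open>\<open>\<iota>\<close> sends a sheet to its neighbor across the wall
    \<open>c\<close>. It pairs \<open>\<B>'\<close> with the rest of \<open>\<B>\<close>.\<close>
  define \<iota> where "\<iota> b = (THE b'. b' \<in> \<B> \<and> rel S (sd b {c}) b')" for b
  have BI: "\<B> \<subseteq> Pow I" using tr by (simp add: transv_def)
  have i: "\<iota> b \<in> \<B>" "rel S (sd b {c}) (\<iota> b)" if "b \<in> \<B>" for b
  proof -
    have "sd b {c} \<in> Pow I" using that BI c by (auto simp: sd_def)
    then have "\<exists>!b'. b' \<in> \<B> \<and> rel S (sd b {c}) b'" using tr by (simp add: transv_def)
    from theI'[OF this] show "\<iota> b \<in> \<B>" "rel S (sd b {c}) (\<iota> b)" by (auto simp: \<iota>_def)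
  qed
  have rel': "rel (insert c S) b (\<iota> b)" if b: "b \<in> \<B>" for b
  proof -
    obtain g where "g \<in> \<Gamma>" "sd (sd (sd b {c}) (\<iota> b)) g \<subseteq> S" using i(2)[OF b] by (auto simp: rel_def)
    then have "sd (sd b (\<iota> b)) g \<subseteq> insert c S" by (auto simp: sd_def)
    then show ?thesis using \<open>g \<in> \<Gamma>\<close> by (auto simp: rel_def)
  qed
  have neq: "\<iota> b \<noteq> b" if b: "b \<in> \<B>" for b
  proof
    assume "\<iota> b = b"
    then have "rel S (sd b {c}) b" using i(2)[OF b] by simp
    then obtain g where g: "g \<in> \<Gamma>" "sd (sd (sd b {c}) b) g \<subseteq> S" by (auto simp: rel_def)
    then have "c \<in> g" "g \<subseteq> insert c S" using c by (auto simp: sd_def)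
    then show False using Gam_free[OF g(1)] face_mono[OF \<open>g \<subseteq> insert c S\<close>, of \<Omega>] ne by blast
  qed
  have "bij_betw \<iota> \<B>' (\<B> - \<B>')"
    unfolding bij_betw_def
  proof (intro conjI subset_antisym)
    show "inj_on \<iota> \<B>'"
    proof (rule inj_onI)
      fix a b assume ab: "a \<in> \<B>'" "b \<in> \<B>'" "\<iota> a = \<iota> b"
      then have "rel (insert c S) a b"
        using rel'[of a] rel'[of b] rel_sym[of "insert c S" b "\<iota> b"] rel_trans[of "insert c S" a "\<iota> a" b] sub
        by auto
      then show "a = b" using transv_unique[OF tr'] ab by blast
    qed
    show "\<iota> ` \<B>' \<subseteq> \<B> - \<B>'"
    proof
      fix b' assume "b' \<in> \<iota> ` \<B>'"
      then obtain b where b: "b \<in> \<B>'" "b' = \<iota> b" by auto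
      then have "\<iota> b \<notin> \<B>'" using transv_unique[OF tr' b(1)] rel'[of b] neq[of b] sub by fastforce
      then show "b' \<in> \<B> - \<B>'" using i b sub by auto
    qed
    show "\<B> - \<B>' \<subseteq> \<iota> ` \<B>'"
    proof
      fix b assume b: "b \<in> \<B> - \<B>'"
      then have "b \<subseteq> I" using BI by auto
      then obtain a where a: "a \<in> \<B>'" "rel (insert c S) b a" using transv_ex[OF tr'] by blast
      then obtain g where g: "g \<in> \<Gamma>" "sd (sd b a) g \<subseteq> insert c S" by (auto simp: rel_def)
      have "c \<in> sd (sd b a) g"
      proof (rule ccontr)
        assume "c \<notin> sd (sd b a) g"
        then have "rel S b a" using g by (auto simp: rel_def)
        then show False using transv_unique[OF tr, of b a] a b sub by blast
      qed
      then have "sd (sd (sd a {c}) b) g \<subseteq> S" using g(2) c by (auto simp: sd_def)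
      then have "rel S (sd a {c}) b" using g(1) by (auto simp: rel_def)
      then have "rel S b (\<iota> a)" using i(2)[of a] a sub rel_sym rel_trans by blast
      then have "b = \<iota> a" using transv_unique[OF tr] b i(1)[of a] a sub by blast
      then show "b \<in> \<iota> ` \<B>'" using a by blast
    qed
  qed
  then have "(\<Sum>b\<in>\<B> - \<B>'. \<phi> b) = (\<Sum>b\<in>\<B>'. \<phi> (\<iota> b))"
    by (rule sum.reindex_bij_betw[symmetric])
  moreover have "(\<Sum>b\<in>\<B>. \<phi> b) = (\<Sum>b\<in>\<B> - \<B>'. \<phi> b) + (\<Sum>b\<in>\<B>'. \<phi> b)"
    using sum.subset_diff[OF sub finite_transv[OF tr]] .
  ultimately have "(\<Sum>b\<in>\<B>. \<phi> b) = (\<Sum>b\<in>\<B>'. \<phi> b + \<phi> (\<iota> b))"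
    by (simp add: sum.distrib add.commute)
  also have "\<dots> = (\<Sum>b\<in>\<B>'. \<psi> b)"
  proof (rule sum.cong[OF refl])
    fix b assume b: "b \<in> \<B>'"
    then have "b \<in> \<B>" using sub by auto
    obtain g where "g \<in> \<Gamma>" "sd (sd (sd b {c}) (\<iota> b)) g \<subseteq> S" using i(2)[OF \<open>b \<in> \<B>\<close>] by (auto simp: rel_def)
    then show "\<phi> b + \<phi> (\<iota> b) = \<psi> b" using psi[OF b i(1)[OF \<open>b \<in> \<B>\<close>]] by blast
  qed
  finally show ?thesis .
qed

text \<open>The coboundary of such a function is invariant and represents the degree one class of
  \<kappa> on the quotient. Continuity is not asked for, as cochains are arbitrary functions of
  tuples.\<close>

definition odd_fun :: "('a set \<Rightarrow> bit) \<Rightarrow> (('a \<Rightarrow> real) \<Rightarrow> bit) \<Rightarrow> bool" where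
  "odd_fun \<kappa> s \<longleftrightarrow> (\<forall>g\<in>\<Gamma>. \<forall>x\<in>X. s (flip g x) = s x + \<kappa> g)"

definition character :: "('a set \<Rightarrow> bit) \<Rightarrow> bool" where
  "character \<kappa> \<longleftrightarrow> (\<forall>g\<in>\<Gamma>. \<forall>h\<in>\<Gamma>. \<kappa> (sd g h) = \<kappa> g + \<kappa> h)"

text \<open>The action on \<open>X\<close> is free, so exactly one element of \<Gamma> moves a point
  to the chosen representative of its orbit; \<kappa> of this element is the function.\<close>

lemma odd_fun_exists:
  assumes "character \<kappa>"
  shows "\<exists>s. odd_fun \<kappa> s"
proof -
  define rep where "rep x = (SOME y. \<exists>g\<in>\<Gamma>. y = flip g x)" for x :: "'a \<Rightarrow> real"
  define \<tau> where "\<tau> x = (SOME g. g \<in> \<Gamma> \<and> rep x = flip g x)" for x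
  have t: "\<tau> x \<in> \<Gamma> \<and> rep x = flip (\<tau> x) x" for x
  proof -
    have "\<exists>y. \<exists>g\<in>\<Gamma>. y = flip g x" using Gam_empty by blast
    from someI_ex[OF this] have "\<exists>g. g \<in> \<Gamma> \<and> rep x = flip g x" unfolding rep_def by blast
    from someI_ex[OF this] show ?thesis unfolding \<tau>_def .
  qed
  have "\<kappa> (\<tau> (flip g x)) = \<kappa> (\<tau> x) + \<kappa> g" if g: "g \<in> \<Gamma>" and x: "x \<in> X" for g x
  proof -
    have "(\<exists>h\<in>\<Gamma>. y = flip h (flip g x)) \<longleftrightarrow> (\<exists>h\<in>\<Gamma>. y = flip h x)" for y
    proof
      assume "\<exists>h\<in>\<Gamma>. y = flip h (flip g x)"
      then show "\<exists>h\<in>\<Gamma>. y = flip h x" using Gam_sd g flip_flip by metis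
    next
      assume "\<exists>h\<in>\<Gamma>. y = flip h x"
      then obtain h where h: "h \<in> \<Gamma>" "y = flip h x" by blast
      have "sd (sd h g) g = h" by (auto simp: sd_def)
      then have "y = flip (sd h g) (flip g x)" using h by (simp add: flip_flip)
      then show "\<exists>h\<in>\<Gamma>. y = flip h (flip g x)" using Gam_sd g h by blast
    qed
    then have "rep (flip g x) = rep x" by (simp add: rep_def)
    then have "flip (\<tau> (flip g x)) (flip g x) = flip (\<tau> x) x" using t by metis
    then have "flip (sd (\<tau> x) (sd (\<tau> (flip g x)) g)) x = x"
      by (simp add: flip_flip[symmetric]) (simp add: flip_flip, simp add: sd_def)
    moreover have "sd (\<tau> (flip g x)) g \<in> \<Gamma>" using t g Gam_sd by blast
    ultimately have "sd (\<tau> x) (sd (\<tau> (flip g x)) g) = {}" using X_free[OF x] t Gam_sd by blast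
    then have "\<tau> x = sd (\<tau> (flip g x)) g" by (auto simp: sd_def)
    then have "\<kappa> (\<tau> x) = \<kappa> (\<tau> (flip g x)) + \<kappa> g" using assms t g by (metis character_def)
    then show ?thesis by (simp add: add.assoc)
  qed
  then show ?thesis unfolding odd_fun_def by (intro exI[of _ "\<lambda>x. \<kappa> (\<tau> x)"]) auto
qed

end

section \<open>Evaluation of products of characters\<close>

fun pre :: "('p \<Rightarrow> bit) \<Rightarrow> ('p list \<Rightarrow> bit) \<Rightarrow> 'p list \<Rightarrow> bit" where
  "pre s \<beta> (v # w # vs) = (s v + s w) * \<beta> (w # vs)"
| "pre s \<beta> vs = 0"

text \<open>\<open>pre s \<beta>\<close> is the cup product of the coboundary of \<open>s\<close> with \<open>\<beta>\<close>.\<close>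

fun cup :: "('p \<Rightarrow> bit) \<Rightarrow> ('p list \<Rightarrow> bit) \<Rightarrow> 'p list \<Rightarrow> bit" where
  "cup s \<beta> [] = 0"
| "cup s \<beta> (v # vs) = s v * \<beta> (v # vs)"

lemma cobd_cup:
  "cobd (cup s \<beta>) (v # w # vs) = pre s \<beta> (v # w # vs) + s v * cobd \<beta> (v # w # vs)"
proof -
  have "cobd (\<lambda>us. cup s \<beta> (v # us)) (w # vs) = s v * cobd (\<lambda>us. \<beta> (v # us)) (w # vs)"
    by (simp only: cup.simps cobd_scale)
  then have "cobd (cup s \<beta>) (v # w # vs) =
      s w * \<beta> (w # vs) + s v * cobd (\<lambda>us. \<beta> (v # us)) (w # vs)" by simp
  also have "\<dots> = (s v + s w) * \<beta> (w # vs) +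
      s v * (\<beta> (w # vs) + cobd (\<lambda>us. \<beta> (v # us)) (w # vs))"
    by (simp add: algebra_simps)
  finally show ?thesis by simp
qed

lemma cobd_pre: "cobd (pre s \<beta>) (v # w # x # vs) = pre s (cobd \<beta>) (v # w # x # vs)"
proof -
  let ?d = "cobd (\<lambda>us. \<beta> (w # us)) (x # vs)"
  have "cobd (\<lambda>us. (s v + s w) * \<beta> (w # us)) (x # vs) = (s v + s w) * ?d"
    by (rule cobd_scale)
  then have "cobd (pre s \<beta>) (v # w # x # vs) =
      (s w + s x) * \<beta> (x # vs) + ((s v + s x) * \<beta> (x # vs) + (s v + s w) * ?d)"
    by simp
  also have "\<dots> = (s v + s w) * (\<beta> (x # vs) + ?d)"
    by (simp add: algebra_simps)
  finally show ?thesis by simp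
qed

fun swap_cochain :: "('p \<Rightarrow> bit) \<Rightarrow> ('p \<Rightarrow> bit) \<Rightarrow> ('p list \<Rightarrow> bit) \<Rightarrow> 'p list \<Rightarrow> bit" where
  "swap_cochain s t \<beta> (v # w # vs) = (s v + s w) * (t v + t w) * \<beta> (w # vs)"
| "swap_cochain s t \<beta> vs = 0"

text \<open>The cup product of two 1-cocycles is commutative up to the coboundary of their cup-1 product.\<close>

lemma cobd_swap_cochain:
  assumes "cobd \<beta> (w # x # vs) = 0"
  shows "cobd (swap_cochain s t \<beta>) (v # w # x # vs) =
    pre s (pre t \<beta>) (v # w # x # vs) + pre t (pre s \<beta>) (v # w # x # vs)"
proof -
  let ?d = "cobd (\<lambda>us. \<beta> (w # us)) (x # vs)" and ?c = "(s v + s w) * (t v + t w)"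
  have d: "?d = \<beta> (x # vs)" using assms by (simp add: bit_add_eq_0_iff)
  have "cobd (\<lambda>us. ?c * \<beta> (w # us)) (x # vs) = ?c * ?d"
    by (rule cobd_scale)
  then have "cobd (swap_cochain s t \<beta>) (v # w # x # vs) =
      (s w + s x) * (t w + t x) * \<beta> (x # vs) + ((s v + s x) * (t v + t x) * \<beta> (x # vs) + ?c * ?d)"
    by simp
  also have "\<dots> = pre s (pre t \<beta>) (v # w # x # vs) + pre t (pre s \<beta>) (v # w # x # vs)"
    unfolding d by (simp add: algebra_simps)
  finally show ?thesis .
qed

lemma pre_add_left: "pre (\<lambda>x. s x + t x) \<beta> vs = pre s \<beta> vs + pre t \<beta> vs"
  by (cases "(s, \<beta>, vs)" rule: pre.cases) (auto simp: algebra_simps)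

definition pr :: "('p \<Rightarrow> bit) list \<Rightarrow> 'p list \<Rightarrow> bit" where
  "pr ss = foldr pre ss (\<lambda>_. 1)"

lemma pr_simps [simp]: "pr [] = (\<lambda>_. 1)" "pr (s # ss) = pre s (pr ss)"
  by (simp_all add: pr_def)

text \<open>The product contains the difference of the \<open>j\<close>-th function between the
  vertices \<open>j\<close> and \<open>j + 1\<close>, so a single edge on which that function is
  constant kills it.\<close>

lemma pr_eq_0:
  assumes "length vs = Suc (length ss)" "j < length ss" "(ss ! j) (vs ! j) = (ss ! j) (vs ! Suc j)"
  shows "pr ss vs = 0"
  using assms
proof (induction ss arbitrary: vs j)
  case (Cons s ss)
  obtain v w us where vs: "vs = v # w # us"
    using Cons.prems(1) by (auto simp: length_Suc_conv)
  show ?case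
  proof (cases j)
    case 0
    then show ?thesis using Cons.prems by (simp add: vs)
  next
    case (Suc i)
    then have "pr ss (w # us) = 0" using Cons.prems by (intro Cons.IH[of _ i]) (auto simp: vs)
    then show ?thesis by (simp add: vs)
  qed
qed simp

section \<open>Cohomology of the complex of invariant cochains\<close>

context gauge
begin

definition cocycle :: "nat \<Rightarrow> (('a \<Rightarrow> real) list \<Rightarrow> bit) \<Rightarrow> bool" where
  "cocycle k B \<longleftrightarrow> inv_cochain B \<and> (\<forall>vs. set vs \<subseteq> X \<longrightarrow> length vs = k + 2 \<longrightarrow> cobd B vs = 0)"

text \<open>\<open>k\<close> is the degree, so the tuples have \<open>k + 1\<close> entries. In
  degree zero the augmented coboundary makes all constants cohomologous, and \<open>ev_cohom\<close>
  therefore asks for positive degree.\<close>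

definition cohom :: "nat \<Rightarrow> (('a \<Rightarrow> real) list \<Rightarrow> bit) \<Rightarrow> (('a \<Rightarrow> real) list \<Rightarrow> bit) \<Rightarrow> bool" where
  "cohom k B C \<longleftrightarrow> (\<exists>Y. inv_cochain Y \<and>
     (\<forall>vs. set vs \<subseteq> X \<longrightarrow> length vs = Suc k \<longrightarrow> B vs + C vs = cobd Y vs))"

lemma cohom_refl: "cohom k B B"
  unfolding cohom_def by (rule exI[of _ "\<lambda>_. 0"]) (auto simp: inv_cochain_def)

lemma cohom_trans: "cohom k B C \<Longrightarrow> cohom k C E \<Longrightarrow> cohom k B E"
proof -
  assume "cohom k B C" "cohom k C E"
  then obtain Y Z where Y: "inv_cochain Y"
      "\<And>vs. set vs \<subseteq> X \<Longrightarrow> length vs = Suc k \<Longrightarrow> B vs + C vs = cobd Y vs"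
    and Z: "inv_cochain Z"
      "\<And>vs. set vs \<subseteq> X \<Longrightarrow> length vs = Suc k \<Longrightarrow> C vs + E vs = cobd Z vs"
    unfolding cohom_def by blast
  have "B vs + E vs = cobd (\<lambda>us. Y us + Z us) vs" if "set vs \<subseteq> X" "length vs = Suc k" for vs
  proof -
    have "cobd (\<lambda>us. Y us + Z us) vs = (B vs + C vs) + (C vs + E vs)"
      using Y(2)[OF that] Z(2)[OF that] by (simp only: cobd_add)
    then show ?thesis by (simp add: add.assoc)
  qed
  moreover have "inv_cochain (\<lambda>us. Y us + Z us)" using Y(1) Z(1) by (auto simp: inv_cochain_def)
  ultimately show "cohom k B E" unfolding cohom_def by blast
qed

lemma inv_pre: "odd_fun \<kappa> s \<Longrightarrow> inv_cochain B \<Longrightarrow> inv_cochain (pre s B)"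
  unfolding inv_cochain_def
proof (intro ballI allI impI)
  fix g vs assume s: "odd_fun \<kappa> s" and B: "\<forall>g\<in>\<Gamma>. \<forall>vs. set vs \<subseteq> X \<longrightarrow> B (map (flip g) vs) = B vs"
    and g: "g \<in> \<Gamma>" and vs: "set vs \<subseteq> X"
  show "pre s B (map (flip g) vs) = pre s B vs"
  proof (cases "(s, B, vs)" rule: pre.cases)
    case (1 s' B' v w us)
    then have "B (map (flip g) (w # us)) = B (w # us)" "s (flip g v) = s v + \<kappa> g" "s (flip g w) = s w + \<kappa> g"
      using B s g vs by (auto simp: odd_fun_def simp del: list.map)
    then show ?thesis using 1 by (simp add: algebra_simps)
  qed auto
qed

lemma cocycle_pre:
  assumes s: "odd_fun \<kappa> s" and B: "cocycle k B"
  shows "cocycle (Suc k) (pre s B)"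
  unfolding cocycle_def
proof (intro conjI allI impI)
  show "inv_cochain (pre s B)" using assms inv_pre by (auto simp: cocycle_def)
  fix vs assume vs: "set vs \<subseteq> X" "length vs = Suc k + 2"
  then obtain v w x us where vs': "vs = v # w # x # us" by (auto simp: length_Suc_conv)
  have "cobd B (w # x # us) = 0" using B vs by (auto simp: cocycle_def vs' simp del: cobd.simps)
  then show "cobd (pre s B) vs = 0" unfolding vs' cobd_pre by (simp del: cobd.simps)
qed

lemma cocycle_1: "cocycle 0 (\<lambda>_. 1)"
  by (auto simp: cocycle_def inv_cochain_def length_Suc_conv)

lemma cocycle_pr:
  assumes "\<And>s. s \<in> set ss \<Longrightarrow> \<exists>\<kappa>. odd_fun \<kappa> s"
  shows "cocycle (length ss) (pr ss)"
  using assms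
proof (induction ss)
  case (Cons s ss)
  then show ?case using cocycle_pre[of _ s "length ss" "pr ss"] by auto
qed (auto simp: cocycle_1)

lemma cohom_pre:
  assumes s: "odd_fun \<kappa> s" and BC: "cohom (Suc k) B C"
  shows "cohom (Suc (Suc k)) (pre s B) (pre s C)"
proof -
  obtain Y where Y: "inv_cochain Y"
    "\<And>vs. set vs \<subseteq> X \<Longrightarrow> length vs = Suc (Suc k) \<Longrightarrow> B vs + C vs = cobd Y vs"
    using BC unfolding cohom_def by blast
  have "pre s B vs + pre s C vs = cobd (pre s Y) vs"
    if vs: "set vs \<subseteq> X" "length vs = Suc (Suc (Suc k))" for vs
  proof -
    obtain v w x us where vs': "vs = v # w # x # us" using vs by (auto simp: length_Suc_conv)
    have "B (w # x # us) + C (w # x # us) = cobd Y (w # x # us)" using vs by (intro Y(2)) (auto simp: vs')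
    then show ?thesis unfolding vs' cobd_pre
      by (simp only: pre.simps) (simp only: flip: distrib_left)
  qed
  then show ?thesis using inv_pre[OF s Y(1)] unfolding cohom_def by blast
qed

text \<open>The sum of two odd functions with the same character is invariant, so its product with
  \<open>B\<close> is an invariant cochain; the coboundary of this cochain is the difference. Thus
  only the character matters.\<close>

lemma cohom_replace:
  assumes s: "odd_fun \<kappa> s" and t: "odd_fun \<kappa> t" and B: "cocycle k B"
  shows "cohom (Suc k) (pre s B) (pre t B)"
proof -
  define u where "u x = s x + t x" for x
  have "cup u B (map (flip g) vs) = cup u B vs" if "g \<in> \<Gamma>" "set vs \<subseteq> X" for g vs
  proof (cases vs)
    case (Cons v us)
    have "u (flip g v) = u v" using s t that Cons by (auto simp: odd_fun_def u_def algebra_simps)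
    moreover have "B (map (flip g) vs) = B vs" using B that by (auto simp: cocycle_def inv_cochain_def)
    ultimately show ?thesis by (simp add: Cons)
  qed simp
  then have "inv_cochain (cup u B)" by (simp add: inv_cochain_def)
  moreover have "pre s B vs + pre t B vs = cobd (cup u B) vs"
    if vs: "set vs \<subseteq> X" "length vs = Suc (Suc k)" for vs
  proof -
    obtain v w us where vs': "vs = v # w # us" using vs by (auto simp: length_Suc_conv)
    have "cobd B (v # w # us) = 0" using B vs by (auto simp: cocycle_def vs' simp del: cobd.simps)
    then have "cobd (cup u B) vs = pre u B vs" unfolding vs' cobd_cup by (simp only: mult_zero_right add_0_right)
    also have "\<dots> = pre s B vs + pre t B vs" unfolding u_def by (rule pre_add_left)
    finally show ?thesis by simp
  qed
  ultimately show ?thesis unfolding cohom_def by blast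
qed

lemma cohom_swap:
  assumes s: "odd_fun \<kappa> s" and t: "odd_fun \<mu> t" and B: "cocycle k B"
  shows "cohom (Suc (Suc k)) (pre s (pre t B)) (pre t (pre s B))"
proof -
  have "swap_cochain s t B (map (flip g) vs) = swap_cochain s t B vs" if g: "g \<in> \<Gamma>" "set vs \<subseteq> X" for g vs
  proof (cases "(s, t, B, vs)" rule: swap_cochain.cases)
    case (1 s' t' B' v w us)
    have "B (map (flip g) (w # us)) = B (w # us)" "s (flip g v) = s v + \<kappa> g" "s (flip g w) = s w + \<kappa> g"
      "t (flip g v) = t v + \<mu> g" "t (flip g w) = t w + \<mu> g"
      using B s t g 1 by (auto simp: odd_fun_def cocycle_def inv_cochain_def simp del: list.map)
    then show ?thesis using 1 by (simp add: algebra_simps)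
  qed auto
  then have "inv_cochain (swap_cochain s t B)" by (simp add: inv_cochain_def)
  moreover have "pre s (pre t B) vs + pre t (pre s B) vs = cobd (swap_cochain s t B) vs"
    if vs: "set vs \<subseteq> X" "length vs = Suc (Suc (Suc k))" for vs
  proof -
    obtain v w x us where vs': "vs = v # w # x # us" using vs by (auto simp: length_Suc_conv)
    have "cobd B (w # x # us) = 0" using B vs by (auto simp: cocycle_def vs' simp del: cobd.simps)
    then show ?thesis unfolding vs' by (rule cobd_swap_cochain[symmetric])
  qed
  ultimately show ?thesis unfolding cohom_def by blast
qed

lemma cohom_pr_cons:
  assumes "odd_fun \<kappa> s" "length ss = k" "length ts = k" "cohom k (pr ss) (pr ts)"
  shows "cohom (Suc k) (pr (s # ss)) (pr (s # ts))"
proof (cases k)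
  case 0
  then show ?thesis using assms by (simp add: cohom_refl)
next
  case (Suc j)
  then show ?thesis using cohom_pre[OF assms(1), of j] assms(4) by simp
qed

lemma cohom_pr_replace:
  assumes "list_all2 (\<lambda>s t. \<exists>\<kappa>. odd_fun \<kappa> s \<and> odd_fun \<kappa> t) ss ts"
  shows "cohom (length ss) (pr ss) (pr ts)"
  using assms
proof (induction ss ts rule: list_all2_induct)
  case (Cons s ss t ts)
  obtain \<kappa> where k: "odd_fun \<kappa> s" "odd_fun \<kappa> t" using Cons by blast
  have len: "length ts = length ss" using Cons(2) by (simp add: list_all2_lengthD)
  have "cohom (Suc (length ss)) (pr (s # ss)) (pr (s # ts))"
    by (rule cohom_pr_cons[OF k(1)]) (use Cons len in auto)
  moreover have "cocycle (length ss) (pr ts)"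
  proof -
    have "\<exists>\<kappa>. odd_fun \<kappa> u" if "u \<in> set ts" for u
      using Cons(2) that by (auto simp: list_all2_conv_all_nth in_set_conv_nth)
    then show ?thesis using cocycle_pr[of ts] len by auto
  qed
  then have "cohom (Suc (length ss)) (pr (s # ts)) (pr (t # ts))"
    using cohom_replace[OF k] by simp
  ultimately show ?case using cohom_trans by auto
qed (simp add: cohom_refl)

lemma cohom_pr_perm:
  assumes "mset ss = mset ts" "\<And>s. s \<in> set ss \<Longrightarrow> \<exists>\<kappa>. odd_fun \<kappa> s"
  shows "cohom (length ss) (pr ss) (pr ts)"
  using assms
proof (induction ss arbitrary: ts)
  case (Cons s ss)
  obtain \<kappa> where k: "odd_fun \<kappa> s" using Cons.prems by auto
  have "s \<in> set ts" using Cons.prems(1) by (metis list.set_intros(1) set_mset_mset)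
  then obtain us vs where ts: "ts = us @ s # vs" by (meson split_list)
  have ms: "mset ss = mset (us @ vs)" using Cons.prems(1) by (simp add: ts)
  have len: "length ss = length (us @ vs)" using ms by (metis size_mset)
  have set: "set ss = set (us @ vs)" using ms by (metis set_mset_mset)
  have "cohom (length ss) (pr ss) (pr (us @ vs))"
    using Cons.IH[OF ms] Cons.prems(2) by auto
  then have 1: "cohom (Suc (length ss)) (pr (s # ss)) (pr (s # us @ vs))"
    using cohom_pr_cons[OF k] len by auto
  have "\<And>u. u \<in> set (us @ vs) \<Longrightarrow> \<exists>\<kappa>. odd_fun \<kappa> u" using Cons.prems(2) set by auto
  then have 2: "cohom (Suc (length (us @ vs))) (pr (s # us @ vs)) (pr (us @ s # vs))"
  proof (induction us)
    case (Cons u us)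
    obtain \<mu> where m: "odd_fun \<mu> u" using Cons.prems by auto
    have "cocycle (length (us @ vs)) (pr (us @ vs))" by (rule cocycle_pr) (use Cons.prems in auto)
    then have "cohom (Suc (Suc (length (us @ vs)))) (pr (s # u # us @ vs)) (pr (u # s # us @ vs))"
      using cohom_swap[OF k m] by simp
    moreover have "cohom (Suc (Suc (length (us @ vs)))) (pr (u # s # us @ vs)) (pr (u # us @ s # vs))"
      by (rule cohom_pr_cons[OF m]) (use Cons in auto)
    ultimately show ?case using cohom_trans by auto
  qed (simp add: cohom_refl)
  show ?case using cohom_trans[OF 1] 2 len by (simp add: ts)
qed (simp add: cohom_refl)

end

section \<open>Evaluation on the fundamental cycle of the quotient\<close>

locale gauge_chain = gauge +
  fixes \<epsilon> :: real and z :: "'a set \<Rightarrow> (('a \<Rightarrow> real) list \<Rightarrow> bit) \<Rightarrow> bit"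
  assumes z: "chain_system \<epsilon> z"
begin

lemma z_chain: "S \<subseteq> I \<Longrightarrow> card S \<le> D \<Longrightarrow> chain (tuples (Suc (D - card S)) (face \<Omega> S) \<epsilon>) (z S)"
  using z unfolding chain_system_def by blast

lemma z_cobd: "S \<subseteq> I \<Longrightarrow> card S < D \<Longrightarrow> z S (cobd \<beta>) = (\<Sum>c\<in>I - S. z (insert c S) \<beta>)"
  using z unfolding chain_system_def by auto

lemma z_vertex: "S \<subseteq> I \<Longrightarrow> card S = D \<Longrightarrow> face \<Omega> S \<noteq> {} \<Longrightarrow> z S (\<lambda>_. 1) = 1"
  using z unfolding chain_system_def by auto

definition ev_at :: "'a set \<Rightarrow> 'a set \<Rightarrow> (('a \<Rightarrow> real) list \<Rightarrow> bit) \<Rightarrow> bit" where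
  "ev_at S b B = z S (\<lambda>vs. B (map (lift b) vs))"

lemma lift_tuples: "vs \<in> tuples k (face \<Omega> S) \<epsilon> \<Longrightarrow> set (map (lift b) vs) \<subseteq> X"
  using lift_X by (auto simp: tuples_def face_def)

lemma ev_at_cong:
  assumes "S \<subseteq> I" "card S \<le> D"
    and "\<And>vs. set vs \<subseteq> X \<Longrightarrow> length vs = Suc (D - card S) \<Longrightarrow> B vs = C vs"
  shows "ev_at S b B = ev_at S b C"
  unfolding ev_at_def
proof (rule chain_cong[OF z_chain[OF assms(1,2)]])
  fix vs :: "('a \<Rightarrow> real) list" assume vs: "vs \<in> tuples (Suc (D - card S)) (face \<Omega> S) \<epsilon>"
  then have "length vs = Suc (D - card S)" by (simp add: tuples_def)
  then show "B (map (lift b) vs) = C (map (lift b) vs)"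
    using lift_tuples[OF vs] by (intro assms(3)) auto
qed

lemma ev_at_add:
  assumes "S \<subseteq> I" "card S \<le> D"
  shows "ev_at S b (\<lambda>vs. B vs + C vs) = ev_at S b B + ev_at S b C"
  unfolding ev_at_def by (rule chain_add[OF z_chain[OF assms]])

lemma ev_at_scale:
  assumes "S \<subseteq> I" "card S \<le> D"
  shows "ev_at S b (\<lambda>vs. r * B vs) = r * ev_at S b B"
  unfolding ev_at_def by (rule chain_scale[OF z_chain[OF assms]])

lemma ev_at_empty:
  assumes "S \<subseteq> I" "card S \<le> D" "face \<Omega> S = {}"
  shows "ev_at S b B = 0"
  unfolding ev_at_def
  by (rule chain_eq_0[OF z_chain[OF assms(1,2)]]) (auto simp: tuples_def assms(3) length_Suc_conv)

lemma ev_at_flip: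
  assumes S: "S \<subseteq> I" "card S \<le> D" and ab: "sd (sd a b) g \<subseteq> S"
  shows "ev_at S b B = ev_at S a (\<lambda>vs. B (map (flip g) vs))"
  unfolding ev_at_def
proof (rule chain_cong[OF z_chain[OF S]])
  fix vs :: "('a \<Rightarrow> real) list" assume "vs \<in> tuples (Suc (D - card S)) (face \<Omega> S) \<epsilon>"
  then have "map (lift b) vs = map (flip g) (map (lift a) vs)"
    using lift_rel[OF ab] by (auto simp: tuples_def)
  then show "B (map (lift b) vs) = B (map (flip g) (map (lift a) vs))" by (rule arg_cong)
qed

lemma ev_at_rel:
  assumes S: "S \<subseteq> I" "card S \<le> D" and ab: "rel S a b" and B: "inv_cochain B"
  shows "ev_at S b B = ev_at S a B"
proof -
  obtain g where g: "g \<in> \<Gamma>" "sd (sd a b) g \<subseteq> S" using ab by (auto simp: rel_def)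
  have "ev_at S b B = ev_at S a (\<lambda>vs. B (map (flip g) vs))" by (rule ev_at_flip[OF S g(2)])
  also have "\<dots> = ev_at S a B"
    by (rule ev_at_cong[OF S]) (use B g in \<open>auto simp: inv_cochain_def\<close>)
  finally show ?thesis .
qed

lemma ev_at_cobd:
  assumes "S \<subseteq> I" "card S < D"
  shows "ev_at S b (cobd B) = (\<Sum>c\<in>I - S. ev_at (insert c S) b B)"
  unfolding ev_at_def cobd_map z_cobd[OF assms] by simp

text \<open>One lifted copy of \<open>z S\<close> for each sheet makes up the fundamental cycle of
  the quotient of the face \<open>S\<close>. On invariant cochains the value is independent of the
  representatives, by \<open>ev_eq\<close>.\<close>

definition ev :: "'a set \<Rightarrow> (('a \<Rightarrow> real) list \<Rightarrow> bit) \<Rightarrow> bit" where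
  "ev S B = (\<Sum>b\<in>(SOME \<B>. transv S \<B>). ev_at S b B)"

lemma ev_eq:
  assumes S: "S \<subseteq> I" "card S \<le> D" and tr: "transv S \<B>" and B: "inv_cochain B"
  shows "ev S B = (\<Sum>b\<in>\<B>. ev_at S b B)"
proof -
  define \<C> where "\<C> = (SOME \<B>. transv S \<B>)"
  have tr': "transv S \<C>" unfolding \<C>_def using tr by (rule someI)
  define \<rho> where "\<rho> \<B> a = (SOME b. b \<in> \<B> \<and> rel S a b)" for \<B> a
  have r: "\<rho> \<A> a \<in> \<A> \<and> rel S a (\<rho> \<A> a)" if "transv S \<A>" "a \<subseteq> I" for \<A> a
    unfolding \<rho>_def by (rule someI_ex) (use transv_ex[OF that] in blast)
  have sub: "a \<subseteq> I" if "transv S \<A>" "a \<in> \<A>" for a \<A> using that by (auto simp: transv_def)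
  have bk: "\<rho> \<A>' (\<rho> \<A> a) = a" if "transv S \<A>" "transv S \<A>'" "a \<in> \<A>'" for \<A> \<A>' a
  proof -
    have "\<rho> \<A> a \<in> \<A>" "rel S a (\<rho> \<A> a)" using r[OF that(1) sub[OF that(2,3)]] by auto
    moreover have "\<rho> \<A>' (\<rho> \<A> a) \<in> \<A>'" "rel S (\<rho> \<A> a) (\<rho> \<A>' (\<rho> \<A> a))"
      using r[OF that(2) sub[OF that(1) calculation(1)]] by auto
    ultimately show ?thesis using transv_unique[OF that(2) that(3)] rel_trans by metis
  qed
  have "(\<Sum>b\<in>\<C>. ev_at S b B) = (\<Sum>b\<in>\<B>. ev_at S b B)"
  proof (rule sum.reindex_bij_witness[of _ "\<rho> \<C>" "\<rho> \<B>"])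
    fix a assume a: "a \<in> \<C>"
    show "\<rho> \<C> (\<rho> \<B> a) = a" using bk tr tr' a by blast
    show "\<rho> \<B> a \<in> \<B>" using r[OF tr sub[OF tr' a]] by simp
    show "ev_at S (\<rho> \<B> a) B = ev_at S a B"
      using r[OF tr sub[OF tr' a]] by (intro ev_at_rel[OF S _ B]) simp
  next
    fix b assume b: "b \<in> \<B>"
    show "\<rho> \<B> (\<rho> \<C> b) = b" using bk tr tr' b by blast
    show "\<rho> \<C> b \<in> \<C>" using r[OF tr' sub[OF tr b]] by simp
  qed
  then show ?thesis unfolding ev_def \<C>_def .
qed

lemma transv_all: "\<exists>\<B>. transv S \<B>"
  using transv_exists[of "Pow I" S] rel_refl by blast

lemma ev_cong:
  assumes "S \<subseteq> I" "card S \<le> D"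
    and "\<And>vs. set vs \<subseteq> X \<Longrightarrow> length vs = Suc (D - card S) \<Longrightarrow> B vs = C vs"
  shows "ev S B = ev S C"
  unfolding ev_def using ev_at_cong[OF assms] by simp

lemma ev_add:
  assumes "S \<subseteq> I" "card S \<le> D"
  shows "ev S (\<lambda>vs. B vs + C vs) = ev S B + ev S C"
  unfolding ev_def ev_at_add[OF assms] by (simp add: sum.distrib)

lemma ev_empty:
  assumes "S \<subseteq> I" "card S \<le> D" "face \<Omega> S = {}"
  shows "ev S B = 0"
  unfolding ev_def ev_at_empty[OF assms] by simp

text \<open>
  Stokes' formula: the two sheets over a facet \<open>c\<close> are exchanged by an element of \<open>\<Gamma>\<close>, so only the
  failure of invariance contributes.
\<close>

lemma boundary_sum:
  assumes S: "S \<subseteq> I" "card S < D" and tr: "transv S \<B>" and c: "c \<in> I - S"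
    and tr': "transv (insert c S) \<B>'" and sub: "\<B>' \<subseteq> \<B>"
    and psi: "\<And>b b' g. b \<in> \<B>' \<Longrightarrow> b' \<in> \<B> \<Longrightarrow> g \<in> \<Gamma> \<Longrightarrow> sd (sd (sd b {c}) b') g \<subseteq> S \<Longrightarrow>
      ev_at (insert c S) b B + ev_at (insert c S) b (\<lambda>vs. B (map (flip g) vs)) = \<psi> b"
    and empty: "\<And>b. face \<Omega> (insert c S) = {} \<Longrightarrow> \<psi> b = 0"
  shows "(\<Sum>b\<in>\<B>. ev_at (insert c S) b B) = (\<Sum>b\<in>\<B>'. \<psi> b)"
proof -
  have S': "insert c S \<subseteq> I" "card (insert c S) \<le> D" using S c finite_sub[OF S(1)] by auto
  show ?thesis
  proof (cases "face \<Omega> (insert c S) = {}")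
    case True
    then show ?thesis using ev_at_empty[OF S'] empty by simp
  next
    case False
    show ?thesis
    proof (rule transv_halves[OF tr tr' sub c False])
      fix b b' g assume b: "b \<in> \<B>'" "b' \<in> \<B>" "g \<in> \<Gamma>" "sd (sd (sd b {c}) b') g \<subseteq> S"
      then have "sd (sd b b') g \<subseteq> insert c S" by (auto simp: sd_def)
      then show "ev_at (insert c S) b B + ev_at (insert c S) b' B = \<psi> b"
        using psi[OF b] ev_at_flip[OF S'] by simp
    qed
  qed
qed

lemma transv_sub:
  assumes "transv S \<B>" "S \<subseteq> T"
  shows "\<exists>\<B>'\<subseteq>\<B>. transv T \<B>'"
proof (rule transv_exists)
  show "\<B> \<subseteq> Pow I" using assms by (simp add: transv_def)
  show "\<exists>b\<in>\<B>. rel T a b" if "a \<subseteq> I" for a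
    using transv_ex[OF assms(1) that] rel_mono assms(2) by blast
qed

lemma inv_cobd: "inv_cochain Y \<Longrightarrow> inv_cochain (cobd Y)"
  unfolding inv_cochain_def cobd_map
  by (intro ballI allI impI cobd_cong) (meson order_trans)

lemma ev_cobd:
  assumes S: "S \<subseteq> I" "card S < D" and Y: "inv_cochain Y"
  shows "ev S (cobd Y) = 0"
proof -
  obtain \<B> where tr: "transv S \<B>" using transv_all by blast
  have "ev S (cobd Y) = (\<Sum>b\<in>\<B>. ev_at S b (cobd Y))"
    by (rule ev_eq) (use S tr inv_cobd[OF Y] in auto)
  also have "\<dots> = (\<Sum>c\<in>I - S. \<Sum>b\<in>\<B>. ev_at (insert c S) b Y)"
    unfolding ev_at_cobd[OF S] by (rule sum.swap)
  also have "\<dots> = (\<Sum>c\<in>I - S. 0)"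
  proof (rule sum.cong[OF refl])
    fix c assume c: "c \<in> I - S"
    have S': "insert c S \<subseteq> I" "card (insert c S) \<le> D" using S c finite_sub[OF S(1)] by auto
    obtain \<B>' where "\<B>' \<subseteq> \<B>" "transv (insert c S) \<B>'"
      using transv_sub[OF tr, of "insert c S"] by blast
    then have "(\<Sum>b\<in>\<B>. ev_at (insert c S) b Y) = (\<Sum>b\<in>\<B>'. 0)"
    proof (intro boundary_sum[OF S tr c])
      fix b b' g assume g: "g \<in> \<Gamma>"
      have "ev_at (insert c S) b (\<lambda>vs. Y (map (flip g) vs)) = ev_at (insert c S) b Y"
        by (rule ev_at_cong[OF S']) (use Y g in \<open>auto simp: inv_cochain_def\<close>)
      then show "ev_at (insert c S) b Y + ev_at (insert c S) b (\<lambda>vs. Y (map (flip g) vs)) = 0" by simp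
    qed auto
    then show "(\<Sum>b\<in>\<B>. ev_at (insert c S) b Y) = 0" by simp
  qed
  finally show ?thesis by simp
qed

lemma ev_cohom:
  assumes S: "S \<subseteq> I" "card S + k = D" and k: "k > 0" and BC: "cohom k B C"
  shows "ev S B = ev S C"
proof -
  obtain Y where Y: "inv_cochain Y"
    "\<And>vs. set vs \<subseteq> X \<Longrightarrow> length vs = Suc k \<Longrightarrow> B vs + C vs = cobd Y vs"
    using BC unfolding cohom_def by blast
  have S': "card S \<le> D" "card S < D" "D - card S = k" using S k by auto
  have "ev S (\<lambda>vs. B vs + C vs) = ev S (cobd Y)"
    by (rule ev_cong[OF S(1) S'(1)]) (use Y(2) S' in auto)
  then show ?thesis using ev_cobd[OF S(1) S'(2) Y(1)] ev_add[OF S(1) S'(1), of B C]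
    by (simp add: bit_add_eq_0_iff)
qed

text \<open>The class of the coordinate \<open>c\<close> is dual to its zero locus. By means of
  \<open>g0\<close> all sheets are taken on the side where this coordinate is nonnegative. On each
  sheet the integrand is the coboundary of \<open>cup s B\<close>. Two sheets glued along a wall
  \<open>d\<close> cancel unless the gluing element changes the coordinate \<open>c\<close>; this
  happens only for \<open>d = c\<close>, where \<open>B\<close> remains.\<close>

lemma ev_cut:
  assumes S: "S \<subseteq> I" "card S + Suc k = D" and c: "c \<in> I - S"
    and g0: "g0 \<in> \<Gamma>" "c \<in> g0" and s: "odd_fun (\<lambda>g. of_bool (c \<in> g)) s" and B: "cocycle k B"
  shows "ev S (pre s B) = ev (insert c S) B"
proof -
  have S': "card S \<le> D" "card S < D" using S by auto
  have invB: "inv_cochain B" using B by (simp add: cocycle_def)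
  obtain \<B> where tr: "transv S \<B>" and avoid: "\<B> \<subseteq> Pow (I - {c})"
  proof -
    have "\<exists>b\<in>Pow (I - {c}). rel S a b" if a: "a \<subseteq> I" for a
    proof (cases "c \<in> a")
      case False
      then show ?thesis using a rel_refl by blast
    next
      case True
      then have "sd a g0 \<in> Pow (I - {c})" using a g0 Gam_sub[OF g0(1)] by (auto simp: sd_def)
      moreover have "rel S a (sd a g0)" unfolding rel_def by (rule bexI[OF _ g0(1)]) (auto simp: sd_def)
      ultimately show ?thesis by blast
    qed
    then show ?thesis using transv_exists[of "Pow (I - {c})" S] by (metis Diff_subset Pow_mono that)
  qed
  have "ev S (pre s B) = (\<Sum>b\<in>\<B>. ev_at S b (pre s B))"
    by (rule ev_eq[OF S(1) S'(1) tr]) (use inv_pre[OF s invB] in simp)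
  also have "\<dots> = (\<Sum>b\<in>\<B>. ev_at S b (cobd (cup s B)))"
  proof (rule sum.cong[OF refl], rule ev_at_cong[OF S(1) S'(1)])
    fix vs assume vs: "set vs \<subseteq> X" "length vs = Suc (D - card S)"
    have "D - card S = Suc k" using S(2) by linarith
    then obtain v w us where vs': "vs = v # w # us" using vs by (auto simp: length_Suc_conv)
    have "cobd B (v # w # us) = 0"
      using B vs \<open>D - card S = Suc k\<close> by (auto simp: cocycle_def vs' simp del: cobd.simps)
    then show "pre s B vs = cobd (cup s B) vs"
      unfolding vs' cobd_cup by (simp only: mult_zero_right add_0_right)
  qed
  also have "\<dots> = (\<Sum>d\<in>I - S. \<Sum>b\<in>\<B>. ev_at (insert d S) b (cup s B))"
    unfolding ev_at_cobd[OF S(1) S'(2)] by (rule sum.swap)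
  also have "\<dots> = (\<Sum>d\<in>I - S. if d = c then ev (insert c S) B else 0)"
  proof (rule sum.cong[OF refl])
    fix d assume d: "d \<in> I - S"
    have Sd: "insert d S \<subseteq> I" "card (insert d S) \<le> D" using S S' d finite_sub[OF S(1)] by auto
    obtain \<B>' where sub: "\<B>' \<subseteq> \<B>" and tr': "transv (insert d S) \<B>'"
      using transv_sub[OF tr, of "insert d S"] by blast
    have "(\<Sum>b\<in>\<B>. ev_at (insert d S) b (cup s B)) =
        (\<Sum>b\<in>\<B>'. if d = c then ev_at (insert c S) b B else 0)"
    proof (rule boundary_sum[OF S(1) S'(2) tr d tr' sub])
      fix b b' g assume b: "b \<in> \<B>'" "b' \<in> \<B>" and g: "g \<in> \<Gamma>" "sd (sd (sd b {d}) b') g \<subseteq> S"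
      have "c \<notin> b" "c \<notin> b'" "c \<notin> S" using b avoid sub c by auto
      then have cg: "c \<in> g \<longleftrightarrow> d = c" using g(2) by (auto simp: sd_def)
      have "ev_at (insert d S) b (\<lambda>vs. cup s B (map (flip g) vs)) =
          ev_at (insert d S) b (\<lambda>vs. cup s B vs + of_bool (d = c) * B vs)"
      proof (rule ev_at_cong[OF Sd])
        fix vs assume vs: "set vs \<subseteq> X" "length vs = Suc (D - card (insert d S))"
        obtain v us where vs': "vs = v # us" using vs(2) by (auto simp: length_Suc_conv)
        have "B (map (flip g) vs) = B vs" using invB g vs by (auto simp: inv_cochain_def)
        moreover have "s (flip g v) = s v + of_bool (d = c)"
          using s g(1) vs vs' cg by (auto simp: odd_fun_def)
        ultimately show "cup s B (map (flip g) vs) = cup s B vs + of_bool (d = c) * B vs"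
          by (simp add: vs' algebra_simps)
      qed
      also have "\<dots> = ev_at (insert d S) b (cup s B) + of_bool (d = c) * ev_at (insert d S) b B"
        by (simp only: ev_at_add[OF Sd] ev_at_scale[OF Sd])
      finally show "ev_at (insert d S) b (cup s B) + ev_at (insert d S) b (\<lambda>vs. cup s B (map (flip g) vs)) =
          (if d = c then ev_at (insert c S) b B else 0)"
        by simp
    qed (use Sd ev_at_empty in auto)
    also have "\<dots> = (if d = c then ev (insert c S) B else 0)"
      using ev_eq[OF Sd tr' invB] by auto
    finally show "(\<Sum>b\<in>\<B>. ev_at (insert d S) b (cup s B)) = (if d = c then ev (insert c S) B else 0)" .
  qed
  also have "\<dots> = ev (insert c S) B" using c finite_I by (simp add: sum.delta)
  finally show ?thesis .
qed

text \<open>By \<open>gen\<close> the signs of the coordinates outside \<open>S\<close> can be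
  changed one at a time, so all sign patterns are equivalent to the empty one and the quotient has a
  single sheet there.\<close>

lemma ev_vertex:
  assumes S: "S \<subseteq> I" "card S = D" and ne: "face \<Omega> S \<noteq> {}"
    and gen: "\<And>c. c \<in> I - S \<Longrightarrow> \<exists>g\<in>\<Gamma>. g - S = {c}"
  shows "ev S (\<lambda>_. 1) = 1"
proof -
  have "\<exists>g\<in>\<Gamma>. g - S = a" if "finite a" "a \<subseteq> I - S" for a
    using that
  proof (induction a rule: finite_induct)
    case empty
    then show ?case using Gam_empty by (intro bexI[of _ "{}"]) auto
  next
    case (insert c a)
    then obtain g h where "g \<in> \<Gamma>" "g - S = a" "h \<in> \<Gamma>" "h - S = {c}" using gen by blast
    moreover have "sd g h - S = insert c a"
    proof -
      have "sd g h - S = sd (g - S) (h - S)" by (auto simp: sd_def)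
      then show ?thesis using calculation insert.hyps by (auto simp: sd_def)
    qed
    moreover have "sd g h \<in> \<Gamma>" using calculation by (intro Gam_sd)
    ultimately show ?case by (intro bexI[of _ "sd g h"])
  qed
  then have all: "rel S a {}" if "a \<subseteq> I" for a
  proof -
    have "finite (a - S)" "a - S \<subseteq> I - S" using that finite_sub by auto
    then obtain g where g: "g \<in> \<Gamma>" "g - S = a - S"
      using \<open>\<And>a. finite a \<Longrightarrow> a \<subseteq> I - S \<Longrightarrow> \<exists>g\<in>\<Gamma>. g - S = a\<close> by blast
    then have "sd (sd a {}) g \<subseteq> S" by (auto simp: sd_def)
    then show ?thesis using g(1) by (auto simp: rel_def)
  qed
  have "transv S {{}}" unfolding transv_def using all by auto
  then have "ev S (\<lambda>_. 1) = (\<Sum>b\<in>{{}}. ev_at S b (\<lambda>_. 1))"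
    using S by (intro ev_eq) (auto simp: inv_cochain_def)
  also have "\<dots> = 1" using z_vertex[OF S ne] by (simp add: ev_at_def)
  finally show ?thesis .
qed

end

definition (in gauge) odd_choice :: "('a set \<Rightarrow> bit) \<Rightarrow> ('a \<Rightarrow> real) \<Rightarrow> bit" where
  "odd_choice \<kappa> = (SOME s. odd_fun \<kappa> s)"

context gauge_chain
begin

lemma odd_choice: "character \<kappa> \<Longrightarrow> odd_fun \<kappa> (odd_choice \<kappa>)"
  unfolding odd_choice_def using someI_ex[OF odd_fun_exists] .

definition E :: "'a set \<Rightarrow> ('a set \<Rightarrow> bit) list \<Rightarrow> bit" where
  "E S \<kappa>s = ev S (pr (map odd_choice \<kappa>s))"

text \<open>This is what permits signs of concrete functions in the place of the chosen odd
  functions.\<close>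

lemma E_eq_ev:
  assumes S: "S \<subseteq> I" "card S + length \<kappa>s = D"
    and ss: "list_all2 odd_fun \<kappa>s ss" and ch: "\<forall>\<kappa>\<in>set \<kappa>s. character \<kappa>"
  shows "E S \<kappa>s = ev S (pr ss)"
proof (cases "\<kappa>s = []")
  case True
  then show ?thesis using ss by (simp add: E_def)
next
  case False
  have len: "length ss = length \<kappa>s" using ss by (simp add: list_all2_lengthD)
  have "list_all2 (\<lambda>s t. \<exists>\<kappa>. odd_fun \<kappa> s \<and> odd_fun \<kappa> t) (map odd_choice \<kappa>s) ss"
    unfolding list_all2_conv_all_nth
  proof (intro conjI allI impI)
    fix i assume "i < length (map odd_choice \<kappa>s)"
    then have i: "i < length \<kappa>s" by simp
    then have "odd_fun (\<kappa>s ! i) (ss ! i)" using ss by (simp add: list_all2_conv_all_nth)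
    moreover have "odd_fun (\<kappa>s ! i) (odd_choice (\<kappa>s ! i))" using i ch by (intro odd_choice) auto
    ultimately show "\<exists>\<kappa>. odd_fun \<kappa> (map odd_choice \<kappa>s ! i) \<and> odd_fun \<kappa> (ss ! i)" using i by auto
  qed (simp add: len)
  from cohom_pr_replace[OF this] show ?thesis
    unfolding E_def by (intro ev_cohom[OF S]) (use False in auto)
qed

lemma E_perm:
  assumes S: "S \<subseteq> I" "card S + length \<kappa>s = D"
    and m: "mset \<kappa>s = mset \<mu>s" and ch: "\<forall>\<kappa>\<in>set \<kappa>s. character \<kappa>"
  shows "E S \<kappa>s = E S \<mu>s"
proof (cases "\<kappa>s = []")
  case False
  have "cohom (length \<kappa>s) (pr (map odd_choice \<kappa>s)) (pr (map odd_choice \<mu>s))"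
    using cohom_pr_perm[of "map odd_choice \<kappa>s" "map odd_choice \<mu>s"] m ch odd_choice by auto
  then show ?thesis unfolding E_def by (intro ev_cohom[OF S]) (use False in auto)
qed (use m in simp)

lemma odd_fun_add: "odd_fun \<kappa> s \<Longrightarrow> odd_fun \<mu> t \<Longrightarrow> odd_fun (\<lambda>g. \<kappa> g + \<mu> g) (\<lambda>x. s x + t x)"
  by (auto simp: odd_fun_def algebra_simps)

lemma character_add: "character \<kappa> \<Longrightarrow> character \<mu> \<Longrightarrow> character (\<lambda>g. \<kappa> g + \<mu> g)"
  by (auto simp: character_def algebra_simps)

lemma character_coord: "character (\<lambda>g. of_bool (c \<in> g))"
  by (auto simp: character_def sd_def)

lemma odd_choices: "\<forall>\<kappa>\<in>set \<kappa>s. character \<kappa> \<Longrightarrow> list_all2 odd_fun \<kappa>s (map odd_choice \<kappa>s)"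
  by (auto simp: list_all2_conv_all_nth intro: odd_choice)

lemma E_add:
  assumes S: "S \<subseteq> I" "card S + Suc (length \<kappa>s) = D"
    and ch: "character \<kappa>" "character \<mu>" "\<forall>\<kappa>\<in>set \<kappa>s. character \<kappa>"
  shows "E S ((\<lambda>g. \<kappa> g + \<mu> g) # \<kappa>s) = E S (\<kappa> # \<kappa>s) + E S (\<mu> # \<kappa>s)"
proof -
  let ?s = "\<lambda>x. odd_choice \<kappa> x + odd_choice \<mu> x" and ?B = "pr (map odd_choice \<kappa>s)"
  have "E S ((\<lambda>g. \<kappa> g + \<mu> g) # \<kappa>s) = ev S (pr (?s # map odd_choice \<kappa>s))"
    by (rule E_eq_ev)
      (use assms odd_choices odd_fun_add odd_choice character_add in auto)
  also have "\<dots> = ev S (\<lambda>vs. pre (odd_choice \<kappa>) ?B vs + pre (odd_choice \<mu>) ?B vs)"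
  proof -
    have "pre ?s ?B = (\<lambda>vs. pre (odd_choice \<kappa>) ?B vs + pre (odd_choice \<mu>) ?B vs)"
      by (rule ext) (rule pre_add_left)
    then show ?thesis by simp
  qed
  also have "\<dots> = E S (\<kappa> # \<kappa>s) + E S (\<mu> # \<kappa>s)"
    unfolding E_def by (subst ev_add) (use S in auto)
  finally show ?thesis .
qed

lemma E_trivial:
  assumes S: "S \<subseteq> I" "card S + Suc (length \<kappa>s) = D"
    and ch: "\<forall>\<kappa>\<in>set \<kappa>s. character \<kappa>" and triv: "\<And>g. g \<in> \<Gamma> \<Longrightarrow> \<kappa> g = 0"
  shows "E S (\<kappa> # \<kappa>s) = 0"
proof -
  have "E S (\<kappa> # \<kappa>s) = ev S (pr ((\<lambda>x. 0) # map odd_choice \<kappa>s))"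
    by (rule E_eq_ev)
      (use assms odd_choices Gam_sd in \<open>auto simp: odd_fun_def character_def\<close>)
  also have "\<dots> = ev S (\<lambda>vs. 0)"
    by (rule ev_cong) (use S in \<open>auto simp: length_Suc_conv\<close>)
  also have "\<dots> = 0" using ev_add[of S "\<lambda>_. 0" "\<lambda>_. 0"] S by simp
  finally show ?thesis .
qed

lemma E_cut:
  assumes S: "S \<subseteq> I" "card S + Suc (length \<kappa>s) = D" and c: "c \<in> I - S"
    and ch: "\<forall>\<kappa>\<in>set \<kappa>s. character \<kappa>" and g: "\<exists>g\<in>\<Gamma>. c \<in> g"
  shows "E S ((\<lambda>g. of_bool (c \<in> g)) # \<kappa>s) = E (insert c S) \<kappa>s"
proof -
  obtain g0 where g0: "g0 \<in> \<Gamma>" "c \<in> g0" using g by blast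
  have "cocycle (length (map odd_choice \<kappa>s)) (pr (map odd_choice \<kappa>s))"
    by (rule cocycle_pr) (use ch odd_choice in auto)
  then show ?thesis unfolding E_def
    using ev_cut[OF S c g0 odd_choice[OF character_coord[of c]]] by simp
qed

lemma E_cuts:
  assumes S: "S \<subseteq> I" "card S + length cs + length \<kappa>s = D" and cs: "set cs \<subseteq> I - S" "distinct cs"
    and ch: "\<forall>\<kappa>\<in>set \<kappa>s. character \<kappa>" and g: "\<And>c. c \<in> set cs \<Longrightarrow> \<exists>g\<in>\<Gamma>. c \<in> g"
  shows "E S (map (\<lambda>c g. of_bool (c \<in> g)) cs @ \<kappa>s) = E (S \<union> set cs) \<kappa>s"
  using S cs g
proof (induction cs arbitrary: S)
  case (Cons c cs)
  have fin: "finite S" using Cons.prems(1) finite_sub by blast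
  have "E S (map (\<lambda>c g. of_bool (c \<in> g)) (c # cs) @ \<kappa>s) =
      E (insert c S) (map (\<lambda>c g. of_bool (c \<in> g)) cs @ \<kappa>s)"
    unfolding list.map append_Cons
  proof (rule E_cut)
    show "\<forall>\<kappa>\<in>set (map (\<lambda>c g. of_bool (c \<in> g)) cs @ \<kappa>s). character \<kappa>"
      using ch character_coord by auto
  qed (use Cons.prems in auto)
  also have "\<dots> = E (insert c S \<union> set cs) \<kappa>s"
    by (rule Cons.IH) (use Cons.prems fin in auto)
  finally show ?case by simp
qed simp

text \<open>Cutting by the coordinates ends in an empty face. It requires that each of them is
  changed by some element of \<Gamma>; a coordinate that is never changed has a trivial character,
  which kills the product as well.\<close>

lemma E_coords_eq_0:
  assumes len: "length cs + length \<kappa>s = D" and cs: "set cs \<subseteq> I" "distinct cs"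
    and ch: "\<forall>\<kappa>\<in>set \<kappa>s. character \<kappa>" and empty: "face \<Omega> (set cs) = {}"
  shows "E {} (map (\<lambda>c g. of_bool (c \<in> g)) cs @ \<kappa>s) = 0"
proof (cases "\<forall>c\<in>set cs. \<exists>g\<in>\<Gamma>. c \<in> g")
  case True
  then have "E {} (map (\<lambda>c g. of_bool (c \<in> g)) cs @ \<kappa>s) = E ({} \<union> set cs) \<kappa>s"
    by (intro E_cuts) (use assms in auto)
  also have "\<dots> = 0" unfolding E_def
    by (rule ev_empty) (use assms distinct_card[OF cs(2)] in auto)
  finally show ?thesis .
next
  case False
  then obtain c where c: "c \<in> set cs" "\<And>g. g \<in> \<Gamma> \<Longrightarrow> c \<notin> g" by blast
  then obtain us vs where cs': "cs = us @ c # vs" by (meson split_list)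
  let ?k = "\<lambda>c g. of_bool (c \<in> g) :: bit"
  have chars: "\<forall>\<kappa>\<in>set (map ?k (us @ vs) @ \<kappa>s). character \<kappa>" using ch character_coord by auto
  have "E {} (map ?k cs @ \<kappa>s) = E {} (?k c # map ?k (us @ vs) @ \<kappa>s)"
    by (rule E_perm) (use len ch character_coord cs' in auto)
  also have "\<dots> = 0" by (rule E_trivial) (use len chars c cs' in auto)
  finally show ?thesis .
qed

end

section \<open>Products of characters of odd functions without a common zero\<close>

context gauge
begin

definition converges :: "(nat \<Rightarrow> 'a \<Rightarrow> real) \<Rightarrow> ('a \<Rightarrow> real) \<Rightarrow> bool" where
  "converges a x \<longleftrightarrow> (\<forall>i. (\<lambda>m. a m i) \<longlonglongrightarrow> x i)"

lemma X_compact: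
  assumes "\<And>m. a m \<in> X"
  shows "\<exists>r x. strict_mono (r :: nat \<Rightarrow> nat) \<and> x \<in> X \<and> converges (a \<circ> r) x"
proof -
  obtain B where B: "\<And>p i. p \<in> \<Omega> \<Longrightarrow> \<bar>p i\<bar> \<le> B" using bounded_Om by blast
  have "\<bar>a m i\<bar> \<le> sqrt B" for m i
  proof -
    have "(a m i)\<^sup>2 \<le> B" using assms[of m] B[of "\<lambda>i. (a m i)\<^sup>2" i] by (simp add: X_def)
    then show ?thesis by (metis real_sqrt_abs real_sqrt_le_iff)
  qed
  then obtain r l where r: "strict_mono (r :: nat \<Rightarrow> nat)" "\<forall>i\<in>I. (\<lambda>m. a (r m) i) \<longlonglongrightarrow> l i"
    using bounded_subsequence[OF finite_I] by blast
  define x where "x i = (if i \<in> I then l i else 0)" for i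
  have conv: "(\<lambda>m. a (r m) i) \<longlonglongrightarrow> x i" for i
  proof (cases "i \<in> I")
    case False
    then have "a (r m) i = 0" for m using X_supp assms by blast
    then show ?thesis using False by (simp add: x_def)
  qed (use r in \<open>simp add: x_def\<close>)
  have "(\<lambda>i. (x i)\<^sup>2) \<in> \<Omega>"
    by (rule closed_Om[of "\<lambda>m i. (a (r m) i)\<^sup>2"]) (use assms conv in \<open>auto simp: X_def intro!: tendsto_intros\<close>)
  then show ?thesis using r conv by (auto simp: X_def converges_def)
qed

lemma converges_subseq: "converges a x \<Longrightarrow> strict_mono r \<Longrightarrow> converges (a \<circ> r) x"
  unfolding converges_def using LIMSEQ_subseq_LIMSEQ[of "\<lambda>m. a m i" "x i" r for i]
  by (auto simp: o_def)

definition equivariant :: "('a set \<Rightarrow> bit) \<Rightarrow> (('a \<Rightarrow> real) \<Rightarrow> real) \<Rightarrow> bool" where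
  "equivariant \<kappa> f \<longleftrightarrow> (\<forall>g\<in>\<Gamma>. \<forall>x\<in>X. f (flip g x) = (if \<kappa> g = 0 then f x else - f x))"

lemma odd_fun_sign:
  assumes f: "equivariant \<kappa> f" and \<kappa>: "character \<kappa>"
  shows "\<exists>s. odd_fun \<kappa> s \<and> (\<forall>x\<in>X. f x \<noteq> 0 \<longrightarrow> s x = of_bool (f x < 0))"
proof -
  obtain t where t: "odd_fun \<kappa> t" using odd_fun_exists[OF \<kappa>] by blast
  \<comment> \<open>Where \<open>f\<close> vanishes it has no sign, and the value is borrowed from
    an arbitrary odd function.\<close>
  define s where "s x = (if f x = 0 then t x else of_bool (f x < 0))" for x
  have "s (flip g x) = s x + \<kappa> g" if "g \<in> \<Gamma>" "x \<in> X" for g x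
    using f t that unfolding equivariant_def odd_fun_def s_def by (cases "\<kappa> g") auto
  then show ?thesis unfolding odd_fun_def by (intro exI[of _ s]) (auto simp: s_def)
qed

text \<open>
  The theorem of Lusternik and Schnirelmann: on a fine simplex one of the functions has constant
  sign, so that the product of their sign cocycles vanishes there.
\<close>

lemma equivariant_no_zero:
  fixes fs :: "(('a set \<Rightarrow> bit) \<times> (('a \<Rightarrow> real) \<Rightarrow> real)) list"
  assumes len: "length fs = D"
    and fs: "\<And>\<kappa> f. (\<kappa>, f) \<in> set fs \<Longrightarrow> character \<kappa> \<and> equivariant \<kappa> f"
    and sign: "\<And>x. x \<in> X \<Longrightarrow> \<exists>j<D. \<exists>\<sigma>\<in>{1, -1}. \<forall>a. (\<forall>m. a m \<in> X) \<longrightarrow> converges a x \<longrightarrow>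
      (\<exists>r. strict_mono (r :: nat \<Rightarrow> nat) \<and> (\<forall>m. \<sigma> * snd (fs ! j) (a (r m)) > 0))"
  shows "\<exists>\<epsilon>>0. \<forall>z. chain_system \<epsilon> z \<longrightarrow> gauge_chain.E I \<Omega> \<Gamma> z {} (map fst fs) = 0"
proof -
  have "\<forall>j\<in>{..<D}. \<exists>s. odd_fun (fst (fs ! j)) s \<and>
      (\<forall>x\<in>X. snd (fs ! j) x \<noteq> 0 \<longrightarrow> s x = of_bool (snd (fs ! j) x < 0))"
    using fs len odd_fun_sign by (metis lessThan_iff nth_mem surjective_pairing)
  then obtain s where s: "\<And>j. j < D \<Longrightarrow> odd_fun (fst (fs ! j)) (s j)"
    "\<And>j x. j < D \<Longrightarrow> x \<in> X \<Longrightarrow> snd (fs ! j) x \<noteq> 0 \<Longrightarrow> s j x = of_bool (snd (fs ! j) x < 0)"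
    by (metis lessThan_iff)
  \<comment> \<open>Otherwise simplices without a constant edge, of mesh tending to zero, would
    shrink to a point \<open>x\<close>. The stable sign at \<open>x\<close> applies to their
    \<open>j\<close>-th vertices and then, along that subsequence, to the next vertices, so both
    ends of the \<open>j\<close>-th edge get the same sign.\<close>
  have "\<exists>\<delta>>0. \<forall>vs\<in>tuples (Suc D) X \<delta>. \<exists>j<D. s j (vs ! j) = s j (vs ! Suc j)"
  proof (rule ccontr)
    assume "\<not> ?thesis"
    then have "\<forall>m::nat. \<exists>vs. vs \<in> tuples (Suc D) X (inverse (real (Suc m))) \<and>
        (\<forall>j<D. s j (vs ! j) \<noteq> s j (vs ! Suc j))"
      by (metis of_nat_0_less_iff positive_imp_inverse_positive zero_less_Suc)
    then obtain vs where vs: "\<And>m. vs m \<in> tuples (Suc D) X (inverse (real (Suc m)))"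
      "\<And>m j. j < D \<Longrightarrow> s j (vs m ! j) \<noteq> s j (vs m ! Suc j)" by metis
    have vsX: "vs m ! k \<in> X" if "k \<le> D" for m k
    proof -
      have "set (vs m) \<subseteq> X" "length (vs m) = Suc D" using vs(1)[of m] by (auto simp: tuples_def)
      then show ?thesis using that nth_mem[of k "vs m"] by auto
    qed
    obtain r x where r: "strict_mono (r :: nat \<Rightarrow> nat)" "x \<in> X" "converges ((\<lambda>m. vs m ! 0) \<circ> r) x"
      using X_compact[of "\<lambda>m. vs m ! 0"] vsX by blast
    have conv: "converges (\<lambda>m. vs (r m) ! k) x" if k: "k \<le> D" for k
      unfolding converges_def
    proof
      fix i
      have "\<bar>(vs (r m) ! k) i - (vs (r m) ! 0) i\<bar> \<le> inverse (real (Suc (r m)))" for m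
        using vs(1)[of "r m"] k by (auto simp: tuples_def less_Suc_eq_le)
      then have bd: "eventually (\<lambda>m. norm ((vs (r m) ! k) i - (vs (r m) ! 0) i) \<le>
          inverse (real (Suc (r m)))) sequentially" by simp
      have "(\<lambda>m. inverse (real (Suc (r m)))) \<longlonglongrightarrow> 0"
        by (rule filterlim_compose[OF LIMSEQ_inverse_real_of_nat filterlim_subseq[OF r(1)]])
      then have 1: "(\<lambda>m. (vs (r m) ! k) i - (vs (r m) ! 0) i) \<longlonglongrightarrow> 0"
        by (rule Lim_null_comparison[OF bd])
      have "(\<lambda>m. (vs (r m) ! 0) i) \<longlonglongrightarrow> x i" using r(3) by (simp add: converges_def)
      from tendsto_add[OF 1 this]
      show "(\<lambda>m. (vs (r m) ! k) i) \<longlonglongrightarrow> x i" by simp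
    qed
    obtain j \<sigma> where j: "j < D" "\<sigma> \<in> {1, - 1}" and sg': "\<forall>a. (\<forall>m. a m \<in> X) \<longrightarrow> converges a x \<longrightarrow>
      (\<exists>r. strict_mono (r :: nat \<Rightarrow> nat) \<and> (\<forall>m. \<sigma> * snd (fs ! j) (a (r m)) > 0))"
      using sign[OF r(2)] by (elim exE conjE bexE)
    have sg: "\<exists>r. strict_mono (r :: nat \<Rightarrow> nat) \<and> (\<forall>m. \<sigma> * snd (fs ! j) (a (r m)) > 0)"
      if "\<And>m. a m \<in> X" "converges a x" for a
      using sg' that by simp
    obtain q :: "nat \<Rightarrow> nat" where q: "strict_mono q" "\<And>m. \<sigma> * snd (fs ! j) (vs (r (q m)) ! j) > 0"
      using sg[of "\<lambda>m. vs (r m) ! j"] vsX[of j] conv[of j] j(1) by auto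
    have "converges (\<lambda>m. vs (r (q m)) ! Suc j) x"
      using converges_subseq[OF conv[of "Suc j"] q(1)] j by (simp add: o_def)
    then obtain q' :: "nat \<Rightarrow> nat" where q': "\<And>m. \<sigma> * snd (fs ! j) (vs (r (q (q' m))) ! Suc j) > 0"
      using sg[of "\<lambda>m. vs (r (q m)) ! Suc j"] vsX[of "Suc j"] j(1) by auto
    let ?v = "vs (r (q (q' 0)))"
    have "s j (?v ! j) = of_bool (snd (fs ! j) (?v ! j) < 0)"
      using q(2)[of "q' 0"] j vsX by (intro s(2)) auto
    moreover have "s j (?v ! Suc j) = of_bool (snd (fs ! j) (?v ! Suc j) < 0)"
      using q'[of 0] j vsX by (intro s(2)) auto
    moreover have "snd (fs ! j) (?v ! j) < 0 \<longleftrightarrow> snd (fs ! j) (?v ! Suc j) < 0"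
      using q(2)[of "q' 0"] q'[of 0] j(2) by auto
    ultimately show False using vs(2)[OF j(1), of "r (q (q' 0))"] by simp
  qed
  then obtain \<delta> where d: "\<delta> > 0" and fine: "\<And>vs. vs \<in> tuples (Suc D) X \<delta> \<Longrightarrow>
      \<exists>j<D. s j (vs ! j) = s j (vs ! Suc j)" by blast
  \<comment> \<open>Square roots of numbers at distance at most \<open>\<delta>\<^sup>2\<close>
    differ by at most \<open>\<delta>\<close>; hence the mesh \<open>\<delta>\<^sup>2\<close>
    downstairs.\<close>
  have "gauge_chain.E I \<Omega> \<Gamma> z {} (map fst fs) = 0" if z: "chain_system (\<delta>\<^sup>2) z" for z
  proof -
    interpret gauge_chain I \<Omega> D \<Gamma> "\<delta>\<^sup>2" z using z by unfold_locales
    let ?ss = "map s [0..<D]"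
    have "E {} (map fst fs) = ev {} (pr ?ss)"
    proof (rule E_eq_ev)
      show "list_all2 odd_fun (map fst fs) ?ss" using s(1) len by (auto simp: list_all2_conv_all_nth)
      show "\<forall>\<kappa>\<in>set (map fst fs). character \<kappa>" using fs by auto
    qed (use len in auto)
    also have "\<dots> = 0"
    proof -
      have "ev_at {} b (pr ?ss) = 0" for b
        unfolding ev_at_def
      proof (rule chain_eq_0[OF z_chain])
        fix vs assume vs: "vs \<in> tuples (Suc (D - card {})) (face \<Omega> {}) (\<delta>\<^sup>2)"
        have "map (lift b) vs \<in> tuples (Suc D) X \<delta>"
        proof -
          have "\<bar>lift b p i - lift b q i\<bar> \<le> \<delta>" if "p \<in> set vs" "q \<in> set vs" for p q i
          proof -
            have pq: "0 \<le> p i" "0 \<le> q i" "\<bar>p i - q i\<bar> \<le> \<delta>\<^sup>2"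
              using vs that nonneg_Om by (auto simp: tuples_def face_def)
            have "\<bar>lift b p i - lift b q i\<bar> = \<bar>sqrt (p i) - sqrt (q i)\<bar>" by (auto simp: lift_def flip_def)
            also have "\<dots> \<le> \<delta>"
            proof (rule power2_le_imp_le)
              have "\<bar>sqrt (p i) - sqrt (q i)\<bar> * \<bar>sqrt (p i) - sqrt (q i)\<bar> \<le>
                  \<bar>sqrt (p i) - sqrt (q i)\<bar> * (sqrt (p i) + sqrt (q i))"
                using real_sqrt_ge_zero[OF pq(1)] real_sqrt_ge_zero[OF pq(2)]
                by (intro mult_left_mono) linarith+
              also have "\<dots> = \<bar>(sqrt (p i) - sqrt (q i)) * (sqrt (p i) + sqrt (q i))\<bar>"
                using pq by (simp add: abs_mult)
              also have "\<dots> = \<bar>p i - q i\<bar>" using pq by (simp add: algebra_simps)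
              finally show "\<bar>sqrt (p i) - sqrt (q i)\<bar>\<^sup>2 \<le> \<delta>\<^sup>2" using pq(3) by (simp add: power2_eq_square)
            qed (use d in simp)
            finally show ?thesis .
          qed
          then show ?thesis using vs lift_tuples[OF vs, of b] by (auto simp: tuples_def)
        qed
        from fine[OF this] obtain j where "j < D" "s j (map (lift b) vs ! j) = s j (map (lift b) vs ! Suc j)"
          by blast
        then show "pr ?ss (map (lift b) vs) = 0"
          using vs by (intro pr_eq_0[where j = j]) (auto simp: tuples_def)
      qed auto
      then show ?thesis by (simp add: ev_def)
    qed
    finally show ?thesis .
  qed
  then show ?thesis using d by (intro exI[of _ "\<delta>\<^sup>2"]) auto
qed

end

section \<open>Rings with a congruence\<close>

text \<open>By absorption the inner entries of row \<open>2 ^ k\<close> of Pascal's triangle are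
  even, so neighbors in the row before have the same parity.\<close>

lemma odd_binomial_two_power: "j < 2 ^ k \<Longrightarrow> odd ((2 ^ k - 1) choose j)"
proof (induction j)
  case (Suc j)
  let ?N = "2 ^ k :: nat"
  have N: "?N = Suc (?N - 1)" by simp
  have "Suc j * (?N choose Suc j) = ?N * ((?N - 1) choose j)"
    using binomial_absorption[of j "?N"] by simp
  have even: "even (?N choose Suc j)"
  proof (rule ccontr)
    assume "odd (?N choose Suc j)"
    then have "coprime ?N (?N choose Suc j)" by (simp add: coprime_left_2_iff_odd)
    moreover have "?N dvd Suc j * (?N choose Suc j)"
      using \<open>Suc j * (?N choose Suc j) = _\<close> by simp
    ultimately have "?N dvd Suc j" by (simp only: coprime_dvd_mult_left_iff)
    then show False using Suc.prems dvd_imp_le by fastforce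
  qed
  have "?N choose Suc j = ((?N - 1) choose j) + ((?N - 1) choose Suc j)"
    by (subst N) (simp only: binomial_Suc_Suc)
  then show ?case using even Suc by (metis Suc_lessD even_add)
qed simp

lemma even_central_binomial: "even ((2 * Suc k) choose Suc k)"
proof -
  have "(2 * Suc k) choose Suc k = (Suc (2 * k) choose k) + (Suc (2 * k) choose Suc k)" by simp
  also have "Suc (2 * k) choose Suc k = Suc (2 * k) choose k"
    using binomial_symmetric[of "Suc k" "Suc (2 * k)"] by simp
  finally show ?thesis by simp
qed

text \<open>The complete homogeneous symmetric polynomial of degree \<open>D\<close> in
  \<open>t 0\<close>, ..., \<open>t (m - 1)\<close>.\<close>

fun csym :: "(nat \<Rightarrow> 'r::comm_ring_1) \<Rightarrow> nat \<Rightarrow> nat \<Rightarrow> 'r" where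
  "csym t m 0 = 1"
| "csym t 0 (Suc D) = 0"
| "csym t (Suc m) (Suc D) = csym t m (Suc D) + t m * csym t (Suc m) D"

text \<open>The sum of \<open>X ^ (D - i) * csym t m i\<close> over \<open>i \<le> D\<close>: the
  homogenized inverse of the product of the \<open>X + t i\<close>, truncated at degree
  \<open>D\<close>. Signs play no part, as it is used modulo two.\<close>

fun csym_poly :: "(nat \<Rightarrow> 'r::comm_ring_1) \<Rightarrow> 'r \<Rightarrow> nat \<Rightarrow> nat \<Rightarrow> 'r" where
  "csym_poly t X m 0 = 1"
| "csym_poly t X m (Suc D) = X * csym_poly t X m D + csym t m (Suc D)"

text \<open>A quotient ring of characteristic two in the form of a congruence; it is instantiated by
  the pairing \<open>lin_eqv\<close>.\<close>

locale ring_cong =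
  fixes eqv :: "'r::comm_ring_1 \<Rightarrow> 'r \<Rightarrow> bool" (infix "\<doteq>" 50)
  assumes eqv_refl [simp]: "a \<doteq> a"
    and eqv_sym: "a \<doteq> b \<Longrightarrow> b \<doteq> a"
    and eqv_trans [trans]: "a \<doteq> b \<Longrightarrow> b \<doteq> c \<Longrightarrow> a \<doteq> c"
    and eqv_add: "a \<doteq> b \<Longrightarrow> a' \<doteq> b' \<Longrightarrow> a + a' \<doteq> b + b'"
    and eqv_mult: "a \<doteq> b \<Longrightarrow> a' \<doteq> b' \<Longrightarrow> a * a' \<doteq> b * b'"
    and eqv_char2: "1 + 1 \<doteq> 0"
begin

lemma eqv_trans_eq [trans]: "a \<doteq> b \<Longrightarrow> b = c \<Longrightarrow> a \<doteq> c" "a = b \<Longrightarrow> b \<doteq> c \<Longrightarrow> a \<doteq> c"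
  by auto

lemma eqv_power: "a \<doteq> b \<Longrightarrow> a ^ k \<doteq> b ^ k"
  by (induction k) (auto intro: eqv_mult)

lemma eqv_sum: "(\<And>i. i \<in> A \<Longrightarrow> f i \<doteq> g i) \<Longrightarrow> sum f A \<doteq> sum g A"
  by (induction A rule: infinite_finite_induct) (auto intro: eqv_add)

lemma eqv_prod: "(\<And>i. i \<in> A \<Longrightarrow> f i \<doteq> g i) \<Longrightarrow> prod f A \<doteq> prod g A"
  by (induction A rule: infinite_finite_induct) (auto intro: eqv_mult)

lemma eqv_0_mult: "a \<doteq> 0 \<Longrightarrow> b * a \<doteq> 0" "a \<doteq> 0 \<Longrightarrow> a * b \<doteq> 0"
  using eqv_mult[of b b a 0] eqv_mult[of a 0 b b] by auto

lemma eqv_add_0: "a \<doteq> 0 \<Longrightarrow> a + b \<doteq> b" "b \<doteq> 0 \<Longrightarrow> a + b \<doteq> a"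
  using eqv_add[of a 0 b b] eqv_add[of a a b 0] by auto

lemma eqv_double: "a + a \<doteq> 0"
  using eqv_0_mult(1)[OF eqv_char2, of a] by (simp add: algebra_simps)

lemma eqv_cancel: "a + b \<doteq> 0 \<Longrightarrow> a \<doteq> b"
proof -
  assume "a + b \<doteq> 0"
  then have "(a + b) + b \<doteq> b" by (rule eqv_add_0)
  moreover have "a + (b + b) \<doteq> a" by (rule eqv_add_0) (rule eqv_double)
  ultimately show ?thesis using eqv_sym eqv_trans by (metis add.assoc)
qed

lemma eqv_of_nat: "of_nat k \<doteq> (if even k then 0 else 1)"
proof (induction k)
  case (Suc k)
  have "of_nat (Suc k) \<doteq> (if even k then 0 else 1) + 1"
    using eqv_add[OF Suc eqv_refl, of 1] by (simp add: add.commute)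
  then show ?case using eqv_trans[OF _ eqv_char2, of "of_nat (Suc k)"]
    by (cases "even k") simp_all
qed simp

lemma frobenius: "d \<in> {1, 2} \<Longrightarrow> (a + b) ^ d \<doteq> a ^ d + b ^ d"
proof -
  have "(a + b) ^ 2 = (a * b + a * b) + (a ^ 2 + b ^ 2)" by (simp add: power2_eq_square algebra_simps)
  then have "(a + b) ^ 2 \<doteq> a ^ 2 + b ^ 2" using eqv_add_0(1)[OF eqv_double, of "a * b" "a ^ 2 + b ^ 2"] by simp
  then show "d \<in> {1, 2} \<Longrightarrow> ?thesis" by auto
qed

lemma frobenius_sum:
  assumes "d \<in> {1, 2}"
  shows "(sum f A) ^ d \<doteq> (\<Sum>i\<in>A. f i ^ d)"
proof (induction A rule: infinite_finite_induct)
  case (insert a A)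
  have "(sum f (insert a A)) ^ d \<doteq> f a ^ d + sum f A ^ d" using frobenius[OF assms] insert by simp
  also have "\<dots> \<doteq> f a ^ d + (\<Sum>i\<in>A. f i ^ d)" using insert by (intro eqv_add) auto
  finally show ?case using insert by simp
qed (use assms in auto)

text \<open>In the expansion all products of two different \<open>v a\<close> drop out, so only
  their sum is seen. This is meant for the facets of one color, which do not meet.\<close>

lemma prod_orthogonal:
  assumes "finite A" "A \<noteq> {}" "\<And>a b. a \<in> A \<Longrightarrow> b \<in> A \<Longrightarrow> a \<noteq> b \<Longrightarrow> v a * v b \<doteq> 0"
  shows "(\<Prod>a\<in>A. X + v a) \<doteq> X ^ (card A - 1) * (X + sum v A)"
  using assms
proof (induction A rule: finite_ne_induct)
  case (insert a A)
  have "(\<Sum>b\<in>A. v a * v b) \<doteq> (\<Sum>b\<in>A. 0)"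
    by (rule eqv_sum) (use insert in auto)
  then have z: "v a * sum v A \<doteq> 0" by (simp add: sum_distrib_left)
  let ?Y = "X ^ (card A - 1)"
  have c: "card A = Suc (card A - 1)" using insert.hyps by (simp add: card_gt_0_iff)
  have "(\<Prod>b\<in>insert a A. X + v b) = (X + v a) * (\<Prod>b\<in>A. X + v b)" using insert by simp
  also have "\<dots> \<doteq> (X + v a) * (?Y * (X + sum v A))"
    by (rule eqv_mult) (use insert in auto)
  also have "\<dots> = ?Y * (v a * sum v A) + ?Y * X * (X + (v a + sum v A))" by (simp add: algebra_simps)
  also have "\<dots> \<doteq> ?Y * X * (X + (v a + sum v A))" by (rule eqv_add_0, rule eqv_0_mult, rule z)
  also have "\<dots> = X ^ (card (insert a A) - 1) * (X + sum v (insert a A))"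
  proof -
    have "?Y * X = X ^ card A" by (subst (2) c) (simp add: mult.commute)
    then show ?thesis using insert by simp
  qed
  finally show ?case .
qed simp

end

text \<open>
  The classes \<open>t i\<close> satisfy \<open>(t (i + 1))\<^sup>2 = t i * t (i + 1)\<close>, like the cohomology ring of a Bott
  tower; there the complete symmetric polynomial of top degree is an odd multiple of the
  product of all classes when \<open>n\<close> is a power of two.
\<close>

locale tower = ring_cong eqv for eqv :: "'r::comm_ring_1 \<Rightarrow> 'r \<Rightarrow> bool" (infix "\<doteq>" 50) +
  fixes t :: "nat \<Rightarrow> 'r" and n :: nat
  assumes t0: "t 0 \<doteq> 0" and n0: "n > 0"
    and tS: "Suc i < n \<Longrightarrow> t (Suc i) * t (Suc i) \<doteq> t i * t (Suc i)"
begin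

lemma t_power:
  assumes "Suc i < n"
  shows "t (Suc i) ^ Suc e \<doteq> t (Suc i) * t i ^ e"
proof (induction e)
  case (Suc e)
  have "t (Suc i) ^ Suc (Suc e) \<doteq> t (Suc i) * (t (Suc i) * t i ^ e)"
    using eqv_mult[OF eqv_refl Suc] by simp
  also have "\<dots> = (t (Suc i) * t (Suc i)) * t i ^ e" by (simp add: algebra_simps)
  also have "\<dots> \<doteq> (t i * t (Suc i)) * t i ^ e" by (rule eqv_mult[OF tS[OF assms] eqv_refl])
  finally show ?case by (simp add: algebra_simps)
qed simp

text \<open>The factor \<open>t m ^ e\<close> is carried along because \<open>t_power\<close> turns
  \<open>t (Suc m) ^ Suc e\<close> into \<open>t (Suc m) * t m ^ e\<close>, which leads back to the
  case \<open>m\<close>. The recursion of \<open>csym\<close> then becomes Pascal's rule.\<close>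

lemma csym_eval:
  assumes "m < n"
  shows "(e + D = m \<longrightarrow> t m ^ e * csym t (Suc m) D \<doteq> of_nat ((Suc m + D) choose D) * prod t {1..m}) \<and>
    (e + D > m \<longrightarrow> t m ^ e * csym t (Suc m) D \<doteq> 0)"
  using assms
proof (induction m arbitrary: e D)
  case 0
  have "t 0 ^ e * csym t (Suc 0) D \<doteq> 0" if "e + D > 0"
  proof (cases e)
    case (Suc e')
    then show ?thesis using eqv_0_mult(2)[OF t0] by (simp add: mult.assoc)
  next
    case 0
    then obtain D' where "D = Suc D'" using \<open>e + D > 0\<close> by (cases D) auto
    then show ?thesis using eqv_0_mult(2)[OF t0] 0 by simp
  qed
  then show ?case by simp
next
  case (Suc m)
  have m: "m < n" using Suc.prems by simp
  have csym_zero: "csym t (Suc m) D \<doteq> 0" if "D > m" for D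
    using Suc.IH[OF m, of 0 D] that by simp
  have first: "(Suc e + D = Suc m \<longrightarrow> t (Suc m) ^ Suc e * csym t (Suc m) D \<doteq>
        of_nat ((Suc m + D) choose D) * prod t {1..Suc m}) \<and>
      (Suc e + D > Suc m \<longrightarrow> t (Suc m) ^ Suc e * csym t (Suc m) D \<doteq> 0)" for e D
  proof -
    have 1: "t (Suc m) ^ Suc e * csym t (Suc m) D \<doteq> t (Suc m) * (t m ^ e * csym t (Suc m) D)"
      using eqv_mult[OF t_power[OF Suc.prems, of e] eqv_refl, of "csym t (Suc m) D"]
      by (simp only: mult.assoc)
    have "t (Suc m) * (t m ^ e * csym t (Suc m) D) \<doteq> of_nat ((Suc m + D) choose D) * prod t {1..Suc m}"
      if "e + D = m"
    proof -
      have "t (Suc m) * (t m ^ e * csym t (Suc m) D) \<doteq>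
          t (Suc m) * (of_nat ((Suc m + D) choose D) * prod t {1..m})"
        by (rule eqv_mult) (use Suc.IH[OF m, of e D] that in auto)
      also have "\<dots> = of_nat ((Suc m + D) choose D) * prod t {1..Suc m}"
        by (simp add: mult_ac del: binomial_Suc_Suc)
      finally show ?thesis .
    qed
    moreover have "t (Suc m) * (t m ^ e * csym t (Suc m) D) \<doteq> 0" if "e + D > m"
      by (rule eqv_0_mult) (use Suc.IH[OF m, of e D] that in auto)
    ultimately show ?thesis using eqv_trans[OF 1] by auto
  qed
  show ?case
  proof (induction D arbitrary: e)
    case 0
    show ?case
    proof (cases e)
      case (Suc e')
      then show ?thesis using first[of e' 0] by simp
    qed simp
  next
    case (Suc D)
    have split: "t (Suc m) ^ e * csym t (Suc (Suc m)) (Suc D) =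
        t (Suc m) ^ e * csym t (Suc m) (Suc D) + t (Suc m) ^ Suc e * csym t (Suc (Suc m)) D"
      by (simp add: algebra_simps)
    show ?case
    proof (intro conjI impI)
      assume e: "e + Suc D = Suc m"
      have "t (Suc m) ^ Suc e * csym t (Suc (Suc m)) D \<doteq>
          of_nat ((Suc (Suc m) + D) choose D) * prod t {1..Suc m}"
        using Suc.IH[of "Suc e"] e by simp
      moreover have "t (Suc m) ^ e * csym t (Suc m) (Suc D) \<doteq>
          of_nat ((Suc m + Suc D) choose Suc D) * prod t {1..Suc m}"
      proof (cases e)
        case (Suc e')
        then show ?thesis using first[of e' "Suc D"] e by simp
      next
        \<comment> \<open>Here the left side vanishes for reasons of degree, while the binomial
          coefficient on the right is the central one of row \<open>2 * Suc m\<close>, which is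
          even.\<close>
        case 0
        then have D: "D = m" using e by simp
        have z: "csym t (Suc m) (Suc D) \<doteq> 0" by (rule csym_zero) (simp add: D)
        have "even ((Suc m + Suc D) choose Suc D)"
          using even_central_binomial[of m] D by (simp add: mult_2 del: binomial_Suc_Suc)
        then have "of_nat ((Suc m + Suc D) choose Suc D) * prod t {1..Suc m} \<doteq> 0"
          using eqv_0_mult(2)[of "of_nat ((Suc m + Suc D) choose Suc D)" "prod t {1..Suc m}"]
            eqv_of_nat[of "(Suc m + Suc D) choose Suc D"] by simp
        from eqv_trans[OF z eqv_sym[OF this]] show ?thesis by (simp only: 0 power_0 mult_1)
      qed
      ultimately have "t (Suc m) ^ e * csym t (Suc (Suc m)) (Suc D) \<doteq>
          of_nat ((Suc m + Suc D) choose Suc D) * prod t {1..Suc m} +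
          of_nat ((Suc (Suc m) + D) choose D) * prod t {1..Suc m}"
        unfolding split by (intro eqv_add)
      also have "\<dots> = of_nat ((Suc (Suc m) + Suc D) choose Suc D) * prod t {1..Suc m}"
        by (simp add: algebra_simps)
      finally show "t (Suc m) ^ e * csym t (Suc (Suc m)) (Suc D) \<doteq>
          of_nat ((Suc (Suc m) + Suc D) choose Suc D) * prod t {1..Suc m}" .
    next
      assume e: "Suc m < e + Suc D"
      have "t (Suc m) ^ e * csym t (Suc m) (Suc D) \<doteq> 0"
      proof (cases e)
        case (Suc e')
        then show ?thesis using first[of e' "Suc D"] e by simp
      next
        case 0
        then have "csym t (Suc m) (Suc D) \<doteq> 0" using e by (intro csym_zero) simp
        then show ?thesis by (simp only: 0 power_0 mult_1)
      qed
      moreover have "t (Suc m) ^ Suc e * csym t (Suc (Suc m)) D \<doteq> 0"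
        using Suc.IH[of "Suc e"] e by simp
      ultimately show "t (Suc m) ^ e * csym t (Suc (Suc m)) (Suc D) \<doteq> 0"
        unfolding split using eqv_add_0(1) eqv_trans by blast
    qed
  qed
qed

lemma csym_top: "m \<le> n \<Longrightarrow> csym t m n \<doteq> 0"
proof (cases m)
  case 0
  then show ?thesis using n0 by (cases n) auto
next
  case (Suc j)
  then show "m \<le> n \<Longrightarrow> ?thesis" using csym_eval[of j 0 n] by simp
qed

lemma csym_poly_step:
  "(X + t m) * csym_poly t X (Suc m) D \<doteq> X * csym_poly t X m D + t m * csym t (Suc m) D"
proof (induction D)
  case (Suc D)
  let ?g = "csym_poly t X (Suc m) D" and ?h = "csym t (Suc m) D"
  have "(X + t m) * csym_poly t X (Suc m) (Suc D) =
      X * ((X + t m) * ?g) + (X + t m) * csym t (Suc m) (Suc D)" by (simp add: algebra_simps)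
  also have "\<dots> \<doteq> X * (X * csym_poly t X m D + t m * ?h) + (X + t m) * csym t (Suc m) (Suc D)"
    by (rule eqv_add[OF eqv_mult[OF eqv_refl Suc] eqv_refl])
  also have "\<dots> = (X * t m * ?h + X * t m * ?h) +
      (X * csym_poly t X m (Suc D) + t m * csym t (Suc m) (Suc D))" by (simp add: algebra_simps)
  also have "\<dots> \<doteq> X * csym_poly t X m (Suc D) + t m * csym t (Suc m) (Suc D)"
    by (rule eqv_add_0(1)[OF eqv_double])
  finally show ?case .
qed simp

text \<open>The error term of \<open>csym_poly_step\<close> vanishes for \<open>D = n - 1\<close>:
  it is the difference of \<open>csym t (Suc m) n\<close> and \<open>csym t m n\<close>, which are
  both zero by \<open>csym_top\<close>. So the factors cancel one after the other.\<close>

lemma csym_poly_inverse: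
  "m \<le> n \<Longrightarrow> (\<Prod>i<m. X + t i) * csym_poly t X m (n - 1) \<doteq> X ^ (m + (n - 1))"
proof (induction m)
  case 0
  have "csym_poly t X 0 D = X ^ D" for D by (induction D) auto
  then show ?case by simp
next
  case (Suc m)
  have "csym t (Suc m) (Suc (n - 1)) = csym t m (Suc (n - 1)) + t m * csym t (Suc m) (n - 1)" by simp
  then have "csym t m n + t m * csym t (Suc m) (n - 1) \<doteq> 0"
    using csym_top[of "Suc m"] Suc.prems n0 by simp
  then have "t m * csym t (Suc m) (n - 1) \<doteq> 0"
    using eqv_cancel eqv_sym eqv_trans csym_top[of m] Suc.prems by (metis Suc_leD)
  then have "(X + t m) * csym_poly t X (Suc m) (n - 1) \<doteq> X * csym_poly t X m (n - 1)"
    by (intro eqv_trans[OF csym_poly_step] eqv_add_0(2))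
  then have "(\<Prod>i<Suc m. X + t i) * csym_poly t X (Suc m) (n - 1) \<doteq>
      (\<Prod>i<m. X + t i) * (X * csym_poly t X m (n - 1))"
    using eqv_mult[OF eqv_refl, of _ _ "\<Prod>i<m. X + t i"] by (simp add: mult.assoc)
  also have "\<dots> = X * ((\<Prod>i<m. X + t i) * csym_poly t X m (n - 1))" by (simp add: mult_ac)
  also have "\<dots> \<doteq> X * X ^ (m + (n - 1))" by (rule eqv_mult[OF eqv_refl]) (use Suc in auto)
  finally show ?case by simp
qed

text \<open>Multiplication by \<open>W\<close> kills all terms with a factor \<open>X\<close>, and
  \<open>csym t n (n - 1)\<close> is left. It is the product of the classes times
  \<open>(2 * n - 1) choose (n - 1)\<close>, which is odd because \<open>2 * n\<close> is a power of
  two.\<close>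

lemma csym_poly_top:
  assumes "n = 2 ^ k" "W * X \<doteq> 0"
  shows "W * csym_poly t X n (n - 1) \<doteq> W * prod t {1..<n}"
proof -
  have "W * csym_poly t X n D \<doteq> W * csym t n D" for D
  proof (cases D)
    case (Suc D)
    have "W * csym_poly t X n (Suc D) = (W * X) * csym_poly t X n D + W * csym t n (Suc D)"
      by (simp add: algebra_simps)
    also have "\<dots> \<doteq> W * csym t n (Suc D)" by (intro eqv_add_0(1) eqv_0_mult(2) assms(2))
    finally show ?thesis by (simp add: Suc)
  qed simp
  also have "W * csym t n (n - 1) \<doteq> W * (1 * prod t {1..<n})"
  proof -
    define m where "m = n - 1"
    have n: "n = Suc m" using n0 by (simp add: m_def)
    have "m + m = 2 ^ Suc k - 2" using assms(1) n by simp
    then have "Suc m + m = 2 ^ Suc k - 1" "m < 2 ^ Suc k" using assms(1) n by simp_all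
    then have "odd ((Suc m + m) choose m)" using odd_binomial_two_power[of m "Suc k"] by simp
    then have "of_nat ((Suc m + m) choose m) * prod t {1..m} \<doteq> 1 * prod t {1..m}"
      using eqv_of_nat[of "(Suc m + m) choose m"] by (intro eqv_mult) auto
    moreover have "csym t (Suc m) m \<doteq> of_nat ((Suc m + m) choose m) * prod t {1..m}"
      using csym_eval[of m 0 m] n by simp
    ultimately have "csym t (Suc m) m \<doteq> 1 * prod t {1..m}" using eqv_trans by blast
    then have "csym t n (n - 1) \<doteq> 1 * prod t {1..<n}"
      by (simp only: n diff_Suc_1 atLeastLessThanSuc_atLeastAtMost)
    then show ?thesis by (rule eqv_mult[OF eqv_refl])
  qed
  finally show ?thesis by simp
qed

end

lemma (in ring_cong) prod_by_color:
  fixes v :: "'f \<Rightarrow> 'r" and col :: "'f \<Rightarrow> nat"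
  assumes fin: "finite Fs" and col: "\<And>F. F \<in> Fs \<Longrightarrow> col F < n" and ne: "\<And>i. i < n \<Longrightarrow> \<exists>F\<in>Fs. col F = i"
    and orth: "\<And>F F'. F \<in> Fs \<Longrightarrow> F' \<in> Fs \<Longrightarrow> F \<noteq> F' \<Longrightarrow> col F = col F' \<Longrightarrow> v F * v F' \<doteq> 0"
  shows "(\<Prod>F\<in>Fs. X + v F) \<doteq> X ^ (card Fs - n) * (\<Prod>i<n. X + (\<Sum>F\<in>{F\<in>Fs. col F = i}. v F))"
    and "n \<le> card Fs"
proof -
  let ?C = "\<lambda>i. {F\<in>Fs. col F = i}"
  have c1: "card (?C i) \<ge> 1" if "i < n" for i
  proof -
    have "?C i \<noteq> {}" using ne[OF that] by auto
    then have "card (?C i) > 0" using fin by (simp add: card_gt_0_iff)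
    then show ?thesis by simp
  qed
  have U: "Fs = (\<Union>i<n. ?C i)" using col by auto
  have card: "card Fs = (\<Sum>i<n. card (?C i))"
    by (subst U, rule card_UN_disjoint) (use fin in auto)
  have "(\<Sum>i<n. 1) \<le> (\<Sum>i<n. card (?C i))" by (rule sum_mono) (use c1 in auto)
  then show n: "n \<le> card Fs" using card by simp
  have sum: "(\<Sum>i<n. card (?C i) - 1) = card Fs - n"
    using card sum_subtractf_nat[of "{..<n}" "\<lambda>_. 1" "\<lambda>i. card (?C i)"] c1 by simp
  have "(\<Prod>F\<in>Fs. X + v F) = (\<Prod>i<n. \<Prod>F\<in>?C i. X + v F)"
    by (subst U, rule prod.UNION_disjoint) (use fin in auto)
  also have "\<dots> \<doteq> (\<Prod>i<n. X ^ (card (?C i) - 1) * (X + (\<Sum>F\<in>?C i. v F)))"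
  proof (rule eqv_prod)
    fix i assume "i \<in> {..<n}"
    then show "(\<Prod>F\<in>?C i. X + v F) \<doteq> X ^ (card (?C i) - 1) * (X + (\<Sum>F\<in>?C i. v F))"
      using fin ne[of i] orth by (intro prod_orthogonal) auto
  qed
  also have "\<dots> = X ^ (\<Sum>i<n. card (?C i) - 1) * (\<Prod>i<n. X + (\<Sum>F\<in>?C i. v F))"
    by (simp add: prod.distrib power_sum)
  finally show "(\<Prod>F\<in>Fs. X + v F) \<doteq> X ^ (card Fs - n) * (\<Prod>i<n. X + (\<Sum>F\<in>?C i. v F))"
    unfolding sum .
qed

text \<open>
  The relations among the classes \<open>v F\<close> of the facets in one factor: in the cohomology of a small
  cover for \<open>d = 1\<close>, and with \<open>v F ^ 2\<close> as the degree two classes of a quasitoric manifold for \<open>d = 2\<close>.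
\<close>

locale facet_ring = ring_cong eqv for eqv :: "'r::comm_ring_1 \<Rightarrow> 'r \<Rightarrow> bool" (infix "\<doteq>" 50) +
  fixes Fs :: "'f set" and col :: "'f \<Rightarrow> nat" and H :: "nat \<Rightarrow> 'f" and n d k :: nat and v :: "'f \<Rightarrow> 'r"
  assumes d: "d \<in> {1, 2}" and n: "n = 2 ^ k"
    and fin: "finite Fs" and col: "F \<in> Fs \<Longrightarrow> col F < n"
    and H: "i < n \<Longrightarrow> H i \<in> Fs" "i < n \<Longrightarrow> col (H i) = i"
    and orth: "F \<in> Fs \<Longrightarrow> F' \<in> Fs \<Longrightarrow> F \<noteq> F' \<Longrightarrow> col F = col F' \<Longrightarrow> v F ^ d * v F' ^ d \<doteq> 0"
    and row: "i < n \<Longrightarrow> (\<Sum>F\<in>{F\<in>Fs. col F = i}. v F) + (\<Sum>l<i. v (H l)) \<doteq> 0"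
begin

definition T :: "nat \<Rightarrow> 'r" where
  "T i = (\<Sum>F\<in>{F\<in>Fs. col F = i}. v F ^ d)"

lemma T_eq: "i < n \<Longrightarrow> T i \<doteq> (\<Sum>l<i. v (H l) ^ d)"
proof -
  assume i: "i < n"
  have "T i \<doteq> (\<Sum>F\<in>{F\<in>Fs. col F = i}. v F) ^ d"
    unfolding T_def by (rule eqv_sym[OF frobenius_sum[OF d]])
  also have "\<dots> \<doteq> (\<Sum>l<i. v (H l)) ^ d" by (rule eqv_power[OF eqv_cancel[OF row[OF i]]])
  also have "\<dots> \<doteq> (\<Sum>l<i. v (H l) ^ d)" by (rule frobenius_sum[OF d])
  finally show ?thesis .
qed

lemma T_Suc: "Suc i < n \<Longrightarrow> T (Suc i) \<doteq> T i + v (H i) ^ d"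
proof -
  assume i: "Suc i < n"
  have "T i + v (H i) ^ d \<doteq> (\<Sum>l<i. v (H l) ^ d) + v (H i) ^ d"
    by (rule eqv_add[OF T_eq eqv_refl]) (use i in simp)
  from eqv_trans[OF _ eqv_sym[OF this], of "T (Suc i)"] T_eq[OF i] show ?thesis by simp
qed

lemma T_mult: "i < n \<Longrightarrow> T i * v (H i) ^ d \<doteq> v (H i) ^ d * v (H i) ^ d"
proof -
  assume i: "i < n"
  let ?C = "{F\<in>Fs. col F = i}"
  have "T i * v (H i) ^ d = (\<Sum>F\<in>?C. v F ^ d * v (H i) ^ d)" by (simp add: T_def sum_distrib_right)
  also have "\<dots> \<doteq> (\<Sum>F\<in>?C. if F = H i then v (H i) ^ d * v (H i) ^ d else 0)"
    by (rule eqv_sum) (use H[OF i] orth in auto)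
  also have "\<dots> = v (H i) ^ d * v (H i) ^ d"
    using H[OF i] fin by (subst sum.delta) auto
  finally show ?thesis .
qed

text \<open>Let \<open>V\<close> be the class of \<open>H i\<close>. The row relations give
  \<open>T (Suc i) = T i + V\<close>, and \<open>T i * V = V * V\<close> because \<open>H i\<close>
  meets no other facet of its color. Squaring the first relation gives the relation of the
  tower.\<close>

sublocale tower eqv T n
proof
  show "T 0 \<doteq> 0" using T_eq[of 0] n by simp
  show "n > 0" using n by simp
  fix i assume i: "Suc i < n"
  let ?V = "v (H i) ^ d"
  have "T (Suc i) * T (Suc i) \<doteq> (T i + ?V) * (T i + ?V)" by (intro eqv_mult T_Suc i)
  also have "\<dots> = (T i * ?V + T i * ?V) + (T i * T i + ?V * ?V)" by (simp add: algebra_simps)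
  also have "\<dots> \<doteq> T i * T i + ?V * ?V" by (rule eqv_add_0(1)[OF eqv_double])
  also have "\<dots> \<doteq> T i * T i + T i * ?V" by (intro eqv_add eqv_refl eqv_sym[OF T_mult]) (use i in auto)
  also have "\<dots> = T i * (T i + ?V)" by (simp add: algebra_simps)
  also have "\<dots> \<doteq> T i * T (Suc i)" by (intro eqv_mult eqv_refl eqv_sym[OF T_Suc] i)
  finally show "T (Suc i) * T (Suc i) \<doteq> T i * T (Suc i)" .
qed

text \<open>Both claims go together: since the product of the first classes annihilates
  \<open>T m\<close>, the next factor \<open>T m + v (H m) ^ d\<close> can be replaced by
  \<open>v (H m) ^ d\<close>.\<close>

lemma prod_T: "m < n \<Longrightarrow> prod T {1..m} * T m \<doteq> 0 \<and> prod T {1..m} \<doteq> (\<Prod>i<m. v (H i) ^ d)"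
proof (induction m)
  case 0
  then show ?case using t0 by simp
next
  case (Suc m)
  have IH: "prod T {1..m} * T m \<doteq> 0" "prod T {1..m} \<doteq> (\<Prod>i<m. v (H i) ^ d)" using Suc by auto
  have P: "prod T {1..Suc m} = prod T {1..m} * T (Suc m)" by simp
  have "prod T {1..Suc m} * T (Suc m) = prod T {1..m} * (T (Suc m) * T (Suc m))" by (simp add: mult.assoc)
  also have "\<dots> \<doteq> prod T {1..m} * (T m * T (Suc m))" by (rule eqv_mult[OF eqv_refl tS[OF Suc.prems]])
  also have "\<dots> = (prod T {1..m} * T m) * T (Suc m)" by (simp add: mult.assoc)
  also have "\<dots> \<doteq> 0" by (rule eqv_0_mult(2)[OF IH(1)])
  finally have 1: "prod T {1..Suc m} * T (Suc m) \<doteq> 0" .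
  have "prod T {1..Suc m} \<doteq> prod T {1..m} * (T m + v (H m) ^ d)"
    unfolding P by (rule eqv_mult[OF eqv_refl T_Suc[OF Suc.prems]])
  also have "\<dots> = prod T {1..m} * T m + prod T {1..m} * v (H m) ^ d" by (simp add: algebra_simps)
  also have "\<dots> \<doteq> prod T {1..m} * v (H m) ^ d" by (rule eqv_add_0(1)[OF IH(1)])
  also have "\<dots> \<doteq> (\<Prod>i<m. v (H i) ^ d) * v (H m) ^ d" by (rule eqv_mult[OF IH(2) eqv_refl])
  finally show ?case using 1 by simp
qed

lemma prod_T_top: "prod T {1..<n} \<doteq> (\<Prod>i<n - 1. v (H i) ^ d)"
proof -
  have "{1..<n} = {1..n - 1}" using n0 by auto
  then show ?thesis using prod_T[of "n - 1"] n0 by simp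
qed

text \<open>The homogenized total Stiefel-Whitney class of the tangent bundle plus a trivial bundle
  of rank \<open>d * (card Fs - n)\<close>, split into the line bundles of the facets.\<close>

definition W :: "'r \<Rightarrow> 'r" where
  "W x = (\<Prod>F\<in>Fs. (x + v F) ^ d)"

text \<open>Collected by colors, \<open>W x\<close> is a power of \<open>x ^ d\<close> times the
  product of the \<open>x ^ d + T i\<close>, and \<open>csym_poly\<close> inverts this
  product.\<close>

lemma W_inverse: "W x * csym_poly T (x ^ d) n (n - 1) \<doteq> (x ^ d) ^ (card Fs + n - 1)"
proof -
  have "W x \<doteq> (\<Prod>F\<in>Fs. x ^ d + v F ^ d)" unfolding W_def by (intro eqv_prod frobenius d)
  also have "\<dots> \<doteq> (x ^ d) ^ (card Fs - n) * (\<Prod>i<n. x ^ d + T i)"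
    unfolding T_def by (rule prod_by_color(1)) (use fin col H orth in auto)
  finally have "W x * csym_poly T (x ^ d) n (n - 1) \<doteq>
      ((x ^ d) ^ (card Fs - n) * (\<Prod>i<n. x ^ d + T i)) * csym_poly T (x ^ d) n (n - 1)"
    by (rule eqv_mult[OF _ eqv_refl])
  also have "\<dots> = (x ^ d) ^ (card Fs - n) * ((\<Prod>i<n. x ^ d + T i) * csym_poly T (x ^ d) n (n - 1))"
    by (simp add: mult.assoc)
  also have "\<dots> \<doteq> (x ^ d) ^ (card Fs - n) * (x ^ d) ^ (n + (n - 1))"
    by (intro eqv_mult[OF eqv_refl] csym_poly_inverse) simp
  also have "\<dots> = (x ^ d) ^ (card Fs - n + (n + (n - 1)))" by (simp only: power_add)
  also have "card Fs - n + (n + (n - 1)) = card Fs + n - 1"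
  proof -
    have "n \<le> card Fs" by (rule prod_by_color(2)[of Fs col n "\<lambda>F. v F ^ d"]) (use fin col H orth in auto)
    then show ?thesis using n0 by simp
  qed
  finally show ?thesis .
qed

end

text \<open>
  The class \<open>x\<close> is that of the projectivization of the sum of the tangent bundles and a trivial
  line; \<open>W x * W' x * x = 0\<close> is its defining relation.
\<close>

lemma top_power:
  assumes "facet_ring eqv Fs col H n d k v" "facet_ring eqv Fs' col' H' n d k v'"
    and rel: "eqv (facet_ring.W Fs d v x * facet_ring.W Fs' d v' x * x) 0"
  shows "eqv (x ^ (d * (card Fs + n - 1 + (card Fs' + n - 1))))
    (facet_ring.W Fs d v x * facet_ring.W Fs' d v' x *
      (\<Prod>i<n - 1. v (H i) ^ d) * (\<Prod>i<n - 1. v' (H' i) ^ d))"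
proof -
  interpret A: facet_ring eqv Fs col H n d k v by fact
  interpret B: facet_ring eqv Fs' col' H' n d k v' by fact
  let ?G = "csym_poly A.T (x ^ d) n (n - 1)" and ?G' = "csym_poly B.T (x ^ d) n (n - 1)"
  have "x ^ (d * (card Fs + n - 1 + (card Fs' + n - 1))) =
      (x ^ d) ^ (card Fs + n - 1) * (x ^ d) ^ (card Fs' + n - 1)"
    by (simp only: power_mult power_add)
  also have "eqv \<dots> ((A.W x * ?G) * (B.W x * ?G'))"
    by (intro A.eqv_mult A.eqv_sym[OF A.W_inverse] A.eqv_sym[OF B.W_inverse])
  also have "\<dots> = (A.W x * B.W x) * ?G * ?G'" by (simp add: mult_ac)
  finally have 1: "eqv (x ^ (d * (card Fs + n - 1 + (card Fs' + n - 1)))) ((A.W x * B.W x) * ?G * ?G')" .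
  have "x ^ d = x * x ^ (d - 1)" using A.d by (auto simp: power2_eq_square)
  then have X: "eqv (A.W x * B.W x * x ^ d) 0"
    using A.eqv_0_mult(2)[OF rel, of "x ^ (d - 1)"] by (simp add: mult.assoc)
  \<comment> \<open>Behind the factor \<open>A.W x * B.W x\<close> the class \<open>x ^ d\<close> is
    zero, so only the coefficient free of \<open>x\<close> remains of each of the two
    inverses.\<close>
  have 2: "eqv ((A.W x * B.W x) * ?G * ?G') ((A.W x * B.W x) * prod A.T {1..<n} * ?G')"
    by (rule A.eqv_mult[OF A.csym_poly_top[OF A.n X] A.eqv_refl])
  have "eqv ((A.W x * B.W x) * prod A.T {1..<n} * x ^ d) 0"
    using A.eqv_0_mult(2)[OF X, of "prod A.T {1..<n}"] by (simp add: mult_ac)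
  then have 3: "eqv ((A.W x * B.W x) * prod A.T {1..<n} * ?G')
      ((A.W x * B.W x) * prod A.T {1..<n} * prod B.T {1..<n})"
    by (rule B.csym_poly_top[OF B.n])
  have 4: "eqv ((A.W x * B.W x) * prod A.T {1..<n} * prod B.T {1..<n})
      ((A.W x * B.W x) * (\<Prod>i<n - 1. v (H i) ^ d) * (\<Prod>i<n - 1. v' (H' i) ^ d))"
    by (intro A.eqv_mult A.eqv_refl A.prod_T_top B.prod_T_top)
  show ?thesis using A.eqv_trans[OF 1 A.eqv_trans[OF 2 A.eqv_trans[OF 3 4]]] .
qed

section \<open>The ring of characters\<close>

text \<open>Polynomials over the field with two elements in variables from \<open>'c\<close>; a
  multiset is a monomial.\<close>

type_synonym 'c mpoly2 = "'c multiset \<Rightarrow>\<^sub>0 bit"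

definition lin :: "('c multiset \<Rightarrow> bit) \<Rightarrow> 'c mpoly2 \<Rightarrow> bit" where
  "lin e p = (\<Sum>m\<in>Poly_Mapping.keys p. e m)"

definition Var :: "'c \<Rightarrow> 'c mpoly2" where
  "Var c = Poly_Mapping.single {#c#} 1"

lemma lin_superset:
  assumes "finite A" "Poly_Mapping.keys p \<subseteq> A"
  shows "lin e p = (\<Sum>m\<in>A. Poly_Mapping.lookup p m * e m)"
proof -
  have "(\<Sum>m\<in>A. Poly_Mapping.lookup p m * e m) =
      (\<Sum>m\<in>Poly_Mapping.keys p. Poly_Mapping.lookup p m * e m)"
    by (rule sum.mono_neutral_right) (use assms in \<open>auto simp: in_keys_iff\<close>)
  also have "\<dots> = lin e p" unfolding lin_def
    by (rule sum.cong) (auto simp: in_keys_iff)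
  finally show ?thesis by simp
qed

lemma lin_add: "lin e (p + q) = lin e p + lin e q"
proof -
  let ?A = "Poly_Mapping.keys p \<union> Poly_Mapping.keys q"
  have "Poly_Mapping.keys (p + q) \<subseteq> ?A" by (rule Poly_Mapping.keys_add)
  then show ?thesis
    by (simp add: lin_superset[of ?A] lookup_add sum.distrib algebra_simps)
qed

lemma lin_0 [simp]: "lin e 0 = 0"
  by (simp add: lin_def)

lemma lin_sum: "lin e (sum f A) = (\<Sum>i\<in>A. lin e (f i))"
  by (induction A rule: infinite_finite_induct) (auto simp: lin_add)

lemma mpoly2_decompose: "p = (\<Sum>m\<in>Poly_Mapping.keys p. Poly_Mapping.single m (1::bit))"
proof (rule poly_mapping_eqI)
  fix m
  have "(\<Sum>l\<in>Poly_Mapping.keys p. Poly_Mapping.lookup (Poly_Mapping.single l 1) m) =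
      (\<Sum>l\<in>Poly_Mapping.keys p. if l = m then 1 else (0::bit))"
    by (intro sum.cong) (auto simp: lookup_single when_def)
  then show "Poly_Mapping.lookup p m =
      Poly_Mapping.lookup (\<Sum>m\<in>Poly_Mapping.keys p. Poly_Mapping.single m 1) m"
    by (auto simp: lookup_sum sum.delta in_keys_iff)
qed

lemma mpoly2_char2: "(1 :: 'c mpoly2) + 1 = 0"
proof -
  have "(1 :: 'c mpoly2) = Poly_Mapping.single 0 1" by simp
  then show ?thesis by (metis bit_add_self(1) single_add single_zero)
qed

lemma prod_Var: "prod_list (map Var cs) = Poly_Mapping.single (mset cs) 1"
  by (induction cs) (auto simp: Var_def mult_single zero_multiset_def[symmetric])

text \<open>Two classes are identified when they have the same products with all others under
  \<open>lin e\<close>. This divides by the largest ideal on which the functional vanishes, so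
  relations need only be tested in top degree.\<close>

definition lin_eqv :: "('c multiset \<Rightarrow> bit) \<Rightarrow> 'c mpoly2 \<Rightarrow> 'c mpoly2 \<Rightarrow> bool" where
  "lin_eqv e p q \<longleftrightarrow> (\<forall>r. lin e (p * r) = lin e (q * r))"

lemma lin_eqvI:
  assumes "\<And>m. lin e (p * Poly_Mapping.single m 1) = lin e (q * Poly_Mapping.single m 1)"
  shows "lin_eqv e p q"
  unfolding lin_eqv_def
proof
  fix r
  have "p * r = (\<Sum>m\<in>Poly_Mapping.keys r. p * Poly_Mapping.single m 1)" for p :: "'a mpoly2"
    by (subst mpoly2_decompose[of r]) (simp add: sum_distrib_left)
  then show "lin e (p * r) = lin e (q * r)" using assms by (simp add: lin_sum)
qed

lemma lin_eqv_lin: "lin_eqv e p q \<Longrightarrow> lin e p = lin e q"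
  unfolding lin_eqv_def by (metis mult_1_right)

interpretation lin_eqv: ring_cong "lin_eqv e" for e
proof
  fix a b a' b' :: "'a mpoly2"
  assume ab: "lin_eqv e a b" "lin_eqv e a' b'"
  then show "lin_eqv e (a + a') (b + b')" by (simp add: lin_eqv_def distrib_right lin_add)
  have "lin e (a * a' * r) = lin e (b * b' * r)" for r
  proof -
    have "lin e (a * (a' * r)) = lin e (b * (a' * r))" using ab unfolding lin_eqv_def by blast
    moreover have "lin e (a' * (b * r)) = lin e (b' * (b * r))" using ab unfolding lin_eqv_def by blast
    ultimately show ?thesis by (simp add: mult_ac)
  qed
  then show "lin_eqv e (a * a') (b * b')" by (simp add: lin_eqv_def)
next
  show "lin_eqv e (1 + 1) 0" unfolding mpoly2_char2 by (simp add: lin_eqv_def)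
qed (auto simp: lin_eqv_def)

section \<open>Relations between characters under the evaluation pairing\<close>

context gauge_chain
begin

text \<open>The functional is zero outside degree \<open>D\<close>. The order chosen for the factors
  is immaterial by \<open>E_perm\<close>.\<close>

definition Em :: "('a set \<Rightarrow> bit) multiset \<Rightarrow> bit" where
  "Em m = (if size m = D \<and> (\<forall>\<kappa>\<in>#m. character \<kappa>) then E {} (SOME \<kappa>s. mset \<kappa>s = m) else 0)"

lemma Em_mset:
  assumes "length \<kappa>s = D" "\<forall>\<kappa>\<in>set \<kappa>s. character \<kappa>"
  shows "Em (mset \<kappa>s) = E {} \<kappa>s"
proof -
  let ?l = "SOME \<mu>s. mset \<mu>s = mset \<kappa>s"
  have "mset ?l = mset \<kappa>s" by (rule someI[of _ \<kappa>s]) simp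
  then have "E {} \<kappa>s = E {} ?l" using assms by (intro E_perm) auto
  then show ?thesis using assms by (simp add: Em_def)
qed

abbreviation ceq :: "('a set \<Rightarrow> bit) mpoly2 \<Rightarrow> ('a set \<Rightarrow> bit) mpoly2 \<Rightarrow> bool" (infix "\<doteq>" 50) where
  "p \<doteq> q \<equiv> lin_eqv Em p q"

lemma lin_single: "lin Em (Poly_Mapping.single m 1) = Em m"
  by (simp add: lin_def)

lemma ceq_0I:
  assumes "\<And>\<mu>s. length \<kappa>s + length \<mu>s = D \<Longrightarrow> \<forall>\<kappa>\<in>set \<kappa>s. character \<kappa> \<Longrightarrow> \<forall>\<mu>\<in>set \<mu>s. character \<mu> \<Longrightarrow>
    E {} (\<kappa>s @ \<mu>s) = 0"
  shows "prod_list (map Var \<kappa>s) \<doteq> 0"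
proof (rule lin_eqvI)
  fix m :: "('a set \<Rightarrow> bit) multiset"
  obtain \<mu>s where m: "m = mset \<mu>s" by (metis ex_mset)
  have "prod_list (map Var \<kappa>s) * Poly_Mapping.single m 1 = Poly_Mapping.single (mset (\<kappa>s @ \<mu>s)) 1"
    unfolding prod_Var m by (simp add: mult_single)
  moreover have "Em (mset (\<kappa>s @ \<mu>s)) = 0"
  proof (cases "length (\<kappa>s @ \<mu>s) = D \<and> (\<forall>\<kappa>\<in>set (\<kappa>s @ \<mu>s). character \<kappa>)")
    case True
    then show ?thesis using Em_mset[of "\<kappa>s @ \<mu>s"] assms[of \<mu>s] by auto
  next
    case False
    then show ?thesis unfolding Em_def by (metis set_mset_mset size_mset)
  qed
  ultimately show "lin Em (prod_list (map Var \<kappa>s) * Poly_Mapping.single m 1) =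
      lin Em (0 * Poly_Mapping.single m 1)" by (simp only: lin_single) simp
qed

lemma Var_add:
  assumes ch: "character \<kappa>" "character \<mu>"
  shows "Var (\<lambda>g. \<kappa> g + \<mu> g) \<doteq> Var \<kappa> + Var \<mu>"
proof (rule lin_eqvI)
  fix m :: "('a set \<Rightarrow> bit) multiset"
  obtain \<mu>s where m: "m = mset \<mu>s" by (metis ex_mset)
  have V: "Var c * Poly_Mapping.single m 1 = Poly_Mapping.single (mset (c # \<mu>s)) 1" for c :: "'a set \<Rightarrow> bit"
    unfolding Var_def m by (simp add: mult_single)
  have "Em (mset ((\<lambda>g. \<kappa> g + \<mu> g) # \<mu>s)) = Em (mset (\<kappa> # \<mu>s)) + Em (mset (\<mu> # \<mu>s))"
  proof (cases "Suc (length \<mu>s) = D \<and> (\<forall>\<kappa>\<in>set \<mu>s. character \<kappa>)")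
    case True
    then show ?thesis using E_add[of "{}" \<mu>s \<kappa> \<mu>] ch character_add[OF ch]
      by (simp add: Em_mset del: mset.simps)
  next
    case False
    then have "Em (mset (c # \<mu>s)) = 0" for c unfolding Em_def by auto
    then show ?thesis by (simp del: mset.simps)
  qed
  then show "lin Em (Var (\<lambda>g. \<kappa> g + \<mu> g) * Poly_Mapping.single m 1) =
      lin Em ((Var \<kappa> + Var \<mu>) * Poly_Mapping.single m 1)"
    by (simp only: distrib_right lin_add V lin_single)
qed

lemma Var_trivial:
  assumes "\<And>g. g \<in> \<Gamma> \<Longrightarrow> \<kappa> g = 0"
  shows "Var \<kappa> \<doteq> 0"
  using ceq_0I[of "[\<kappa>]"] E_trivial[of "{}" _ \<kappa>] assms by simp

lemma Var_sum_trivial: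
  assumes "finite A" "\<And>i. i \<in> A \<Longrightarrow> character (\<kappa> i)" "\<And>g. g \<in> \<Gamma> \<Longrightarrow> (\<Sum>i\<in>A. \<kappa> i g) = 0"
  shows "(\<Sum>i\<in>A. Var (\<kappa> i)) \<doteq> 0"
proof -
  have "Var (\<lambda>g. \<Sum>i\<in>B. \<kappa> i g) \<doteq> (\<Sum>i\<in>B. Var (\<kappa> i)) \<and> character (\<lambda>g. \<Sum>i\<in>B. \<kappa> i g)"
    if "finite B" "B \<subseteq> A" for B
    using that
  proof (induction B rule: finite_induct)
    case empty
    show ?case using Var_trivial[of "\<lambda>g. 0"] by (simp add: character_def)
  next
    case (insert i B)
    then have IH: "Var (\<lambda>g. \<Sum>i\<in>B. \<kappa> i g) \<doteq> (\<Sum>i\<in>B. Var (\<kappa> i))" "character (\<lambda>g. \<Sum>i\<in>B. \<kappa> i g)"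
      and i: "character (\<kappa> i)" using assms(2) by auto
    have "Var (\<lambda>g. \<kappa> i g + (\<Sum>i\<in>B. \<kappa> i g)) \<doteq> Var (\<kappa> i) + (\<Sum>i\<in>B. Var (\<kappa> i))"
      by (rule lin_eqv.eqv_trans[OF Var_add[OF i IH(2)] lin_eqv.eqv_add[OF lin_eqv.eqv_refl IH(1)]])
    then show ?case using insert character_add[OF i IH(2)] by simp
  qed
  from this[OF assms(1) subset_refl] have "(\<Sum>i\<in>A. Var (\<kappa> i)) \<doteq> Var (\<lambda>g. \<Sum>i\<in>A. \<kappa> i g)"
    by (blast intro: lin_eqv.eqv_sym)
  also have "\<dots> \<doteq> 0" by (rule Var_trivial) (use assms in auto)
  finally show ?thesis .
qed

end

section \<open>Products and wedges of simple systems\<close>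

definition join :: "('i \<Rightarrow> real) set \<Rightarrow> ('j \<Rightarrow> real) set \<Rightarrow> ('i + 'j \<Rightarrow> real) set" where
  "join \<Omega> \<Omega>' = {p. p \<circ> Inl \<in> \<Omega> \<and> p \<circ> Inr \<in> \<Omega>'}"

lemma face_join:
  "face (join \<Omega> \<Omega>') S = {} \<longleftrightarrow> face \<Omega> (Inl -` S) = {} \<or> face \<Omega>' (Inr -` S) = {}"
proof -
  have "\<exists>p. p \<in> face (join \<Omega> \<Omega>') S" if "q \<in> face \<Omega> (Inl -` S)" "r \<in> face \<Omega>' (Inr -` S)" for q r
  proof (rule exI[of _ "case_sum q r"])
    have "case_sum q r c = 0" if "c \<in> S" for c
      using \<open>q \<in> _\<close> \<open>r \<in> _\<close> that by (cases c) (auto simp: face_def)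
    then show "case_sum q r \<in> face (join \<Omega> \<Omega>') S"
      using that by (auto simp: face_def join_def case_sum_o_inj)
  qed
  moreover have "p \<circ> Inl \<in> face \<Omega> (Inl -` S) \<and> p \<circ> Inr \<in> face \<Omega>' (Inr -` S)"
    if "p \<in> face (join \<Omega> \<Omega>') S" for p
    using that by (auto simp: face_def join_def)
  ultimately show ?thesis by blast
qed

text \<open>An edge of a product is an edge of one factor times a vertex of the other, so its end
  points come from one factor alone.\<close>

lemma simple_system_join:
  assumes "simple_system I \<Omega> D" "simple_system I' \<Omega>' D'"
  shows "simple_system (I <+> I') (join \<Omega> \<Omega>') (D + D')"
proof -
  interpret A: simple_system I \<Omega> D by fact
  interpret B: simple_system I' \<Omega>' D' by fact
  have split: "card S = card (Inl -` S) + card (Inr -` S)" and sub: "Inl -` S \<subseteq> I" "Inr -` S \<subseteq> I'"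
    if "S \<subseteq> I <+> I'" for S
  proof -
    have "S = (Inl -` S) <+> (Inr -` S)"
    proof (rule Set.set_eqI)
      show "c \<in> S \<longleftrightarrow> c \<in> (Inl -` S) <+> (Inr -` S)" for c by (cases c) auto
    qed
    moreover show "Inl -` S \<subseteq> I" "Inr -` S \<subseteq> I'" using that by auto
    ultimately show "card S = card (Inl -` S) + card (Inr -` S)"
      using A.finite_sub B.finite_sub by (metis card_Plus)
  qed
  show ?thesis
  proof
    show "finite (I <+> I')" using A.finite_I B.finite_I by simp
    show "convex_fun (join \<Omega> \<Omega>')"
      using A.convex_Om B.convex_Om unfolding convex_fun_def join_def by (simp add: o_def)
    obtain b b' where b: "\<forall>p\<in>\<Omega>. \<forall>i. \<bar>p i\<bar> \<le> b" "\<forall>p\<in>\<Omega>'. \<forall>i. \<bar>p i\<bar> \<le> b'"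
      using A.bounded_Om B.bounded_Om by blast
    have "\<bar>p c\<bar> \<le> max b b'" if "p \<in> join \<Omega> \<Omega>'" for p c
      using b that by (cases c) (auto simp: join_def o_def le_max_iff_disj)
    then show "\<exists>B. \<forall>p\<in>join \<Omega> \<Omega>'. \<forall>i. \<bar>p i\<bar> \<le> B" by blast
    show "0 \<le> p c" if "p \<in> join \<Omega> \<Omega>'" for p c
      using that A.nonneg_Om[of "p \<circ> Inl"] B.nonneg_Om[of "p \<circ> Inr"] by (cases c) (auto simp: join_def)
    show "p c = 0" if "p \<in> join \<Omega> \<Omega>'" "c \<notin> I <+> I'" for p c
      using that A.supp_Om[of "p \<circ> Inl"] B.supp_Om[of "p \<circ> Inr"] by (cases c) (auto simp: join_def)
    show "p \<in> join \<Omega> \<Omega>'" if "\<And>m. q m \<in> join \<Omega> \<Omega>'" "\<And>c. (\<lambda>m. q m c) \<longlonglongrightarrow> p c" for q p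
      using that A.closed_Om[of "\<lambda>m. q m \<circ> Inl" "p \<circ> Inl"] B.closed_Om[of "\<lambda>m. q m \<circ> Inr" "p \<circ> Inr"]
      by (auto simp: join_def)
    fix S assume S: "S \<subseteq> I <+> I'"
    let ?L = "Inl -` S" and ?R = "Inr -` S"
    have ins: "Inl -` insert (Inl i) S = insert i ?L" "Inr -` insert (Inl i) S = ?R"
      "Inl -` insert (Inr j) S = ?L" "Inr -` insert (Inr j) S = insert j ?R" for i j by auto
    {
      assume "card S = Suc (D + D')"
      then have "card ?L > D \<or> card ?R > D'" using split[OF S] by linarith
      then show "face (join \<Omega> \<Omega>') S = {}"
        using A.face_empty' B.face_empty' sub[OF S] unfolding face_join by blast
    }
    {
      assume c: "Suc (card S) = D + D'"
      let ?N = "{c \<in> I <+> I' - S. face (join \<Omega> \<Omega>') (insert c S) \<noteq> {}}"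
      let ?NL = "{i \<in> I - ?L. face \<Omega> (insert i ?L) \<noteq> {}}" and ?NR = "{j \<in> I' - ?R. face \<Omega>' (insert j ?R) \<noteq> {}}"
      have N: "c \<in> ?N \<longleftrightarrow> (\<exists>i\<in>?NL. c = Inl i \<and> face \<Omega>' ?R \<noteq> {}) \<or>
          (\<exists>j\<in>?NR. c = Inr j \<and> face \<Omega> ?L \<noteq> {})" for c
        unfolding face_join by (cases c) (auto simp: ins)
      have L1: "face \<Omega> (insert i ?L) = {}" if "i \<in> I - ?L" "card ?L \<ge> D" for i
        using that A.finite_sub[OF sub(1)[OF S]] sub(1)[OF S] by (intro A.face_empty') auto
      have R1: "face \<Omega>' (insert j ?R) = {}" if "j \<in> I' - ?R" "card ?R \<ge> D'" for j
        using that B.finite_sub[OF sub(2)[OF S]] sub(2)[OF S] by (intro B.face_empty') auto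
      consider "card ?L > D" | "card ?R > D'" | "Suc (card ?L) = D" "card ?R = D'"
        | "card ?L = D" "Suc (card ?R) = D'"
        using c split[OF S] by linarith
      then show "even (card ?N)"
      proof cases
        case 1
        then have f: "face \<Omega> ?L = {}" using A.face_empty' sub[OF S] by blast
        have NL: "?NL = {}" using L1 1 by auto
        have "?N = {}"
        proof (rule equals0I)
          show False if "c \<in> ?N" for c using that f unfolding N NL by simp
        qed
        then show ?thesis by (simp only: card.empty) simp
      next
        case 2
        then have f: "face \<Omega>' ?R = {}" using B.face_empty' sub[OF S] by blast
        have NR: "?NR = {}" using R1 2 by auto
        have "?N = {}"
        proof (rule equals0I)
          show False if "c \<in> ?N" for c using that f unfolding N NR by simp
        qed
        then show ?thesis by (simp only: card.empty) simp
      next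
        case 3
        have NR: "?NR = {}" using R1 3 by auto
        have "?N = (if face \<Omega>' ?R = {} then {} else Inl ` ?NL)"
        proof (rule Set.set_eqI)
          show "c \<in> ?N \<longleftrightarrow> c \<in> (if face \<Omega>' ?R = {} then {} else Inl ` ?NL)" for c
            unfolding N NR by auto
        qed
        moreover have "even (card (Inl ` ?NL :: ('a + 'b) set))"
          using A.edge_even[OF sub(1)[OF S] 3(1)] by (subst card_image) auto
        ultimately show ?thesis by (simp split: if_splits)
      next
        case 4
        have NL: "?NL = {}" using L1 4 by auto
        have "?N = (if face \<Omega> ?L = {} then {} else Inr ` ?NR)"
        proof (rule Set.set_eqI)
          show "c \<in> ?N \<longleftrightarrow> c \<in> (if face \<Omega> ?L = {} then {} else Inr ` ?NR)" for c
            unfolding N NL by auto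
        qed
        moreover have "even (card (Inr ` ?NR :: ('a + 'b) set))"
          using B.edge_even[OF sub(2)[OF S] 4(2)] by (subst card_image) auto
        ultimately show ?thesis by (simp split: if_splits)
      qed
    }
  qed
qed

text \<open>A point whose only coordinate never vanishes. Its wedge is a simplex, and the square
  roots over a simplex form a sphere.\<close>

lemma simple_system_point: "simple_system {()} {\<lambda>_. 1} 0"
proof
  show "(p :: unit \<Rightarrow> real) \<in> {\<lambda>_. 1}" if "\<And>m. q m \<in> {\<lambda>_. 1}" "\<And>i. (\<lambda>m. q m i) \<longlonglongrightarrow> p i"
    for q :: "nat \<Rightarrow> unit \<Rightarrow> real" and p
  proof -
    have "(\<lambda>m. 1) \<longlonglongrightarrow> p ()" using that by auto
    then have "p () = 1" using LIMSEQ_unique[OF tendsto_const] by metis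
    then show ?thesis by auto
  qed
  show "face {\<lambda>_. 1} S = {}" if "S \<subseteq> {()}" "card S = Suc 0" for S :: "unit set"
  proof -
    have "S = {()}" using that by (metis card.empty nat.distinct(1) subset_singletonD)
    then show ?thesis by (simp add: face_def)
  qed
qed (auto simp: convex_fun_def)

text \<open>The simplicial wedge: the coordinate \<open>i\<close> is split into nonnegative parts.
  After square roots are taken, the parts are the components of a vector whose squared norm is that
  coordinate; this is how complex coordinates and spheres become real loci.\<close>

definition wedge :: "'j set \<Rightarrow> ('j \<Rightarrow> 'i) \<Rightarrow> ('i \<Rightarrow> real) set \<Rightarrow> ('j \<Rightarrow> real) set" where
  "wedge J \<tau> \<Omega> = {p. (\<forall>c. 0 \<le> p c) \<and> (\<forall>c. c \<notin> J \<longrightarrow> p c = 0) \<and> (\<lambda>i. \<Sum>c\<in>{c\<in>J. \<tau> c = i}. p c) \<in> \<Omega>}"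

locale wedge_system = simple_system I \<Omega> D for I :: "'i set" and \<Omega> D +
  fixes J :: "'j set" and \<tau> :: "'j \<Rightarrow> 'i"
  assumes finite_J: "finite J" and onto: "\<tau> ` J = I"
begin

definition full :: "'j set \<Rightarrow> 'i set" where
  "full S = {i\<in>I. {c\<in>J. \<tau> c = i} \<subseteq> S}"

lemma full_sub: "full S \<subseteq> I"
  by (auto simp: full_def)

lemma full_compl: "I - full S = \<tau> ` (J - S)"
proof (intro subset_antisym subsetI)
  fix i assume "i \<in> I - full S"
  then obtain c where "c \<in> J" "\<tau> c = i" "c \<notin> S" by (auto simp: full_def)
  then show "i \<in> \<tau> ` (J - S)" by auto
next
  fix i assume "i \<in> \<tau> ` (J - S)"
  then obtain c where c: "c \<in> J" "c \<notin> S" "i = \<tau> c" by auto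
  then have "i \<in> I" using onto by auto
  then show "i \<in> I - full S" using c by (auto simp: full_def)
qed

lemma face_wedge: "face (wedge J \<tau> \<Omega>) S = {} \<longleftrightarrow> face \<Omega> (full S) = {}"
proof
  assume e: "face \<Omega> (full S) = {}"
  have "(\<lambda>i. \<Sum>c\<in>{c\<in>J. \<tau> c = i}. p c) \<in> face \<Omega> (full S)" if "p \<in> face (wedge J \<tau> \<Omega>) S" for p
    using that by (auto simp: face_def wedge_def full_def intro!: sum.neutral)
  then show "face (wedge J \<tau> \<Omega>) S = {}" using e by blast
next
  assume e: "face (wedge J \<tau> \<Omega>) S = {}"
  show "face \<Omega> (full S) = {}"
  proof (rule ccontr)
    assume "face \<Omega> (full S) \<noteq> {}"
    then obtain q where q: "q \<in> face \<Omega> (full S)" by blast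
    have "\<forall>i\<in>I - full S. \<exists>c. c \<in> J - S \<and> \<tau> c = i" unfolding full_compl by blast
    then obtain r where r: "\<And>i. i \<in> I - full S \<Longrightarrow> r i \<in> J - S \<and> \<tau> (r i) = i" by metis
    \<comment> \<open>The whole value of \<open>q i\<close> goes to one part over \<open>i\<close>
      that is not forced to vanish.\<close>
    define p where "p c = (if c \<in> J \<and> \<tau> c \<in> I - full S \<and> c = r (\<tau> c) then q (\<tau> c) else 0)" for c
    have push: "(\<Sum>c\<in>{c\<in>J. \<tau> c = i}. p c) = q i" for i
    proof (cases "i \<in> I - full S")
      case True
      then have "(\<Sum>c\<in>{c\<in>J. \<tau> c = i}. p c) = (\<Sum>c\<in>{c\<in>J. \<tau> c = i}. if c = r i then q i else 0)"
        by (intro sum.cong) (auto simp: p_def)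
      also have "\<dots> = q i" using r[OF True] finite_J by (subst sum.delta) auto
      finally show ?thesis .
    next
      case False
      then have "q i = 0" using q supp_Om by (auto simp: face_def)
      moreover have "p c = 0" if "\<tau> c = i" for c using False that by (auto simp: p_def)
      ultimately show ?thesis by simp
    qed
    have "0 \<le> p c" for c using q nonneg_Om by (auto simp: p_def face_def)
    moreover have "p c = 0" if "c \<notin> J" for c using that by (simp add: p_def)
    moreover have "(\<lambda>i. \<Sum>c\<in>{c\<in>J. \<tau> c = i}. p c) \<in> \<Omega>" unfolding push using q by (simp add: face_def)
    ultimately have "p \<in> wedge J \<tau> \<Omega>" by (simp add: wedge_def)
    moreover have "p c = 0" if "c \<in> S" for c using r[of "\<tau> c"] that by (auto simp: p_def)
    ultimately show False using e by (auto simp: face_def)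
  qed
qed

lemma card_full: "card (full S) + card (\<tau> ` (J - S)) = card I"
  using card_Diff_subset[of "full S" I] full_sub[of S] finite_I finite_subset[OF full_sub[of S] finite_I]
    card_mono[OF finite_I full_sub[of S]]
  by (simp add: full_compl)

lemma full_insert:
  "c \<in> J - S \<Longrightarrow> full (insert c S) = (if \<exists>c'\<in>J - S. c' \<noteq> c \<and> \<tau> c' = \<tau> c then full S else insert (\<tau> c) (full S))"
proof -
  assume c: "c \<in> J - S"
  have "full (insert c S) = full S \<union> {i. i = \<tau> c \<and> (\<forall>c'\<in>J - S. \<tau> c' = \<tau> c \<longrightarrow> c' = c)}"
    using c onto unfolding full_def by blast
  then show ?thesis by auto
qed

text \<open>An edge of the wedge lies over an edge of \<Omega>, with one free part for each free
  coordinate, or over a vertex, where two free parts \<open>a\<close> and \<open>b\<close> share a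
  coordinate. In the second case the end points are those where \<open>a\<close> or \<open>b\<close>
  vanishes.\<close>

lemma simple_system_wedge: "simple_system J (wedge J \<tau> \<Omega>) (D + card J - card I)"
proof
  let ?push = "\<lambda>p i. \<Sum>c\<in>{c\<in>J. \<tau> c = i}. p c"
  have cJI: "card I \<le> card J" using card_image_le[OF finite_J, of \<tau>] onto by simp
  show "finite J" by (rule finite_J)
  show "convex_fun (wedge J \<tau> \<Omega>)"
    unfolding convex_fun_def
  proof (intro ballI allI impI)
    fix p q and t :: real assume p: "p \<in> wedge J \<tau> \<Omega>" and q: "q \<in> wedge J \<tau> \<Omega>" and t: "0 \<le> t" "t \<le> 1"
    have "0 \<le> (1 - t) * p c + t * q c" for c using p q t by (auto simp: wedge_def)
    then have "0 \<le> p c + t * (q c - p c)" for c by (simp add: algebra_simps)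
    moreover have "?push (\<lambda>c. p c + t * (q c - p c)) = (\<lambda>i. ?push p i + t * (?push q i - ?push p i))"
      by (simp add: sum.distrib sum_subtractf flip: sum_distrib_left)
    then have "?push (\<lambda>c. p c + t * (q c - p c)) \<in> \<Omega>"
      using convex_Om p q t unfolding convex_fun_def wedge_def by auto
    ultimately show "(\<lambda>c. p c + t * (q c - p c)) \<in> wedge J \<tau> \<Omega>"
      using p q by (auto simp: wedge_def)
  qed
  obtain B where B: "\<forall>p\<in>\<Omega>. \<forall>i. \<bar>p i\<bar> \<le> B" using bounded_Om by blast
  have "\<bar>p c\<bar> \<le> \<bar>B\<bar>" if p: "p \<in> wedge J \<tau> \<Omega>" for p c
  proof (cases "c \<in> J")
    case True
    have "p c \<le> ?push p (\<tau> c)"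
      by (rule member_le_sum) (use True p finite_J in \<open>auto simp: wedge_def\<close>)
    also have "\<dots> \<le> \<bar>?push p (\<tau> c)\<bar>" by simp
    also have "\<dots> \<le> B"
    proof -
      have "?push p \<in> \<Omega>" using p by (simp add: wedge_def)
      from spec[OF bspec[OF B this], of "\<tau> c"] show ?thesis by simp
    qed
    finally show ?thesis using p by (auto simp: wedge_def)
  qed (use p in \<open>auto simp: wedge_def\<close>)
  then show "\<exists>B. \<forall>p\<in>wedge J \<tau> \<Omega>. \<forall>i. \<bar>p i\<bar> \<le> B" by blast
  show "0 \<le> p c" if "p \<in> wedge J \<tau> \<Omega>" for p c using that by (simp add: wedge_def)
  show "p c = 0" if "p \<in> wedge J \<tau> \<Omega>" "c \<notin> J" for p c using that by (simp add: wedge_def)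
  show "p \<in> wedge J \<tau> \<Omega>" if q: "\<And>m. q m \<in> wedge J \<tau> \<Omega>" and l: "\<And>c. (\<lambda>m. q m c) \<longlonglongrightarrow> p c" for q p
  proof -
    have "0 \<le> p c" for c by (rule LIMSEQ_le_const[OF l]) (use q in \<open>auto simp: wedge_def\<close>)
    moreover have "p c = 0" if "c \<notin> J" for c
    proof -
      have "q m c = 0" for m using q that by (simp add: wedge_def)
      then show ?thesis using LIMSEQ_unique[OF l[of c], of 0] by simp
    qed
    moreover have "?push p \<in> \<Omega>"
      by (rule closed_Om[of "\<lambda>m. ?push (q m)"]) (use q l in \<open>auto simp: wedge_def intro!: tendsto_sum\<close>)
    ultimately show ?thesis by (simp add: wedge_def)
  qed
  fix S assume S: "S \<subseteq> J"
  have cS: "card (J - S) + card S = card J"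
    using S finite_J by (metis add.commute card_Diff_subset card_mono finite_subset le_add_diff_inverse)
  have im: "card (\<tau> ` (J - S)) \<le> card (J - S)" using finite_J by (intro card_image_le) auto
  {
    assume "card S = Suc (D + card J - card I)"
    then have "card (full S) > D" using card_full[of S] cS im cJI by linarith
    then show "face (wedge J \<tau> \<Omega>) S = {}" using face_empty'[OF full_sub] unfolding face_wedge by blast
  }
  assume c: "Suc (card S) = D + card J - card I"
  let ?N = "{c \<in> J - S. face (wedge J \<tau> \<Omega>) (insert c S) \<noteq> {}}"
  have fin: "finite (full S)" using full_sub finite_I finite_subset by blast
  have big: "face \<Omega> (insert (\<tau> c) (full S)) = {}" if "c \<in> J - S" "\<tau> c \<notin> full S" "card (full S) \<ge> D" for c
    using that onto full_sub[of S] fin by (intro face_empty') auto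
  have notfull: "\<tau> c \<notin> full S" if "c \<in> J - S" for c using that by (auto simp: full_def)
  consider "card (full S) > D" | "card (full S) = D" "Suc (card (\<tau> ` (J - S))) = card (J - S)"
    | "Suc (card (full S)) = D" "card (\<tau> ` (J - S)) = card (J - S)"
    using card_full[of S] cS im cJI c by linarith
  then show "even (card ?N)"
  proof cases
    case 1
    then have "face \<Omega> (full S) = {}" using face_empty'[OF full_sub] by blast
    moreover have "full S \<subseteq> full (insert c S)" for c by (auto simp: full_def)
    ultimately have "face \<Omega> (full (insert c S)) = {}" for c using face_mono by blast
    then have "?N = {}" unfolding face_wedge by blast
    then show ?thesis by (simp only: card.empty) simp
  next
    case 2
    have "\<not> inj_on \<tau> (J - S)" using 2(2) card_image by fastforce
    then obtain a b where ab: "a \<in> J - S" "b \<in> J - S" "a \<noteq> b" "\<tau> a = \<tau> b" by (auto simp: inj_on_def)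
    have "\<tau> ` (J - S - {a}) = \<tau> ` (J - S)" using ab by (auto simp: image_iff)
    moreover have "card (J - S - {a}) = card (\<tau> ` (J - S))" using 2(2) ab finite_J by simp
    ultimately have inj: "inj_on \<tau> (J - S - {a})" using finite_J by (intro eq_card_imp_inj_on) auto
    have "face (wedge J \<tau> \<Omega>) (insert c S) \<noteq> {} \<longleftrightarrow> (c = a \<or> c = b) \<and> face \<Omega> (full S) \<noteq> {}"
      if c: "c \<in> J - S" for c
    proof (cases "c = a \<or> c = b")
      case True
      then have "\<exists>c'\<in>J - S. c' \<noteq> c \<and> \<tau> c' = \<tau> c" using ab by metis
      then show ?thesis using True full_insert[OF c] by (simp add: face_wedge)
    next
      case False
      then have "\<not> (\<exists>c'\<in>J - S. c' \<noteq> c \<and> \<tau> c' = \<tau> c)"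
        using inj c ab unfolding inj_on_def by (metis DiffI singletonD)
      then have "full (insert c S) = insert (\<tau> c) (full S)" unfolding full_insert[OF c] by (rule if_not_P)
      then show ?thesis using False big[OF c notfull[OF c]] 2(1) by (simp add: face_wedge)
    qed
    then have "?N = (if face \<Omega> (full S) = {} then {} else {a, b})" using ab by auto
    then show ?thesis using ab by (simp split: if_splits)
  next
    case 3
    have inj: "inj_on \<tau> (J - S)" using 3(2) finite_J by (intro eq_card_imp_inj_on) auto
    have "face (wedge J \<tau> \<Omega>) (insert c S) \<noteq> {} \<longleftrightarrow> face \<Omega> (insert (\<tau> c) (full S)) \<noteq> {}" if c: "c \<in> J - S" for c
    proof -
      have "\<not> (\<exists>c'\<in>J - S. c' \<noteq> c \<and> \<tau> c' = \<tau> c)" using inj c by (auto simp: inj_on_def)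
      then have "full (insert c S) = insert (\<tau> c) (full S)" unfolding full_insert[OF c] by (rule if_not_P)
      then show ?thesis by (simp add: face_wedge)
    qed
    then have "\<tau> ` ?N = {i \<in> I - full S. face \<Omega> (insert i (full S)) \<noteq> {}}"
      unfolding full_compl by auto
    moreover have "card (\<tau> ` ?N) = card ?N" using inj by (intro card_image) (auto simp: inj_on_def)
    ultimately show ?thesis using edge_even[OF full_sub 3(1)] by simp
  qed
qed

end

section \<open>Simple polytopes\<close>

text \<open>Inside the affine hull, \<open>\<beta> F + \<alpha> F \<bullet> x\<close> is the signed distance to the hyperplane of \<open>F\<close>.\<close>

lemma facet_functionals:
  fixes P :: "'a::euclidean_space set"
  assumes P: "polytope P"
  shows "\<exists>\<alpha> \<beta>. (\<forall>F. F facet_of P \<longrightarrow> (\<forall>x\<in>affine hull P. x + \<alpha> F \<in> affine hull P) \<and>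
      (\<forall>x\<in>P. infdist x (affine hull F) = \<beta> F + \<alpha> F \<bullet> x) \<and> F = {x\<in>P. \<beta> F + \<alpha> F \<bullet> x = 0}) \<and>
    P = {x\<in>affine hull P. \<forall>F. F facet_of P \<longrightarrow> 0 \<le> \<beta> F + \<alpha> F \<bullet> x}"
proof -
  let ?A = "affine hull P"
  obtain Hs where Hs: "finite Hs" "P = ?A \<inter> \<Inter>Hs"
    and ab: "\<forall>h\<in>Hs. \<exists>a b. a \<noteq> 0 \<and> h = {x. a \<bullet> x \<le> b} \<and> (\<forall>x\<in>?A. x + a \<in> ?A)"
    and min: "\<And>H'. H' \<subset> Hs \<Longrightarrow> P \<subset> ?A \<inter> \<Inter>H'"
    using polyhedron_Int_affine_parallel_minimal[of P] polytope_imp_polyhedron[OF P] by auto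
  obtain a b where h: "\<And>h. h \<in> Hs \<Longrightarrow> a h \<noteq> 0 \<and> h = {x. a h \<bullet> x \<le> b h}"
    and par: "\<And>h x. h \<in> Hs \<Longrightarrow> x \<in> ?A \<Longrightarrow> x + a h \<in> ?A"
    using ab by metis
  have facet: "C facet_of P \<longleftrightarrow> (\<exists>h. h \<in> Hs \<and> C = P \<inter> {x. a h \<bullet> x = b h})" for C
    by (rule facet_of_polyhedron_explicit[OF Hs h min])
  define hh where "hh C = (SOME h. h \<in> Hs \<and> C = P \<inter> {x. a h \<bullet> x = b h})" for C
  have hh: "hh C \<in> Hs" "C = P \<inter> {x. a (hh C) \<bullet> x = b (hh C)}" if "C facet_of P" for C
    using someI_ex[of "\<lambda>h. h \<in> Hs \<and> C = P \<inter> {x. a h \<bullet> x = b h}"] that facet unfolding hh_def by auto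
  define \<alpha> where "\<alpha> C = - (a (hh C) /\<^sub>R norm (a (hh C)))" for C
  define \<beta> where "\<beta> C = b (hh C) / norm (a (hh C))" for C
  have Apar: "x + t *\<^sub>R a h \<in> ?A" if "h \<in> Hs" "x \<in> ?A" for h x t
  proof -
    have "(1 - t) *\<^sub>R x + t *\<^sub>R (x + a h) \<in> ?A"
      using affine_affine_hull[of P] that par by (intro mem_affine) auto
    then show ?thesis by (simp add: algebra_simps)
  qed
  define s where "s h x = (b h - a h \<bullet> x) / norm (a h)" for h x
  have dist: "infdist x (affine hull F) = s h x"
    if F: "F facet_of P" and hF: "h \<in> Hs" "F = P \<inter> {x. a h \<bullet> x = b h}" and x: "x \<in> P" for F h x
  proof -
    let ?a = "a h" and ?b = "b h"
    have a0: "?a \<noteq> 0" using h[OF hF(1)] by simp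
    have ne: "F \<noteq> {}" using F by (simp add: facet_of_def)
    have hull: "affine hull F = ?A \<inter> {x. ?a \<bullet> x = ?b}"
    proof -
      let ?B = "?A \<inter> {x. ?a \<bullet> x = ?b}"
      have sub: "F \<subseteq> ?B" using hF(2) hull_subset[of P affine] by auto
      obtain y where y: "y \<in> F" using ne by blast
      then have y': "?a \<bullet> y = ?b" "y \<in> ?A" using hF(2) sub by auto
      have "y + ?a \<in> ?A" using par[OF hF(1)] y' by auto
      moreover have "?a \<bullet> (y + ?a) \<noteq> ?b" using y' a0 by (simp add: inner_add_right)
      ultimately have "\<not> ?A \<subseteq> {x. ?a \<bullet> x = ?b}" by blast
      then have "aff_dim ?B = aff_dim ?A - 1"
        using aff_dim_affine_Int_hyperplane[OF affine_affine_hull, of P ?a ?b] sub ne by auto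
      also have "\<dots> = aff_dim F" using F by (simp add: facet_of_def)
      finally have "affine hull F = affine hull ?B" using aff_dim_eq_full_gen[OF sub] by simp
      moreover have "affine ?B" by (intro affine_Int affine_affine_hull affine_hyperplane)
      ultimately show ?thesis by (simp add: hull_same)
    qed
    let ?s = "s h x"
    have xA: "x \<in> ?A" using x hull_subset[of P affine] by auto
    have "x \<in> h" using x Hs(2) hF(1) by blast
    then have "?a \<bullet> x \<le> ?b" using h[OF hF(1)] by auto
    then have s0: "?s \<ge> 0" by (simp add: s_def)
    \<comment> \<open>The foot of the perpendicular; it stays in the affine hull because
      \<open>a h\<close> is parallel to it.\<close>
    let ?y = "x + (?s / norm ?a) *\<^sub>R ?a"
    have ns: "norm ?a * norm ?a = ?a \<bullet> ?a" by (simp add: norm_eq_sqrt_inner)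
    have "?y \<in> ?A" by (rule Apar[OF hF(1) xA])
    moreover have "?a \<bullet> ?y = ?b" using a0 by (simp add: s_def inner_add_right ns[symmetric])
    ultimately have yH: "?y \<in> affine hull F" unfolding hull by simp
    have "infdist x (affine hull F) \<le> dist x ?y" by (rule infdist_le[OF yH])
    also have "\<dots> = ?s" using s0 a0 by (simp add: dist_norm)
    finally have le: "infdist x (affine hull F) \<le> ?s" .
    have "?s \<le> dist x z" if "z \<in> affine hull F" for z
    proof -
      have "?b - ?a \<bullet> x = ?a \<bullet> (z - x)" using that hull by (simp add: inner_diff_right)
      also have "\<dots> \<le> norm ?a * norm (z - x)" by (rule norm_cauchy_schwarz)
      finally show ?thesis using a0
        by (simp add: s_def divide_simps dist_norm norm_minus_commute mult.commute)
    qed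
    then have "?s \<le> infdist x (affine hull F)"
      using yH by (subst infdist_notempty) (auto intro!: cINF_greatest)
    then show ?thesis using le by simp
  qed
  have val: "\<beta> C + \<alpha> C \<bullet> x = s (hh C) x" for C x
    by (simp add: \<alpha>_def \<beta>_def s_def divide_simps)
  have main: "(\<forall>x\<in>?A. x + \<alpha> F \<in> ?A) \<and> (\<forall>x\<in>P. infdist x (affine hull F) = \<beta> F + \<alpha> F \<bullet> x) \<and>
      F = {x\<in>P. \<beta> F + \<alpha> F \<bullet> x = 0}" if F: "F facet_of P" for F
  proof (intro conjI ballI)
    show "x + \<alpha> F \<in> ?A" if "x \<in> ?A" for x
      using Apar[OF hh(1)[OF F] that, of "- inverse (norm (a (hh F)))"] by (simp add: \<alpha>_def)
    show "infdist x (affine hull F) = \<beta> F + \<alpha> F \<bullet> x" if "x \<in> P" for x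
      unfolding val by (rule dist[OF F hh[OF F] that])
    have "a (hh F) \<noteq> 0" using h hh(1)[OF F] by blast
    then have "s (hh F) x = 0 \<longleftrightarrow> a (hh F) \<bullet> x = b (hh F)" for x by (auto simp: s_def)
    then show "F = {x\<in>P. \<beta> F + \<alpha> F \<bullet> x = 0}" unfolding val using hh(2)[OF F] by auto
  qed
  have "P = {x\<in>?A. \<forall>F. F facet_of P \<longrightarrow> 0 \<le> \<beta> F + \<alpha> F \<bullet> x}"
  proof (intro subset_antisym subsetI)
    fix x assume x: "x \<in> P"
    have "0 \<le> \<beta> F + \<alpha> F \<bullet> x" if "F facet_of P" for F
      using main[OF that] x infdist_nonneg[of x "affine hull F"] by simp
    then show "x \<in> {x\<in>?A. \<forall>F. F facet_of P \<longrightarrow> 0 \<le> \<beta> F + \<alpha> F \<bullet> x}"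
      using x hull_subset[of P affine] by auto
  next
    fix x assume x: "x \<in> {x\<in>?A. \<forall>F. F facet_of P \<longrightarrow> 0 \<le> \<beta> F + \<alpha> F \<bullet> x}"
    have "x \<in> g" if g: "g \<in> Hs" for g
    proof -
      let ?F = "P \<inter> {x. a g \<bullet> x = b g}"
      have F: "?F facet_of P" using facet g by blast
      text \<open>Both functions are the distance to the hyperplane on \<open>P\<close>, hence agree on the affine hull.\<close>
      have "s (hh ?F) y = s g y" if "y \<in> P" for y
        using dist[OF F hh[OF F] that] dist[OF F g refl that] by simp
      moreover have "s k y = b k / norm (a k) - (a k /\<^sub>R norm (a k)) \<bullet> y" for k y
        by (simp add: s_def divide_simps)
      ultimately have "P \<subseteq> {y. (a (hh ?F) /\<^sub>R norm (a (hh ?F)) - a g /\<^sub>R norm (a g)) \<bullet> y =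
          b (hh ?F) / norm (a (hh ?F)) - b g / norm (a g)}"
        by (force simp: inner_diff_left)
      then have "?A \<subseteq> {y. (a (hh ?F) /\<^sub>R norm (a (hh ?F)) - a g /\<^sub>R norm (a g)) \<bullet> y =
          b (hh ?F) / norm (a (hh ?F)) - b g / norm (a g)}"
        by (rule hull_minimal) (rule affine_hyperplane)
      then have "s (hh ?F) x = s g x"
        using x \<open>\<And>k y. s k y = b k / norm (a k) - (a k /\<^sub>R norm (a k)) \<bullet> y\<close>[of "hh ?F" x]
          \<open>\<And>k y. s k y = b k / norm (a k) - (a k /\<^sub>R norm (a k)) \<bullet> y\<close>[of g x]
        by (auto simp: inner_diff_left)
      moreover have "0 \<le> \<beta> ?F + \<alpha> ?F \<bullet> x" using x F by blast
      ultimately have "0 \<le> s g x" unfolding val by simp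
      then have "a g \<bullet> x \<le> b g" using h[OF g] by (simp add: s_def zero_le_divide_iff)
      then show ?thesis using h[OF g] by auto
    qed
    then show "x \<in> P" using x Hs(2) by auto
  qed
  then show ?thesis using main by blast
qed

section \<open>Vertices, edges and facets of a simple polytope\<close>

locale simple_poly =
  fixes P :: "'a::euclidean_space set" and n :: nat
  assumes simple: "simple_polytope n P" and n_pos: "n > 0"
begin

definition facets :: "'a set set" where
  "facets = {F. F facet_of P}"

definition facets_at :: "'a \<Rightarrow> 'a set set" where
  "facets_at p = {F \<in> facets. p \<in> F}"

definition is_normals :: "('a set \<Rightarrow> 'a) \<Rightarrow> ('a set \<Rightarrow> real) \<Rightarrow> bool" where
  "is_normals a b \<longleftrightarrow> (\<forall>F. F facet_of P \<longrightarrow> (\<forall>x\<in>affine hull P. x + a F \<in> affine hull P) \<and>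
      (\<forall>x\<in>P. infdist x (affine hull F) = b F + a F \<bullet> x) \<and> F = {x\<in>P. b F + a F \<bullet> x = 0}) \<and>
    P = {x\<in>affine hull P. \<forall>F. F facet_of P \<longrightarrow> 0 \<le> b F + a F \<bullet> x}"

definition normals :: "('a set \<Rightarrow> 'a) \<times> ('a set \<Rightarrow> real)" where
  "normals = (SOME n. is_normals (fst n) (snd n))"

definition \<alpha> :: "'a set \<Rightarrow> 'a" where "\<alpha> = fst normals"

definition ell :: "'a set \<Rightarrow> 'a \<Rightarrow> real" where "ell F x = snd normals F + \<alpha> F \<bullet> x"

lemma polytope: "polytope P" and aff_dim: "aff_dim P = int n"
  using simple by (auto simp: simple_polytope_def)

lemma card_facets_at: "v extreme_point_of P \<Longrightarrow> card (facets_at v) = n"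
  using simple by (auto simp: simple_polytope_def facets_at_def facets_def)

lemma finite_facets: "finite facets"
  unfolding facets_def by (rule finite_polytope_facets[OF polytope])

lemma finite_facets_at: "finite (facets_at p)"
  using finite_facets by (simp add: facets_at_def)

lemma normals:
  shows par: "F \<in> facets \<Longrightarrow> x \<in> affine hull P \<Longrightarrow> x + \<alpha> F \<in> affine hull P"
    and ell_infdist: "F \<in> facets \<Longrightarrow> x \<in> P \<Longrightarrow> infdist x (affine hull F) = ell F x"
    and mem_facet: "F \<in> facets \<Longrightarrow> x \<in> P \<Longrightarrow> x \<in> F \<longleftrightarrow> ell F x = 0"
    and P_iff: "x \<in> P \<longleftrightarrow> x \<in> affine hull P \<and> (\<forall>F\<in>facets. 0 \<le> ell F x)"
proof -
  have "\<exists>n. is_normals (fst n) (snd n)"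
    using facet_functionals[OF polytope] unfolding is_normals_def by simp
  from someI_ex[OF this] have *: "(\<forall>F. F facet_of P \<longrightarrow> (\<forall>x\<in>affine hull P. x + \<alpha> F \<in> affine hull P) \<and>
      (\<forall>x\<in>P. infdist x (affine hull F) = ell F x) \<and> F = {x\<in>P. ell F x = 0}) \<and>
    P = {x\<in>affine hull P. \<forall>F. F facet_of P \<longrightarrow> 0 \<le> ell F x}"
    unfolding normals_def[symmetric] by (simp add: is_normals_def \<alpha>_def ell_def)
  from * show "F \<in> facets \<Longrightarrow> x \<in> affine hull P \<Longrightarrow> x + \<alpha> F \<in> affine hull P"
    and "F \<in> facets \<Longrightarrow> x \<in> P \<Longrightarrow> infdist x (affine hull F) = ell F x" by (auto simp: facets_def)
  show "x \<in> F \<longleftrightarrow> ell F x = 0" if "F \<in> facets" "x \<in> P"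
  proof -
    have "F = {x\<in>P. ell F x = 0}" using * that by (simp add: facets_def)
    then show ?thesis using that by blast
  qed
  have "P = {x\<in>affine hull P. \<forall>F. F facet_of P \<longrightarrow> 0 \<le> ell F x}" using * by simp
  then show "x \<in> P \<longleftrightarrow> x \<in> affine hull P \<and> (\<forall>F\<in>facets. 0 \<le> ell F x)" by (auto simp: facets_def)
qed

lemma facet_sub: "F \<in> facets \<Longrightarrow> F \<subseteq> P"
  by (simp add: facets_def facet_of_imp_subset)

lemma ell_nonneg: "F \<in> facets \<Longrightarrow> x \<in> P \<Longrightarrow> 0 \<le> ell F x"
  using P_iff by blast

lemma ell_add: "ell F (x + u) = ell F x + \<alpha> F \<bullet> u"
  by (simp add: ell_def inner_add_right)

lemma P_sub_hull: "x \<in> P \<Longrightarrow> x \<in> affine hull P"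
  using hull_subset[of P affine] by auto

definition dirs :: "'a set" where
  "dirs = {u. \<forall>x\<in>affine hull P. x + u \<in> affine hull P}"

lemma dirs_iff: "v \<in> affine hull P \<Longrightarrow> u \<in> dirs \<longleftrightarrow> v + u \<in> affine hull P"
proof
  assume v: "v \<in> affine hull P" and vu: "v + u \<in> affine hull P"
  have "x + u \<in> affine hull P" if x: "x \<in> affine hull P" for x
    using mem_affine_3[OF affine_affine_hull x vu v, of 1 1 "-1"] by (simp add: algebra_simps)
  then show "u \<in> dirs" by (simp add: dirs_def)
qed (auto simp: dirs_def)

lemma nonempty: "P \<noteq> {}"
  using aff_dim n_pos by auto

lemma dirs_image: "v \<in> P \<Longrightarrow> dirs = (\<lambda>x. x - v) ` (affine hull P)"
proof (intro subset_antisym subsetI)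
  fix u assume "v \<in> P" "u \<in> dirs"
  then have "v + u \<in> affine hull P" using dirs_iff P_sub_hull by blast
  then show "u \<in> (\<lambda>x. x - v) ` (affine hull P)" by (rule rev_image_eqI) simp
next
  fix u assume v: "v \<in> P" and "u \<in> (\<lambda>x. x - v) ` (affine hull P)"
  then show "u \<in> dirs" using dirs_iff[OF P_sub_hull[OF v], of u] by auto
qed

lemma subspace_dirs: "subspace dirs"
proof -
  obtain v where "v \<in> P" using nonempty by blast
  then show ?thesis
    using dirs_image affine_diffs_subspace_subtract[OF affine_affine_hull, of v P] P_sub_hull by simp
qed

lemma dim_dirs: "dim dirs = n"
proof -
  obtain v where v: "v \<in> P" using nonempty by blast
  have "int (dim dirs) = aff_dim (affine hull P)"
    unfolding dirs_image[OF v]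
    by (rule aff_dim_dim_affine_diffs[symmetric]) (use v P_sub_hull in auto)
  then show ?thesis using aff_dim by simp
qed

lemma alpha_dirs: "F \<in> facets \<Longrightarrow> \<alpha> F \<in> dirs"
  using par by (auto simp: dirs_def)

lemma diff_dirs: "x \<in> affine hull P \<Longrightarrow> y \<in> affine hull P \<Longrightarrow> x - y \<in> dirs"
  using dirs_iff[of y "x - y"] by simp

lemma vertex_in_P: "v extreme_point_of P \<Longrightarrow> v \<in> P"
  by (simp add: extreme_point_of_def)

lemma small_steps:
  assumes v: "v \<in> P" and u: "u \<in> dirs" and zero: "\<And>F. F \<in> facets_at v \<Longrightarrow> \<alpha> F \<bullet> u \<ge> 0"
  shows "\<exists>t>0. v + t *\<^sub>R u \<in> P"
proof -
  have "\<exists>\<delta>>0. \<forall>t. 0 < t \<longrightarrow> t \<le> \<delta> \<longrightarrow> 0 \<le> ell F (v + t *\<^sub>R u)" if F: "F \<in> facets" for F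
  proof (cases "\<alpha> F \<bullet> u \<ge> 0")
    case True
    then show ?thesis using ell_nonneg[OF F v] by (intro exI[of _ 1]) (auto simp: ell_add)
  next
    case False
    then have "F \<notin> facets_at v" using zero by blast
    then have pos: "ell F v > 0" using ell_nonneg[OF F v] mem_facet[OF F v] F by (auto simp: facets_at_def)
    have "0 \<le> ell F v + t * (\<alpha> F \<bullet> u)" if "0 < t" "t \<le> ell F v / - (\<alpha> F \<bullet> u)" for t
      using that False by (simp add: field_simps)
    then show ?thesis using pos False
      by (intro exI[of _ "ell F v / - (\<alpha> F \<bullet> u)"]) (auto simp: ell_add divide_pos_neg)
  qed
  then obtain \<delta> where d: "\<And>F. F \<in> facets \<Longrightarrow> \<delta> F > 0"
    "\<And>F t. F \<in> facets \<Longrightarrow> 0 < t \<Longrightarrow> t \<le> \<delta> F \<Longrightarrow> 0 \<le> ell F (v + t *\<^sub>R u)" by metis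
  define t where "t = Min (insert 1 (\<delta> ` facets))"
  have t: "t > 0" "\<And>F. F \<in> facets \<Longrightarrow> t \<le> \<delta> F"
    using finite_facets d(1) by (auto simp: t_def)
  have "t *\<^sub>R u \<in> dirs" using u subspace_dirs subspace_scale by blast
  then have "v + t *\<^sub>R u \<in> affine hull P" using dirs_iff v P_sub_hull by blast
  then have "v + t *\<^sub>R u \<in> P" using d(2) t unfolding P_iff[of "v + t *\<^sub>R u"] by blast
  then show ?thesis using t by blast
qed

text \<open>Otherwise short steps from \<open>v\<close> along \<open>u\<close> and along
  \<open>- u\<close> would both stay in \<open>P\<close>, and \<open>v\<close> would lie inside a
  segment.\<close>

lemma normals_separate:
  assumes v: "v extreme_point_of P" and u: "u \<in> dirs" and zero: "\<And>F. F \<in> facets_at v \<Longrightarrow> \<alpha> F \<bullet> u = 0"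
  shows "u = 0"
proof (rule ccontr)
  assume u0: "u \<noteq> 0"
  have vP: "v \<in> P" using v by (rule vertex_in_P)
  obtain s where s: "s > 0" "v + s *\<^sub>R u \<in> P" using small_steps[OF vP u] zero by auto
  have "- u \<in> dirs" using u subspace_dirs subspace_neg by blast
  then obtain t where t: "t > 0" "v + t *\<^sub>R (- u) \<in> P" using small_steps[OF vP, of "- u"] zero by auto
  have "v \<in> open_segment (v + s *\<^sub>R u) (v + t *\<^sub>R (- u))"
    unfolding in_segment
  proof (intro conjI exI[of _ "s / (s + t)"])
    have ne: "(s + t) *\<^sub>R u \<noteq> 0" using u0 s t by simp
    then show "v + s *\<^sub>R u \<noteq> v + t *\<^sub>R (- u)" by (simp add: scaleR_add_left) (metis eq_neg_iff_add_eq_0)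
    show "0 < s / (s + t)" "s / (s + t) < 1" using s t by auto
    have c: "(1 - s / (s + t)) * s = (s / (s + t)) * t" using s t by (simp add: field_simps)
    have "(1 - s / (s + t)) *\<^sub>R (v + s *\<^sub>R u) + (s / (s + t)) *\<^sub>R (v + t *\<^sub>R - u) =
        v + ((1 - s / (s + t)) * s - (s / (s + t)) * t) *\<^sub>R u" by (simp add: algebra_simps)
    then show "v = (1 - s / (s + t)) *\<^sub>R (v + s *\<^sub>R u) + (s / (s + t)) *\<^sub>R (v + t *\<^sub>R - u)"
      unfolding c by simp
  qed
  then show False using v s t unfolding extreme_point_of_def by blast
qed

text \<open>The edge vectors at the vertex \<open>v\<close>, dual to the normals of the
  \<open>n\<close> facets there.\<close>

definition dual :: "'a \<Rightarrow> 'a set \<Rightarrow> 'a" where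
  "dual v F = (SOME u. u \<in> dirs \<and> (\<forall>G\<in>facets_at v. \<alpha> G \<bullet> u = of_bool (G = F)))"

lemma dual:
  assumes v: "v extreme_point_of P" and F: "F \<in> facets_at v"
  shows dual_dirs: "dual v F \<in> dirs"
    and dual_eq: "G \<in> facets_at v \<Longrightarrow> \<alpha> G \<bullet> dual v F = of_bool (G = F)"
proof -
  let ?B = "\<alpha> ` (facets_at v - {F})"
  have sub: "facets_at v \<subseteq> facets" by (auto simp: facets_at_def)
  have spanB: "span ?B \<subseteq> span dirs"
    by (rule span_mono) (use sub alpha_dirs in auto)
  have sd: "span dirs = dirs" using subspace_dirs by (simp add: span_eq_iff)
  have "dim ?B \<le> card ?B" using finite_facets_at by (simp add: dim_le_card')
  also have "\<dots> \<le> card (facets_at v - {F})" using finite_facets_at by (intro card_image_le) auto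
  also have "\<dots> < n" using card_facets_at[OF v] F finite_facets_at n_pos by simp
  finally have lt: "dim ?B < n" .
  then have "span ?B \<noteq> span dirs" using dim_dirs by (metis dim_span less_irrefl)
  then obtain x where x: "x \<noteq> 0" "x \<in> span dirs" "\<And>y. y \<in> span ?B \<Longrightarrow> orthogonal x y"
    using orthogonal_to_subspace_exists_gen[of ?B dirs] spanB by blast
  have xG: "\<alpha> G \<bullet> x = 0" if "G \<in> facets_at v" "G \<noteq> F" for G
    using x(3)[of "\<alpha> G"] that span_superset[of ?B] by (auto simp: orthogonal_def inner_commute)
  have xF: "\<alpha> F \<bullet> x \<noteq> 0"
    using normals_separate[OF v, of x] x sd xG by metis
  have "(inverse (\<alpha> F \<bullet> x)) *\<^sub>R x \<in> dirs" using x sd subspace_dirs subspace_scale by blast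
  then have "\<exists>u. u \<in> dirs \<and> (\<forall>G\<in>facets_at v. \<alpha> G \<bullet> u = of_bool (G = F))"
    using xG xF by (intro exI[of _ "(inverse (\<alpha> F \<bullet> x)) *\<^sub>R x"]) auto
  from someI_ex[OF this] show "dual v F \<in> dirs"
    and "G \<in> facets_at v \<Longrightarrow> \<alpha> G \<bullet> dual v F = of_bool (G = F)" by (auto simp: dual_def)
qed

lemma dirs_expand:
  assumes v: "v extreme_point_of P" and u: "u \<in> dirs"
  shows "u = (\<Sum>F\<in>facets_at v. (\<alpha> F \<bullet> u) *\<^sub>R dual v F)"
proof -
  let ?w = "\<Sum>F\<in>facets_at v. (\<alpha> F \<bullet> u) *\<^sub>R dual v F"
  have w: "?w \<in> dirs"
    using subspace_dirs dual_dirs[OF v] by (intro subspace_sum subspace_scale) auto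
  have "u - ?w = 0"
  proof (rule normals_separate[OF v])
    show "u - ?w \<in> dirs" using u w subspace_dirs subspace_diff by blast
    fix G assume G: "G \<in> facets_at v"
    have "\<alpha> G \<bullet> ?w = (\<Sum>F\<in>facets_at v. (\<alpha> F \<bullet> u) * of_bool (G = F))"
      unfolding inner_sum_right using dual_eq[OF v _ G] by (intro sum.cong) auto
    also have "\<dots> = (\<Sum>F\<in>facets_at v. if G = F then \<alpha> F \<bullet> u else 0)" by (intro sum.cong) auto
    also have "\<dots> = \<alpha> G \<bullet> u" using G finite_facets_at by (simp add: sum.delta')
    finally show "\<alpha> G \<bullet> (u - ?w) = 0" by (simp add: inner_diff_right)
  qed
  then show ?thesis by simp
qed

lemma hull_expand:
  assumes v: "v extreme_point_of P" and x: "x \<in> affine hull P"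
  shows "x = v + (\<Sum>F\<in>facets_at v. ell F x *\<^sub>R dual v F)"
proof -
  have vP: "v \<in> P" using v by (rule vertex_in_P)
  have "\<alpha> F \<bullet> (x - v) = ell F x" if "F \<in> facets_at v" for F
    using that mem_facet[OF _ vP, of F] by (auto simp: facets_at_def ell_def inner_diff_right)
  then have "x - v = (\<Sum>F\<in>facets_at v. ell F x *\<^sub>R dual v F)"
    by (subst dirs_expand[OF v diff_dirs[OF x P_sub_hull[OF vP]]]) simp
  then show ?thesis by (simp add: algebra_simps)
qed

text \<open>An extreme point of the intersection of all facets through \<open>p\<close>.\<close>

lemma vertex_above:
  assumes p: "p \<in> P"
  shows "\<exists>v. v extreme_point_of P \<and> facets_at p \<subseteq> facets_at v"
proof -
  let ?C = "\<Inter>(insert P (facets_at p))"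
  have face: "?C face_of P"
    by (rule face_of_Inter) (auto simp: facets_at_def facets_def facet_of_imp_face_of polytope_imp_convex[OF polytope] face_of_refl)
  have "compact ?C" using face_of_imp_compact[OF polytope_imp_convex[OF polytope] polytope_imp_compact[OF polytope] face] .
  moreover have "convex ?C" using face_of_imp_convex[OF face] .
  moreover have "?C \<noteq> {}" using p by (auto simp: facets_at_def)
  ultimately obtain v where "v extreme_point_of ?C" using extreme_point_exists_convex by blast
  then have "v extreme_point_of P" "v \<in> ?C" using extreme_point_of_face[OF face] by auto
  then show ?thesis by (auto simp: facets_at_def)
qed

lemma card_facets_at_le: "p \<in> P \<Longrightarrow> card (facets_at p) \<le> n"
  using vertex_above card_facets_at card_mono[OF finite_facets_at] by metis

text \<open>The edge leaving \<open>F\<close> is followed in the direction \<open>dual v F\<close>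
  until the first facet \<open>F'\<close> stops it. There \<open>n\<close> facets already meet, so
  the vertex above has no others. The last part says that \<open>F\<close> and \<open>F'\<close> are
  the two end points of the edge.\<close>

lemma opposite_vertex:
  assumes v: "v extreme_point_of P" and F: "F \<in> facets_at v"
  shows "\<exists>w F'. w extreme_point_of P \<and> F' \<notin> facets_at v \<and> facets_at w = insert F' (facets_at v - {F}) \<and>
    {G \<in> facets - (facets_at v - {F}). \<exists>x\<in>P. x \<in> G \<and> facets_at v - {F} \<subseteq> facets_at x} = {F, F'}"
proof -
  let ?T = "facets_at v - {F}" and ?u = "dual v F"
  have vP: "v \<in> P" using v by (rule vertex_in_P)
  have u: "?u \<in> dirs" "\<And>G. G \<in> facets_at v \<Longrightarrow> \<alpha> G \<bullet> ?u = of_bool (G = F)"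
    using dual[OF v F] by auto
  have Ff: "F \<in> facets" using F by (simp add: facets_at_def)
  have lF: "ell F v = 0" using F mem_facet[OF Ff vP] by (simp add: facets_at_def)
  have hullu: "v + t *\<^sub>R ?u \<in> affine hull P" for t
    using u(1) subspace_dirs subspace_scale dirs_iff P_sub_hull[OF vP] by blast
  let ?N = "{G \<in> facets. \<alpha> G \<bullet> ?u < 0}"
  let ?t = "\<lambda>G. ell G v / - (\<alpha> G \<bullet> ?u)"
  have N: "G \<notin> facets_at v" "ell G v > 0" if "G \<in> ?N" for G
  proof -
    show "G \<notin> facets_at v" using that u(2)[of G] by (auto simp: of_bool_def split: if_splits)
    then show "ell G v > 0" using that ell_nonneg[OF _ vP, of G] mem_facet[OF _ vP, of G]
      by (auto simp: facets_at_def)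
  qed
  have "?N \<noteq> {}"
  proof
    assume empty: "?N = {}"
    have inP: "v + t *\<^sub>R ?u \<in> P" if "t \<ge> 0" for t
      unfolding P_iff[of "v + t *\<^sub>R ?u"]
    proof (intro conjI ballI hullu)
      fix G assume G: "G \<in> facets"
      then have "\<alpha> G \<bullet> ?u \<ge> 0" using empty by force
      then show "0 \<le> ell G (v + t *\<^sub>R ?u)" using ell_nonneg[OF G vP] that by (simp add: ell_add)
    qed
    have "?u \<noteq> 0" using u(2)[OF F] by auto
    obtain B where B: "\<And>x. x \<in> P \<Longrightarrow> norm x \<le> B"
      using polytope_imp_bounded[OF polytope] bounded_iff by blast
    let ?s = "(B + norm v + 1) / norm ?u"
    have "B \<ge> 0" using B[OF vP] norm_ge_zero[of v] by linarith
    then have s: "?s \<ge> 0" by simp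
    have "norm (?s *\<^sub>R ?u) \<le> norm (v + ?s *\<^sub>R ?u) + norm v" by (metis add_diff_cancel_left' norm_triangle_ineq4)
    also have "\<dots> \<le> B + norm v" using B[OF inP[OF s]] by simp
    finally show False using \<open>?u \<noteq> 0\<close> \<open>B \<ge> 0\<close> by simp
  qed
  moreover have finN: "finite ?N" using finite_facets by simp
  ultimately have "Min (?t ` ?N) \<in> ?t ` ?N" by (intro Min_in) auto
  then obtain F' where F': "F' \<in> ?N" "Min (?t ` ?N) = ?t F'" by blast
  define tau where "tau = ?t F'"
  have least: "tau \<le> ?t G" if "G \<in> ?N" for G
  proof -
    have "Min (?t ` ?N) \<le> ?t G" by (rule Min_le) (use that finN in auto)
    then show ?thesis unfolding tau_def F'(2) .
  qed
  have neg: "\<alpha> F' \<bullet> ?u < 0" using F'(1) by simp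
  have tau: "tau > 0" unfolding tau_def by (rule divide_pos_pos) (use F'(1) N[of F'] in auto)
  let ?w = "v + tau *\<^sub>R ?u"
  have wP: "?w \<in> P"
    unfolding P_iff[of ?w]
  proof (intro conjI ballI hullu)
    fix G assume G: "G \<in> facets"
    show "0 \<le> ell G ?w"
    proof (cases "\<alpha> G \<bullet> ?u < 0")
      case True
      then have "tau \<le> ell G v / - (\<alpha> G \<bullet> ?u)" using least[of G] G by simp
      then have "tau * - (\<alpha> G \<bullet> ?u) \<le> ell G v" using True by (subst (asm) pos_le_divide_eq) auto
      then show ?thesis by (simp add: ell_add)
    next
      case False
      then show ?thesis using ell_nonneg[OF G vP] tau by (simp add: ell_add)
    qed
  qed
  have F'f: "F' \<in> facets" using F' by simp
  have F'line: "ell F' (v + t *\<^sub>R ?u) = (tau - t) * - (\<alpha> F' \<bullet> ?u)" for t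
    using neg by (simp add: tau_def ell_add field_simps)
  have F'w: "F' \<in> facets_at ?w" using mem_facet[OF F'f wP] F'line[of tau] F'f by (simp add: facets_at_def)
  have Tline: "ell G (v + t *\<^sub>R ?u) = 0" if "G \<in> ?T" for G t
    using that u(2)[of G] mem_facet[OF _ vP, of G] by (auto simp: ell_add facets_at_def)
  have "?T \<subseteq> facets_at ?w"
  proof
    fix G assume G: "G \<in> ?T"
    then have "G \<in> facets" by (auto simp: facets_at_def)
    then show "G \<in> facets_at ?w" using mem_facet[OF _ wP, of G] Tline[OF G, of tau] by (simp add: facets_at_def)
  qed
  then have sub: "insert F' ?T \<subseteq> facets_at ?w" using F'w by blast
  have F'v: "F' \<notin> facets_at v" using N F'(1) by blast
  have cardT: "card (insert F' ?T) = n"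
    using card_facets_at[OF v] F F'v finite_facets_at n_pos by (simp add: card_Diff_singleton)
  obtain w where w: "w extreme_point_of P" "facets_at ?w \<subseteq> facets_at w" using vertex_above[OF wP] by blast
  have eq: "facets_at w = insert F' ?T"
    using card_subset_eq[OF finite_facets_at[of w], of "insert F' ?T"] sub w(2) cardT card_facets_at[OF w(1)]
    by auto
  have "{G \<in> facets - ?T. \<exists>x\<in>P. x \<in> G \<and> ?T \<subseteq> facets_at x} = {F, F'}" (is "?L = _")
  proof (intro subset_antisym subsetI)
    fix G assume "G \<in> {F, F'}"
    moreover have "F \<in> ?L" using vP F Ff by (auto simp: facets_at_def)
    moreover have "F' \<in> ?L" using wP sub F'f F'v by (auto simp: facets_at_def)
    ultimately show "G \<in> ?L" by blast
  next
    fix G assume "G \<in> ?L"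
    then obtain x where G: "G \<in> facets" "G \<notin> ?T" and x: "x \<in> P" "x \<in> G" "?T \<subseteq> facets_at x" by blast
    let ?s = "ell F x"
    have lx: "ell K x = 0" if "K \<in> ?T" for K using that x mem_facet[OF _ x(1), of K] by (auto simp: facets_at_def)
    have "x = v + (\<Sum>K\<in>facets_at v. ell K x *\<^sub>R dual v K)" by (rule hull_expand[OF v P_sub_hull[OF x(1)]])
    also have "(\<Sum>K\<in>facets_at v. ell K x *\<^sub>R dual v K) = ?s *\<^sub>R ?u"
      using sum.remove[OF finite_facets_at F, of "\<lambda>K. ell K x *\<^sub>R dual v K"] lx by simp
    finally have xs: "x = v + ?s *\<^sub>R ?u" .
    have s0: "?s \<ge> 0" by (rule ell_nonneg[OF Ff x(1)])
    have zero: "ell G v + ?s * (\<alpha> G \<bullet> ?u) = 0" using mem_facet[OF G(1) x(1)] x(2) xs by (metis ell_add inner_scaleR_right)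
    have stau: "?s \<le> tau"
    proof (rule ccontr)
      assume "\<not> ?s \<le> tau"
      then have "ell F' (v + ?s *\<^sub>R ?u) < 0" unfolding F'line using neg by (intro mult_neg_pos) auto
      then show False using ell_nonneg[OF F'f x(1)] xs by simp
    qed
    show "G \<in> {F, F'}"
    proof (cases "?s = 0 \<or> ?s = tau")
      case True
      then show ?thesis
      proof
        assume "?s = 0"
        then show ?thesis using xs x(2) G by (auto simp: facets_at_def)
      next
        assume "?s = tau"
        then have "x = ?w" using xs by simp
        then have "G \<in> facets_at w" using x(2) G w(2) by (auto simp: facets_at_def)
        then show ?thesis using eq G(2) by auto
      qed
    next
      case False
      then have s: "0 < ?s" "?s < tau" using s0 stau by auto
      have "ell G v \<ge> 0" "ell G v + tau * (\<alpha> G \<bullet> ?u) \<ge> 0"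
        using ell_nonneg[OF G(1) vP] ell_nonneg[OF G(1) wP] by (auto simp: ell_add)
      \<comment> \<open>The affine function \<open>ell G\<close> is nonnegative at both ends of the
        edge and zero at an inner point, so it vanishes on the whole edge.\<close>
      then have "ell G v = 0"
      proof -
        assume a: "ell G v \<ge> 0" "ell G v + tau * (\<alpha> G \<bullet> ?u) \<ge> 0"
        have "\<alpha> G \<bullet> ?u = - ell G v / ?s" using zero s by (simp add: field_simps)
        then have "ell G v * (1 - tau / ?s) \<ge> 0" using a by (simp add: field_simps)
        moreover have "tau / ?s > 1" using s by simp
        then have "1 - tau / ?s < 0" by simp
        ultimately show ?thesis using a(1) by (metis less_eq_real_def mult_pos_neg not_less)
      qed
      then have "G \<in> facets_at v" using mem_facet[OF G(1) vP] G(1) by (simp add: facets_at_def)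
      then have "G = F" using G(2) by blast
      then show ?thesis by simp
    qed
  qed
  then show ?thesis using w(1) F'v eq by blast
qed

end

context simple_poly
begin

lemma ell_inj:
  assumes v: "v extreme_point_of P" and xy: "x \<in> affine hull P" "y \<in> affine hull P"
    and eq: "\<And>F. F \<in> facets_at v \<Longrightarrow> ell F x = ell F y"
  shows "x = y"
proof -
  have "(\<Sum>F\<in>facets_at v. ell F x *\<^sub>R dual v F) = (\<Sum>F\<in>facets_at v. ell F y *\<^sub>R dual v F)"
    by (rule sum.cong) (use eq in auto)
  then show ?thesis using hull_expand[OF v xy(1)] hull_expand[OF v xy(2)] by metis
qed

definition facet_vec :: "'a set \<Rightarrow> 'a \<Rightarrow> 'a set \<Rightarrow> real" where
  "facet_vec F0 p F = (if F \<in> facets - {F0} then ell F p else 0)"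

lemma ell_convex: "ell F (p + t *\<^sub>R (q - p)) = ell F p + t * (ell F q - ell F p)"
  by (simp add: ell_def inner_add_right inner_diff_right algebra_simps)

lemma facets_at_face:
  assumes F0: "F0 \<in> facets" and S: "S \<subseteq> facets - {F0}"
  shows "face (facet_vec F0 ` F0) S \<noteq> {} \<longleftrightarrow> (\<exists>p\<in>P. insert F0 S \<subseteq> facets_at p)"
proof
  assume "face (facet_vec F0 ` F0) S \<noteq> {}"
  then obtain p where p: "p \<in> F0" "\<forall>F\<in>S. facet_vec F0 p F = 0" by (auto simp: face_def)
  have pP: "p \<in> P" using p(1) facet_sub[OF F0] by blast
  have "F \<in> facets_at p" if "F \<in> S" for F
  proof -
    have "F \<in> facets - {F0}" "facet_vec F0 p F = 0" using that S p(2) by auto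
    then show ?thesis using mem_facet[OF _ pP, of F] by (simp add: facet_vec_def facets_at_def)
  qed
  then show "\<exists>p\<in>P. insert F0 S \<subseteq> facets_at p" using pP p(1) F0 by (auto simp: facets_at_def)
next
  assume "\<exists>p\<in>P. insert F0 S \<subseteq> facets_at p"
  then obtain p where p: "p \<in> P" "insert F0 S \<subseteq> facets_at p" by blast
  have "facet_vec F0 p F = 0" if "F \<in> S" for F
    using that p mem_facet[OF _ p(1), of F] by (auto simp: facet_vec_def facets_at_def)
  moreover have "p \<in> F0" using p(2) by (auto simp: facets_at_def)
  ultimately show "face (facet_vec F0 ` F0) S \<noteq> {}" by (auto simp: face_def)
qed

text \<open>An edge of the facet is an edge of \<open>P\<close>, so the parity of its end points
  comes from \<open>opposite_vertex\<close>.\<close>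

lemma simple_system_facet:
  assumes F0: "F0 \<in> facets"
  shows "simple_system (facets - {F0}) (facet_vec F0 ` F0) (n - 1)"
proof
  have F0face: "F0 face_of P" using F0 by (simp add: facets_def facet_of_imp_face_of)
  have F0conv: "convex F0" using face_of_imp_convex[OF F0face] .
  have F0comp: "compact F0"
    using face_of_imp_compact[OF polytope_imp_convex[OF polytope] polytope_imp_compact[OF polytope] F0face] .
  have F0P: "p \<in> P" if "p \<in> F0" for p using that facet_sub[OF F0] by blast
  show "finite (facets - {F0})" using finite_facets by simp
  show "convex_fun (facet_vec F0 ` F0)"
    unfolding convex_fun_def
  proof (intro ballI allI impI)
    fix p' q' and t :: real assume "p' \<in> facet_vec F0 ` F0" "q' \<in> facet_vec F0 ` F0" and t: "0 \<le> t" "t \<le> 1"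
    then obtain p q where pq: "p \<in> F0" "p' = facet_vec F0 p" "q \<in> F0" "q' = facet_vec F0 q" by blast
    have "(1 - t) *\<^sub>R p + t *\<^sub>R q \<in> F0" using F0conv pq t by (simp add: convex_alt)
    then have "p + t *\<^sub>R (q - p) \<in> F0" by (simp add: algebra_simps)
    moreover have "(\<lambda>i. p' i + t * (q' i - p' i)) = facet_vec F0 (p + t *\<^sub>R (q - p))"
      by (auto simp: facet_vec_def ell_convex pq)
    ultimately show "(\<lambda>i. p' i + t * (q' i - p' i)) \<in> facet_vec F0 ` F0" by simp
  qed
  have "\<exists>B. \<forall>p\<in>F0. \<bar>ell F p\<bar> \<le> B" for F
  proof -
    have "compact (ell F ` F0)"
      by (rule compact_continuous_image[OF _ F0comp]) (auto simp: ell_def[abs_def] intro!: continuous_intros)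
    then obtain B where "\<forall>x\<in>ell F ` F0. norm x \<le> B" using compact_imp_bounded bounded_iff by metis
    then show ?thesis by (intro exI[of _ B]) auto
  qed
  then obtain B where B: "\<And>F p. p \<in> F0 \<Longrightarrow> \<bar>ell F p\<bar> \<le> B F" by metis
  have "\<bar>facet_vec F0 p F\<bar> \<le> (\<Sum>F\<in>facets. \<bar>B F\<bar>)" if "p \<in> F0" for p F
  proof (cases "F \<in> facets - {F0}")
    case True
    have "\<bar>ell F p\<bar> \<le> \<bar>B F\<bar>" using B[OF that, of F] by linarith
    also have "\<dots> \<le> (\<Sum>F\<in>facets. \<bar>B F\<bar>)" by (rule member_le_sum) (use True finite_facets in auto)
    finally show ?thesis using True by (simp add: facet_vec_def)
  qed (auto simp: facet_vec_def intro: sum_nonneg)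
  then show "\<exists>B. \<forall>p\<in>facet_vec F0 ` F0. \<forall>i. \<bar>p i\<bar> \<le> B" by blast
  show "0 \<le> p i" if "p \<in> facet_vec F0 ` F0" for p i
    using that ell_nonneg F0P by (auto simp: facet_vec_def)
  show "p i = 0" if "p \<in> facet_vec F0 ` F0" "i \<notin> facets - {F0}" for p i
    using that by (auto simp: facet_vec_def)
  show "p \<in> facet_vec F0 ` F0"
    if q: "\<And>m. q m \<in> facet_vec F0 ` F0" and l: "\<And>i. (\<lambda>m. q m i) \<longlonglongrightarrow> p i" for q p
  proof -
    have "\<forall>m. \<exists>x. x \<in> F0 \<and> q m = facet_vec F0 x" using q by blast
    then obtain x where x: "\<And>m. x m \<in> F0" "\<And>m. q m = facet_vec F0 (x m)" by metis
    obtain y r where y: "y \<in> F0" "strict_mono (r :: nat \<Rightarrow> nat)" "(x \<circ> r) \<longlonglongrightarrow> y"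
      using F0comp x(1) unfolding compact_def by metis
    have "p F = facet_vec F0 y F" for F
    proof (rule LIMSEQ_unique)
      show "(\<lambda>m. q (r m) F) \<longlonglongrightarrow> p F"
        by (rule filterlim_compose[OF l filterlim_subseq[OF y(2)]])
      show "(\<lambda>m. q (r m) F) \<longlonglongrightarrow> facet_vec F0 y F"
        using y(3) by (auto simp: x(2) facet_vec_def ell_def o_def intro!: tendsto_intros)
    qed
    then show ?thesis using y(1) by blast
  qed
  fix S assume S: "S \<subseteq> facets - {F0}"
  have finS: "finite S" using S finite_facets finite_subset by blast
  {
    assume c: "card S = Suc (n - 1)"
    show "face (facet_vec F0 ` F0) S = {}"
    proof (rule ccontr)
      assume "face (facet_vec F0 ` F0) S \<noteq> {}"
      then obtain p where p: "p \<in> P" "insert F0 S \<subseteq> facets_at p" using facets_at_face[OF F0 S] by blast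
      have "Suc n = card (insert F0 S)" using S finS c n_pos by (subst card_insert_disjoint) auto
      also have "\<dots> \<le> card (facets_at p)" by (rule card_mono[OF finite_facets_at p(2)])
      also have "\<dots> \<le> n" by (rule card_facets_at_le[OF p(1)])
      finally show False by simp
    qed
  }
  {
    assume c: "Suc (card S) = n - 1"
    let ?N = "{c \<in> facets - {F0} - S. face (facet_vec F0 ` F0) (insert c S) \<noteq> {}}"
    have mem: "c \<in> ?N \<longleftrightarrow> c \<in> facets - insert F0 S \<and> (\<exists>p\<in>P. p \<in> c \<and> insert F0 S \<subseteq> facets_at p)" for c
      using facets_at_face[OF F0, of "insert c S"] S by (auto simp: facets_at_def)
    show "even (card ?N)"
    proof (cases "\<exists>p\<in>P. insert F0 S \<subseteq> facets_at p")
      case False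
      then have "?N = {}" using mem by blast
      then show ?thesis by (simp only: card.empty) simp
    next
      case True
      then obtain v where v: "v extreme_point_of P" "insert F0 S \<subseteq> facets_at v" using vertex_above by (metis order_trans)
      have cS: "card (insert F0 S) = n - 1" using S finS c by (subst card_insert_disjoint) auto
      then have "card (facets_at v - insert F0 S) = 1"
        using card_facets_at[OF v(1)] v(2) finS n_pos by (simp add: card_Diff_subset)
      then obtain F where F: "facets_at v - insert F0 S = {F}" by (auto simp: card_1_singleton_iff)
      then have T: "facets_at v - {F} = insert F0 S" and Fv: "F \<in> facets_at v" using v(2) by auto
      obtain F' where F': "F' \<notin> facets_at v"
        "{G \<in> facets - (facets_at v - {F}). \<exists>x\<in>P. x \<in> G \<and> facets_at v - {F} \<subseteq> facets_at x} = {F, F'}"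
        using opposite_vertex[OF v(1) Fv] by blast
      have "?N = {F, F'}"
      proof (rule Set.set_eqI)
        show "c \<in> ?N \<longleftrightarrow> c \<in> {F, F'}" for c unfolding mem F'(2)[unfolded T, symmetric] by simp
      qed
      moreover have "F \<noteq> F'" using Fv F'(1) by blast
      ultimately show ?thesis by simp
    qed
  }
qed

end

section \<open>Characteristic matrices\<close>

definition monomial_map :: "int ^ 'n ^ 'n \<Rightarrow> 'k::{real_normed_field,euclidean_space} ^ 'n \<Rightarrow> 'k ^ 'n::finite" where
  "monomial_map A s = (\<chi> i. \<Prod>j\<in>UNIV. s $ j powi (A $ i $ j))"

lemma power_int_prod: "(\<Prod>i\<in>S. f i) powi m = (\<Prod>i\<in>S. f i powi m)" for f :: "_ \<Rightarrow> 'k::field"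
  by (induction S rule: infinite_finite_induct) (auto simp: power_int_mult_distrib)

lemma power_int_sum: "x \<noteq> 0 \<Longrightarrow> x powi (\<Sum>i\<in>S. f i) = (\<Prod>i\<in>S. x powi f i)" for x :: "'k::field"
  by (induction S rule: infinite_finite_induct) (auto simp: power_int_add)

lemma monomial_map_mult: "monomial_map A (s * t) = monomial_map A s * monomial_map A t"
  by (simp add: monomial_map_def vec_eq_iff power_int_mult_distrib prod.distrib)

lemma monomial_map_comp:
  assumes "\<And>j. s $ j \<noteq> 0"
  shows "monomial_map A (monomial_map B s) = monomial_map (A ** B) s"
proof -
  have "(\<Prod>l\<in>UNIV. (\<Prod>j\<in>UNIV. s $ j powi (B $ l $ j)) powi (A $ i $ l)) =
      (\<Prod>j\<in>UNIV. s $ j powi (\<Sum>l\<in>UNIV. A $ i $ l * B $ l $ j))" for i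
  proof -
    have "(\<Prod>l\<in>UNIV. (\<Prod>j\<in>UNIV. s $ j powi (B $ l $ j)) powi (A $ i $ l)) =
        (\<Prod>l\<in>UNIV. \<Prod>j\<in>UNIV. s $ j powi (A $ i $ l * B $ l $ j))"
      by (simp add: power_int_prod mult.commute flip: power_int_mult)
    also have "\<dots> = (\<Prod>j\<in>UNIV. \<Prod>l\<in>UNIV. s $ j powi (A $ i $ l * B $ l $ j))"
      by (rule prod.swap)
    finally show ?thesis using assms by (simp add: power_int_sum)
  qed
  then show ?thesis by (simp add: monomial_map_def matrix_matrix_mult_def vec_eq_iff)
qed

lemma monomial_map_1: "monomial_map (mat 1) s = s"
proof -
  have "(\<Prod>j\<in>UNIV. s $ j powi (if i = j then 1 else 0)) = (\<Prod>j\<in>UNIV. if i = j then s $ j else 1)" for i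
    by (intro prod.cong) auto
  then show ?thesis by (simp add: monomial_map_def mat_def vec_eq_iff prod.delta')
qed

lemma int_matrix_left_right_inverse:
  fixes A B :: "int ^ 'n::finite ^ 'n"
  assumes "B ** A = mat 1"
  shows "A ** B = mat 1"
proof -
  define r where "r M = (\<chi> i j. real_of_int (M $ i $ j))" for M :: "int ^ 'n ^ 'n"
  have mul: "r M ** r N = r (M ** N)" for M N
    by (simp add: r_def matrix_matrix_mult_def vec_eq_iff)
  have one: "r (mat 1) = mat 1" by (simp add: r_def mat_def vec_eq_iff)
  have "r B ** r A = mat 1" using assms mul one by metis
  then have "r A ** r B = mat 1" by (simp only: matrix_left_right_inverse)
  then have "r (A ** B) = r (mat 1)" using mul one by metis
  then show ?thesis by (simp add: r_def vec_eq_iff)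
qed

section \<open>Unimodularity of the characteristic vectors at the vertices\<close>

locale colored_poly =
  fixes P :: "'a::euclidean_space set" and h :: "'a set \<Rightarrow> 'n::{finite,linorder}" and H :: "'n \<Rightarrow> 'a set"
  assumes simple_P: "simple_polytope CARD('n) P" and proper: "proper_coloring P h"
    and H_facet: "\<And>i. H i facet_of P" and h_H: "\<And>i. h (H i) = i"
begin

sublocale simple_poly P "CARD('n)"
  by unfold_locales (use simple_P in auto)

abbreviation \<Lambda> :: "'a set \<Rightarrow> (int, 'n) vec" where "\<Lambda> \<equiv> char_vector h H"

abbreviation fa :: "'a \<Rightarrow> 'n \<Rightarrow> 'a set" where "fa \<equiv> facet_at P h"

lemma color_inj: "F \<in> facets_at p \<Longrightarrow> G \<in> facets_at p \<Longrightarrow> h F = h G \<Longrightarrow> F = G"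
  using proper unfolding proper_coloring_def facets_at_def facets_def by blast

lemma color_bij:
  assumes v: "v extreme_point_of P"
  shows "bij_betw h (facets_at v) UNIV"
proof -
  have inj: "inj_on h (facets_at v)" using color_inj by (auto simp: inj_on_def)
  then have "card (h ` facets_at v) = CARD('n)" using card_facets_at[OF v] by (simp add: card_image)
  then have "h ` facets_at v = UNIV" by (intro card_subset_eq) auto
  then show ?thesis using inj by (simp add: bij_betw_def)
qed

lemma fa:
  assumes v: "v extreme_point_of P"
  shows fa_mem: "fa v i \<in> facets_at v" and h_fa: "h (fa v i) = i"
proof -
  obtain F where F: "F \<in> facets_at v" "h F = i"
    using color_bij[OF v] unfolding bij_betw_def by (metis UNIV_I image_iff)
  have "\<exists>!F. F facet_of P \<and> v \<in> F \<and> h F = i"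
  proof (rule ex1I[of _ F])
    show "F facet_of P \<and> v \<in> F \<and> h F = i" using F by (auto simp: facets_at_def facets_def)
    show "G = F" if "G facet_of P \<and> v \<in> G \<and> h G = i" for G
      using that F color_inj[of G v F] by (auto simp: facets_at_def facets_def)
  qed
  from theI'[OF this] show "fa v i \<in> facets_at v" "h (fa v i) = i"
    by (auto simp: facet_at_def facets_at_def facets_def)
qed

lemma fa_h: "v extreme_point_of P \<Longrightarrow> F \<in> facets_at v \<Longrightarrow> fa v (h F) = F"
  using fa color_inj by metis

lemma fa_inj: "v extreme_point_of P \<Longrightarrow> fa v i = fa v j \<longleftrightarrow> i = j"
  using h_fa by metis

lemma range_fa: "v extreme_point_of P \<Longrightarrow> range (fa v) = facets_at v"
  using fa_mem fa_h by blast

lemma sum_facets_at: "v extreme_point_of P \<Longrightarrow> (\<Sum>F\<in>facets_at v. f F) = (\<Sum>i\<in>UNIV. f (fa v i))"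
  using sum.reindex[of "fa v" UNIV f] fa_inj range_fa by (simp add: inj_on_def)

lemma prod_facets_at: "v extreme_point_of P \<Longrightarrow> (\<Prod>F\<in>facets_at v. f F) = (\<Prod>i\<in>UNIV. f (fa v i))"
  using prod.reindex[of "fa v" UNIV f] fa_inj range_fa by (simp add: inj_on_def)

abbreviation M :: "'a \<Rightarrow> ((int, 'n) vec, 'n) vec" where "M \<equiv> vertex_matrix P h \<Lambda>"

abbreviation W :: "'a \<Rightarrow> ((int, 'n) vec, 'n) vec" where "W v \<equiv> matrix_inv (M v)"

lemma M_entry:
  assumes v: "v extreme_point_of P"
  shows "M v $ j $ i = of_bool (if fa v i = H i then i \<le> j else i = j)"
  by (simp add: vertex_matrix_def char_vector_def h_fa[OF v] h_H axis_def)

text \<open>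
  Subtracting from each row the row of the last special facet before it reduces the matrix to
  the identity.
\<close>

lemma M_invertible:
  assumes v: "v extreme_point_of P"
  shows "W v ** M v = mat 1" "M v ** W v = mat 1"
proof -
  define pred where "pred j i \<longleftrightarrow> fa v i = H i \<and> i < j \<and> (\<forall>k. fa v k = H k \<longrightarrow> k < j \<longrightarrow> k \<le> i)" for i j
  define B :: "((int, 'n) vec, 'n) vec" where "B = (\<chi> j i. of_bool (i = j) - of_bool (pred j i))"
  have "(\<Sum>i\<in>UNIV. B $ j $ i * M v $ i $ l) = of_bool (j = l)" for j l
  proof -
    have s: "(\<Sum>i\<in>UNIV. B $ j $ i * M v $ i $ l) =
        (\<Sum>i\<in>UNIV. if i = j then M v $ i $ l else 0) - (\<Sum>i\<in>UNIV. if pred j i then M v $ i $ l else 0)"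
      unfolding sum_subtractf[symmetric] by (intro sum.cong) (auto simp: B_def)
    show ?thesis
    proof (cases "\<exists>p. pred j p")
      case True
      then obtain p where p: "pred j p" by blast
      then have "pred j i \<longleftrightarrow> i = p" for i by (auto simp: pred_def intro: antisym)
      then have "(\<Sum>i\<in>UNIV. B $ j $ i * M v $ i $ l) = M v $ j $ l - M v $ p $ l"
        unfolding s by (simp add: sum.delta)
      also have "\<dots> = of_bool (j = l)"
        using p unfolding M_entry[OF v] pred_def by (auto simp: of_bool_def dest: leD)
      finally show ?thesis .
    next
      case False
      have "\<not> (fa v i = H i \<and> i < j)" for i
      proof
        assume i: "fa v i = H i \<and> i < j"
        let ?S = "{i. fa v i = H i \<and> i < j}"
        have "?S \<noteq> {}" using i by blast
        then have "Max ?S \<in> ?S" "\<forall>k\<in>?S. k \<le> Max ?S" by (auto intro: Max_in Max_ge simp del: Max_in) (use Max_in[of ?S] in auto)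
        then have "pred j (Max ?S)" unfolding pred_def by blast
        then show False using False by blast
      qed
      then have "M v $ j $ l = of_bool (j = l)" unfolding M_entry[OF v] by (auto simp: of_bool_def le_less)
      then show ?thesis unfolding s using False by (simp add: sum.delta)
    qed
  qed
  then have "B ** M v = mat 1" by (simp add: matrix_matrix_mult_def mat_def vec_eq_iff)
  then have "\<exists>B. M v ** B = mat 1 \<and> B ** M v = mat 1" using int_matrix_left_right_inverse by blast
  from someI_ex[OF this] show "W v ** M v = mat 1" "M v ** W v = mat 1" by (auto simp: matrix_inv_def)
qed

text \<open>The coefficients of \<open>\<Lambda> F\<close> in the basis of characteristic vectors at
  the vertex \<open>v\<close>, see \<open>Lambda_mm\<close>.\<close>

definition mm :: "'a \<Rightarrow> 'n \<Rightarrow> 'a set \<Rightarrow> int" where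
  "mm v i F = (\<Sum>j\<in>UNIV. W v $ i $ j * \<Lambda> F $ j)"

lemma M_Lambda: "M v $ j $ i = \<Lambda> (fa v i) $ j"
  by (simp add: vertex_matrix_def)

lemma mm_fa: "v extreme_point_of P \<Longrightarrow> mm v i (fa v k) = of_bool (i = k)"
  using M_invertible(1)[of v] by (simp add: mm_def matrix_matrix_mult_def vec_eq_iff mat_def M_Lambda)

lemma Lambda_mm:
  assumes v: "v extreme_point_of P"
  shows "\<Lambda> F $ j = (\<Sum>i\<in>UNIV. mm v i F * \<Lambda> (fa v i) $ j)"
proof -
  have "(\<Sum>i\<in>UNIV. mm v i F * \<Lambda> (fa v i) $ j) =
      (\<Sum>i\<in>UNIV. \<Sum>l\<in>UNIV. (M v $ j $ i * W v $ i $ l) * \<Lambda> F $ l)"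
    by (simp add: mm_def M_Lambda sum_distrib_right sum_distrib_left mult_ac)
  also have "\<dots> = (\<Sum>l\<in>UNIV. (M v ** W v) $ j $ l * \<Lambda> F $ l)"
    by (subst sum.swap) (simp add: matrix_matrix_mult_def sum_distrib_right)
  also have "\<dots> = (\<Sum>l\<in>UNIV. if j = l then \<Lambda> F $ l else 0)"
    by (intro sum.cong) (auto simp: M_invertible(2)[OF v] mat_def)
  also have "\<dots> = \<Lambda> F $ j" by (simp add: sum.delta')
  finally show ?thesis by simp
qed

text \<open>The sets of facets that define elements of order two of the kernel of \<open>\<Lambda>\<close>.\<close>

definition even_set :: "'a set set \<Rightarrow> bool" where
  "even_set A \<longleftrightarrow> A \<subseteq> facets \<and> (\<forall>j. even (\<Sum>F\<in>A. \<Lambda> F $ j))"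

lemma even_set_mm:
  assumes "even_set A"
  shows "even (\<Sum>F\<in>A. mm v i F)"
proof -
  have "(\<Sum>F\<in>A. mm v i F) = (\<Sum>j\<in>UNIV. W v $ i $ j * (\<Sum>F\<in>A. \<Lambda> F $ j))"
    unfolding mm_def by (subst sum.swap) (simp add: sum_distrib_left)
  then show ?thesis using assms by (auto simp: even_set_def intro!: dvd_sum)
qed

text \<open>The characteristic vectors of the facets at a vertex are independent modulo two.\<close>

lemma even_set_free:
  assumes A: "even_set A" and p: "p \<in> P" "A \<subseteq> facets_at p"
  shows "A = {}"
proof (rule ccontr)
  assume "A \<noteq> {}"
  then obtain G where G: "G \<in> A" by blast
  obtain v where v: "v extreme_point_of P" "A \<subseteq> facets_at v" using vertex_above[OF p(1)] p(2) by blast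
  have "mm v (h G) F = of_bool (F = G)" if "F \<in> A" for F
  proof -
    have FG: "F \<in> facets_at v" "G \<in> facets_at v" using that G v(2) by auto
    then have "mm v (h G) F = of_bool (h G = h F)" using mm_fa[OF v(1), of "h G" "h F"] fa_h[OF v(1)] by simp
    then show ?thesis using color_inj[OF FG] by auto
  qed
  then have "(\<Sum>F\<in>A. mm v (h G) F) = (\<Sum>F\<in>A. of_bool (F = G))" by simp
  also have "\<dots> = 1" using G finite_subset[OF v(2) finite_facets_at] by (simp add: of_bool_def sum.delta)
  finally show False using even_set_mm[OF A, of v "h G"] by simp
qed

end

section \<open>The charts\<close>

lemma torus_mem: "t \<in> carrier torus \<longleftrightarrow> (\<forall>j. norm (t $ j) = 1)"
  by (simp add: torus_def)

lemma torus_nz: "t \<in> carrier torus \<Longrightarrow> t $ j \<noteq> 0"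
  by (metis torus_mem norm_zero zero_neq_one)

lemma torus_mult [simp]: "s \<otimes>\<^bsub>torus\<^esub> t = s * t" and torus_one [simp]: "\<one>\<^bsub>torus\<^esub> = 1"
  by (simp_all add: torus_def)

lemma torus_inv:
  assumes "t \<in> carrier torus"
  shows "inv\<^bsub>torus\<^esub> t = (\<chi> j. inverse (t $ j))"
proof (rule group.inv_equality[OF group_torus])
  show "(\<chi> j. inverse (t $ j)) \<otimes>\<^bsub>torus\<^esub> t = \<one>\<^bsub>torus\<^esub>"
    using torus_nz[OF assms] by (simp add: vec_eq_iff)
qed (use assms in \<open>auto simp: torus_mem norm_inverse\<close>)

lemma monomial_map_torus: "t \<in> carrier torus \<Longrightarrow> monomial_map A t \<in> carrier torus"
  by (simp add: torus_mem monomial_map_def norm_power_int flip: prod_norm)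

lemma monomial_map_inv: "monomial_map A (\<chi> j. inverse (t $ j)) = (\<chi> i. inverse (monomial_map A t $ i))"
  by (simp add: monomial_map_def vec_eq_iff prod_inversef[symmetric] power_int_inverse o_def)

lemma monomial_map_one: "monomial_map A 1 = 1"
  by (simp add: monomial_map_def vec_eq_iff)

context colored_poly
begin

lemma monomial_map_circle:
  assumes "g \<noteq> (0::'k::{real_normed_field,euclidean_space})"
  shows "monomial_map (W v) (\<chi> j. g powi (\<Lambda> F $ j)) $ i = g powi mm v i F"
  using assms by (simp add: monomial_map_def mm_def power_int_sum mult.commute power_int_mult)

text \<open>In the coordinates \<open>monomial_map (W v) t\<close> the subgroup of
  \<open>fa v i\<close> is the \<open>i\<close>-th coordinate subgroup, so the isotropy group is the
  product of those whose facet contains \<open>p\<close>.\<close>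

lemma isotropy_iff:
  fixes t :: "('k::{real_normed_field,euclidean_space}, 'n) vec"
  assumes v: "v extreme_point_of P" and p: "facets_at p \<subseteq> facets_at v"
  shows "t \<in> isotropy P \<Lambda> p \<longleftrightarrow>
    t \<in> carrier torus \<and> (\<forall>i. fa v i \<notin> facets_at p \<longrightarrow> monomial_map (W v) t $ i = 1)"
proof
  let ?S = "\<Union>F\<in>{F. F facet_of P \<and> p \<in> F}. circle_subgroup (\<Lambda> F) :: ('k, 'n) vec set"
  let ?R = "{t :: ('k, 'n) vec. t \<in> carrier torus \<and> (\<forall>i. fa v i \<notin> facets_at p \<longrightarrow> monomial_map (W v) t $ i = 1)}"
  have fp: "F \<in> facets_at p" if "F facet_of P" "p \<in> F" for F
    using that by (simp add: facets_at_def facets_def)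
  {
    have "?S \<subseteq> ?R"
    proof
      fix u :: "('k, 'n) vec" assume "u \<in> ?S"
      then obtain F g where F: "F \<in> facets_at p" and u: "u = (\<chi> j. g powi (\<Lambda> F $ j))" "norm g = 1"
        using fp by (auto simp: circle_subgroup_def)
      have "g \<noteq> 0" using u(2) by auto
      have "monomial_map (W v) u $ i = 1" if "fa v i \<notin> facets_at p" for i
      proof -
        have "F = fa v (h F)" using fa_h[OF v] F p by auto
        then have "mm v i F = of_bool (i = h F)" using mm_fa[OF v] by metis
        moreover have "i \<noteq> h F" using that F \<open>F = fa v (h F)\<close> by metis
        ultimately show ?thesis unfolding u(1) monomial_map_circle[OF \<open>g \<noteq> 0\<close>] by simp
      qed
      moreover have "u \<in> carrier torus" using u by (simp add: torus_mem norm_power_int)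
      ultimately show "u \<in> ?R" by simp
    qed
    moreover have "subgroup ?R torus"
    proof (rule group.subgroupI[OF group_torus])
      show "?R \<noteq> {}" by (auto simp: torus_mem monomial_map_one intro!: exI[of _ 1])
      show "inv\<^bsub>torus\<^esub> t \<in> ?R" if "t \<in> ?R" for t
        using that by (auto simp: torus_inv monomial_map_inv torus_mem norm_inverse)
      show "s \<otimes>\<^bsub>torus\<^esub> t \<in> ?R" if "s \<in> ?R" "t \<in> ?R" for s t
        using that by (auto simp: monomial_map_mult torus_mem norm_mult)
    qed auto
    ultimately have "isotropy P \<Lambda> p \<subseteq> ?R"
      unfolding isotropy_def by (rule group.generate_subgroup_incl[OF group_torus])
    then show "t \<in> isotropy P \<Lambda> p \<Longrightarrow>
      t \<in> carrier torus \<and> (\<forall>i. fa v i \<notin> facets_at p \<longrightarrow> monomial_map (W v) t $ i = 1)" by blast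
  }
  assume t: "t \<in> carrier torus \<and> (\<forall>i. fa v i \<notin> facets_at p \<longrightarrow> monomial_map (W v) t $ i = 1)"
  let ?s = "monomial_map (W v) t"
  \<comment> \<open>\<open>t\<close> is the product of the elements \<open>u i\<close> that its
    coordinates determine in the subgroups of the facets at \<open>v\<close>; the factors of facets
    that miss \<open>p\<close> are trivial.\<close>
  define u where "u i = (\<chi> j. ?s $ i powi (\<Lambda> (fa v i) $ j))" for i
  have u: "u i \<in> generate torus ?S" for i
  proof (cases "fa v i \<in> facets_at p")
    case True
    have "norm (?s $ i) = 1" using monomial_map_torus t torus_mem by blast
    then have "u i \<in> ?S" unfolding u_def circle_subgroup_def using True by (auto simp: facets_at_def facets_def)
    then show ?thesis by (rule generate.incl)
  next
    case False
    then have "u i = \<one>\<^bsub>torus\<^esub>" using t by (simp add: u_def vec_eq_iff)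
    then show ?thesis using generate.one[of torus ?S] by simp
  qed
  have "(\<chi> j. \<Prod>i\<in>S. u i $ j) \<in> generate torus ?S" if "finite S" for S
    using that
  proof (induction S rule: finite_induct)
    case empty
    have "(\<chi> j. \<Prod>i\<in>{}. u i $ j) = \<one>\<^bsub>torus\<^esub>" by (simp add: vec_eq_iff)
    then show ?case using generate.one[of torus ?S] by simp
  next
    case (insert i S)
    have "(\<chi> j. \<Prod>i\<in>insert i S. u i $ j) = u i \<otimes>\<^bsub>torus\<^esub> (\<chi> j. \<Prod>i\<in>S. u i $ j)"
      using insert.hyps by (simp add: vec_eq_iff)
    then show ?case using generate.eng[OF u insert.IH] by simp
  qed
  moreover have "t = (\<chi> j. \<Prod>i\<in>UNIV. u i $ j)"
  proof -
    have "t = monomial_map (M v) ?s"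
      using monomial_map_comp[of t "M v" "W v"] torus_nz[of t] t M_invertible(2)[OF v]
      by (simp add: monomial_map_1)
    also have "\<dots> = (\<chi> j. \<Prod>i\<in>UNIV. u i $ j)" by (simp add: monomial_map_def u_def M_Lambda)
    finally show ?thesis .
  qed
  ultimately show "t \<in> isotropy P \<Lambda> p" unfolding isotropy_def by simp
qed

definition cls :: "('k::{real_normed_field,euclidean_space}, 'n) vec \<Rightarrow> 'a \<Rightarrow> (('k, 'n) vec \<times> 'a) set" where
  "cls t p = orbit_rel P \<Lambda> `` {(t, p)}"

lemma mem_cls: "(s, q) \<in> cls t p \<longleftrightarrow> t \<in> carrier torus \<and> s \<in> carrier torus \<and> p \<in> P \<and> q = p \<and>
    t \<otimes>\<^bsub>torus\<^esub> inv\<^bsub>torus\<^esub> s \<in> isotropy P \<Lambda> p"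
  by (auto simp: cls_def orbit_rel_def)

lemma subgroup_isotropy: "subgroup (isotropy P \<Lambda> p) torus"
  unfolding isotropy_def
proof (rule group.generate_is_subgroup[OF group_torus])
  show "(\<Union>F\<in>{F. F facet_of P \<and> p \<in> F}. circle_subgroup (\<Lambda> F)) \<subseteq> carrier torus"
    by (auto simp: circle_subgroup_def torus_mem norm_power_int)
qed

lemma cls_self: "t \<in> carrier torus \<Longrightarrow> p \<in> P \<Longrightarrow> (t, p) \<in> cls t p"
  unfolding mem_cls using subgroup.one_closed[OF subgroup_isotropy] group.r_inv[OF group_torus] by metis

lemma cls_sub:
  assumes st: "s \<in> carrier torus" "t \<in> carrier torus" "s \<otimes>\<^bsub>torus\<^esub> inv\<^bsub>torus\<^esub> t \<in> isotropy P \<Lambda> p" "p \<in> P"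
  shows "cls t p \<subseteq> cls s p"
proof
  fix x assume "x \<in> cls t p"
  then obtain r where r: "x = (r, p)" "r \<in> carrier torus" "t \<otimes>\<^bsub>torus\<^esub> inv\<^bsub>torus\<^esub> r \<in> isotropy P \<Lambda> p"
    by (cases x) (auto simp: mem_cls)
  have "s \<otimes>\<^bsub>torus\<^esub> inv\<^bsub>torus\<^esub> r =
      (s \<otimes>\<^bsub>torus\<^esub> inv\<^bsub>torus\<^esub> t) \<otimes>\<^bsub>torus\<^esub> (t \<otimes>\<^bsub>torus\<^esub> inv\<^bsub>torus\<^esub> r)"
    using st(1,2) r(2) torus_nz[OF st(2)] by (simp add: torus_inv vec_eq_iff)
  then have "s \<otimes>\<^bsub>torus\<^esub> inv\<^bsub>torus\<^esub> r \<in> isotropy P \<Lambda> p"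
    using subgroup.m_closed[OF subgroup_isotropy st(3) r(3)] by simp
  then show "x \<in> cls s p" using st r by (simp add: mem_cls)
qed

lemma cls_eq:
  assumes st: "s \<in> carrier torus" "t \<in> carrier torus" "s \<otimes>\<^bsub>torus\<^esub> inv\<^bsub>torus\<^esub> t \<in> isotropy P \<Lambda> p" "p \<in> P"
  shows "cls s p = cls t p"
proof -
  have "t \<otimes>\<^bsub>torus\<^esub> inv\<^bsub>torus\<^esub> s = inv\<^bsub>torus\<^esub> (s \<otimes>\<^bsub>torus\<^esub> inv\<^bsub>torus\<^esub> t)"
    using st(1,2) by (subst (2) torus_inv)
      (auto simp: torus_inv torus_mem vec_eq_iff norm_mult norm_inverse)
  then have "t \<otimes>\<^bsub>torus\<^esub> inv\<^bsub>torus\<^esub> s \<in> isotropy P \<Lambda> p"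
    using subgroup.m_inv_closed[OF subgroup_isotropy st(3)] by simp
  then show ?thesis using cls_sub[OF st] cls_sub[OF st(2,1) _ st(4)] by blast
qed

lemma topspace_quotient:
  "topspace (torus_quotient P \<Lambda> :: (('k::{real_normed_field,euclidean_space}, 'n) vec \<times> 'a) set topology) =
    {cls t p |t p. t \<in> carrier torus \<and> p \<in> P}"
proof -
  have "topspace (torus_quotient P \<Lambda> :: (('k, 'n) vec \<times> 'a) set topology) =
      (\<lambda>x. orbit_rel P \<Lambda> `` {x}) ` topspace (prod_topology (top_of_set (carrier torus)) (top_of_set P))"
    unfolding torus_quotient_def using quotient_map_quotient_topology[unfolded quotient_map_def] by metis
  then show ?thesis by (auto simp: cls_def topspace_prod_topology)
qed

definition chart :: "'a \<Rightarrow> ((('k::{real_normed_field,euclidean_space}, 'n) vec \<times> 'a) set, ('k, 'n) vec) chart" where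
  "chart v = (vertex_nbhd P \<Lambda> v, \<lambda>x. the_elem (chart_coords P h \<Lambda> v ` x))"

lemma standard_atlas: "standard_atlas P h \<Lambda> = chart ` {v. v extreme_point_of P}"
  by (simp add: standard_atlas_def chart_def)

lemma mem_chart:
  "x \<in> fst (chart v) \<longleftrightarrow> (\<exists>t p. x = cls t p \<and> t \<in> carrier torus \<and> p \<in> P \<and> facets_at p \<subseteq> facets_at v)"
proof -
  have "(\<forall>(s, q)\<in>cls t p. \<forall>F. F facet_of P \<and> q \<in> F \<longrightarrow> v \<in> F) \<longleftrightarrow> facets_at p \<subseteq> facets_at v"
    if "t \<in> carrier torus" "p \<in> P" for t :: "('b, 'n) vec" and p
  proof
    assume "\<forall>(s, q)\<in>cls t p. \<forall>F. F facet_of P \<and> q \<in> F \<longrightarrow> v \<in> F"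
    then show "facets_at p \<subseteq> facets_at v" using cls_self[OF that] by (auto simp: facets_at_def facets_def)
  next
    assume "facets_at p \<subseteq> facets_at v"
    then show "\<forall>(s, q)\<in>cls t p. \<forall>F. F facet_of P \<and> q \<in> F \<longrightarrow> v \<in> F"
      by (auto simp: mem_cls facets_at_def facets_def)
  qed
  then show ?thesis unfolding chart_def vertex_nbhd_def topspace_quotient fst_conv by blast
qed

lemma chart_coords_eq:
  assumes v: "v extreme_point_of P" and p: "p \<in> P"
  shows "chart_coords P h \<Lambda> v (t, p) $ i = monomial_map (W v) t $ i * of_real (sqrt (ell (fa v i) p))"
  using ell_infdist[OF _ p, of "fa v i"] fa_mem[OF v, of i]
  by (simp add: chart_coords_def monomial_map_def facets_at_def)

lemma chart_cls:
  assumes v: "v extreme_point_of P" and t: "t \<in> carrier torus" and p: "p \<in> P" "facets_at p \<subseteq> facets_at v"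
  shows "snd (chart v) (cls t p) = (\<chi> i. monomial_map (W v) t $ i * of_real (sqrt (ell (fa v i) p)))"
proof -
  have "chart_coords P h \<Lambda> v x = chart_coords P h \<Lambda> v (t, p)" if xc: "x \<in> cls t p" for x
  proof -
    obtain s where s: "x = (s, p)" "s \<in> carrier torus" "t \<otimes>\<^bsub>torus\<^esub> inv\<^bsub>torus\<^esub> s \<in> isotropy P \<Lambda> p"
      using xc by (cases x) (auto simp: mem_cls)
    have "monomial_map (W v) s $ i * of_real (sqrt (ell (fa v i) p)) =
        monomial_map (W v) t $ i * of_real (sqrt (ell (fa v i) p))" for i
    proof (cases "fa v i \<in> facets_at p")
      case True
      then have "ell (fa v i) p = 0" using mem_facet[OF _ p(1), of "fa v i"] by (auto simp: facets_at_def)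
      then show ?thesis by simp
    next
      case False
      then have "monomial_map (W v) (t \<otimes>\<^bsub>torus\<^esub> inv\<^bsub>torus\<^esub> s) $ i = 1"
        using s(3) isotropy_iff[OF v p(2)] by blast
      then have "monomial_map (W v) t $ i * inverse (monomial_map (W v) s $ i) = 1"
        using s(2) by (simp add: torus_inv monomial_map_mult monomial_map_inv)
      then have "monomial_map (W v) t $ i = monomial_map (W v) s $ i"
        using torus_nz[OF monomial_map_torus[OF s(2)], of "W v" i] by (simp add: field_simps)
      then show ?thesis by simp
    qed
    then show ?thesis unfolding s(1) by (simp add: vec_eq_iff chart_coords_eq[OF v p(1)])
  qed
  then have "chart_coords P h \<Lambda> v ` cls t p = {chart_coords P h \<Lambda> v (t, p)}"
    using cls_self[OF t p(1)] by blast
  then show ?thesis by (simp add: chart_def vec_eq_iff chart_coords_eq[OF v p(1)])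
qed

text \<open>The norms of the coordinates determine the point of \<open>P\<close>, and the nonzero
  coordinates determine the torus element up to isotropy.\<close>

lemma chart_inj:
  assumes v: "v extreme_point_of P"
  shows "inj_on (snd (chart v :: ((('k::{real_normed_field,euclidean_space}, 'n) vec \<times> 'a) set, ('k, 'n) vec) chart)) (fst (chart v))"
proof (rule inj_onI)
  fix x y :: "(('k, 'n) vec \<times> 'a) set"
  assume "x \<in> fst (chart v)" "y \<in> fst (chart v)" and eq: "snd (chart v) x = snd (chart v) y"
  then obtain t p s q where x: "x = cls t p" "t \<in> carrier torus" "p \<in> P" "facets_at p \<subseteq> facets_at v"
    and y: "y = cls s q" "s \<in> carrier torus" "q \<in> P" "facets_at q \<subseteq> facets_at v"
    unfolding mem_chart by blast
  have c: "monomial_map (W v) t $ i * of_real (sqrt (ell (fa v i) p)) =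
      monomial_map (W v) s $ i * of_real (sqrt (ell (fa v i) q))" for i
    using eq unfolding x(1) y(1) chart_cls[OF v x(2,3,4)] chart_cls[OF v y(2,3,4)] by (simp add: vec_eq_iff)
  have nt: "norm (monomial_map (W v) t $ i) = 1" "norm (monomial_map (W v) s $ i) = 1" for i
    using monomial_map_torus x(2) y(2) torus_mem by blast+
  have l: "ell (fa v i) p = ell (fa v i) q" for i
  proof -
    have f: "fa v i \<in> facets" using fa_mem[OF v] by (auto simp: facets_at_def)
    have "sqrt (ell (fa v i) p) = sqrt (ell (fa v i) q)"
      using arg_cong[OF c[of i], of norm] nt ell_nonneg[OF f x(3)] ell_nonneg[OF f y(3)] by (simp add: norm_mult)
    then show ?thesis by simp
  qed
  have pq: "p = q"
    by (rule ell_inj[OF v P_sub_hull[OF x(3)] P_sub_hull[OF y(3)]]) (metis l fa_h[OF v])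
  have "monomial_map (W v) (t \<otimes>\<^bsub>torus\<^esub> inv\<^bsub>torus\<^esub> s) $ i = 1" if "fa v i \<notin> facets_at p" for i
  proof -
    have "ell (fa v i) p \<noteq> 0" using that fa_mem[OF v, of i] mem_facet[OF _ x(3), of "fa v i"] by (auto simp: facets_at_def)
    then have "monomial_map (W v) t $ i = monomial_map (W v) s $ i" using c[of i] l[of i] by simp
    then show ?thesis using y(2) torus_nz[OF monomial_map_torus[OF y(2)], of "W v" i]
      by (simp add: torus_inv monomial_map_mult monomial_map_inv)
  qed
  moreover have "t \<otimes>\<^bsub>torus\<^esub> inv\<^bsub>torus\<^esub> s \<in> carrier torus"
    using x(2) y(2) by (simp add: torus_inv torus_mem norm_mult norm_inverse)
  ultimately have "t \<otimes>\<^bsub>torus\<^esub> inv\<^bsub>torus\<^esub> s \<in> isotropy P \<Lambda> p" using isotropy_iff[OF v x(4)] by blast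
  then show "x = y" using cls_eq[OF x(2) y(2) _ x(3)] x(1) y(1) pq by simp
qed

text \<open>The inverse of the affine coordinates \<open>ell (fa v i)\<close> on the hull of
  \<open>P\<close>.\<close>

definition pt :: "'a \<Rightarrow> ('n \<Rightarrow> real) \<Rightarrow> 'a" where
  "pt v q = v + (\<Sum>i\<in>UNIV. q i *\<^sub>R dual v (fa v i))"

lemma pt_hull: "v extreme_point_of P \<Longrightarrow> pt v q \<in> affine hull P"
  unfolding pt_def using dirs_iff[OF P_sub_hull[OF vertex_in_P]] subspace_dirs dual_dirs fa_mem
  by (metis (no_types, lifting) subspace_sum subspace_scale)

lemma ell_pt: "ell F (pt v q) = ell F v + (\<Sum>i\<in>UNIV. q i * (\<alpha> F \<bullet> dual v (fa v i)))"
  by (simp add: pt_def ell_add inner_sum_right)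

lemma ell_pt_fa:
  assumes v: "v extreme_point_of P"
  shows "ell (fa v i) (pt v q) = q i"
proof -
  have "ell (fa v i) v = 0"
    using mem_facet[OF _ vertex_in_P[OF v], of "fa v i"] fa_mem[OF v, of i] by (simp add: facets_at_def)
  moreover have "\<alpha> (fa v i) \<bullet> dual v (fa v j) = of_bool (i = j)" for j
    using dual_eq[OF v fa_mem[OF v] fa_mem[OF v]] fa_inj[OF v] by simp
  then have "(\<Sum>j\<in>UNIV. q j * (\<alpha> (fa v i) \<bullet> dual v (fa v j))) = (\<Sum>j\<in>UNIV. if i = j then q j else 0)"
    by (intro sum.cong) auto
  ultimately show ?thesis by (simp add: ell_pt sum.delta')
qed

lemma pt_ell:
  assumes v: "v extreme_point_of P" and x: "x \<in> affine hull P"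
  shows "pt v (\<lambda>i. ell (fa v i) x) = x"
  by (rule ell_inj[OF v pt_hull[OF v] x]) (metis fa_h[OF v] ell_pt_fa[OF v])

lemma pt_in_P:
  assumes v: "v extreme_point_of P" and q: "\<And>i. 0 \<le> q i" and pos: "\<And>F. F \<in> facets - facets_at v \<Longrightarrow> 0 < ell F (pt v q)"
  shows "pt v q \<in> P" "facets_at (pt v q) \<subseteq> facets_at v"
proof -
  show P: "pt v q \<in> P"
    unfolding P_iff[of "pt v q"]
  proof (intro conjI ballI pt_hull[OF v])
    fix F assume F: "F \<in> facets"
    show "0 \<le> ell F (pt v q)"
    proof (cases "F \<in> facets_at v")
      case True
      then show ?thesis using ell_pt_fa[OF v, of "h F" q] q fa_h[OF v] by simp
    qed (use pos[of F] F in auto)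
  qed
  show "facets_at (pt v q) \<subseteq> facets_at v"
    using pos mem_facet[OF _ P] by (force simp: facets_at_def)
qed

text \<open>The squared norms of \<open>z\<close> are the distances of a unique point of the hull to
  the facets at \<open>v\<close>. The image of the chart is given by the strict inequalities of the
  remaining facets at this point.\<close>

lemma chart_open:
  assumes v: "v extreme_point_of P"
  shows "open (snd (chart v) ` fst (chart v :: ((('k::{real_normed_field,euclidean_space}, 'n) vec \<times> 'a) set, ('k, 'n) vec) chart))"
proof -
  let ?c = "chart v :: ((('k, 'n) vec \<times> 'a) set, ('k, 'n) vec) chart"
  let ?q = "\<lambda>z :: ('k, 'n) vec. \<lambda>i. (norm (z $ i))\<^sup>2"
  have "snd ?c ` fst ?c = {z. \<forall>F\<in>facets - facets_at v. 0 < ell F (pt v (?q z))}"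
  proof (intro subset_antisym subsetI)
    fix z assume "z \<in> snd ?c ` fst ?c"
    then obtain x where "x \<in> fst ?c" "z = snd ?c x" by blast
    then obtain t p where t: "z = snd ?c (cls t p)" "t \<in> carrier torus" "p \<in> P" "facets_at p \<subseteq> facets_at v"
      unfolding mem_chart by blast
    have "(norm (z $ i))\<^sup>2 = ell (fa v i) p" for i
    proof -
      have "norm (monomial_map (W v) t $ i) = 1" using monomial_map_torus[OF t(2)] torus_mem by blast
      moreover have "0 \<le> ell (fa v i) p" using fa_mem[OF v] ell_nonneg[OF _ t(3)] by (auto simp: facets_at_def)
      ultimately show ?thesis unfolding t(1) chart_cls[OF v t(2-4)] by (simp add: norm_mult)
    qed
    then have "pt v (?q z) = p" using pt_ell[OF v P_sub_hull[OF t(3)]] by simp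
    moreover have "0 < ell F p" if "F \<in> facets - facets_at v" for F
      using that t(4) ell_nonneg[OF _ t(3), of F] mem_facet[OF _ t(3), of F] by (force simp: facets_at_def)
    ultimately show "z \<in> {z. \<forall>F\<in>facets - facets_at v. 0 < ell F (pt v (?q z))}" by simp
  next
    fix z assume z: "z \<in> {z. \<forall>F\<in>facets - facets_at v. 0 < ell F (pt v (?q z))}"
    let ?p = "pt v (?q z)"
    have p: "?p \<in> P" "facets_at ?p \<subseteq> facets_at v" using pt_in_P[OF v, of "?q z"] z by auto
    define s where "s = (\<chi> i. if z $ i = 0 then 1 else z $ i / of_real (norm (z $ i)))"
    have s: "s \<in> carrier torus" by (auto simp: torus_mem s_def norm_divide)
    let ?t = "monomial_map (M v) s"
    have t: "?t \<in> carrier torus" by (rule monomial_map_torus[OF s])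
    have "monomial_map (W v) ?t = s"
      using monomial_map_comp[of s "W v" "M v"] torus_nz[OF s] M_invertible(1)[OF v] by (simp add: monomial_map_1)
    then have "snd ?c (cls ?t ?p) = z"
      unfolding chart_cls[OF v t p] by (simp add: vec_eq_iff ell_pt_fa[OF v] s_def)
    moreover have "cls ?t ?p \<in> fst ?c" using mem_chart t p by blast
    ultimately show "z \<in> snd ?c ` fst ?c" by (intro image_eqI[of _ _ "cls ?t ?p"]) auto
  qed
  also have "\<dots> = (\<Inter>F\<in>facets - facets_at v. {z. 0 < ell F (pt v (?q z))})" by auto
  also have "open \<dots>"
    using finite_facets unfolding ell_pt
    by (intro open_INT ballI open_Collect_less continuous_intros) auto
  finally show ?thesis .
qed

end

section \<open>Points of the moment-angle space and their velocities\<close>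

text \<open>Polarization of the multiplicativity of the norm, for real and complex scalars at
  once.\<close>

lemma inner_mult_left_field: "(y * a) \<bullet> (y * b) = (norm y)\<^sup>2 * (a \<bullet> b)"
  for y :: "'k::{real_normed_field,euclidean_space}"
proof -
  have "norm (y * a + y * b) = norm y * norm (a + b)" by (metis distrib_left norm_mult)
  then show ?thesis unfolding dot_norm by (simp add: norm_mult power_mult_distrib right_diff_distrib)
qed

definition ph :: "'k::real_normed_field \<Rightarrow> 'k" where
  "ph z = (if z = 0 then 1 else z / of_real (norm z))"

lemma norm_ph [simp]: "norm (ph z) = 1"
  by (simp add: ph_def norm_divide)

lemma ph_nz [simp]: "ph z \<noteq> 0"
  by (metis norm_ph norm_zero zero_neq_one)

lemma ph_norm: "ph z * of_real (norm z) = z"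
  by (simp add: ph_def)

lemma ph_scale: "r > 0 \<Longrightarrow> ph (z * of_real r) = ph z"
  by (simp add: ph_def norm_mult)

lemma vec_has_vector_derivative:
  fixes g :: "'n::finite \<Rightarrow> real \<Rightarrow> 'k::euclidean_space"
  assumes "\<And>i. (g i has_vector_derivative g' i) F"
  shows "((\<lambda>t. \<chi> i. g i t) has_vector_derivative (\<chi> i. g' i)) F"
proof -
  have bl: "bounded_linear (axis i :: 'k \<Rightarrow> 'k ^ 'n)" for i
    by (rule linear_conv_bounded_linear[THEN iffD1], rule linearI) (auto simp: axis_def vec_eq_iff)
  have eq: "(\<chi> i. x i) = (\<Sum>i\<in>UNIV. axis i (x i))" for x :: "'n \<Rightarrow> 'k"
    by (simp add: vec_eq_iff axis_def sum.delta')
  show ?thesis unfolding eq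
    by (intro has_vector_derivative_sum bounded_linear.has_vector_derivative[OF bl] assms)
qed

lemma prod_has_vector_derivative:
  fixes f :: "'i \<Rightarrow> real \<Rightarrow> 'k::real_normed_field"
  assumes "finite S" "\<And>i. i \<in> S \<Longrightarrow> (f i has_vector_derivative (f i x * c i)) (at x)"
  shows "((\<lambda>t. \<Prod>i\<in>S. f i t) has_vector_derivative ((\<Prod>i\<in>S. f i x) * (\<Sum>i\<in>S. c i))) (at x)"
  using assms
proof (induction S rule: finite_induct)
  case (insert i S)
  have "((\<lambda>t. f i t * (\<Prod>i\<in>S. f i t)) has_vector_derivative
      (f i x * ((\<Prod>i\<in>S. f i x) * (\<Sum>i\<in>S. c i)) + f i x * c i * (\<Prod>i\<in>S. f i x))) (at x)"
    by (intro has_vector_derivative_mult insert) (use insert in auto)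
  then show ?case using insert.hyps by (simp add: algebra_simps)
qed simp

lemma norm_square_line:
  fixes y e :: "'k::euclidean_space"
  shows "((\<lambda>t. (norm (y + t *\<^sub>R e))\<^sup>2) has_real_derivative (2 * (y \<bullet> e))) (at 0)"
proof -
  have "(norm (y + t *\<^sub>R e))\<^sup>2 = (y \<bullet> y) + 2 * t * (y \<bullet> e) + t\<^sup>2 * (e \<bullet> e)" for t
    unfolding power2_norm_eq_inner by (simp add: inner_simps inner_commute power2_eq_square algebra_simps)
  then show ?thesis by (auto intro!: derivative_eq_intros)
qed

lemma norm_line:
  fixes y e :: "'k::euclidean_space"
  assumes "y \<noteq> 0"
  shows "((\<lambda>t. norm (y + t *\<^sub>R e)) has_real_derivative ((y \<bullet> e) / norm y)) (at 0)"
proof -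
  have "(sqrt has_real_derivative (inverse (sqrt ((norm (y + 0 *\<^sub>R e))\<^sup>2)) / 2)) (at ((norm (y + 0 *\<^sub>R e))\<^sup>2))"
    by (rule DERIV_real_sqrt) (use assms in simp)
  from DERIV_chain2[OF this norm_square_line]
  have "((\<lambda>t. sqrt ((norm (y + t *\<^sub>R e))\<^sup>2)) has_real_derivative
      inverse (sqrt ((norm (y + 0 *\<^sub>R e))\<^sup>2)) / 2 * (2 * (y \<bullet> e))) (at 0)" .
  moreover have "inverse (sqrt ((norm (y + 0 *\<^sub>R e))\<^sup>2)) / 2 * (2 * (y \<bullet> e)) = (y \<bullet> e) / norm y"
  proof -
    have "sqrt ((norm (y + 0 *\<^sub>R e))\<^sup>2) = norm y" by (simp only: scaleR_zero_left add_0_right real_sqrt_abs abs_norm_cancel)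
    moreover have "inverse a / 2 * (2 * b) = b / a" for a b :: real by (simp only: divide_inverse) simp
    ultimately show ?thesis by (simp only:)
  qed
  moreover have "(\<lambda>t. sqrt ((norm (y + t *\<^sub>R e))\<^sup>2)) = (\<lambda>t. norm (y + t *\<^sub>R e))"
    by (simp only: real_sqrt_abs abs_norm_cancel)
  ultimately show ?thesis by (simp only:)
qed

lemma line_has_vector_derivative: "((\<lambda>t. y + t *\<^sub>R e) has_vector_derivative e) (at x)"
  by (auto intro!: derivative_eq_intros simp: has_vector_derivative_def)

lemma line_nonzero:
  fixes y e :: "'k::real_normed_vector"
  assumes "y \<noteq> 0"
  shows "\<forall>\<^sub>F t in nhds 0. y + t *\<^sub>R e \<noteq> 0"
proof -
  have "isCont (\<lambda>t. y + t *\<^sub>R e) 0" by (intro continuous_intros)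
  then have "((\<lambda>t. y + t *\<^sub>R e) \<longlongrightarrow> y + 0 *\<^sub>R e) (nhds 0)"
    unfolding isCont_def by (subst (asm) tendsto_at_iff_tendsto_nhds)
  then have "((\<lambda>t. y + t *\<^sub>R e) \<longlongrightarrow> y) (nhds 0)" by simp
  then show ?thesis using assms tendsto_imp_eventually_ne by blast
qed

text \<open>The logarithmic derivative of \<open>ph y\<close> is \<open>e / y\<close> minus its
  radial part, which is that of the norm.\<close>

lemma ph_power_line:
  fixes y e :: "'k::{real_normed_field,euclidean_space}"
  assumes "y \<noteq> 0"
  shows "((\<lambda>t. ph (y + t *\<^sub>R e) powi m) has_vector_derivative
    (ph y powi m * (of_int m * (e / y - of_real ((y \<bullet> e) / (norm y)\<^sup>2))))) (at 0)"
proof -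
  let ?N = "of_real (norm y) :: 'k"
  have N: "?N \<noteq> 0" using assms by simp
  have inv: "((\<lambda>t. inverse (norm (y + t *\<^sub>R e))) has_real_derivative (- ((y \<bullet> e) / norm y) / (norm y)\<^sup>2)) (at 0)"
    using DERIV_inverse_fun[OF norm_line[OF assms, of e]] assms by (simp add: power2_eq_square divide_simps)
  have "((\<lambda>t. (y + t *\<^sub>R e) * of_real (inverse (norm (y + t *\<^sub>R e)))) has_vector_derivative
      ((y + 0 *\<^sub>R e) * of_real (- ((y \<bullet> e) / norm y) / (norm y)\<^sup>2) + e * of_real (inverse (norm (y + 0 *\<^sub>R e))))) (at 0)"
    by (intro has_vector_derivative_mult line_has_vector_derivative has_vector_derivative_of_real inv)
  moreover have "((y + 0 *\<^sub>R e) * of_real (- ((y \<bullet> e) / norm y) / (norm y)\<^sup>2) + e * of_real (inverse (norm (y + 0 *\<^sub>R e)))) =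
      ph y * (e / y - of_real ((y \<bullet> e) / (norm y)\<^sup>2))"
    using assms N by (simp add: ph_def divide_simps)
  ultimately have "((\<lambda>t. (y + t *\<^sub>R e) * of_real (inverse (norm (y + t *\<^sub>R e)))) has_vector_derivative
      (ph y * (e / y - of_real ((y \<bullet> e) / (norm y)\<^sup>2)))) (at 0)" by simp
  then have "((\<lambda>t. ph (y + t *\<^sub>R e)) has_vector_derivative
      (ph y * (e / y - of_real ((y \<bullet> e) / (norm y)\<^sup>2)))) (at 0)"
  proof (rule has_vector_derivative_cong_ev[THEN iffD1, rotated 2])
    show "\<forall>\<^sub>F t in nhds 0. t \<in> UNIV \<longrightarrow>
        (y + t *\<^sub>R e) * of_real (inverse (norm (y + t *\<^sub>R e))) = ph (y + t *\<^sub>R e)"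
      by (rule eventually_mono[OF line_nonzero[OF assms]]) (simp add: ph_def divide_inverse)
  qed (use assms in \<open>simp add: ph_def divide_inverse\<close>)
  moreover have "((\<lambda>z. z powi m) has_field_derivative (of_int m * ph y powi (m - 1))) (at (ph (y + 0 *\<^sub>R e)))"
    by (auto intro!: derivative_eq_intros)
  ultimately have 1: "(((\<lambda>z. z powi m) \<circ> (\<lambda>t. ph (y + t *\<^sub>R e))) has_vector_derivative
      (ph y * (e / y - of_real ((y \<bullet> e) / (norm y)\<^sup>2)) * (of_int m * ph y powi (m - 1)))) (at 0)"
    by (rule field_vector_diff_chain_at)
  have 2: "ph y * (e / y - of_real ((y \<bullet> e) / (norm y)\<^sup>2)) * (of_int m * ph y powi (m - 1)) =
      ph y powi m * (of_int m * (e / y - of_real ((y \<bullet> e) / (norm y)\<^sup>2)))"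
  proof -
    have "ph y powi m = ph y powi (m - 1) * ph y" by (simp add: power_int_minus_mult)
    then show ?thesis by (simp add: mult_ac)
  qed
  show ?thesis using 1 unfolding 2 o_def .
qed

context colored_poly
begin

text \<open>The points of the moment-angle space over \<open>p\<close>.\<close>

definition zpt :: "'a \<Rightarrow> ('a set \<Rightarrow> 'k::{real_normed_field,euclidean_space}) \<Rightarrow> bool" where
  "zpt p y \<longleftrightarrow> p \<in> P \<and> (\<forall>F\<in>facets. (norm (y F))\<^sup>2 = ell F p)"

text \<open>The quotient map from the moment-angle space to the manifold is \<Lambda> applied to the
  phases: it sends \<open>y\<close> over \<open>p\<close> to \<open>cls (tor y) p\<close>. The
  arbitrary phase of a vanishing entry is absorbed by the isotropy group.\<close>

definition tor :: "('a set \<Rightarrow> 'k::{real_normed_field,euclidean_space}) \<Rightarrow> ('k, 'n) vec" where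
  "tor y = (\<chi> j. \<Prod>F\<in>facets. ph (y F) powi (\<Lambda> F $ j))"

definition phase :: "'a \<Rightarrow> ('a set \<Rightarrow> 'k::{real_normed_field,euclidean_space}) \<Rightarrow> 'n \<Rightarrow> 'k" where
  "phase v y i = (\<Prod>F\<in>facets - facets_at v. ph (y F) powi mm v i F)"

definition Zc :: "'a \<Rightarrow> ('a set \<Rightarrow> 'k::{real_normed_field,euclidean_space}) \<Rightarrow> ('k, 'n) vec" where
  "Zc v y = (\<chi> i. y (fa v i) * phase v y i)"

text \<open>The differential of \<open>Zc v\<close> at \<open>y\<close> in the direction
  \<open>e\<close>, computed with the phases of the straight line. It makes sense also for
  \<open>e\<close> that are not tangent to the moment-angle space, but then depends on
  \<open>v\<close>.\<close>

definition Zd :: "'a \<Rightarrow> ('a set \<Rightarrow> 'k::{real_normed_field,euclidean_space}) \<Rightarrow> ('a set \<Rightarrow> 'k) \<Rightarrow> ('k, 'n) vec" where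
  "Zd v y e = (\<chi> i. (e (fa v i) + y (fa v i) * (\<Sum>F\<in>facets - facets_at v.
     of_int (mm v i F) * (e F / y F - of_real ((y F \<bullet> e F) / (norm (y F))\<^sup>2)))) * phase v y i)"

text \<open>The derivative of the equations in \<open>zpt\<close>, with \<xi> as the velocity of the
  point in \<open>P\<close>.\<close>

definition tangent :: "('a set \<Rightarrow> 'k::{real_normed_field,euclidean_space}) \<Rightarrow> ('a set \<Rightarrow> 'k) \<Rightarrow> bool" where
  "tangent y e \<longleftrightarrow> (\<exists>\<xi>\<in>dirs. \<forall>F\<in>facets. \<alpha> F \<bullet> \<xi> = 2 * (y F \<bullet> e F))"

lemma fa_facets: "v extreme_point_of P \<Longrightarrow> fa v i \<in> facets"
  using fa_mem by (auto simp: facets_at_def)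

lemma zpt_zero: "zpt p y \<Longrightarrow> F \<in> facets \<Longrightarrow> y F = 0 \<longleftrightarrow> F \<in> facets_at p"
  using mem_facet[of F p] by (auto simp: zpt_def facets_at_def)

lemma zpt_sqrt: "zpt p y \<Longrightarrow> F \<in> facets \<Longrightarrow> sqrt (ell F p) = norm (y F)"
  by (intro real_sqrt_unique) (auto simp: zpt_def)

lemma norm_phase [simp]: "norm (phase v y i) = 1"
  by (simp add: phase_def norm_power_int flip: prod_norm)

lemma tor_torus: "tor y \<in> carrier torus"
  by (simp add: torus_mem tor_def norm_power_int flip: prod_norm)

lemma monomial_tor:
  "monomial_map (W v) (tor y) $ i = (\<Prod>F\<in>facets. ph (y F) powi mm v i F)"
proof -
  have "monomial_map (W v) (tor y) $ i =
      (\<Prod>j\<in>UNIV. \<Prod>F\<in>facets. ph (y F) powi (W v $ i $ j * \<Lambda> F $ j))"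
    by (simp add: monomial_map_def tor_def power_int_prod mult.commute flip: power_int_mult)
  also have "\<dots> = (\<Prod>F\<in>facets. \<Prod>j\<in>UNIV. ph (y F) powi (W v $ i $ j * \<Lambda> F $ j))"
    by (rule prod.swap)
  finally show ?thesis by (simp add: mm_def power_int_sum)
qed

lemma monomial_tor_phase:
  assumes v: "v extreme_point_of P"
  shows "monomial_map (W v) (tor y) $ i = ph (y (fa v i)) * phase v y i"
proof -
  have sub: "facets_at v \<subseteq> facets" by (auto simp: facets_at_def)
  have "(\<Prod>F\<in>facets_at v. ph (y F) powi mm v i F) = (\<Prod>k\<in>UNIV. if i = k then ph (y (fa v k)) else 1)"
    unfolding prod_facets_at[OF v] by (intro prod.cong) (auto simp: mm_fa[OF v])
  also have "\<dots> = ph (y (fa v i))" by (simp add: prod.delta')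
  finally show ?thesis
    unfolding monomial_tor phase_def
    using prod.subset_diff[OF sub finite_facets, of "\<lambda>F. ph (y F) powi mm v i F"] by (simp add: mult.commute)
qed

lemma chart_zpt:
  assumes v: "v extreme_point_of P" and y: "zpt p y" and p: "facets_at p \<subseteq> facets_at v"
  shows "cls (tor y) p \<in> fst (chart v)" "snd (chart v) (cls (tor y) p) = Zc v y"
proof -
  have pP: "p \<in> P" using y by (simp add: zpt_def)
  show "cls (tor y) p \<in> fst (chart v)" unfolding mem_chart using tor_torus pP p by blast
  have "sqrt (ell (fa v i) p) = norm (y (fa v i))" for i
    by (rule zpt_sqrt[OF y fa_facets[OF v]])
  then show "snd (chart v) (cls (tor y) p) = Zc v y"
    unfolding chart_cls[OF v tor_torus pP p] monomial_tor_phase[OF v]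
    by (simp add: vec_eq_iff Zc_def ph_norm mult.commute mult.left_commute)
qed

text \<open>The straight line in the direction \<open>e\<close> leaves the moment-angle space. The
  entries of the facets at \<open>v\<close> are kept and determine a point of \<open>P\<close>; the
  others are rescaled to the norm that this point prescribes. Tangency says that the scaling factors
  have derivative zero, so the velocity is still \<open>e\<close>, and positive factors do not
  change the phases.\<close>

lemma curve_exists:
  fixes y e :: "'a set \<Rightarrow> 'k::{real_normed_field,euclidean_space}"
  assumes y: "zpt p y" and tan: "tangent y e"
  shows "\<exists>\<gamma> \<pi>. \<gamma> 0 = y \<and> \<pi> 0 = p \<and> (\<forall>\<^sub>F t in nhds 0. zpt (\<pi> t) (\<gamma> t) \<and> facets_at (\<pi> t) \<subseteq> facets_at p) \<and>
    (\<forall>F\<in>facets. ((\<lambda>t. \<gamma> t F) has_vector_derivative e F) (at 0)) \<and>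
    (\<forall>F\<in>facets - facets_at p. \<forall>\<^sub>F t in nhds 0. ph (\<gamma> t F) = ph (y F + t *\<^sub>R e F))"
proof -
  have pP: "p \<in> P" and ny: "\<And>F. F \<in> facets \<Longrightarrow> (norm (y F))\<^sup>2 = ell F p" using y by (auto simp: zpt_def)
  obtain v where v: "v extreme_point_of P" "facets_at p \<subseteq> facets_at v" using vertex_above[OF pP] by blast
  obtain \<xi> where xi: "\<xi> \<in> dirs" "\<And>F. F \<in> facets \<Longrightarrow> \<alpha> F \<bullet> \<xi> = 2 * (y F \<bullet> e F)"
    using tan by (auto simp: tangent_def)
  define L where "L F t = y F + t *\<^sub>R e F" for F t
  define \<pi> where "\<pi> t = pt v (\<lambda>i. (norm (L (fa v i) t))\<^sup>2)" for t
  define r where "r F t = sqrt (ell F (\<pi> t)) / norm (L F t)" for F t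
  define \<gamma> where "\<gamma> t F = (if F \<in> facets - facets_at v then L F t * of_real (r F t) else L F t)" for t F
  have L0: "L F 0 = y F" for F by (simp add: L_def)
  have p0: "\<pi> 0 = p"
    unfolding \<pi>_def L0 using ny fa_facets[OF v(1)] pt_ell[OF v(1) P_sub_hull[OF pP]] by simp
  have deriv: "((\<lambda>t. ell F (\<pi> t)) has_real_derivative 2 * (y F \<bullet> e F)) (at 0)" if F: "F \<in> facets" for F
  proof -
    have "((\<lambda>t. ell F (\<pi> t)) has_real_derivative
        (0 + (\<Sum>i\<in>UNIV. (2 * (y (fa v i) \<bullet> e (fa v i))) * (\<alpha> F \<bullet> dual v (fa v i))))) (at 0)"
      unfolding \<pi>_def ell_pt L_def
      by (intro DERIV_add DERIV_const DERIV_sum DERIV_cmult_right norm_square_line)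
    also have "0 + (\<Sum>i\<in>UNIV. (2 * (y (fa v i) \<bullet> e (fa v i))) * (\<alpha> F \<bullet> dual v (fa v i))) =
        (\<Sum>i\<in>UNIV. (2 * (y (fa v i) \<bullet> e (fa v i))) * (\<alpha> F \<bullet> dual v (fa v i)))" by simp
    also have "(\<Sum>i\<in>UNIV. (2 * (y (fa v i) \<bullet> e (fa v i))) * (\<alpha> F \<bullet> dual v (fa v i))) =
        \<alpha> F \<bullet> (\<Sum>G\<in>facets_at v. (\<alpha> G \<bullet> \<xi>) *\<^sub>R dual v G)"
      unfolding sum_facets_at[OF v(1)] inner_sum_right using xi(2) fa_facets[OF v(1)] by simp
    also have "\<dots> = 2 * (y F \<bullet> e F)" using dirs_expand[OF v(1) xi(1)] xi(2)[OF F] by simp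
    finally show ?thesis .
  qed
  have cont: "((\<lambda>t. ell F (\<pi> t)) \<longlongrightarrow> ell F p) (nhds 0)" if "F \<in> facets" for F
  proof -
    have "((\<lambda>t. ell F (\<pi> t)) \<longlongrightarrow> ell F (\<pi> 0)) (nhds 0)"
      using DERIV_isCont[OF deriv[OF that]] unfolding isCont_def
      by (simp only: tendsto_at_iff_tendsto_nhds[of "\<lambda>t. ell F (\<pi> t)" 0])
    then show ?thesis by (simp only: p0)
  qed
  have pos: "ell F p > 0" if "F \<in> facets - facets_at p" for F
    using that ell_nonneg[OF _ pP, of F] mem_facet[OF _ pP, of F] by (force simp: facets_at_def)
  have ev_pos: "\<forall>\<^sub>F t in nhds 0. \<forall>F\<in>facets - facets_at p. ell F (\<pi> t) > 0"
  proof -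
    have "\<forall>F\<in>facets - facets_at p. \<forall>\<^sub>F t in nhds 0. ell F (\<pi> t) > 0"
      using order_tendstoD(1)[OF cont] pos by blast
    then show ?thesis using finite_facets by (subst eventually_ball_finite_distrib) auto
  qed
  have ev_L: "\<forall>\<^sub>F t in nhds 0. L F t \<noteq> 0" if "F \<in> facets - facets_at p" for F
    unfolding L_def by (rule line_nonzero) (use that zpt_zero[OF y] in auto)
  have ev_Lall: "\<forall>\<^sub>F t in nhds 0. \<forall>F\<in>facets - facets_at p. L F t \<noteq> 0"
    using finite_facets ev_L by (subst eventually_ball_finite_distrib) auto
  have ev_zpt: "\<forall>\<^sub>F t in nhds 0. zpt (\<pi> t) (\<gamma> t) \<and> facets_at (\<pi> t) \<subseteq> facets_at p"
    using ev_pos ev_Lall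
  proof eventually_elim
    case (elim t)
    have "0 < ell F (\<pi> t)" if "F \<in> facets - facets_at v" for F using elim that v(2) by blast
    then have inP: "\<pi> t \<in> P" unfolding \<pi>_def by (intro pt_in_P(1)[OF v(1)]) auto
    have "(norm (\<gamma> t F))\<^sup>2 = ell F (\<pi> t)" if F: "F \<in> facets" for F
    proof (cases "F \<in> facets_at v")
      case True
      then have "F = fa v (h F)" using fa_h[OF v(1)] by simp
      then show ?thesis using True ell_pt_fa[OF v(1), of "h F"] by (simp add: \<gamma>_def \<pi>_def)
    next
      case False
      then have "L F t \<noteq> 0" "ell F (\<pi> t) > 0" using elim F v(2) by auto
      then have "norm (L F t) * \<bar>r F t\<bar> = sqrt (ell F (\<pi> t))" by (simp add: r_def)
      then have "norm (L F t * of_real (r F t)) = sqrt (ell F (\<pi> t))" by (simp only: norm_mult norm_of_real)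
      then have "norm (\<gamma> t F) = sqrt (ell F (\<pi> t))" using False F by (simp only: \<gamma>_def) simp
      then show ?thesis using \<open>ell F (\<pi> t) > 0\<close> by simp
    qed
    moreover have "facets_at (\<pi> t) \<subseteq> facets_at p"
    proof
      fix F assume "F \<in> facets_at (\<pi> t)"
      then have "F \<in> facets" "ell F (\<pi> t) = 0" using mem_facet[OF _ inP] by (auto simp: facets_at_def)
      then show "F \<in> facets_at p" using elim by force
    qed
    ultimately show ?case using inP by (simp add: zpt_def)
  qed
  have r0: "r F 0 = 1" if "F \<in> facets - facets_at v" for F
  proof -
    have "y F \<noteq> 0" using zpt_zero[OF y] that v(2) by auto
    moreover have "sqrt (ell F p) = norm (y F)" using zpt_sqrt[OF y] that by simp
    ultimately show ?thesis by (simp add: r_def p0 L0)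
  qed
  have dgamma: "((\<lambda>t. \<gamma> t F) has_vector_derivative e F) (at 0)" if F: "F \<in> facets" for F
  proof (cases "F \<in> facets_at v")
    case True
    then show ?thesis using line_has_vector_derivative by (simp add: \<gamma>_def L_def)
  next
    case False
    then have Fp: "F \<in> facets - facets_at p" and Fv: "F \<in> facets - facets_at v" using F v(2) by auto
    have y0: "y F \<noteq> 0" using zpt_zero[OF y] Fp by auto
    have s: "sqrt (ell F p) = norm (y F)" by (rule zpt_sqrt[OF y F])
    have "((\<lambda>t. sqrt (ell F (\<pi> t))) has_real_derivative (inverse (sqrt (ell F (\<pi> 0))) / 2 * (2 * (y F \<bullet> e F)))) (at 0)"
      by (rule DERIV_chain2[OF DERIV_real_sqrt deriv[OF F]]) (use pos[OF Fp] p0 in simp)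
    then have d1: "((\<lambda>t. sqrt (ell F (\<pi> t))) has_real_derivative ((y F \<bullet> e F) / norm (y F))) (at 0)"
    proof -
      have "inverse a / 2 * (2 * b) = b / a" for a b :: real by (simp only: divide_inverse) simp
      then show ?thesis using \<open>(_ has_real_derivative _) _\<close> unfolding p0 s by (simp only:)
    qed
    have "(r F has_real_derivative
        (((y F \<bullet> e F) / norm (y F)) * norm (L F 0) - sqrt (ell F (\<pi> 0)) * ((y F \<bullet> e F) / norm (y F))) /
        (norm (L F 0) * norm (L F 0))) (at 0)"
      unfolding r_def[abs_def] L_def
      by (rule DERIV_divide[OF d1 norm_line[OF y0]]) (use y0 in simp)
    then have "(r F has_real_derivative 0) (at 0)" unfolding L0 p0 s by simp
    then have "((\<lambda>t. L F t * of_real (r F t)) has_vector_derivative (L F 0 * of_real 0 + e F * of_real (r F 0))) (at 0)"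
      by (intro has_vector_derivative_mult has_vector_derivative_of_real) (auto simp: L_def line_has_vector_derivative)
    then show ?thesis using Fv r0[OF Fv] by (simp add: \<gamma>_def)
  qed
  have phg: "\<forall>\<^sub>F t in nhds 0. ph (\<gamma> t F) = ph (y F + t *\<^sub>R e F)" if F: "F \<in> facets - facets_at p" for F
    using ev_pos ev_L[OF F]
  proof eventually_elim
    case (elim t)
    show ?case
    proof (cases "F \<in> facets_at v")
      case False
      have "r F t > 0" using elim F by (simp add: r_def)
      then show ?thesis using False F by (simp add: \<gamma>_def ph_scale L_def)
    qed (use F in \<open>simp add: \<gamma>_def L_def\<close>)
  qed
  have "\<gamma> 0 = y"
  proof
    show "\<gamma> 0 F = y F" for F using r0[of F] by (simp add: \<gamma>_def L0)
  qed
  then show ?thesis using p0 ev_zpt dgamma phg by blast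
qed

lemma Zc_derivative:
  fixes y e :: "'a set \<Rightarrow> 'k::{real_normed_field,euclidean_space}"
  assumes v: "v extreme_point_of P" and y: "zpt p y" and p: "facets_at p \<subseteq> facets_at v"
    and g0: "\<gamma> 0 = y" and g: "\<And>F. F \<in> facets \<Longrightarrow> ((\<lambda>t. \<gamma> t F) has_vector_derivative e F) (at 0)"
    and ph: "\<And>F. F \<in> facets - facets_at p \<Longrightarrow> \<forall>\<^sub>F t in nhds 0. ph (\<gamma> t F) = ph (y F + t *\<^sub>R e F)"
  shows "((\<lambda>t. Zc v (\<gamma> t)) has_vector_derivative Zd v y e) (at 0)"
proof -
  have "((\<lambda>t. \<gamma> t (fa v i) * phase v (\<gamma> t) i) has_vector_derivative
      (Zd v y e $ i)) (at 0)" for i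
  proof -
    let ?S = "facets - facets_at v"
    let ?c = "\<lambda>F. of_int (mm v i F) * (e F / y F - of_real ((y F \<bullet> e F) / (norm (y F))\<^sup>2)) :: 'k"
    have "((\<lambda>t. ph (\<gamma> t F) powi mm v i F) has_vector_derivative (ph (\<gamma> 0 F) powi mm v i F * ?c F)) (at 0)"
      if F: "F \<in> ?S" for F
    proof -
      have Fp: "F \<in> facets - facets_at p" using F p by auto
      have y0: "y F \<noteq> 0" using zpt_zero[OF y] Fp by auto
      show ?thesis
        unfolding g0
      proof (rule has_vector_derivative_cong_ev[THEN iffD2, OF _ _ ph_power_line[OF y0]])
        show "\<forall>\<^sub>F t in nhds 0. t \<in> UNIV \<longrightarrow> ph (\<gamma> t F) powi mm v i F = ph (y F + t *\<^sub>R e F) powi mm v i F"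
          by (rule eventually_mono[OF ph[OF Fp]]) simp
      qed (simp add: g0)
    qed
    then have "((\<lambda>t. phase v (\<gamma> t) i) has_vector_derivative (phase v (\<gamma> 0) i * (\<Sum>F\<in>?S. ?c F))) (at 0)"
      unfolding phase_def using finite_facets by (intro prod_has_vector_derivative) auto
    then have "((\<lambda>t. \<gamma> t (fa v i) * phase v (\<gamma> t) i) has_vector_derivative
        (\<gamma> 0 (fa v i) * (phase v (\<gamma> 0) i * (\<Sum>F\<in>?S. ?c F)) + e (fa v i) * phase v (\<gamma> 0) i)) (at 0)"
      by (intro has_vector_derivative_mult g fa_facets[OF v])
    moreover have "\<gamma> 0 (fa v i) * (phase v (\<gamma> 0) i * (\<Sum>F\<in>?S. ?c F)) + e (fa v i) * phase v (\<gamma> 0) i = Zd v y e $ i"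
      by (simp add: g0 Zd_def algebra_simps)
    ultimately show ?thesis by simp
  qed
  then have "((\<lambda>t. \<chi> i. \<gamma> t (fa v i) * phase v (\<gamma> t) i) has_vector_derivative (\<chi> i. Zd v y e $ i)) (at 0)"
    by (rule vec_has_vector_derivative)
  then show ?thesis by (simp add: Zc_def)
qed

end

section \<open>Totally skew embeddings\<close>

locale skew_embedding = colored_poly P h H
  for P :: "'a::euclidean_space set" and h :: "'a set \<Rightarrow> 'n::{finite,linorder}" and H :: "'n \<Rightarrow> 'a set" +
  fixes N :: nat and f :: "(('k::{real_normed_field,euclidean_space}, 'n) vec \<times> 'a) set \<Rightarrow> nat \<Rightarrow> real"
  assumes skew: "totally_skew_embedding (torus_quotient P (char_vector h H))
    (standard_atlas P h (char_vector h H) :: ((('k, 'n) vec \<times> 'a) set, ('k, 'n) vec) chart set) N f"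
begin

abbreviation ch :: "'a \<Rightarrow> ((('k, 'n) vec \<times> 'a) set, ('k, 'n) vec) chart" where "ch \<equiv> chart"

definition img :: "'a \<Rightarrow> ('k, 'n) vec set" where
  "img v = snd (ch v) ` fst (ch v)"

lemma open_img: "v extreme_point_of P \<Longrightarrow> open (img v)"
  unfolding img_def by (rule chart_open)

definition dG :: "'a \<Rightarrow> ('k, 'n) vec \<Rightarrow> ('k, 'n) vec \<Rightarrow> nat \<Rightarrow> real" where
  "dG v z u i = frechet_derivative (chart_expr (ch v) f i) (at z) u"

lemma chart_deriv_dG: "chart_deriv (ch v) f x = dG v (snd (ch v) x)"
  by (intro ext) (simp add: chart_deriv_def dG_def)

lemma ch_atlas: "v extreme_point_of P \<Longrightarrow> ch v \<in> standard_atlas P h \<Lambda>"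
  by (simp add: standard_atlas)

lemma ch_topspace: "x \<in> fst (ch v) \<Longrightarrow> x \<in> topspace (torus_quotient P \<Lambda>)"
  unfolding mem_chart topspace_quotient by blast

lemma f_outside:
  assumes "x \<in> topspace (torus_quotient P \<Lambda>)" "i \<ge> N"
  shows "f x i = 0"
proof -
  have "embedding_map (torus_quotient P \<Lambda>) (Euclidean_space N) f"
    using skew by (simp add: totally_skew_embedding_def smooth_embedding_def)
  then have "f ` topspace (torus_quotient P \<Lambda>) = topspace (subtopology (Euclidean_space N) (f ` topspace (torus_quotient P \<Lambda>)))"
    unfolding embedding_map_def by (rule homeomorphic_imp_surjective_map)
  then have "f x \<in> topspace (Euclidean_space N)" using assms(1) by auto
  then show ?thesis using assms(2) by (simp add: topspace_Euclidean_space)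
qed

lemma chart_expr_chart:
  assumes v: "v extreme_point_of P" and x: "x \<in> fst (ch v)"
  shows "chart_expr (ch v) f i (snd (ch v) x) = f x i"
  using inv_into_f_f[OF chart_inj[OF v] x] by (simp add: chart_expr_def)

lemma chart_expr_outside:
  assumes v: "v extreme_point_of P" and z: "z \<in> img v" and i: "i \<ge> N"
  shows "(chart_expr (ch v) f i has_derivative (\<lambda>_. 0)) (at z)"
proof -
  have "chart_expr (ch v) f i w = 0" if "w \<in> img v" for w
    using that chart_expr_chart[OF v] f_outside[OF ch_topspace i] by (auto simp: img_def)
  then show ?thesis
    using has_derivative_transform_within_open[OF has_derivative_const open_img[OF v] z] by metis
qed

lemma chart_expr_differentiable:
  assumes v: "v extreme_point_of P" and z: "z \<in> img v"
  shows "chart_expr (ch v) f i differentiable (at z)"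
proof (cases "i < N")
  case True
  then have "smooth_on (chart_expr (ch v) f i) (img v)"
    using skew ch_atlas[OF v] by (simp add: totally_skew_embedding_def smooth_embedding_def img_def)
  then have "Ck_on (Suc 0) (chart_expr (ch v) f i) (img v)" unfolding smooth_on_def by blast
  then show ?thesis using z by simp
next
  case False
  then show ?thesis using chart_expr_outside[OF v z, of i] by (auto simp: differentiable_def)
qed

lemma dG_derivative:
  assumes "v extreme_point_of P" "z \<in> img v"
  shows "(chart_expr (ch v) f i has_derivative (\<lambda>u. dG v z u i)) (at z)"
  using chart_expr_differentiable[OF assms] unfolding dG_def frechet_derivative_works by simp

lemma dG_outside:
  assumes "v extreme_point_of P" "z \<in> img v" "i \<ge> N"
  shows "dG v z u i = 0"
  using has_derivative_unique[OF dG_derivative[OF assms(1,2)] chart_expr_outside[OF assms]] by metis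

lemma dG_linear:
  assumes "v extreme_point_of P" "z \<in> img v"
  shows "linear (\<lambda>u. dG v z u i)"
  using has_derivative_linear[OF dG_derivative[OF assms]] .

lemma dG_continuous:
  assumes v: "v extreme_point_of P" and i: "i < N"
  shows "continuous_on (img v) (\<lambda>z. dG v z u i)"
proof -
  have "smooth_on (chart_expr (ch v) f i) (img v)"
    using skew ch_atlas[OF v] i by (simp add: totally_skew_embedding_def smooth_embedding_def img_def)
  then have "Ck_on (Suc 0) (chart_expr (ch v) f i) (img v)" unfolding smooth_on_def by blast
  then show ?thesis unfolding dG_def by simp
qed

lemma dG_tendsto:
  assumes v: "v extreme_point_of P" and i: "i < N" and z: "z \<in> img v"
    and zm: "zm \<longlonglongrightarrow> z" and um: "um \<longlonglongrightarrow> u"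
  shows "(\<lambda>m. dG v (zm m) (um m) i) \<longlonglongrightarrow> dG v z u i"
proof -
  have op: "open (img v)" by (rule open_img[OF v])
  have ev: "\<forall>\<^sub>F m in sequentially. zm m \<in> img v"
    by (rule topological_tendstoD[OF zm op z])
  have exp: "dG v w a i = (\<Sum>b\<in>Basis. (a \<bullet> b) * dG v w b i)" if "w \<in> img v" for w a
  proof -
    note lin = dG_linear[OF v that, of i]
    have "dG v w (\<Sum>b\<in>Basis. (a \<bullet> b) *\<^sub>R b) i = (\<Sum>b\<in>Basis. dG v w ((a \<bullet> b) *\<^sub>R b) i)"
      by (rule linear_sum[OF lin])
    also have "\<dots> = (\<Sum>b\<in>Basis. (a \<bullet> b) * dG v w b i)"
      using linear_scale[OF lin] by simp
    finally show ?thesis by (simp only: euclidean_representation)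
  qed
  have "(\<lambda>m. dG v (zm m) b i) \<longlonglongrightarrow> dG v z b i" for b
  proof -
    have "isCont (\<lambda>z. dG v z b i) z" using dG_continuous[OF v i, of b] op z by (simp add: continuous_on_eq_continuous_at)
    then show ?thesis using isCont_tendsto_compose[OF _ zm] by blast
  qed
  then have "(\<lambda>m. \<Sum>b\<in>Basis. (um m \<bullet> b) * dG v (zm m) b i) \<longlonglongrightarrow> (\<Sum>b\<in>Basis. (u \<bullet> b) * dG v z b i)"
    by (intro tendsto_intros um)
  moreover have "\<forall>\<^sub>F m in sequentially. (\<Sum>b\<in>Basis. (um m \<bullet> b) * dG v (zm m) b i) = dG v (zm m) (um m) i"
    by (rule eventually_mono[OF ev]) (rule exp[symmetric])
  ultimately have "(\<lambda>m. dG v (zm m) (um m) i) \<longlonglongrightarrow> (\<Sum>b\<in>Basis. (u \<bullet> b) * dG v z b i)"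
    by (rule Lim_transform_eventually)
  then show ?thesis by (simp only: exp[OF z, symmetric])
qed

text \<open>Both sides are the derivative of \<open>f\<close> along the same curve in the manifold.
  Tangency is needed to have this curve.\<close>

lemma chart_independent:
  assumes y: "zpt p y" "tangent y e" and v: "v extreme_point_of P" "facets_at p \<subseteq> facets_at v"
    and w: "w extreme_point_of P" "facets_at p \<subseteq> facets_at w"
  shows "dG v (Zc v y) (Zd v y e) i = dG w (Zc w y) (Zd w y e) i"
proof -
  obtain \<gamma> \<pi> where g: "\<gamma> 0 = y" "\<pi> 0 = p" "\<forall>\<^sub>F t in nhds 0. zpt (\<pi> t) (\<gamma> t) \<and> facets_at (\<pi> t) \<subseteq> facets_at p"
    "\<And>F. F \<in> facets \<Longrightarrow> ((\<lambda>t. \<gamma> t F) has_vector_derivative e F) (at 0)"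
    "\<And>F. F \<in> facets - facets_at p \<Longrightarrow> \<forall>\<^sub>F t in nhds 0. ph (\<gamma> t F) = ph (y F + t *\<^sub>R e F)"
    using curve_exists[OF y] by blast
  have "((\<lambda>t. f (cls (tor (\<gamma> t)) (\<pi> t)) i) has_vector_derivative dG v (Zc v y) (Zd v y e) i) (at 0)"
    if v: "v extreme_point_of P" "facets_at p \<subseteq> facets_at v" for v
  proof -
    have z: "Zc v y \<in> img v" using chart_zpt[OF v(1) y(1) v(2)] unfolding img_def by (metis image_eqI)
    have "(chart_expr (ch v) f i has_derivative (\<lambda>u. dG v (Zc v (\<gamma> 0)) u i)) (at (Zc v (\<gamma> 0)))"
      unfolding g(1) by (rule dG_derivative[OF v(1) z])
    moreover have "((\<lambda>t. Zc v (\<gamma> t)) has_derivative (\<lambda>t. t *\<^sub>R Zd v y e)) (at 0)"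
      using Zc_derivative[OF v(1) y(1) v(2) g(1,4,5)] by (simp add: has_vector_derivative_def)
    ultimately have "((\<lambda>t. chart_expr (ch v) f i (Zc v (\<gamma> t))) has_derivative
        (\<lambda>t. dG v (Zc v (\<gamma> 0)) (t *\<^sub>R Zd v y e) i)) (at 0)"
      using has_derivative_compose by fast
    then have 1: "((\<lambda>t. chart_expr (ch v) f i (Zc v (\<gamma> t))) has_vector_derivative dG v (Zc v y) (Zd v y e) i) (at 0)"
      using linear_scale[OF dG_linear[OF v(1) z]] by (simp add: has_vector_derivative_def g(1))
    have eq: "chart_expr (ch v) f i (Zc v (\<gamma> t)) = f (cls (tor (\<gamma> t)) (\<pi> t)) i"
      if "zpt (\<pi> t) (\<gamma> t) \<and> facets_at (\<pi> t) \<subseteq> facets_at p" for t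
    proof -
      have "facets_at (\<pi> t) \<subseteq> facets_at v" "zpt (\<pi> t) (\<gamma> t)" using that v(2) by auto
      then show ?thesis using chart_zpt[OF v(1), of "\<pi> t" "\<gamma> t"] chart_expr_chart[OF v(1), of "cls (tor (\<gamma> t)) (\<pi> t)" i]
        by simp
    qed
    show ?thesis
    proof (rule has_vector_derivative_cong_ev[THEN iffD1, OF _ _ 1])
      show "\<forall>\<^sub>F t in nhds 0. t \<in> UNIV \<longrightarrow> chart_expr (ch v) f i (Zc v (\<gamma> t)) = f (cls (tor (\<gamma> t)) (\<pi> t)) i"
        by (rule eventually_mono[OF g(3)]) (use eq in auto)
      show "chart_expr (ch v) f i (Zc v (\<gamma> 0)) = f (cls (tor (\<gamma> 0)) (\<pi> 0)) i"
        by (rule eq) (use g(1,2) y(1) in auto)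
    qed
  qed
  from vector_derivative_unique_at[OF this[OF v] this[OF w]] show ?thesis .
qed

text \<open>A relation with \<open>r \<noteq> 0\<close> gives a common point of two tangent lines,
  and one with \<open>r = 0\<close> gives parallel tangent lines.\<close>

lemma skew_zero:
  assumes v: "v extreme_point_of P" "x \<in> fst (ch v)" and w: "w extreme_point_of P" "x' \<in> fst (ch w)"
    and ne: "x \<noteq> x'"
    and eq: "\<And>i. i < N \<Longrightarrow> dG v (snd (ch v) x) a i + dG w (snd (ch w) x') a' i + r * (f x i - f x' i) = 0"
  shows "a = 0 \<and> a' = 0 \<and> r = 0"
proof -
  let ?z = "snd (ch v) x" and ?z' = "snd (ch w) x'"
  have z: "?z \<in> img v" "?z' \<in> img w" using v w by (auto simp: img_def)
  have top: "x \<in> topspace (torus_quotient P \<Lambda>)" "x' \<in> topspace (torus_quotient P \<Lambda>)"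
    using v w ch_topspace by auto
  have eq': "dG v ?z a i + dG w ?z' a' i + r * (f x i - f x' i) = 0" for i
    using eq[of i] dG_outside[OF v(1) z(1), of i a] dG_outside[OF w(1) z(2), of i a'] f_outside[OF top(1), of i]
      f_outside[OF top(2), of i] by (cases "i < N") auto
  have sk: "skew_lines (f x) (dG v ?z b) (f x') (dG w ?z' b')"
    if "dG v ?z b \<noteq> (\<lambda>i. 0)" "dG w ?z' b' \<noteq> (\<lambda>i. 0)" for b b'
  proof -
    have "dG v ?z b \<in> tangent_space (standard_atlas P h \<Lambda>) f x" "dG w ?z' b' \<in> tangent_space (standard_atlas P h \<Lambda>) f x'"
      unfolding tangent_space_def using ch_atlas[OF v(1)] ch_atlas[OF w(1)] v(2) w(2)
      by (auto simp del: split_paired_Ex simp flip: chart_deriv_dG intro!: UN_I)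
    then show ?thesis using skew top ne that unfolding totally_skew_embedding_def by blast
  qed
  have inj: "b = 0" if "dG v ?z b = (\<lambda>i. 0)" for b
  proof -
    have "inj (dG v ?z)"
      using skew ch_atlas[OF v(1)] v(2) unfolding totally_skew_embedding_def smooth_embedding_def
      by (metis chart_deriv_dG)
    moreover have "dG v ?z 0 = (\<lambda>i. 0)" using linear_0[OF dG_linear[OF v(1) z(1)]] by auto
    ultimately show ?thesis using that by (metis injD)
  qed
  have inj': "b = 0" if "dG w ?z' b = (\<lambda>i. 0)" for b
  proof -
    have "inj (dG w ?z')"
      using skew ch_atlas[OF w(1)] w(2) unfolding totally_skew_embedding_def smooth_embedding_def
      by (metis chart_deriv_dG)
    moreover have "dG w ?z' 0 = (\<lambda>i. 0)" using linear_0[OF dG_linear[OF w(1) z(2)]] by auto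
    ultimately show ?thesis using that by (metis injD)
  qed
  have r0: "r = 0"
  proof (rule ccontr)
    assume r: "r \<noteq> 0"
    define one :: "('k, 'n) vec" where "one = 1"
    have one: "one \<noteq> 0" by (simp add: one_def)
    \<comment> \<open>Skewness is available for nonzero directions only. If \<open>a\<close> is
      zero, the common point is \<open>f x\<close> itself, which lies on a tangent line in any
      direction.\<close>
    define b where "b = (if a = 0 then one else a)"
    define b' where "b' = (if a' = 0 then one else a')"
    have nb: "dG v ?z b \<noteq> (\<lambda>i. 0)" "dG w ?z' b' \<noteq> (\<lambda>i. 0)"
      using inj inj' one by (auto simp: b_def b'_def)
    have a0: "a = 0 \<Longrightarrow> dG v ?z a i = 0" "a' = 0 \<Longrightarrow> dG w ?z' a' i = 0" for i
      using linear_0[OF dG_linear[OF v(1) z(1)]] linear_0[OF dG_linear[OF w(1) z(2)]] by auto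
    let ?q = "\<lambda>i. f x i + (if a = 0 then 0 else 1 / r) * dG v ?z b i"
    have "?q \<in> affine_line (f x) (dG v ?z b)" unfolding affine_line_def by blast
    moreover have "?q = (\<lambda>i. f x' i + (if a' = 0 then 0 else - 1 / r) * dG w ?z' b' i)"
    proof
      fix i
      have "r * (f x i - f x' i) = - (dG v ?z a i + dG w ?z' a' i)" using eq'[of i] by linarith
      then have "f x i - f x' i = - (dG v ?z a i + dG w ?z' a' i) / r" using r by (simp add: field_simps)
      moreover have "(if a = 0 then 0 else 1 / r) * dG v ?z b i = dG v ?z a i / r"
        using a0(1)[of i] by (simp add: b_def)
      moreover have "(if a' = 0 then 0 else - 1 / r) * dG w ?z' b' i = - dG w ?z' a' i / r"
        using a0(2)[of i] by (simp add: b'_def)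
      ultimately show "?q i = f x' i + (if a' = 0 then 0 else - 1 / r) * dG w ?z' b' i"
        by (simp add: field_simps diff_divide_distrib add_divide_distrib)
    qed
    then have "?q \<in> affine_line (f x') (dG w ?z' b')" unfolding affine_line_def by blast
    ultimately show False using sk[OF nb] unfolding skew_lines_def by blast
  qed
  have neg: "dG w ?z' a' i = - 1 * dG v ?z a i" for i using eq'[of i] r0 by simp
  have "a = 0"
  proof (rule ccontr)
    assume "a \<noteq> 0"
    then have na: "dG v ?z a \<noteq> (\<lambda>i. 0)" using inj by blast
    then have "dG w ?z' a' \<noteq> (\<lambda>i. 0)" using neg by (auto simp: fun_eq_iff)
    from sk[OF na this] show False unfolding skew_lines_def using neg by blast
  qed
  moreover have "a' = 0" using neg linear_0[OF dG_linear[OF v(1) z(1)]] calculation by (intro inj') auto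
  ultimately show ?thesis using r0 by blast
qed

end

lemma inner_mult_right_field:
  fixes y b e \<theta> :: "'k::{real_normed_field,euclidean_space}"
  assumes "e = \<theta> * y"
  shows "(b * y) \<bullet> e = (norm y)\<^sup>2 * (b \<bullet> \<theta>)"
proof -
  have "(b * y) \<bullet> e = (y * b) \<bullet> (y * \<theta>)" unfolding assms by (metis mult.commute)
  then show ?thesis using inner_mult_left_field[of y b \<theta>] by metis
qed

context colored_poly
begin

text \<open>
  The common zeros of the functions \<open>nu\<close> are, at each point of the moment-angle space, the tangent
  vectors that are orthogonal to the orbit of the kernel of \<open>\<Lambda>\<close>.
\<close>

definition nu :: "'a \<Rightarrow> 'a set \<Rightarrow> 'k \<Rightarrow> ('a set \<Rightarrow> 'k::{real_normed_field,euclidean_space}) \<Rightarrow> ('a set \<Rightarrow> 'k) \<Rightarrow> real" where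
  "nu V F b y e = (b * y F) \<bullet> e F - (\<Sum>i\<in>UNIV.
     (if b = 1 then \<alpha> F \<bullet> dual V (fa V i) else of_int (mm V i F)) * ((b * y (fa V i)) \<bullet> e (fa V i)))"

lemma nu_tangent:
  assumes V: "V extreme_point_of P" and nu: "\<And>F. F \<in> facets - facets_at V \<Longrightarrow> nu V F 1 y e = 0"
  shows "tangent y e"
proof -
  define \<xi> where "\<xi> = (\<Sum>i\<in>UNIV. (2 * (y (fa V i) \<bullet> e (fa V i))) *\<^sub>R dual V (fa V i))"
  have "\<xi> \<in> dirs" unfolding \<xi>_def
    using subspace_dirs dual_dirs[OF V fa_mem[OF V]] by (intro subspace_sum subspace_scale) auto
  moreover have "\<alpha> F \<bullet> \<xi> = 2 * (y F \<bullet> e F)" if F: "F \<in> facets" for F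
  proof -
    have x: "\<alpha> F \<bullet> \<xi> = (\<Sum>i\<in>UNIV. 2 * (y (fa V i) \<bullet> e (fa V i)) * (\<alpha> F \<bullet> dual V (fa V i)))"
      by (simp add: \<xi>_def inner_sum_right)
    show ?thesis
    proof (cases "F \<in> facets_at V")
      case True
      have "\<alpha> F \<bullet> dual V (fa V i) = of_bool (i = h F)" for i
        using dual_eq[OF V fa_mem[OF V] True, of i] fa_h[OF V True] fa_inj[OF V, of "h F" i] by auto
      then have "\<alpha> F \<bullet> \<xi> = (\<Sum>i\<in>UNIV. if i = h F then 2 * (y (fa V i) \<bullet> e (fa V i)) else 0)"
        unfolding x by (intro sum.cong) auto
      then show ?thesis using fa_h[OF V True] by (simp add: sum.delta)
    next
      case False
      then have "y F \<bullet> e F = (\<Sum>i\<in>UNIV. (\<alpha> F \<bullet> dual V (fa V i)) * (y (fa V i) \<bullet> e (fa V i)))"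
        using nu[of F] F by (simp add: nu_def)
      then show ?thesis unfolding x by (simp add: sum_distrib_left mult_ac)
    qed
  qed
  ultimately show ?thesis unfolding tangent_def by blast
qed

lemma zpt_nonzero:
  assumes "zpt p y" "facets_at p \<subseteq> facets_at v" "F \<in> facets - facets_at v"
  shows "y F \<noteq> 0"
proof -
  have "F \<in> facets" "F \<notin> facets_at p" using assms(2,3) by auto
  then show ?thesis using zpt_zero[OF assms(1)] by simp
qed

lemma sum_facets_split:
  assumes v: "v extreme_point_of P"
  shows "(\<Sum>F\<in>facets. g F) = (\<Sum>F\<in>facets - facets_at v. g F) + (\<Sum>i\<in>UNIV. g (fa v i))"
proof -
  have "facets_at v \<subseteq> facets" by (auto simp: facets_at_def)
  then show ?thesis using sum.subset_diff[OF _ finite_facets] sum_facets_at[OF v, of g] by metis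
qed

text \<open>A vector that vanishes in the chart moves no point of \<open>P\<close>, so its radial
  parts are zero and it is an infinitesimal rotation in the kernel of \<Lambda>. This makes it
  tangent to the orbit, while the \<open>nu\<close> make it orthogonal to the orbit.\<close>

lemma nu_kernel:
  fixes y e :: "'a set \<Rightarrow> 'k::{real_normed_field,euclidean_space}"
  assumes one: "(1::'k) \<in> Basis" and V: "V extreme_point_of P"
    and nu: "\<And>F b. F \<in> facets - facets_at V \<Longrightarrow> b \<in> Basis \<Longrightarrow> nu V F b y e = 0"
    and v: "v extreme_point_of P" and y: "zpt p y" and p: "facets_at p \<subseteq> facets_at v"
    and zero: "Zd v y e = 0" and F: "F \<in> facets"
  shows "e F = 0"
proof -
  have y0: "y F \<noteq> 0" if "F \<in> facets - facets_at v" for F by (rule zpt_nonzero[OF y p that])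
  have one1: "(1::'k) \<bullet> 1 = 1" by (rule inner_same_Basis[OF one])
  have e1: "y F \<bullet> e F = (norm (y F))\<^sup>2 * (1 \<bullet> \<theta>)" if "e F = \<theta> * y F" for F \<theta>
  proof -
    have "(1 * y F) \<bullet> e F = (norm (y F))\<^sup>2 * (1 \<bullet> \<theta>)" by (rule inner_mult_right_field[OF that])
    then show ?thesis by (metis mult_1_left)
  qed
  define \<theta>' where "\<theta>' F = e F / y F - of_real ((y F \<bullet> e F) / (norm (y F))\<^sup>2)" for F
  define \<Theta> where "\<Theta> i = (\<Sum>F\<in>facets - facets_at v. of_int (mm v i F) * \<theta>' F)" for i
  have t1: "1 \<bullet> \<theta>' F = 0" if "F \<in> facets - facets_at v" for F
  proof -
    have "y F \<bullet> e F = (norm (y F))\<^sup>2 * (1 \<bullet> (e F / y F))" by (rule e1) (use y0[OF that] in simp)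
    moreover have "1 \<bullet> (of_real r :: 'k) = r" for r :: real
      using one1 by (simp add: of_real_def)
    ultimately show ?thesis using y0[OF that] by (simp add: \<theta>'_def inner_diff_right del: of_real_divide)
  qed
  have "phase v y i \<noteq> 0" for i using norm_phase by (metis norm_zero zero_neq_one)
  then have efa: "e (fa v i) = (- \<Theta> i) * y (fa v i)" for i
    using zero by (auto simp: Zd_def \<Theta>_def \<theta>'_def vec_eq_iff add_eq_0_iff mult.commute)
  have T1: "1 \<bullet> \<Theta> i = 0" for i
  proof -
    have "1 \<bullet> (of_int m * \<theta>' F) = of_int m * (1 \<bullet> \<theta>' F)" for m :: int and F
      using inner_scaleR_right[of 1 "of_int m" "\<theta>' F"] by (simp add: scaleR_conv_of_real)
    then show ?thesis unfolding \<Theta>_def inner_sum_right using t1 by simp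
  qed
  obtain \<xi> where xi: "\<xi> \<in> dirs" "\<And>F. F \<in> facets \<Longrightarrow> \<alpha> F \<bullet> \<xi> = 2 * (y F \<bullet> e F)"
    using nu_tangent[OF V, of y e] nu one unfolding tangent_def by blast
  have "\<xi> = 0"
  proof (rule normals_separate[OF v xi(1)])
    fix G assume G: "G \<in> facets_at v"
    then have "y G \<bullet> e G = 0" using e1[OF efa[of "h G"]] T1[of "h G"] fa_h[OF v G] by simp
    then show "\<alpha> G \<bullet> \<xi> = 0" using xi(2)[of G] G by (auto simp: facets_at_def)
  qed
  then have radial: "y F \<bullet> e F = 0" if "F \<in> facets" for F using xi(2)[OF that] by simp
  define \<theta> where "\<theta> F = (if F \<in> facets_at v then - \<Theta> (h F) else \<theta>' F)" for F
  have eth: "e F = \<theta> F * y F" if "F \<in> facets" for F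
  proof (cases "F \<in> facets_at v")
    case True
    then show ?thesis using efa[of "h F"] fa_h[OF v True] by (simp add: \<theta>_def)
  next
    case False
    then show ?thesis using y0[of F] that radial[OF that] by (simp add: \<theta>_def \<theta>'_def)
  qed
  have kerL: "(\<Sum>F\<in>facets. of_int (\<Lambda> F $ j) * \<theta> F) = 0" for j
  proof -
    have "(\<Sum>F\<in>facets - facets_at v. of_int (\<Lambda> F $ j) * \<theta> F) =
        (\<Sum>F\<in>facets - facets_at v. \<Sum>i\<in>UNIV. of_int (\<Lambda> (fa v i) $ j) * (of_int (mm v i F) * \<theta>' F))"
    proof (rule sum.cong[OF refl])
      fix F assume F: "F \<in> facets - facets_at v"
      have "(of_int (\<Lambda> F $ j) :: 'k) = (\<Sum>i\<in>UNIV. of_int (mm v i F) * of_int (\<Lambda> (fa v i) $ j))"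
        by (subst Lambda_mm[OF v]) simp
      moreover have "\<theta> F = \<theta>' F" using F by (simp add: \<theta>_def)
      ultimately show "of_int (\<Lambda> F $ j) * \<theta> F =
          (\<Sum>i\<in>UNIV. of_int (\<Lambda> (fa v i) $ j) * (of_int (mm v i F) * \<theta>' F))"
        by (simp only: sum_distrib_right) (simp add: mult_ac)
    qed
    also have "\<dots> = (\<Sum>i\<in>UNIV. of_int (\<Lambda> (fa v i) $ j) * \<Theta> i)"
      unfolding \<Theta>_def sum_distrib_left by (rule sum.swap)
    finally show ?thesis
      unfolding sum_facets_split[OF v] using fa_mem[OF v] h_fa[OF v] by (simp add: \<theta>_def sum_negf)
  qed
  have kerV: "(\<Sum>F\<in>facets. of_int (mm V i F) * \<theta> F) = 0" for i
  proof -
    have "(\<Sum>F\<in>facets. of_int (mm V i F) * \<theta> F) =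
        (\<Sum>F\<in>facets. \<Sum>j\<in>UNIV. of_int (W V $ i $ j) * (of_int (\<Lambda> F $ j) * \<theta> F))"
      by (simp add: mm_def sum_distrib_right mult.assoc)
    also have "\<dots> = (\<Sum>j\<in>UNIV. of_int (W V $ i $ j) * (\<Sum>F\<in>facets. of_int (\<Lambda> F $ j) * \<theta> F))"
      by (subst sum.swap) (simp add: sum_distrib_left)
    finally show ?thesis by (simp add: kerL)
  qed
  \<comment> \<open>The \<open>b\<close>-components of the rotation form a vector in the kernel of
    \<Lambda>, and the \<open>nu\<close> say that it is orthogonal to this kernel for the weights
    \<open>(norm (y F))\<^sup>2\<close>. So its weighted sum of squares is zero.\<close>
  have rot: "(norm (y F))\<^sup>2 * (b \<bullet> \<theta> F)\<^sup>2 = 0" if b: "b \<in> Basis" "b \<noteq> 1" and F: "F \<in> facets" for b F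
  proof -
    define s where "s F = b \<bullet> \<theta> F" for F
    have inner: "(b * y F) \<bullet> e F = (norm (y F))\<^sup>2 * s F" if "F \<in> facets" for F
      unfolding s_def by (rule inner_mult_right_field[OF eth[OF that]])
    have bint: "b \<bullet> (of_int m * x) = of_int m * (b \<bullet> x)" for m :: int and x
      using inner_scaleR_right[of b "of_int m" x] by (simp add: scaleR_conv_of_real)
    have sV: "(\<Sum>F\<in>facets - facets_at V. of_int (mm V i F) * s F) = - s (fa V i)" for i
    proof -
      have "0 = b \<bullet> (\<Sum>F\<in>facets. of_int (mm V i F) * \<theta> F)" by (simp add: kerV)
      also have "\<dots> = (\<Sum>F\<in>facets. of_int (mm V i F) * s F)" by (simp add: inner_sum_right bint s_def)
      also have "\<dots> = (\<Sum>F\<in>facets - facets_at V. of_int (mm V i F) * s F) +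
          (\<Sum>k\<in>UNIV. of_int (mm V i (fa V k)) * s (fa V k))" by (rule sum_facets_split[OF V])
      also have "(\<Sum>k\<in>UNIV. of_int (mm V i (fa V k)) * s (fa V k)) = (\<Sum>k\<in>UNIV. if i = k then s (fa V k) else 0)"
        by (intro sum.cong) (auto simp: mm_fa[OF V])
      finally show ?thesis by (simp add: sum.delta')
    qed
    have "(\<Sum>F\<in>facets - facets_at V. (norm (y F))\<^sup>2 * s F * s F) =
        (\<Sum>F\<in>facets - facets_at V. (\<Sum>i\<in>UNIV. of_int (mm V i F) * ((norm (y (fa V i)))\<^sup>2 * s (fa V i))) * s F)"
    proof (rule sum.cong[OF refl])
      fix F assume F: "F \<in> facets - facets_at V"
      have "(b * y F) \<bullet> e F = (\<Sum>i\<in>UNIV. of_int (mm V i F) * ((b * y (fa V i)) \<bullet> e (fa V i)))"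
        using nu[OF F b(1)] b(2) by (simp add: nu_def)
      then show "(norm (y F))\<^sup>2 * s F * s F =
          (\<Sum>i\<in>UNIV. of_int (mm V i F) * ((norm (y (fa V i)))\<^sup>2 * s (fa V i))) * s F"
        using inner[of F] inner[OF fa_facets[OF V]] F by simp
    qed
    also have "\<dots> = (\<Sum>i\<in>UNIV. ((norm (y (fa V i)))\<^sup>2 * s (fa V i)) *
        (\<Sum>F\<in>facets - facets_at V. of_int (mm V i F) * s F))"
      unfolding sum_distrib_right sum_distrib_left by (subst sum.swap) (simp add: mult_ac)
    also have "\<dots> = - (\<Sum>i\<in>UNIV. (norm (y (fa V i)))\<^sup>2 * s (fa V i) * s (fa V i))"
      unfolding sV by (simp add: sum_negf)
    finally have "(\<Sum>F\<in>facets. (norm (y F))\<^sup>2 * s F * s F) = 0"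
      unfolding sum_facets_split[OF V] by simp
    then have "(\<Sum>F\<in>facets. (norm (y F))\<^sup>2 * (s F)\<^sup>2) = 0" by (simp add: power2_eq_square mult.assoc)
    then have "\<forall>F\<in>facets. (norm (y F))\<^sup>2 * (s F)\<^sup>2 = 0"
      by (subst (asm) sum_nonneg_eq_0_iff) (auto simp: finite_facets)
    then show ?thesis using F by (simp add: s_def)
  qed
  show ?thesis
  proof (cases "y F = 0")
    case True
    then show ?thesis using eth[OF F] by simp
  next
    case False
    have "\<theta> F = 0"
    proof (rule euclidean_eqI)
      fix b :: 'k assume b: "b \<in> Basis"
      show "\<theta> F \<bullet> b = 0 \<bullet> b"
      proof (cases "b = 1")
        case True
        then show ?thesis using e1[OF eth[OF F]] radial[OF F] False by (simp add: inner_commute)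
      next
        case False
        then show ?thesis using rot[OF b False F] \<open>y F \<noteq> 0\<close> by (simp add: inner_commute)
      qed
    qed
    then show ?thesis using eth[OF F] by simp
  qed
qed

definition neg_on :: "'a set set \<Rightarrow> ('a set \<Rightarrow> 'k::{real_normed_field,euclidean_space}) \<Rightarrow> 'a set \<Rightarrow> 'k" where
  "neg_on A y F = (if F \<in> A then - y F else y F)"

lemma zpt_neg_on: "zpt p (neg_on A y) \<longleftrightarrow> zpt p y"
  by (simp add: zpt_def neg_on_def)

lemma nu_neg_on: "nu V F b (neg_on A y) (neg_on A e) = nu V F b y e"
  unfolding nu_def neg_on_def by (intro arg_cong2[where f = "(-)"] sum.cong) auto

lemma nu_minus: "nu V F b y (\<lambda>F. - e F) = - nu V F b y e"
  by (simp add: nu_def sum_negf)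

lemma Zd_minus: "Zd v y (\<lambda>F. - e F) = - Zd v y e"
  by (simp add: Zd_def vec_eq_iff sum_negf algebra_simps sum_subtractf)

text \<open>The exponents \<open>mm v i F\<close> add up to an even number over an even set, so the
  signs cancel in every chart coordinate.\<close>

lemma sign_product:
  assumes A: "even_set A" and v: "v extreme_point_of P"
  shows "(if fa v i \<in> A then - 1 else 1) *
    (\<Prod>F\<in>facets - facets_at v. (if F \<in> A then - 1 else 1) powi mm v i F) = (1 :: 'k::field)"
proof -
  have sub: "facets_at v \<subseteq> facets" "A \<subseteq> facets" using A by (auto simp: facets_at_def even_set_def)
  let ?s = "\<lambda>F. (if F \<in> A then - 1 else 1) :: 'k"
  have "(\<Prod>F\<in>facets_at v. ?s F powi mm v i F) = (\<Prod>k\<in>UNIV. if i = k then ?s (fa v k) else 1)"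
    unfolding prod_facets_at[OF v] by (intro prod.cong) (auto simp: mm_fa[OF v])
  also have "\<dots> = ?s (fa v i)" by (simp add: prod.delta')
  finally have "?s (fa v i) * (\<Prod>F\<in>facets - facets_at v. ?s F powi mm v i F) = (\<Prod>F\<in>facets. ?s F powi mm v i F)"
    using prod.subset_diff[OF sub(1) finite_facets, of "\<lambda>F. ?s F powi mm v i F"] by (simp only: mult.commute)
  also have "\<dots> = (\<Prod>F\<in>A. (- 1) powi mm v i F)"
    by (rule prod.mono_neutral_cong_right) (use finite_facets sub in auto)
  also have "\<dots> = (- 1) powi (\<Sum>F\<in>A. mm v i F)" by (simp add: power_int_sum)
  also have "\<dots> = 1" 
  proof -
    obtain l where "(\<Sum>F\<in>A. mm v i F) = 2 * l" using even_set_mm[OF A, of v i] by (auto elim: evenE)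
    then show ?thesis by (simp add: power_int_mult)
  qed
  finally show ?thesis .
qed

lemma phase_neg_on:
  assumes A: "even_set A" and v: "v extreme_point_of P" and y: "zpt p y" and p: "facets_at p \<subseteq> facets_at v"
  shows "(if fa v i \<in> A then - 1 else 1) * phase v (neg_on A y) i = phase v y i"
proof -
  have "ph (neg_on A y F) = (if F \<in> A then - 1 else 1) * ph (y F)" if "F \<in> facets - facets_at v" for F
    using zpt_nonzero[OF y p that] by (auto simp: neg_on_def ph_def)
  then have "phase v (neg_on A y) i =
      (\<Prod>F\<in>facets - facets_at v. (if F \<in> A then - 1 else 1) powi mm v i F) * phase v y i"
    unfolding phase_def prod.distrib[symmetric] by (intro prod.cong) (auto simp: power_int_mult_distrib)
  then show ?thesis using sign_product[OF A v, of i, where 'k='b] by (simp add: mult.assoc[symmetric])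
qed

lemma Zc_neg_on:
  assumes A: "even_set A" and v: "v extreme_point_of P" and y: "zpt p y" and p: "facets_at p \<subseteq> facets_at v"
  shows "Zc v (neg_on A y) = Zc v y"
  unfolding Zc_def vec_eq_iff
proof
  fix i
  have "neg_on A y (fa v i) * phase v (neg_on A y) i = y (fa v i) * phase v y i"
    unfolding phase_neg_on[OF assms, of i, symmetric] by (simp add: neg_on_def)
  then show "(\<chi> i. neg_on A y (fa v i) * phase v (neg_on A y) i) $ i = (\<chi> i. y (fa v i) * phase v y i) $ i"
    by simp
qed

lemma Zd_neg_on:
  assumes A: "even_set A" and v: "v extreme_point_of P" and y: "zpt p y" and p: "facets_at p \<subseteq> facets_at v"
  shows "Zd v (neg_on A y) (neg_on A e) = Zd v y e"
  unfolding Zd_def vec_eq_iff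
proof
  fix i
  have s: "(\<Sum>F\<in>facets - facets_at v. of_int (mm v i F) * (neg_on A e F / neg_on A y F -
      of_real ((neg_on A y F \<bullet> neg_on A e F) / (norm (neg_on A y F))\<^sup>2))) =
    (\<Sum>F\<in>facets - facets_at v. of_int (mm v i F) * (e F / y F - of_real ((y F \<bullet> e F) / (norm (y F))\<^sup>2)))"
    by (intro sum.cong) (auto simp: neg_on_def)
  have "(neg_on A e (fa v i) + neg_on A y (fa v i) * r) * phase v (neg_on A y) i =
      (e (fa v i) + y (fa v i) * r) * phase v y i" for r
    unfolding phase_neg_on[OF assms, of i, symmetric] by (simp add: neg_on_def algebra_simps)
  then show "(\<chi> i. (neg_on A e (fa v i) + neg_on A y (fa v i) * (\<Sum>F\<in>facets - facets_at v. of_int (mm v i F) *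
      (neg_on A e F / neg_on A y F - of_real ((neg_on A y F \<bullet> neg_on A e F) / (norm (neg_on A y F))\<^sup>2)))) *
      phase v (neg_on A y) i) $ i =
    (\<chi> i. (e (fa v i) + y (fa v i) * (\<Sum>F\<in>facets - facets_at v. of_int (mm v i F) *
      (e F / y F - of_real ((y F \<bullet> e F) / (norm (y F))\<^sup>2)))) * phase v y i) $ i"
    unfolding s vec_lambda_beta by blast
qed

end

lemma constant_subsequence:
  assumes "finite (range (s :: nat \<Rightarrow> 'b))"
  shows "\<exists>r c. strict_mono (r :: nat \<Rightarrow> nat) \<and> (\<forall>m. s (r m) = c)"
proof -
  obtain c where c: "infinite {m. s m = c}"
    using assms pigeonhole_infinite[of UNIV s] by (auto simp: vimage_def)
  obtain r where "strict_mono (r :: nat \<Rightarrow> nat)" "\<And>m. r m \<in> {m. s m = c}"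
    using infinite_enumerate[OF c] by blast
  then show ?thesis by auto
qed

section \<open>A choice of charts that is compatible with limits\<close>

context colored_poly
begin

text \<open>Positive exactly on the domain of the chart at \<open>v\<close>. Choosing a vertex of
  maximal weight prevents a sequence with constant choice \<open>v\<close> from leaving this domain
  in the limit.\<close>

definition weight :: "'a \<Rightarrow> 'a \<Rightarrow> real" where
  "weight v p = (\<Prod>F\<in>facets - facets_at v. ell F p)"

definition sel :: "'a \<Rightarrow> 'a" where
  "sel p = (SOME v. v extreme_point_of P \<and> (\<forall>w. w extreme_point_of P \<longrightarrow> weight w p \<le> weight v p))"

lemma finite_vertices: "finite {v. v extreme_point_of P}"
proof -
  obtain K where K: "finite K" "P = convex hull K" using polytope by (auto simp: polytope_def)
  then have "{v. v extreme_point_of P} \<subseteq> K" using extreme_point_of_convex_hull by blast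
  then show ?thesis using K(1) finite_subset by blast
qed

lemma sel:
  assumes "p \<in> P"
  shows sel_vertex: "sel p extreme_point_of P" and sel_max: "w extreme_point_of P \<Longrightarrow> weight w p \<le> weight (sel p) p"
proof -
  let ?V = "{v. v extreme_point_of P}"
  have "?V \<noteq> {}" using vertex_above[OF assms] by blast
  then have "Max ((\<lambda>v. weight v p) ` ?V) \<in> (\<lambda>v. weight v p) ` ?V" using finite_vertices by (intro Max_in) auto
  then obtain v where v: "v \<in> ?V" "weight v p = Max ((\<lambda>v. weight v p) ` ?V)" by auto
  have "weight w p \<le> weight v p" if "w extreme_point_of P" for w
    unfolding v(2) using finite_vertices that by (intro Max_ge) auto
  then have "\<exists>v. v extreme_point_of P \<and> (\<forall>w. w extreme_point_of P \<longrightarrow> weight w p \<le> weight v p)" using v(1) by blast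
  from someI_ex[OF this] show "sel p extreme_point_of P"
    "w extreme_point_of P \<Longrightarrow> weight w p \<le> weight (sel p) p" by (auto simp: sel_def)
qed

lemma weight_pos:
  assumes p: "p \<in> P"
  shows "weight v p > 0 \<longleftrightarrow> facets_at p \<subseteq> facets_at v"
proof
  assume "weight v p > 0"
  then have "weight v p \<noteq> 0" by simp
  then have "ell F p \<noteq> 0" if "F \<in> facets - facets_at v" for F
    using that finite_facets by (auto simp: weight_def)
  then show "facets_at p \<subseteq> facets_at v" using mem_facet[OF _ p] by (auto simp: facets_at_def)
next
  assume a: "facets_at p \<subseteq> facets_at v"
  show "weight v p > 0" unfolding weight_def
  proof (rule prod_pos)
    fix F assume F: "F \<in> facets - facets_at v"
    then have "F \<in> facets" "p \<notin> F" using a by (auto simp: facets_at_def)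
    then show "0 < ell F p" using ell_nonneg[OF _ p, of F] mem_facet[OF _ p, of F] by simp
  qed
qed

lemma sel_chart: "p \<in> P \<Longrightarrow> facets_at p \<subseteq> facets_at (sel p)"
  using vertex_above[of p] weight_pos[of p] sel_max[of p] by (meson less_le_trans)

text \<open>Weights are continuous, so \<open>v\<close> still has maximal, hence positive, weight at
  the limit.\<close>

lemma sel_limit:
  assumes q: "\<And>m. q m \<in> P" and p: "p \<in> P" and lim: "q \<longlonglongrightarrow> p" and v: "\<And>m. sel (q m) = v"
  shows "facets_at p \<subseteq> facets_at v"
proof -
  have w: "(\<lambda>m. weight u (q m)) \<longlonglongrightarrow> weight u p" for u
    unfolding weight_def ell_def by (intro tendsto_intros lim)
  have "weight (sel p) p \<le> weight v p"
    by (rule LIMSEQ_le[OF w w]) (use sel_max[OF q sel_vertex[OF p]] v in auto)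
  then show ?thesis using weight_pos[OF p] sel_chart[OF p] by (meson less_le_trans)
qed

definition pz :: "'a \<Rightarrow> ('a set \<Rightarrow> 'k::{real_normed_field,euclidean_space}) \<Rightarrow> 'a" where
  "pz V y = pt V (\<lambda>i. (norm (y (fa V i)))\<^sup>2)"

lemma pz_eq:
  assumes V: "V extreme_point_of P" and y: "zpt p y"
  shows "pz V y = p"
proof -
  have "(norm (y (fa V i)))\<^sup>2 = ell (fa V i) p" for i using y fa_facets[OF V] by (simp add: zpt_def)
  then show ?thesis using pt_ell[OF V P_sub_hull, of p] y by (simp add: pz_def zpt_def)
qed

lemma pz_tendsto:
  assumes V: "V extreme_point_of P" and "\<And>F. F \<in> facets \<Longrightarrow> (\<lambda>m. y m F) \<longlonglongrightarrow> yl F"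
  shows "(\<lambda>m. pz V (y m)) \<longlonglongrightarrow> pz V yl"
  unfolding pz_def pt_def by (intro tendsto_intros assms fa_facets[OF V])

lemma ph_tendsto:
  fixes yl :: "'k::{real_normed_field,euclidean_space}"
  assumes "y \<longlonglongrightarrow> yl" "yl \<noteq> 0"
  shows "(\<lambda>m. ph (y m)) \<longlonglongrightarrow> ph yl"
proof -
  have "\<forall>\<^sub>F m in sequentially. y m \<noteq> 0" by (rule tendsto_imp_eventually_ne[OF assms])
  then have "\<forall>\<^sub>F m in sequentially. y m / of_real (norm (y m)) = ph (y m)"
    by (rule eventually_mono) (simp add: ph_def)
  moreover have "(\<lambda>m. y m / of_real (norm (y m))) \<longlonglongrightarrow> yl / of_real (norm yl)"
    by (intro tendsto_intros assms) (use assms(2) in simp)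
  ultimately have "(\<lambda>m. ph (y m)) \<longlonglongrightarrow> yl / of_real (norm yl)" by (rule Lim_transform_eventually[rotated])
  then show ?thesis using assms(2) by (simp add: ph_def)
qed

lemma phase_tendsto:
  assumes y: "\<And>F. F \<in> facets \<Longrightarrow> (\<lambda>m. y m F) \<longlonglongrightarrow> yl F" and nz: "\<And>F. F \<in> facets - facets_at v \<Longrightarrow> yl F \<noteq> 0"
  shows "(\<lambda>m. phase v (y m) i) \<longlonglongrightarrow> phase v yl i"
  unfolding phase_def
proof (rule tendsto_prod)
  fix F assume F: "F \<in> facets - facets_at v"
  have "(\<lambda>m. ph (y m F)) \<longlonglongrightarrow> ph (yl F)" by (rule ph_tendsto) (use y nz F in auto)
  then show "(\<lambda>m. ph (y m F) powi mm v i F) \<longlonglongrightarrow> ph (yl F) powi mm v i F"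
    by (rule tendsto_power_int) simp
qed

lemma Zc_tendsto:
  assumes v: "v extreme_point_of P" and y: "\<And>F. F \<in> facets \<Longrightarrow> (\<lambda>m. y m F) \<longlonglongrightarrow> yl F"
    and nz: "\<And>F. F \<in> facets - facets_at v \<Longrightarrow> yl F \<noteq> 0"
  shows "(\<lambda>m. Zc v (y m)) \<longlonglongrightarrow> Zc v yl"
  unfolding Zc_def by (intro tendsto_vec_lambda tendsto_mult y fa_facets[OF v] phase_tendsto[OF y nz])

lemma Zd_tendsto:
  assumes v: "v extreme_point_of P" and y: "\<And>F. F \<in> facets \<Longrightarrow> (\<lambda>m. y m F) \<longlonglongrightarrow> yl F"
    and e: "\<And>F. F \<in> facets \<Longrightarrow> (\<lambda>m. e m F) \<longlonglongrightarrow> el F"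
    and nz: "\<And>F. F \<in> facets - facets_at v \<Longrightarrow> yl F \<noteq> 0"
  shows "(\<lambda>m. Zd v (y m) (e m)) \<longlonglongrightarrow> Zd v yl el"
proof -
  have "(\<lambda>m. \<Sum>F\<in>facets - facets_at v. of_int (mm v i F) *
      (e m F / y m F - of_real ((y m F \<bullet> e m F) / (norm (y m F))\<^sup>2))) \<longlonglongrightarrow>
    (\<Sum>F\<in>facets - facets_at v. of_int (mm v i F) *
      (el F / yl F - of_real ((yl F \<bullet> el F) / (norm (yl F))\<^sup>2)))" for i
  proof (rule tendsto_sum)
    fix F assume F: "F \<in> facets - facets_at v"
    then have F': "F \<in> facets" "yl F \<noteq> 0" "(norm (yl F))\<^sup>2 \<noteq> 0" using nz[of F] by auto
    show "(\<lambda>m. of_int (mm v i F) * (e m F / y m F - of_real ((y m F \<bullet> e m F) / (norm (y m F))\<^sup>2))) \<longlonglongrightarrow>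
        of_int (mm v i F) * (el F / yl F - of_real ((yl F \<bullet> el F) / (norm (yl F))\<^sup>2))"
      by (intro tendsto_intros y[OF F'(1)] e[OF F'(1)] F'(2,3))
  qed
  then show ?thesis unfolding Zd_def
    by (intro tendsto_vec_lambda tendsto_mult tendsto_add y e fa_facets[OF v] phase_tendsto[OF y nz])
qed

lemma nu_tendsto:
  assumes V: "V extreme_point_of P" and F: "F \<in> facets"
    and y: "\<And>F. F \<in> facets \<Longrightarrow> (\<lambda>m. y m F) \<longlonglongrightarrow> yl F" and e: "\<And>F. F \<in> facets \<Longrightarrow> (\<lambda>m. e m F) \<longlonglongrightarrow> el F"
  shows "(\<lambda>m. nu V F b (y m) (e m)) \<longlonglongrightarrow> nu V F b yl el"
  unfolding nu_def by (intro tendsto_intros y e fa_facets[OF V] F)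

end

section \<open>Positions and velocities under the embedding\<close>

context skew_embedding
begin

text \<open>The differential of \<open>f\<close> composed with the quotient map, in the selected
  chart. For tangent \<open>e\<close> any other chart gives the same value, by
  \<open>chart_independent\<close>.\<close>

definition vel :: "'a \<Rightarrow> ('a set \<Rightarrow> 'k) \<Rightarrow> ('a set \<Rightarrow> 'k) \<Rightarrow> nat \<Rightarrow> real" where
  "vel V y e = dG (sel (pz V y)) (Zc (sel (pz V y)) y) (Zd (sel (pz V y)) y e)"

definition pos :: "'a \<Rightarrow> ('a set \<Rightarrow> 'k) \<Rightarrow> nat \<Rightarrow> real" where
  "pos V y i = chart_expr (ch (sel (pz V y))) f i (Zc (sel (pz V y)) y)"

lemma Zc_img:
  assumes "v extreme_point_of P" "zpt p y" "facets_at p \<subseteq> facets_at v"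
  shows "Zc v y \<in> img v"
  using chart_zpt[OF assms] unfolding img_def by (metis image_eqI)

lemma chart_expr_Zc:
  assumes "v extreme_point_of P" "zpt p y" "facets_at p \<subseteq> facets_at v"
  shows "chart_expr (ch v) f i (Zc v y) = f (cls (tor y) p) i"
  using chart_zpt[OF assms] chart_expr_chart[OF assms(1), of "cls (tor y) p" i] by simp

lemma pos_eq:
  assumes V: "V extreme_point_of P" and y: "zpt p y"
  shows "pos V y i = f (cls (tor y) p) i"
proof -
  have pP: "p \<in> P" using y by (simp add: zpt_def)
  show ?thesis unfolding pos_def pz_eq[OF V y]
    by (rule chart_expr_Zc[OF sel_vertex[OF pP] y sel_chart[OF pP]])
qed

text \<open>
  The function \<open>vel\<close> jumps where the selected chart changes, but not at tangent vectors.
\<close>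

lemma vel_subsequence:
  assumes V: "V extreme_point_of P" and ym: "\<And>m. zpt (q m) (y m)" and yl: "zpt p yl" and tan: "tangent yl el"
    and i: "i < N" and y: "\<And>F. F \<in> facets \<Longrightarrow> (\<lambda>m. y m F) \<longlonglongrightarrow> yl F"
    and e: "\<And>F. F \<in> facets \<Longrightarrow> (\<lambda>m. e m F) \<longlonglongrightarrow> el F"
  shows "\<exists>r. strict_mono (r :: nat \<Rightarrow> nat) \<and> (\<lambda>m. vel V (y (r m)) (e (r m)) i) \<longlonglongrightarrow> vel V yl el i \<and>
    (\<lambda>m. pos V (y (r m)) i) \<longlonglongrightarrow> pos V yl i"
proof -
  have pz: "pz V (y m) = q m" "pz V yl = p" for m using pz_eq[OF V] ym yl by auto
  have qP: "q m \<in> P" "p \<in> P" for m using ym yl by (auto simp: zpt_def)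
  have "range (\<lambda>m. sel (q m)) \<subseteq> {v. v extreme_point_of P}" using sel_vertex[OF qP(1)] by auto
  then have "finite (range (\<lambda>m. sel (q m)))" using finite_vertices finite_subset by blast
  then obtain r v where r: "strict_mono (r :: nat \<Rightarrow> nat)" "\<And>m. sel (q (r m)) = v"
    using constant_subsequence by metis
  have v: "v extreme_point_of P" using sel_vertex[OF qP(1)] r(2) by metis
  have yr: "(\<lambda>m. y (r m) F) \<longlonglongrightarrow> yl F" and er: "(\<lambda>m. e (r m) F) \<longlonglongrightarrow> el F" if "F \<in> facets" for F
    using filterlim_compose[OF y[OF that] filterlim_subseq[OF r(1)]]
      filterlim_compose[OF e[OF that] filterlim_subseq[OF r(1)]] by auto
  have "(\<lambda>m. q (r m)) \<longlonglongrightarrow> p" using pz_tendsto[OF V, of "\<lambda>m. y (r m)" yl] yr by (simp add: pz)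
  then have pv: "facets_at p \<subseteq> facets_at v" using sel_limit[of "\<lambda>m. q (r m)"] qP r(2) by blast
  have nz: "yl F \<noteq> 0" if "F \<in> facets - facets_at v" for F by (rule zpt_nonzero[OF yl pv that])
  have zc: "(\<lambda>m. Zc v (y (r m))) \<longlonglongrightarrow> Zc v yl" by (rule Zc_tendsto[OF v yr nz])
  have zd: "(\<lambda>m. Zd v (y (r m)) (e (r m))) \<longlonglongrightarrow> Zd v yl el" by (rule Zd_tendsto[OF v yr er nz])
  have im: "Zc v yl \<in> img v" by (rule Zc_img[OF v yl pv])
  have "(\<lambda>m. dG v (Zc v (y (r m))) (Zd v (y (r m)) (e (r m))) i) \<longlonglongrightarrow> dG v (Zc v yl) (Zd v yl el) i"
    by (rule dG_tendsto[OF v i im zc zd])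
  moreover have "dG v (Zc v yl) (Zd v yl el) i = vel V yl el i"
    unfolding vel_def pz by (rule chart_independent[OF yl tan v pv sel_vertex[OF qP(2)] sel_chart[OF qP(2)]])
  moreover have "isCont (chart_expr (ch v) f i) (Zc v yl)"
    using has_derivative_continuous[OF dG_derivative[OF v im]] .
  then have "(\<lambda>m. chart_expr (ch v) f i (Zc v (y (r m)))) \<longlonglongrightarrow> chart_expr (ch v) f i (Zc v yl)"
    using isCont_tendsto_compose[OF _ zc] by blast
  moreover have "chart_expr (ch v) f i (Zc v yl) = pos V yl i"
    using chart_expr_Zc[OF v yl pv] pos_eq[OF V yl] by simp
  ultimately have "(\<lambda>m. vel V (y (r m)) (e (r m)) i) \<longlonglongrightarrow> vel V yl el i" "(\<lambda>m. pos V (y (r m)) i) \<longlonglongrightarrow> pos V yl i"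
    by (simp_all add: vel_def pos_def pz r(2))
  then show ?thesis using r(1) by blast
qed

text \<open>\<open>skew_zero\<close> makes the velocities vanish in the charts, and
  \<open>nu_kernel\<close> says that directions orthogonal to the orbits are not lost on the way to
  the charts.\<close>

lemma vel_nonzero:
  assumes one: "(1::'k) \<in> Basis" and V: "V extreme_point_of P" "V' extreme_point_of P"
    and y: "zpt p y" "zpt p' y'" "p \<noteq> p'"
    and nu: "\<And>F b. F \<in> facets - facets_at V \<Longrightarrow> b \<in> Basis \<Longrightarrow> nu V F b y e = 0"
    and nu': "\<And>F b. F \<in> facets - facets_at V' \<Longrightarrow> b \<in> Basis \<Longrightarrow> nu V' F b y' e' = 0"
    and zero: "\<And>i. i < N \<Longrightarrow> vel V y e i + vel V' y' e' i + r * (pos V y i - pos V' y' i) = 0"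
  shows "(\<forall>F\<in>facets. e F = 0) \<and> (\<forall>F\<in>facets. e' F = 0) \<and> r = 0"
proof -
  let ?v = "sel p" and ?w = "sel p'" and ?x = "cls (tor y) p" and ?x' = "cls (tor y') p'"
  have pP: "p \<in> P" "p' \<in> P" using y by (auto simp: zpt_def)
  have pz: "pz V y = p" "pz V' y' = p'" using pz_eq V y by auto
  have v: "?v extreme_point_of P" "facets_at p \<subseteq> facets_at ?v" using sel_vertex sel_chart pP by auto
  have w: "?w extreme_point_of P" "facets_at p' \<subseteq> facets_at ?w" using sel_vertex sel_chart pP by auto
  have x: "?x \<in> fst (ch ?v)" "snd (ch ?v) ?x = Zc ?v y" using chart_zpt[OF v(1) y(1) v(2)] by auto
  have x': "?x' \<in> fst (ch ?w)" "snd (ch ?w) ?x' = Zc ?w y'" using chart_zpt[OF w(1) y(2) w(2)] by auto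
  have "?x \<noteq> ?x'"
  proof
    assume "?x = ?x'"
    then have "(tor y, p) \<in> ?x'" using cls_self[OF tor_torus[of y] pP(1)] by simp
    then show False using mem_cls y(3) by blast
  qed
  then have "Zd ?v y e = 0 \<and> Zd ?w y' e' = 0 \<and> r = 0"
  proof (rule skew_zero[OF v(1) x(1) w(1) x'(1)])
    fix i assume "i < N"
    then show "dG ?v (snd (ch ?v) ?x) (Zd ?v y e) i + dG ?w (snd (ch ?w) ?x') (Zd ?w y' e') i +
        r * (f ?x i - f ?x' i) = 0"
      using zero[of i] pos_eq[OF V(1) y(1)] pos_eq[OF V(2) y(2)] by (simp add: vel_def pz x x')
  qed
  then show ?thesis
    using nu_kernel[OF one V(1) nu v(1) y(1) v(2)] nu_kernel[OF one V(2) nu' w(1) y(2) w(2)] by blast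
qed

lemma vel_neg_on:
  assumes A: "even_set A" and V: "V extreme_point_of P" and y: "zpt p y"
  shows "vel V (neg_on A y) (neg_on A e) = vel V y e" "pos V (neg_on A y) = pos V y"
proof -
  have y': "zpt p (neg_on A y)" using y by (simp add: zpt_neg_on)
  have pz: "pz V (neg_on A y) = p" "pz V y = p" using pz_eq[OF V] y y' by auto
  have pP: "p \<in> P" using y by (simp add: zpt_def)
  show "vel V (neg_on A y) (neg_on A e) = vel V y e"
    unfolding vel_def pz using Zc_neg_on[OF A sel_vertex[OF pP] y sel_chart[OF pP]]
      Zd_neg_on[OF A sel_vertex[OF pP] y sel_chart[OF pP]] by simp
  show "pos V (neg_on A y) = pos V y"
    unfolding pos_def pz using Zc_neg_on[OF A sel_vertex[OF pP] y sel_chart[OF pP]] by simp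
qed

lemma vel_minus:
  assumes V: "V extreme_point_of P" and y: "zpt p y"
  shows "vel V y (\<lambda>F. - e F) i = - vel V y e i"
proof -
  have pz: "pz V y = p" using pz_eq[OF V] y by auto
  have pP: "p \<in> P" using y by (simp add: zpt_def)
  have "Zc (sel p) y \<in> img (sel p)" by (rule Zc_img[OF sel_vertex[OF pP] y sel_chart[OF pP]])
  then show ?thesis
    unfolding vel_def pz Zd_minus using linear_neg[OF dG_linear[OF sel_vertex[OF pP]]] by blast
qed

end

section \<open>The configuration space of a pair of points\<close>

text \<open>
  \<open>Base\<close> coordinates describe two points of moment-angle spaces over two disjoint facets, and
  \<open>Dir\<close> and \<open>Time\<close> coordinates describe a pair of directions and a scalar on a unit sphere.
\<close>

datatype ('f, 'b) coord = Base bool 'f 'b | Dir bool 'f 'b | Time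

locale skew_pair = skew_embedding P h H N f
  for P :: "'a::euclidean_space set" and h :: "'a set \<Rightarrow> 'n::{finite,linorder}" and H :: "'n \<Rightarrow> 'a set" and N :: nat
    and f :: "(('k::{real_normed_field,euclidean_space}, 'n) vec \<times> 'a) set \<Rightarrow> nat \<Rightarrow> real" +
  fixes V V' :: 'a and F' :: "'a set"
  assumes one: "(1::'k) \<in> Basis" and V: "V extreme_point_of P" "facets_at V = range H"
    and V': "V' extreme_point_of P" "F' \<notin> facets_at V" "facets_at V' = insert F' (facets_at V - {H (Max UNIV)})"
begin

abbreviation top :: 'n where "top \<equiv> Max UNIV"

definition vb :: "bool \<Rightarrow> 'a" where
  "vb j = (if j then V else V')"

text \<open>The two facets of the top color. The other facets at either vertex are the
  \<open>H i\<close> of smaller color, and the product of exactly their classes is supplied by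
  \<open>prod_T_top\<close>.\<close>

definition F0 :: "bool \<Rightarrow> 'a set" where
  "F0 j = fa (vb j) top"

lemma vb: "vb j extreme_point_of P"
  using V V' by (simp add: vb_def)

lemma fa_V: "fa V i = H i"
  using fa_h[OF V(1), of "H i"] V(2) h_H[of i] by auto

lemma fa_vb: "i \<noteq> top \<Longrightarrow> fa (vb j) i = H i"
proof -
  assume i: "i \<noteq> top"
  then have "H i \<noteq> H top" using h_H by metis
  then have "H i \<in> facets_at (vb j)" using V(2) V'(3) by (auto simp: vb_def)
  then show ?thesis using fa_h[OF vb, of "H i" j] h_H[of i] by simp
qed

lemma F0: "F0 j \<in> facets" "h (F0 j) = top" "F0 j \<in> facets_at (vb j)"
  using fa_facets[OF vb] h_fa[OF vb] fa_mem[OF vb] by (auto simp: F0_def)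

lemma F0_ne: "F0 True \<noteq> F0 False"
proof
  assume "F0 True = F0 False"
  then have "F0 False = H top" by (simp add: F0_def vb_def fa_V)
  then have "H top \<in> facets_at V'" using F0(3)[of False] by (simp add: vb_def)
  then show False using V' V(2) by auto
qed

lemma F0_disjoint: "p \<in> F0 True \<Longrightarrow> q \<in> F0 False \<Longrightarrow> p \<noteq> q"
  using color_inj[of "F0 True" p "F0 False"] F0 F0_ne by (auto simp: facets_at_def)

definition Co :: "('a set, 'k) coord set" where
  "Co = {Base j F b |j F b. F \<in> facets - {F0 j} \<and> b \<in> Basis} \<union> {Dir j F b |j F b. F \<in> facets \<and> b \<in> Basis} \<union> {Time}"

lemma mem_Co [simp]: "Base j F b \<in> Co \<longleftrightarrow> F \<in> facets \<and> F \<noteq> F0 j \<and> b \<in> Basis"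
  "Dir j F b \<in> Co \<longleftrightarrow> F \<in> facets \<and> b \<in> Basis" "Time \<in> Co"
  by (auto simp: Co_def)

text \<open>Groups the coordinates whose squares are added: the components of one scalar
  \<open>y F\<close>, or all directions together with the time, whose squares add up to one.\<close>

fun blk :: "('a set, 'k) coord \<Rightarrow> ('a set + 'a set) + unit" where
  "blk (Base j F b) = Inl (if j then Inl F else Inr F)"
| "blk c = Inr ()"

definition Om0 :: "(('a set + 'a set) + unit \<Rightarrow> real) set" where
  "Om0 = join (join (facet_vec (F0 True) ` F0 True) (facet_vec (F0 False) ` F0 False)) {\<lambda>_. 1}"

definition Om :: "(('a set, 'k) coord \<Rightarrow> real) set" where
  "Om = wedge Co blk Om0"

definition Dm :: nat where
  "Dm = (CARD('n) - 1 + (CARD('n) - 1) + 0) + card Co -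
    card (((facets - {F0 True}) <+> (facets - {F0 False})) <+> {()})"

lemma Co_eq: "Co = (\<lambda>(j, F, b). Base j F b) ` (SIGMA j:UNIV. (facets - {F0 j}) \<times> Basis) \<union>
    (\<lambda>(j, F, b). Dir j F b) ` (UNIV \<times> facets \<times> Basis) \<union> {Time}"
  by (auto simp: Co_def image_iff)

lemma finite_Co: "finite Co"
  unfolding Co_eq using finite_facets by (intro finite_UnI finite_imageI finite_SigmaI) auto

lemma wedge_Co: "wedge_system (((facets - {F0 True}) <+> (facets - {F0 False})) <+> {()}) Om0
    (CARD('n) - 1 + (CARD('n) - 1) + 0) Co blk"
proof -
  have "simple_system (((facets - {F0 True}) <+> (facets - {F0 False})) <+> {()}) Om0
    (CARD('n) - 1 + (CARD('n) - 1) + 0)"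
    unfolding Om0_def by (intro simple_system_join simple_system_facet simple_system_point F0)
  moreover have "blk ` Co = ((facets - {F0 True}) <+> (facets - {F0 False})) <+> {()}"
  proof (intro subset_antisym subsetI)
    fix i assume "i \<in> blk ` Co"
    then obtain c where "c \<in> Co" "i = blk c" by blast
    then show "i \<in> ((facets - {F0 True}) <+> (facets - {F0 False})) <+> {()}" by (cases c) auto
  next
    fix i assume "i \<in> ((facets - {F0 True}) <+> (facets - {F0 False})) <+> {()}"
    then consider F where "i = Inl (Inl F)" "F \<in> facets - {F0 True}" | F where "i = Inl (Inr F)" "F \<in> facets - {F0 False}"
      | "i = Inr ()" by auto
    then show "i \<in> blk ` Co"
    proof cases
      case 1
      then have "i = blk (Base True F 1)" "Base True F 1 \<in> Co" using one by auto
      then show ?thesis by blast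
    next
      case 2
      then have "i = blk (Base False F 1)" "Base False F 1 \<in> Co" using one by auto
      then show ?thesis by blast
    next
      case 3
      then have "i = blk Time" by simp
      then show ?thesis using mem_Co(3) by blast
    qed
  qed
  ultimately show ?thesis using finite_Co by (intro wedge_system.intro wedge_system_axioms.intro)
qed

lemma face_Om:
  "face Om S \<noteq> {} \<longleftrightarrow> (\<forall>j. \<exists>p\<in>P. F0 j \<in> facets_at p \<and>
      (\<forall>F\<in>facets - {F0 j}. (\<forall>b\<in>Basis. Base j F b \<in> S) \<longrightarrow> F \<in> facets_at p)) \<and>
    \<not> ((\<forall>j. \<forall>F\<in>facets. \<forall>b\<in>Basis. Dir j F b \<in> S) \<and> Time \<in> S)"
proof -
  interpret wedge_system "((facets - {F0 True}) <+> (facets - {F0 False})) <+> {()}" Om0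
    "CARD('n) - 1 + (CARD('n) - 1) + 0" Co blk by (rule wedge_Co)
  define R where "R j = {F \<in> facets - {F0 j}. \<forall>b\<in>Basis. Base j F b \<in> S}" for j
  have fiber: "{c \<in> Co. blk c = Inl (if j then Inl F else Inr F)} = {c \<in> Co. \<exists>b. c = Base j F b}" for j F
  proof (rule Set.set_eqI)
    show "c \<in> {c \<in> Co. blk c = Inl (if j then Inl F else Inr F)} \<longleftrightarrow> c \<in> {c \<in> Co. \<exists>b. c = Base j F b}" for c
      by (cases c) auto
  qed
  have fiber': "{c \<in> Co. blk c = Inr ()} = {c \<in> Co. \<forall>j F b. c \<noteq> Base j F b}"
  proof (rule Set.set_eqI)
    show "c \<in> {c \<in> Co. blk c = Inr ()} \<longleftrightarrow> c \<in> {c \<in> Co. \<forall>j F b. c \<noteq> Base j F b}" for c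
      by (cases c) auto
  qed
  have full_Base: "Inl (if j then Inl F else Inr F) \<in> full S \<longleftrightarrow> F \<in> R j" for j F
  proof -
    have "Inl (if j then Inl F else Inr F) \<in> full S \<longleftrightarrow> F \<in> facets - {F0 j} \<and> {c \<in> Co. \<exists>b. c = Base j F b} \<subseteq> S"
      unfolding full_def mem_Collect_eq fiber by auto
    also have "\<dots> \<longleftrightarrow> F \<in> R j" by (auto simp: R_def)
    finally show ?thesis .
  qed
  have L: "Inl -` (Inl -` full S) = R True" "Inr -` (Inl -` full S) = R False"
    using full_Base[of True] full_Base[of False] by auto
  have T: "() \<in> Inr -` full S \<longleftrightarrow> (\<forall>j. \<forall>F\<in>facets. \<forall>b\<in>Basis. Dir j F b \<in> S) \<and> Time \<in> S"
  proof -
    have "() \<in> Inr -` full S \<longleftrightarrow> {c \<in> Co. \<forall>j F b. c \<noteq> Base j F b} \<subseteq> S"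
      unfolding vimage_eq full_def mem_Collect_eq fiber' by auto
    also have "\<dots> \<longleftrightarrow> (\<forall>j. \<forall>F\<in>facets. \<forall>b\<in>Basis. Dir j F b \<in> S) \<and> Time \<in> S"
    proof
      assume a: "(\<forall>j. \<forall>F\<in>facets. \<forall>b\<in>Basis. Dir j F b \<in> S) \<and> Time \<in> S"
      show "{c \<in> Co. \<forall>j F b. c \<noteq> Base j F b} \<subseteq> S"
      proof
        show "c \<in> S" if "c \<in> {c \<in> Co. \<forall>j F b. c \<noteq> Base j F b}" for c using that a by (cases c) auto
      qed
    qed auto
    finally show ?thesis .
  qed
  have pt: "face {\<lambda>_. 1} A = {} \<longleftrightarrow> () \<in> A" for A :: "unit set" by (auto simp: face_def)
  have R: "face (facet_vec (F0 j) ` F0 j) (R j) \<noteq> {} \<longleftrightarrow> (\<exists>p\<in>P. F0 j \<in> facets_at p \<and>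
      (\<forall>F\<in>facets - {F0 j}. (\<forall>b\<in>Basis. Base j F b \<in> S) \<longrightarrow> F \<in> facets_at p))" for j
  proof -
    have "R j \<subseteq> facets - {F0 j}" by (auto simp: R_def)
    then show ?thesis unfolding facets_at_face[OF F0(1) \<open>R j \<subseteq> facets - {F0 j}\<close>] by (auto simp: R_def)
  qed
  have "face Om S \<noteq> {} \<longleftrightarrow> face (facet_vec (F0 True) ` F0 True) (R True) \<noteq> {} \<and>
      face (facet_vec (F0 False) ` F0 False) (R False) \<noteq> {} \<and> () \<notin> Inr -` full S"
    unfolding Om_def face_wedge unfolding Om0_def face_join L pt by (simp only: de_Morgan_disj conj_assoc)
  then show ?thesis unfolding R T by (simp add: all_bool_eq conj_assoc)
qed

text \<open>\<open>A j\<close> stands for an element of order two of the kernel of \<Lambda>, acting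
  on the \<open>j\<close>-th point and its direction alike; \<open>s\<close> stands for the antipode
  on the sphere of directions and time.\<close>

fun on :: "bool \<Rightarrow> (bool \<Rightarrow> 'a set set) \<Rightarrow> ('a set, 'k) coord \<Rightarrow> bool" where
  "on s A (Base j F b) \<longleftrightarrow> F \<in> A j"
| "on s A (Dir j F b) \<longleftrightarrow> (F \<in> A j) \<noteq> s"
| "on s A Time \<longleftrightarrow> s"

definition flips :: "bool \<Rightarrow> (bool \<Rightarrow> 'a set set) \<Rightarrow> ('a set, 'k) coord set" where
  "flips s A = {c \<in> Co. on s A c}"

definition Gam :: "('a set, 'k) coord set set" where
  "Gam = {flips s A |s A. \<forall>j. even_set (A j)}"

lemma mem_flips: "c \<in> flips s A \<longleftrightarrow> c \<in> Co \<and> on s A c"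
  by (simp add: flips_def)

lemma even_set_empty: "even_set {}"
  by (simp add: even_set_def)

lemma even_set_sd:
  assumes "even_set A" "even_set B"
  shows "even_set (sd A B)"
proof -
  have fin: "finite A" "finite B" "A \<subseteq> facets" "B \<subseteq> facets"
    using assms finite_facets finite_subset by (auto simp: even_set_def)
  have "even (\<Sum>F\<in>sd A B. \<Lambda> F $ i)" for i
  proof -
    have "(\<Sum>F\<in>sd A B. \<Lambda> F $ i) = (\<Sum>F\<in>A - B. \<Lambda> F $ i) + (\<Sum>F\<in>B - A. \<Lambda> F $ i)"
      unfolding sd_def by (rule sum.union_disjoint) (use fin in auto)
    moreover have "(\<Sum>F\<in>A. \<Lambda> F $ i) = (\<Sum>F\<in>A - B. \<Lambda> F $ i) + (\<Sum>F\<in>A \<inter> B. \<Lambda> F $ i)"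
      using sum.Int_Diff[OF fin(1), of _ B] by (simp add: add.commute)
    moreover have "(\<Sum>F\<in>B. \<Lambda> F $ i) = (\<Sum>F\<in>B - A. \<Lambda> F $ i) + (\<Sum>F\<in>A \<inter> B. \<Lambda> F $ i)"
      using sum.Int_Diff[OF fin(2), of _ A] by (simp add: add.commute Int_commute)
    moreover have "even (\<Sum>F\<in>A. \<Lambda> F $ i)" "even (\<Sum>F\<in>B. \<Lambda> F $ i)" using assms by (auto simp: even_set_def)
    ultimately show ?thesis by simp
  qed
  then show ?thesis using fin by (auto simp: even_set_def sd_def)
qed

lemma sd_flips: "sd (flips s A) (flips s' A') = flips (s \<noteq> s') (\<lambda>j. sd (A j) (A' j))"
proof (rule Set.set_eqI)
  show "c \<in> sd (flips s A) (flips s' A') \<longleftrightarrow> c \<in> flips (s \<noteq> s') (\<lambda>j. sd (A j) (A' j))" for c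
    by (cases c) (auto simp: sd_def mem_flips)
qed

text \<open>The action is free: a sign change that fixes a point comes from even sets of facets
  through a point of \<open>P\<close>, which are empty, and the antipode has no fixed point on the
  sphere.\<close>

sublocale G: gauge Co Om Dm Gam
proof -
  interpret wedge_system "((facets - {F0 True}) <+> (facets - {F0 False})) <+> {()}" Om0
    "CARD('n) - 1 + (CARD('n) - 1) + 0" Co blk by (rule wedge_Co)
  have "simple_system Co Om Dm" unfolding Om_def Dm_def by (rule simple_system_wedge)
  moreover have "gauge_axioms Co Om Gam"
  proof
    show "g \<subseteq> Co" if "g \<in> Gam" for g using that by (auto simp: Gam_def flips_def)
    have "flips False (\<lambda>j. {}) = {}"
    proof (rule equals0I)
      show False if "c \<in> flips False (\<lambda>j. {})" for c using that by (cases c) (auto simp: mem_flips)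
    qed
    then show "{} \<in> Gam" unfolding Gam_def using even_set_empty by auto
    show "sd g g' \<in> Gam" if gg: "g \<in> Gam" "g' \<in> Gam" for g g'
    proof -
      obtain s A s' A' where g: "g = flips s A" "g' = flips s' A'" and A: "\<forall>j. even_set (A j)" "\<forall>j. even_set (A' j)"
        using gg unfolding Gam_def by blast
      have "\<forall>j. even_set (sd (A j) (A' j))" using A even_set_sd by blast
      then show ?thesis unfolding g sd_flips Gam_def by blast
    qed
    show "face Om g = {}" if g: "g \<in> Gam" "g \<noteq> {}" for g
    proof (rule ccontr)
      assume ne: "face Om g \<noteq> {}"
      obtain s A where gA: "g = flips s A" and A: "\<And>j. even_set (A j)" using g(1) unfolding Gam_def by blast
      have A0: "A j = {}" for j
      proof -
        obtain p where p: "p \<in> P" "F0 j \<in> facets_at p"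
          "\<forall>F\<in>facets - {F0 j}. (\<forall>b\<in>Basis. Base j F b \<in> g) \<longrightarrow> F \<in> facets_at p"
          using ne unfolding face_Om by blast
        have "A j \<subseteq> facets_at p"
        proof
          fix F assume F: "F \<in> A j"
          then have "F \<in> facets" using A[of j] by (auto simp: even_set_def)
          then show "F \<in> facets_at p" using p F by (cases "F = F0 j") (auto simp: gA mem_flips)
        qed
        then show ?thesis by (rule even_set_free[OF A p(1)])
      qed
      have "\<not> s"
        using ne unfolding face_Om gA by (auto simp: mem_flips A0)
      then have "c \<notin> g" for c by (cases c) (auto simp: gA mem_flips A0)
      then show False using g(2) by blast
    qed
  qed
  ultimately show "gauge Co Om Dm Gam" by (rule gauge.intro)
qed

end

lemma tendsto_sign:
  assumes "g \<longlonglongrightarrow> L" "L \<noteq> (0::real)"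
  shows "\<exists>K. \<forall>m. sgn L * g (m + K) > 0"
proof -
  have "(\<lambda>m. sgn L * g m) \<longlonglongrightarrow> sgn L * L" by (intro tendsto_intros assms)
  moreover have "sgn L * L > 0" using assms(2) by (simp add: sgn_mult_self_eq zero_less_mult_iff sgn_if)
  ultimately have "\<forall>\<^sub>F m in sequentially. sgn L * g m > 0" by (rule order_tendstoD)
  then obtain K where "\<And>m. m \<ge> K \<Longrightarrow> sgn L * g m > 0" by (auto simp: eventually_sequentially)
  then have "\<forall>m. sgn L * g (m + K) > 0" by simp
  then show ?thesis ..
qed

section \<open>Odd functions on the configuration space\<close>

context skew_pair
begin

definition yv :: "(('a set, 'k) coord \<Rightarrow> real) \<Rightarrow> bool \<Rightarrow> 'a set \<Rightarrow> 'k" where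
  "yv x j F = (\<Sum>b\<in>Basis. x (Base j F b) *\<^sub>R b)"

definition dv :: "(('a set, 'k) coord \<Rightarrow> real) \<Rightarrow> bool \<Rightarrow> 'a set \<Rightarrow> 'k" where
  "dv x j F = (\<Sum>b\<in>Basis. x (Dir j F b) *\<^sub>R b)"

lemma norm_basis_sum: "(norm (\<Sum>b\<in>Basis. g b *\<^sub>R b :: 'k))\<^sup>2 = (\<Sum>b\<in>Basis. (g b)\<^sup>2)"
proof -
  have "(norm y)\<^sup>2 = (\<Sum>b\<in>Basis. (y \<bullet> b)\<^sup>2)" for y :: 'k
    unfolding power2_norm_eq_inner euclidean_inner[of y y] by (simp add: power2_eq_square)
  then show ?thesis by (simp add: inner_sum_left_Basis)
qed

lemma G_X:
  assumes x: "x \<in> G.X"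
  shows X_zpt: "\<exists>p. zpt p (yv x j) \<and> p \<in> F0 j"
    and X_sphere: "(\<exists>j. \<exists>F\<in>facets. dv x j F \<noteq> 0) \<or> x Time \<noteq> 0"
proof -
  interpret wedge_system "((facets - {F0 True}) <+> (facets - {F0 False})) <+> {()}" Om0
    "CARD('n) - 1 + (CARD('n) - 1) + 0" Co blk by (rule wedge_Co)
  define q where "q i = (\<Sum>c\<in>{c\<in>Co. blk c = i}. (x c)\<^sup>2)" for i
  have "(\<lambda>c. (x c)\<^sup>2) \<in> Om" using x by (simp add: G.X_def)
  then have q: "q \<in> Om0" unfolding Om_def wedge_def q_def by simp
  have "{c \<in> Co. blk c = Inl (if j then Inl F else Inr F)} = (if F \<in> facets - {F0 j} then Base j F ` Basis else {})" for j F
  proof (rule Set.set_eqI)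
    show "c \<in> {c \<in> Co. blk c = Inl (if j then Inl F else Inr F)} \<longleftrightarrow>
        c \<in> (if F \<in> facets - {F0 j} then Base j F ` Basis else {})" for c
      by (cases c) auto
  qed
  then have qB: "q (Inl (if j then Inl F else Inr F)) = (norm (yv x j F))\<^sup>2" if "F \<in> facets - {F0 j}" for j F
    using that unfolding q_def yv_def norm_basis_sum by (simp add: sum.reindex inj_on_def)
  have "(\<lambda>F. q (Inl (if j then Inl F else Inr F))) \<in> facet_vec (F0 j) ` F0 j"
    using q by (cases j) (auto simp: Om0_def join_def o_def)
  then obtain p where p: "p \<in> F0 j" "(\<lambda>F. q (Inl (if j then Inl F else Inr F))) = facet_vec (F0 j) p" by blast
  have pP: "p \<in> P" using p(1) F0(1)[of j] facet_of_imp_subset by (auto simp: facets_def)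
  have "(norm (yv x j F))\<^sup>2 = ell F p" if F: "F \<in> facets" for F
  proof (cases "F = F0 j")
    case True
    have "x (Base j F b) = 0" for b using G.X_supp[OF x, of "Base j F b"] True by simp
    then show ?thesis using mem_facet[OF F pP] p(1) True by (simp add: yv_def)
  next
    case False
    then show ?thesis using qB[of F j] fun_cong[OF p(2), of F] F by (simp add: facet_vec_def)
  qed
  then show "\<exists>p. zpt p (yv x j) \<and> p \<in> F0 j" using pP p(1) by (auto simp: zpt_def)
  have q1: "q (Inr ()) = 1" using q by (auto simp: Om0_def join_def fun_eq_iff o_def)
  show "(\<exists>j. \<exists>F\<in>facets. dv x j F \<noteq> 0) \<or> x Time \<noteq> 0"
  proof (rule ccontr)
    assume n: "\<not> ?thesis"
    have "x (Dir j F b) = 0" if "F \<in> facets" "b \<in> Basis" for j F b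
    proof -
      have "(\<Sum>b\<in>Basis. (x (Dir j F b))\<^sup>2) = 0" using n that unfolding norm_basis_sum[symmetric] dv_def by auto
      then show ?thesis using that by (subst (asm) sum_nonneg_eq_0_iff) auto
    qed
    then have "x c = 0" if "c \<in> Co" "blk c = Inr ()" for c using that n by (cases c) auto
    then have "q (Inr ()) = 0" unfolding q_def by (intro sum.neutral) auto
    then show False using q1 by simp
  qed
qed

text \<open>The coordinates of the linear map that total skewness makes injective. The zero
  functions for \<open>i \<ge> N\<close> bring their number up to the dimension that is to be
  excluded.\<close>

definition tf :: "nat \<Rightarrow> (('a set, 'k) coord \<Rightarrow> real) \<Rightarrow> real" where
  "tf i x = (if i < N then vel V (yv x True) (dv x True) i + vel V' (yv x False) (dv x False) i +
     x Time * (pos V (yv x True) i - pos V' (yv x False) i) else 0)"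

definition nf :: "bool \<times> 'a set \<times> 'k \<Rightarrow> (('a set, 'k) coord \<Rightarrow> real) \<Rightarrow> real" where
  "nf = (\<lambda>(j, F, b) x. nu (vb j) F b (yv x j) (dv x j))"

definition coord_char :: "('a set, 'k) coord \<Rightarrow> ('a set, 'k) coord set \<Rightarrow> bit" where
  "coord_char c g = of_bool (c \<in> g)"

lemma flip_flips:
  assumes x: "x \<in> G.X" and A: "\<forall>j. even_set (A j)"
  shows "yv (flip (flips s A) x) j = neg_on (A j) (yv x j)"
    "dv (flip (flips s A) x) j = (if s then (\<lambda>F. - neg_on (A j) (dv x j) F) else neg_on (A j) (dv x j))"
    "flip (flips s A) x Time = (if s then - x Time else x Time)"
proof -
  have "flip (flips s A) x (Base j F b) = (if F \<in> A j then - x (Base j F b) else x (Base j F b))" for F b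
    using G.X_supp[OF x, of "Base j F b"] by (auto simp: flip_def mem_flips simp del: mem_Co)
  then show "yv (flip (flips s A) x) j = neg_on (A j) (yv x j)"
    by (intro ext) (simp add: yv_def neg_on_def sum_negf)
  have "flip (flips s A) x (Dir j F b) = (if (F \<in> A j) \<noteq> s then - x (Dir j F b) else x (Dir j F b))"
    for F b
    using G.X_supp[OF x, of "Dir j F b"] by (auto simp: flip_def mem_flips simp del: mem_Co)
  then show "dv (flip (flips s A) x) j = (if s then (\<lambda>F. - neg_on (A j) (dv x j) F) else neg_on (A j) (dv x j))"
    by (auto simp: dv_def neg_on_def sum_negf)
  show "flip (flips s A) x Time = (if s then - x Time else x Time)" by (simp add: flip_def mem_flips)
qed

lemma equivariant_coord: "G.equivariant (coord_char c) (\<lambda>x. x c)"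
  by (auto simp: G.equivariant_def coord_char_def flip_def)

lemma character_coord_char: "G.character (coord_char c)"
  by (auto simp: G.character_def coord_char_def sd_def)

lemma coord_char_Time: "coord_char Time (flips s A) = of_bool s"
  by (simp add: coord_char_def mem_flips)

lemma equivariant_nf: "G.equivariant (coord_char Time) (nf (j, F, b))"
  unfolding G.equivariant_def
proof (intro ballI)
  fix g x assume g: "g \<in> Gam" and x: "x \<in> G.X"
  obtain s A where gA: "g = flips s A" and A: "\<forall>j. even_set (A j)" using g unfolding Gam_def by blast
  show "nf (j, F, b) (flip g x) = (if coord_char Time g = 0 then nf (j, F, b) x else - nf (j, F, b) x)"
    unfolding gA coord_char_Time nf_def by (simp add: flip_flips[OF x A] nu_minus nu_neg_on)
qed

lemma equivariant_tf: "G.equivariant (coord_char Time) (tf i)"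
  unfolding G.equivariant_def
proof (intro ballI)
  fix g x assume g: "g \<in> Gam" and x: "x \<in> G.X"
  obtain s A where gA: "g = flips s A" and A: "\<forall>j. even_set (A j)" using g unfolding Gam_def by blast
  obtain p p' where p: "zpt p (yv x True)" "zpt p' (yv x False)" using X_zpt[OF x] by blast
  then have p': "zpt p (neg_on (A True) (yv x True))" "zpt p' (neg_on (A False) (yv x False))"
    by (simp_all add: zpt_neg_on)
  have A': "even_set (A j)" for j using A by blast
  show "tf i (flip g x) = (if coord_char Time g = 0 then tf i x else - tf i x)"
    unfolding gA coord_char_Time tf_def
    by (simp add: flip_flips[OF x A] vel_minus[OF V(1) p'(1)] vel_minus[OF V'(1) p'(2)]
        vel_neg_on[OF A' V(1) p(1)] vel_neg_on[OF A' V'(1) p(2)] algebra_simps)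
qed

lemma yv_tendsto: "G.converges a x \<Longrightarrow> (\<lambda>m. yv (a m) j F) \<longlonglongrightarrow> yv x j F"
  and dv_tendsto: "G.converges a x \<Longrightarrow> (\<lambda>m. dv (a m) j F) \<longlonglongrightarrow> dv x j F"
  unfolding yv_def dv_def G.converges_def by (auto intro!: tendsto_intros)

text \<open>
  Stability of a sign along subsequences takes the place of continuity, which \<open>tf\<close> need not have.
\<close>

definition stable_sign :: "((('a set, 'k) coord \<Rightarrow> real) \<Rightarrow> real) \<Rightarrow> (('a set, 'k) coord \<Rightarrow> real) \<Rightarrow> bool" where
  "stable_sign u x \<longleftrightarrow> (\<exists>\<sigma>\<in>{1, -1}. \<forall>a. (\<forall>m. a m \<in> G.X) \<longrightarrow> G.converges a x \<longrightarrow>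
      (\<exists>r. strict_mono (r :: nat \<Rightarrow> nat) \<and> (\<forall>m. \<sigma> * u (a (r m)) > 0)))"

lemma stable_signI:
  assumes "u x \<noteq> 0" and "\<And>a. (\<And>m. a m \<in> G.X) \<Longrightarrow> G.converges a x \<Longrightarrow>
    \<exists>r. strict_mono (r :: nat \<Rightarrow> nat) \<and> (\<lambda>m. u (a (r m))) \<longlonglongrightarrow> u x"
  shows "stable_sign u x"
proof -
  have "sgn (u x) \<in> {1, -1}" using assms(1) by (auto simp: sgn_if)
  moreover have "\<exists>r. strict_mono (r :: nat \<Rightarrow> nat) \<and> (\<forall>m. sgn (u x) * u (a (r m)) > 0)"
    if a: "\<forall>m. a m \<in> G.X" "G.converges a x" for a
  proof -
    obtain r where r: "strict_mono (r :: nat \<Rightarrow> nat)" "(\<lambda>m. u (a (r m))) \<longlonglongrightarrow> u x" using assms(2) a by blast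
    obtain K where "\<forall>m. sgn (u x) * u (a (r (m + K))) > 0" using tendsto_sign[OF r(2) assms(1)] by blast
    moreover have "strict_mono (\<lambda>m. r (m + K))" using r(1) by (simp add: strict_mono_def)
    ultimately show ?thesis by blast
  qed
  ultimately show ?thesis unfolding stable_sign_def by blast
qed

text \<open>The functions \<open>nf\<close> are continuous. Where all of them vanish the directions
  are tangent, so \<open>tf\<close> converges along subsequences there by
  \<open>vel_subsequence\<close>, and it is nonzero by \<open>vel_nonzero\<close>.\<close>

lemma no_common_zero:
  assumes x: "x \<in> G.X"
  shows "(\<exists>j F b. F \<in> facets - facets_at (vb j) \<and> b \<in> Basis \<and> stable_sign (nf (j, F, b)) x) \<or>
    (\<exists>i<N. stable_sign (tf i) x)"
proof (cases "\<exists>j F b. F \<in> facets - facets_at (vb j) \<and> b \<in> Basis \<and> nf (j, F, b) x \<noteq> 0")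
  case True
  then obtain j F b where F: "F \<in> facets - facets_at (vb j)" "b \<in> Basis" "nf (j, F, b) x \<noteq> 0" by blast
  have "stable_sign (nf (j, F, b)) x"
  proof (rule stable_signI[where u = "nf (j, F, b)", OF F(3)])
    fix a assume a: "G.converges a x"
    have "(\<lambda>m. nf (j, F, b) (a m)) \<longlonglongrightarrow> nf (j, F, b) x"
      unfolding nf_def prod.case using F(1) by (intro nu_tendsto vb yv_tendsto dv_tendsto a) auto
    then show "\<exists>r. strict_mono (r :: nat \<Rightarrow> nat) \<and> (\<lambda>m. nf (j, F, b) (a (r m))) \<longlonglongrightarrow> nf (j, F, b) x"
      by (intro exI[of _ id]) (simp add: strict_mono_def)
  qed
  then show ?thesis using F by blast
next
  case False
  then have nu: "nu (vb j) F b (yv x j) (dv x j) = 0" if "F \<in> facets - facets_at (vb j)" "b \<in> Basis" for j F b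
    using that by (auto simp: nf_def)
  obtain p p' where p: "zpt p (yv x True)" "zpt p' (yv x False)" "p \<in> F0 True" "p' \<in> F0 False"
    using X_zpt[OF x] by meson
  have nuV: "nu V F b (yv x True) (dv x True) = 0" if "F \<in> facets - facets_at V" "b \<in> Basis" for F b
    using nu[of F True b] that by (simp add: vb_def)
  have nuV': "nu V' F b (yv x False) (dv x False) = 0" if "F \<in> facets - facets_at V'" "b \<in> Basis" for F b
    using nu[of F False b] that by (simp add: vb_def)
  have "\<exists>i<N. tf i x \<noteq> 0"
  proof (rule ccontr)
    assume n: "\<not> ?thesis"
    have "(\<forall>F\<in>facets. dv x True F = 0) \<and> (\<forall>F\<in>facets. dv x False F = 0) \<and> x Time = 0"
    proof (rule vel_nonzero[OF one V(1) V'(1) p(1,2) F0_disjoint[OF p(3,4)] nuV nuV'])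
      fix i assume "i < N"
      then show "vel V (yv x True) (dv x True) i + vel V' (yv x False) (dv x False) i +
          x Time * (pos V (yv x True) i - pos V' (yv x False) i) = 0" using n by (auto simp: tf_def)
    qed
    then show False using X_sphere[OF x] by (metis (full_types))
  qed
  then obtain i where i: "i < N" "tf i x \<noteq> 0" by blast
  have tan: "tangent (yv x True) (dv x True)" "tangent (yv x False) (dv x False)"
    using nu_tangent[OF V(1)] nu_tangent[OF V'(1)] nuV nuV' one by blast+
  have "stable_sign (tf i) x"
  proof (rule stable_signI[where u = "tf i", OF i(2)])
    fix a assume aX: "\<And>m. a m \<in> G.X" and a: "G.converges a x"
    have "\<forall>m. \<exists>q. zpt q (yv (a m) j)" for j using X_zpt[OF aX] by blast
    then obtain q where q: "\<And>m j. zpt (q j m) (yv (a m) j)" by metis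
    obtain r where r: "strict_mono (r :: nat \<Rightarrow> nat)"
      "(\<lambda>m. vel V (yv (a (r m)) True) (dv (a (r m)) True) i) \<longlonglongrightarrow> vel V (yv x True) (dv x True) i"
      "(\<lambda>m. pos V (yv (a (r m)) True) i) \<longlonglongrightarrow> pos V (yv x True) i"
      using vel_subsequence[OF V(1) q p(1) tan(1) i(1) yv_tendsto[OF a] dv_tendsto[OF a]] by blast
    have ar: "G.converges (\<lambda>m. a (r m)) x" using G.converges_subseq[OF a r(1)] by (simp add: o_def)
    obtain s where s: "strict_mono (s :: nat \<Rightarrow> nat)"
      "(\<lambda>m. vel V' (yv (a (r (s m))) False) (dv (a (r (s m))) False) i) \<longlonglongrightarrow> vel V' (yv x False) (dv x False) i"
      "(\<lambda>m. pos V' (yv (a (r (s m))) False) i) \<longlonglongrightarrow> pos V' (yv x False) i"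
      using vel_subsequence[OF V'(1) q p(2) tan(2) i(1) yv_tendsto[OF ar] dv_tendsto[OF ar]] by blast
    have rs: "(\<lambda>m. vel V (yv (a (r (s m))) True) (dv (a (r (s m))) True) i) \<longlonglongrightarrow> vel V (yv x True) (dv x True) i"
      "(\<lambda>m. pos V (yv (a (r (s m))) True) i) \<longlonglongrightarrow> pos V (yv x True) i"
      using LIMSEQ_subseq_LIMSEQ[OF r(2) s(1)] LIMSEQ_subseq_LIMSEQ[OF r(3) s(1)] by (simp_all add: o_def)
    have "(\<lambda>m. a (r (s m)) Time) \<longlonglongrightarrow> x Time"
      using G.converges_subseq[OF ar s(1)] by (simp add: o_def G.converges_def)
    then have "(\<lambda>m. tf i (a (r (s m)))) \<longlonglongrightarrow> tf i x"
      using i(1) unfolding tf_def by (auto intro!: tendsto_intros s(2,3) rs)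
    moreover have "strict_mono (r \<circ> s)" using strict_mono_o[OF r(1) s(1)] .
    ultimately show "\<exists>r. strict_mono (r :: nat \<Rightarrow> nat) \<and> (\<lambda>m. tf i (a (r m))) \<longlonglongrightarrow> tf i x"
      by (intro exI[of _ "r \<circ> s"]) simp
  qed
  then show ?thesis using i(1) by blast
qed

end

section \<open>The top characteristic number\<close>

context gauge_chain
begin

lemma Var_cong:
  assumes "character \<kappa>" "character \<mu>" "\<And>g. g \<in> \<Gamma> \<Longrightarrow> \<kappa> g = \<mu> g"
  shows "Var \<kappa> \<doteq> Var \<mu>"
proof (rule lin_eqv.eqv_cancel, rule lin_eqv.eqv_trans)
  show "Var \<kappa> + Var \<mu> \<doteq> Var (\<lambda>g. \<kappa> g + \<mu> g)" by (rule lin_eqv.eqv_sym[OF Var_add[OF assms(1,2)]])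
  show "Var (\<lambda>g. \<kappa> g + \<mu> g) \<doteq> 0" by (rule Var_trivial) (use assms(3) in simp)
qed

lemma prod_coords:
  assumes "distinct cs"
  shows "(\<Prod>c\<in>set cs. Var (\<kappa> c)) = prod_list (map Var (map \<kappa> cs))"
  using prod.distinct_set_conv_list[OF assms, of "\<lambda>c. Var (\<kappa> c)"] by (simp add: comp_def)

lemma prod_coords_eqv_0:
  assumes S: "S \<subseteq> I" and empty: "face \<Omega> S = {}"
  shows "(\<Prod>c\<in>S. Var (\<lambda>g. of_bool (c \<in> g))) \<doteq> 0"
proof -
  obtain cs where cs: "set cs = S" "distinct cs" using finite_distinct_list[OF finite_sub[OF S]] by blast
  show ?thesis unfolding cs(1)[symmetric] prod_coords[OF cs(2)]
  proof (rule ceq_0I)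
    fix \<mu>s :: "('a set \<Rightarrow> bit) list"
    assume "length (map (\<lambda>c g. of_bool (c \<in> g)) cs) + length \<mu>s = D" "\<forall>\<kappa>\<in>set \<mu>s. character \<kappa>"
    then show "E {} (map (\<lambda>c g. of_bool (c \<in> g)) cs @ \<mu>s) = 0"
      using cs S empty by (intro E_coords_eq_0) auto
  qed
qed

lemma lin_prod_coords:
  assumes S: "S \<subseteq> I" "card S = D" and ne: "face \<Omega> S \<noteq> {}"
    and cut: "\<And>c. c \<in> S \<Longrightarrow> \<exists>g\<in>\<Gamma>. c \<in> g" and gen: "\<And>c. c \<in> I - S \<Longrightarrow> \<exists>g\<in>\<Gamma>. g - S = {c}"
  shows "lin Em (\<Prod>c\<in>S. Var (\<lambda>g. of_bool (c \<in> g))) = 1"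
proof -
  obtain cs where cs: "set cs = S" "distinct cs" using finite_distinct_list[OF finite_sub[OF S(1)]] by blast
  have len: "length cs = D" using S(2) cs distinct_card by fastforce
  let ?\<kappa>s = "map (\<lambda>c g. of_bool (c \<in> g)) cs :: ('a set \<Rightarrow> bit) list"
  have ch: "\<forall>\<kappa>\<in>set ?\<kappa>s. character \<kappa>" using character_coord by auto
  have "lin Em (\<Prod>c\<in>S. Var (\<lambda>g. of_bool (c \<in> g))) = Em (mset ?\<kappa>s)"
    unfolding cs(1)[symmetric] prod_coords[OF cs(2)] prod_Var by (rule lin_single)
  also have "\<dots> = E {} ?\<kappa>s" using len by (intro Em_mset ch) simp
  also have "\<dots> = E ({} \<union> set cs) []"
    using E_cuts[of "{}" cs "[]"] len cs S cut by simp
  also have "\<dots> = 1" using ev_vertex[OF S ne gen] cs by (simp add: E_def)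
  finally show ?thesis .
qed

end

lemma bit_sum_of_bool:
  assumes "finite A" "even (card (A \<inter> B))"
  shows "(\<Sum>F\<in>A. of_bool (F \<in> B) :: bit) = 0"
proof -
  obtain l where l: "card (A \<inter> B) = 2 * l" using assms(2) by (auto elim: evenE)
  have "(\<Sum>F\<in>A. of_bool (F \<in> B) :: bit) = of_nat (card (A \<inter> B))"
    using assms(1) by (simp add: of_bool_def sum.If_cases Int_def)
  then show ?thesis by (simp add: l)
qed

section \<open>Relations and generators from the characteristic matrix\<close>

context colored_poly
begin

definition rank :: "'n \<Rightarrow> nat" where
  "rank c = card {i. i < c}"

lemma rank_less: "c < c' \<Longrightarrow> rank c < rank c'"
  unfolding rank_def by (intro psubset_card_mono) auto

lemma rank_iff: "rank c < rank c' \<longleftrightarrow> c < c'" "rank c = rank c' \<longleftrightarrow> c = c'"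
  using rank_less by (metis linorder_cases less_irrefl less_asym)+

lemma rank_bij: "bij_betw rank UNIV {..<CARD('n)}"
proof -
  have inj: "inj rank" using rank_iff(2) by (simp add: inj_def)
  have "rank c < CARD('n)" for c unfolding rank_def by (intro psubset_card_mono) auto
  then have "range rank = {..<CARD('n)}" using card_image[OF inj] by (intro card_subset_eq) auto
  then show ?thesis using inj by (simp add: bij_betw_def)
qed

definition unrank :: "nat \<Rightarrow> 'n" where
  "unrank = inv_into UNIV rank"

lemma unrank: "unrank (rank c) = c" and rank_unrank: "i < CARD('n) \<Longrightarrow> rank (unrank i) = i"
  using rank_bij by (auto simp: unrank_def bij_betw_def f_inv_into_f)

lemma rank_Max: "rank (Max UNIV) = CARD('n) - 1"
proof -
  have "{i::'n. i < Max UNIV} = UNIV - {Max UNIV}" using Max_ge[OF finite, of _ UNIV] by (auto simp: less_le)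
  then show ?thesis by (simp add: rank_def)
qed

lemma below_bij: "bij_betw unrank {..<rank c} {c'. c' < c}"
proof -
  have le: "i < CARD('n)" if "i < rank c" for i
    using that bij_betw_imp_surj_on[OF rank_bij] by (metis lessThan_iff less_trans rangeI)
  have 1: "rank (unrank i) = i" if "i < rank c" for i by (rule rank_unrank[OF le[OF that]])
  have 2: "unrank i < c" if "i < rank c" for i
    using 1[OF that] that rank_iff(1)[of "unrank i" c] by simp
  have 3: "rank c' < rank c" if "c' < c" for c' using that rank_iff(1) by blast
  show ?thesis
    by (rule bij_betw_byWitness[where f' = rank]) (use 1 2 3 unrank in auto)
qed

text \<open>The facets counted here are those with a one in row \<open>c\<close> of the characteristic matrix.\<close>

lemma even_set_row:
  assumes A: "even_set A"
  shows "even (card (({F \<in> facets. h F = c} \<union> H ` {c'. c' < c}) \<inter> A))"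
proof -
  let ?R = "{F \<in> facets. h F = c} \<union> H ` {c'. c' < c}"
  have fin: "finite A" and sub: "A \<subseteq> facets" using A finite_facets finite_subset by (auto simp: even_set_def)
  have "\<Lambda> F $ c = of_bool (F \<in> ?R)" if "F \<in> facets" for F
  proof -
    have "F \<in> H ` {c'. c' < c} \<longleftrightarrow> F = H (h F) \<and> h F < c" using h_H by auto
    then show ?thesis using that
      by (cases "F = H (h F)"; cases "h F = c"; simp add: char_vector_def axis_def le_less)
  qed
  then have "(\<Sum>F\<in>A. \<Lambda> F $ c) = (\<Sum>F\<in>A. of_bool (F \<in> ?R))" using sub by (intro sum.cong) auto
  also have "\<dots> = int (card (?R \<inter> A))" using fin by (simp add: of_bool_def sum.If_cases Int_def conj_commute)
  finally have eq: "(\<Sum>F\<in>A. \<Lambda> F $ c) = int (card (?R \<inter> A))" .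
  have "even (\<Sum>F\<in>A. \<Lambda> F $ c)" using A by (simp add: even_set_def)
  then show ?thesis unfolding eq by (rule even_of_nat[THEN iffD1])
qed

text \<open>Modulo two, \<open>\<Lambda> F\<close> is the sum of those characteristic vectors at
  \<open>v\<close> whose coefficient \<open>mm v i F\<close> is odd.\<close>

lemma even_set_vertex:
  assumes v: "v extreme_point_of P" and F: "F \<in> facets - facets_at v"
  shows "\<exists>A. even_set A \<and> F \<in> A \<and> A \<subseteq> insert F (facets_at v)"
proof -
  define B where "B = {i. odd (mm v i F)}"
  define A where "A = insert F (fa v ` B)"
  have "F \<notin> fa v ` B" using F fa_mem[OF v] by auto
  have sum: "(\<Sum>G\<in>A. \<Lambda> G $ j) = \<Lambda> F $ j + (\<Sum>i\<in>B. \<Lambda> (fa v i) $ j)" for j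
  proof -
    have "inj_on (fa v) B" using fa_inj[OF v] by (auto simp: inj_on_def)
    then show ?thesis using \<open>F \<notin> _\<close> unfolding A_def by (simp add: sum.reindex)
  qed
  have "even (\<Sum>G\<in>A. \<Lambda> G $ j)" for j
  proof -
    have "\<Lambda> F $ j = (\<Sum>i\<in>B. mm v i F * \<Lambda> (fa v i) $ j) + (\<Sum>i\<in>- B. mm v i F * \<Lambda> (fa v i) $ j)"
      using Lambda_mm[OF v, of F j] sum.Int_Diff[of UNIV "\<lambda>i. mm v i F * \<Lambda> (fa v i) $ j" B]
      by (simp add: Compl_eq_Diff_UNIV)
    moreover have "even (\<Sum>i\<in>- B. mm v i F * \<Lambda> (fa v i) $ j)" by (rule dvd_sum) (simp add: B_def)
    moreover have "even ((\<Sum>i\<in>B. mm v i F * \<Lambda> (fa v i) $ j) + (\<Sum>i\<in>B. \<Lambda> (fa v i) $ j))"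
      unfolding sum.distrib[symmetric] by (rule dvd_sum) (simp add: B_def)
    ultimately show ?thesis unfolding sum by (simp add: algebra_simps)
  qed
  moreover have "A \<subseteq> facets" using F fa_facets[OF v] by (auto simp: A_def)
  ultimately have "even_set A" by (simp add: even_set_def)
  then show ?thesis using fa_mem[OF v] by (intro exI[of _ A]) (auto simp: A_def)
qed

text \<open>The vector of \<open>H i\<close> is the sum of the unit vectors of the colors from
  \<open>i\<close> on. Each color has a facet besides the special one, found at the end of the edge
  leaving the latter, and its vector is the unit vector.\<close>

lemma even_set_H:
  assumes v: "v extreme_point_of P" "facets_at v = range H"
  shows "\<exists>A. even_set A \<and> H i \<in> A"
proof -
  have "\<exists>G\<in>facets. h G = k \<and> G \<noteq> H k" for k
  proof -
    have Hk: "H k \<in> facets_at v" using v(2) by simp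
    obtain w G where w: "w extreme_point_of P" "G \<notin> facets_at v" "facets_at w = insert G (facets_at v - {H k})"
      using opposite_vertex[OF v(1) Hk] by blast
    have "fa w k \<in> facets_at w" "h (fa w k) = k" using fa_mem[OF w(1)] h_fa[OF w(1)] by auto
    moreover have "fa w k \<noteq> H k" using \<open>fa w k \<in> facets_at w\<close> w(2,3) Hk by auto
    ultimately show ?thesis by (auto simp: facets_at_def)
  qed
  then obtain G where G: "\<And>k. G k \<in> facets" "\<And>k. h (G k) = k" "\<And>k. G k \<noteq> H k" by metis
  define A where "A = insert (H i) (G ` {k. i \<le> k})"
  have "H i \<notin> G ` {k. i \<le> k}" using G h_H by (metis imageE)
  moreover have "inj_on G {k. i \<le> k}" using G(2) by (metis inj_onI)
  ultimately have "(\<Sum>F\<in>A. \<Lambda> F $ j) = \<Lambda> (H i) $ j + (\<Sum>k\<in>{k. i \<le> k}. \<Lambda> (G k) $ j)" for j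
    unfolding A_def by (simp add: sum.reindex)
  moreover have "(\<Sum>k\<in>{k. i \<le> k}. \<Lambda> (G k) $ j) = (\<Sum>k\<in>{k. i \<le> k}. if k = j then 1 else 0)" for j
    using G by (intro sum.cong) (auto simp: char_vector_def axis_def)
  ultimately have "even (\<Sum>F\<in>A. \<Lambda> F $ j)" for j
    by (simp add: char_vector_def h_H)
  moreover have "A \<subseteq> facets" using G(1) H_facet by (auto simp: A_def facets_def)
  ultimately show ?thesis by (intro exI[of _ A]) (simp add: even_set_def A_def)
qed

end

section \<open>A vertex of the configuration space\<close>

context skew_pair
begin

lemma H_not_F0: "i \<noteq> top \<Longrightarrow> H i \<in> facets - {F0 j}"
  using F0(2)[of j] h_H[of i] H_facet by (auto simp: facets_def)

end

context skew_pair
begin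

lemma facets_at_vb: "F \<in> facets_at (vb j) \<Longrightarrow> F = F0 j \<or> (\<exists>i. i \<noteq> top \<and> F = H i)"
  using fa_h[OF vb, of F j] fa_vb[of "h F" j] unfolding F0_def by metis

lemma dir_mem_Gam: "\<exists>g\<in>Gam. Dir j F b \<in> Co \<longrightarrow> Dir j F b \<in> g"
  using even_set_empty by (intro bexI[of _ "flips True (\<lambda>_. {})"]) (auto simp: mem_flips Gam_def)

lemma single_flip:
  assumes "even_set A"
  shows "flips False (\<lambda>j'. if j' = j then A else {}) \<in> Gam"
    "Base j' F b \<in> flips False (\<lambda>j'. if j' = j then A else {}) \<longleftrightarrow> j' = j \<and> F \<in> A \<and> Base j F b \<in> Co"
    "Time \<notin> flips False (\<lambda>j'. if j' = j then A else {})"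
proof -
  have "\<forall>j'. even_set (if j' = j then A else {})" using assms even_set_empty by simp
  then show "flips False (\<lambda>j'. if j' = j then A else {}) \<in> Gam" unfolding Gam_def by blast
qed (auto simp: mem_flips)

definition base_set :: "bool \<Rightarrow> ('a set, 'k) coord set" where
  "base_set j = (\<lambda>(F, b). Base j F b) ` ((facets - {F0 j}) \<times> Basis)"

definition dir_set :: "bool \<Rightarrow> ('a set, 'k) coord set" where
  "dir_set j = (\<lambda>(F, b). Dir j F b) ` (facets \<times> Basis)"

definition pole_set :: "bool \<Rightarrow> ('a set, 'k) coord set" where
  "pole_set j = (\<lambda>(i, b). Base j (H i) b) ` ((UNIV - {top}) \<times> Basis)"

definition rest_set :: "bool \<Rightarrow> ('a set, 'k) coord set" where
  "rest_set j = (\<lambda>(F, b). Base j F b) ` ((facets - facets_at (vb j)) \<times> (Basis - {1}))"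

text \<open>The nonzero coordinates at this vertex are \<open>Time\<close> and the real parts
  \<open>Base j F 1\<close> of the facets that miss \<open>vb j\<close>: the two points lie over
  \<open>V\<close> and \<open>V'\<close>, and both directions are zero.\<close>

definition vertex_set :: "('a set, 'k) coord set" where
  "vertex_set = (dir_set True \<union> dir_set False) \<union> (pole_set True \<union> pole_set False) \<union> (rest_set True \<union> rest_set False)"

lemma mem_vertex_set:
  "Base j F b \<in> vertex_set \<longleftrightarrow> b \<in> Basis \<and> ((\<exists>i. i \<noteq> top \<and> F = H i) \<or> F \<in> facets - facets_at (vb j) \<and> b \<noteq> 1)"
  "Dir j F b \<in> vertex_set \<longleftrightarrow> F \<in> facets \<and> b \<in> Basis"
  "Time \<notin> vertex_set"
  by (cases j; auto simp: vertex_set_def dir_set_def pole_set_def rest_set_def image_iff)+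

lemma card_sets:
  shows "card (base_set j) = (card facets - 1) * DIM('k)" "card (dir_set j) = card facets * DIM('k)"
    "card (pole_set j) = (CARD('n) - 1) * DIM('k)" "card (rest_set j) = (card facets - CARD('n)) * (DIM('k) - 1)"
proof -
  have "card (facets - facets_at (vb j)) = card facets - CARD('n)"
    using card_Diff_subset[of "facets_at (vb j)" facets] finite_facets_at card_facets_at[OF vb] by (simp add: facets_at_def)
  moreover have "inj_on H A" for A using h_H by (metis inj_onI)
  ultimately show "card (base_set j) = (card facets - 1) * DIM('k)" "card (dir_set j) = card facets * DIM('k)"
    "card (pole_set j) = (CARD('n) - 1) * DIM('k)" "card (rest_set j) = (card facets - CARD('n)) * (DIM('k) - 1)"
    using F0(1)[of j] finite_facets one h_H unfolding base_set_def dir_set_def pole_set_def rest_set_def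
    by (subst card_image; auto simp: inj_on_def card_cartesian_product)+
qed

lemma finite_sets: "finite (base_set j)" "finite (dir_set j)" "finite (pole_set j)" "finite (rest_set j)"
  using finite_facets by (auto simp: base_set_def dir_set_def pole_set_def rest_set_def)

lemma disjoint_sets:
  "base_set True \<inter> base_set False = {}" "dir_set True \<inter> dir_set False = {}"
  "pole_set True \<inter> pole_set False = {}" "rest_set True \<inter> rest_set False = {}"
  "(base_set True \<union> base_set False) \<inter> (dir_set True \<union> dir_set False) = {}"
  "(dir_set True \<union> dir_set False) \<inter> (pole_set True \<union> pole_set False) = {}"
  "((dir_set True \<union> dir_set False) \<union> (pole_set True \<union> pole_set False)) \<inter> (rest_set True \<union> rest_set False) = {}"
proof -
  have H: "H i \<in> facets_at (vb j)" if "i \<noteq> top" for i j using fa_mem[OF vb, of j i] fa_vb[OF that] by simp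
  have base: "\<exists>F b. c = Base j F b" if "c \<in> base_set j" for c j using that by (auto simp: base_set_def)
  have dir: "\<exists>F b. c = Dir j F b" if "c \<in> dir_set j" for c j using that by (auto simp: dir_set_def)
  have pole: "\<exists>F b. c = Base j F b \<and> F \<in> facets_at (vb j)" if c: "c \<in> pole_set j" for c j
  proof -
    obtain i b where "c = Base j (H i) b" "i \<noteq> top" using c by (auto simp: pole_set_def)
    then show ?thesis using H by blast
  qed
  have rest: "\<exists>F b. c = Base j F b \<and> F \<notin> facets_at (vb j)" if "c \<in> rest_set j" for c j
    using that by (auto simp: rest_set_def)
  show "base_set True \<inter> base_set False = {}" by (rule Int_emptyI) (auto dest!: base)
  show "dir_set True \<inter> dir_set False = {}" by (rule Int_emptyI) (auto dest!: dir)
  show "pole_set True \<inter> pole_set False = {}" by (rule Int_emptyI) (auto dest!: pole)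
  show "rest_set True \<inter> rest_set False = {}" by (rule Int_emptyI) (auto dest!: rest)
  show "(base_set True \<union> base_set False) \<inter> (dir_set True \<union> dir_set False) = {}"
    by (rule Int_emptyI) (auto dest!: base dir)
  show "(dir_set True \<union> dir_set False) \<inter> (pole_set True \<union> pole_set False) = {}"
    by (rule Int_emptyI) (auto dest!: dir pole)
  show "((dir_set True \<union> dir_set False) \<union> (pole_set True \<union> pole_set False)) \<inter> (rest_set True \<union> rest_set False) = {}"
    by (rule Int_emptyI) (auto dest!: dir pole rest)
qed

lemma card_Co: "card Co = 2 * ((card facets - 1) * DIM('k)) + 2 * (card facets * DIM('k)) + 1"
proof -
  have "Co = insert Time ((base_set True \<union> base_set False) \<union> (dir_set True \<union> dir_set False))"
  proof (rule Set.set_eqI)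
    fix c
    have "Base j F b \<in> base_set True \<union> base_set False \<longleftrightarrow> F \<in> facets \<and> F \<noteq> F0 j \<and> b \<in> Basis"
      "Dir j F b \<in> dir_set True \<union> dir_set False \<longleftrightarrow> F \<in> facets \<and> b \<in> Basis"
      "Base j F b \<notin> dir_set j'" "Dir j F b \<notin> base_set j'" for j j' F b
      by (cases j; force simp: base_set_def dir_set_def)+
    then show "c \<in> Co \<longleftrightarrow> c \<in> insert Time ((base_set True \<union> base_set False) \<union> (dir_set True \<union> dir_set False))"
      by (cases c) simp_all
  qed
  moreover have "Time \<notin> (base_set True \<union> base_set False) \<union> (dir_set True \<union> dir_set False)"
    by (auto simp: base_set_def dir_set_def)
  ultimately show ?thesis
    using finite_sets disjoint_sets by (simp add: card_Un_disjoint card_sets)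
qed

lemma card_facets_ge: "CARD('n) \<le> card facets" "0 < CARD('n)"
  using card_mono[OF finite_facets, of "facets_at V"] card_facets_at[OF V(1)] n_pos by (auto simp: facets_at_def)

lemma Dm_eq: "Dm = 2 * (CARD('n) - 1) + 2 * ((card facets - 1) * DIM('k)) + 2 * (card facets * DIM('k)) - 2 * (card facets - 1)"
  using F0(1) finite_facets by (simp add: Dm_def card_Co card_Plus)

lemma card_vertex_set:
  assumes "DIM('k) \<in> {1, 2}"
  shows "card vertex_set = Dm"
proof -
  have "card vertex_set = 2 * (card facets * DIM('k)) + 2 * ((CARD('n) - 1) * DIM('k)) +
      2 * ((card facets - CARD('n)) * (DIM('k) - 1))"
    using finite_sets disjoint_sets unfolding vertex_set_def by (simp add: card_Un_disjoint card_sets)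
  moreover have "2 * (r * d) + 2 * ((n - 1) * d) + 2 * ((r - n) * (d - 1)) =
      2 * (n - 1) + 2 * ((r - 1) * d) + 2 * (r * d) - 2 * (r - 1)"
    if "n \<le> r" "0 < n" "d \<in> {1, 2}" for r n d :: nat
    using that by auto
  ultimately show ?thesis using card_facets_ge assms unfolding Dm_eq by metis
qed

lemma vertex_set_sub: "vertex_set \<subseteq> Co"
proof
  fix c assume c: "c \<in> vertex_set"
  show "c \<in> Co"
  proof (cases c)
    case (Base j F b)
    then show ?thesis using c F0(3)[of j] H_not_F0[of _ j] by (auto simp: mem_vertex_set)
  qed (use c in \<open>auto simp: mem_vertex_set\<close>)
qed

lemma face_vertex_set: "face Om vertex_set \<noteq> {}"
  unfolding face_Om
proof (intro conjI allI bexI[OF _ vertex_in_P[OF vb]])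
  fix j
  show "F0 j \<in> facets_at (vb j)" by (rule F0(3))
  show "\<forall>F\<in>facets - {F0 j}. (\<forall>b\<in>Basis. Base j F b \<in> vertex_set) \<longrightarrow> F \<in> facets_at (vb j)"
  proof (intro ballI impI)
    fix F assume "\<forall>b\<in>Basis. Base j F b \<in> vertex_set"
    then have "Base j F 1 \<in> vertex_set" using one by blast
    then obtain i where "i \<noteq> top" "F = H i" by (auto simp: mem_vertex_set)
    then show "F \<in> facets_at (vb j)" using fa_mem[OF vb, of j i] fa_vb[of i j] by simp
  qed
qed (simp add: mem_vertex_set)

lemma vertex_set_cut:
  assumes c: "c \<in> vertex_set"
  shows "\<exists>g\<in>Gam. c \<in> g"
proof (cases c)
  case (Base j F b)
  have "\<exists>A. even_set A \<and> F \<in> A"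
  proof (cases "F \<in> facets - facets_at (vb j)")
    case True
    then show ?thesis using even_set_vertex[OF vb] by blast
  next
    case False
    then obtain i where "F = H i" using c Base by (auto simp: mem_vertex_set)
    then show ?thesis using even_set_H[OF V] by blast
  qed
  then obtain A where A: "even_set A" "F \<in> A" by blast
  have "c \<in> flips False (\<lambda>j'. if j' = j then A else {})"
    unfolding Base single_flip(2)[OF A(1)] using A(2) c Base vertex_set_sub by auto
  then show ?thesis using single_flip(1)[OF A(1)] by blast
next
  case (Dir j F b)
  then show ?thesis using dir_mem_Gam[of j F b] c vertex_set_sub by auto
qed (use c in \<open>simp add: mem_vertex_set\<close>)

text \<open>For \<open>ev_vertex\<close>: the antipode changes the sign of \<open>Time\<close>, and
  an even set within \<open>F\<close> and the facets at \<open>vb j\<close> changes that of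
  \<open>Base j F 1\<close>, each with no other effect outside \<open>vertex_set\<close>.\<close>

lemma vertex_set_generator:
  assumes c: "c \<in> Co - vertex_set"
  shows "\<exists>g\<in>Gam. g - vertex_set = {c}"
proof (cases c)
  case (Base j F b)
  have F: "F \<in> facets" "F \<noteq> F0 j" "b \<in> Basis" using c Base by auto
  have "F \<notin> facets_at (vb j)" using facets_at_vb[of F j] F(2,3) c Base by (auto simp: mem_vertex_set)
  then have F': "F \<in> facets - facets_at (vb j)" "b = 1" using c Base F by (auto simp: mem_vertex_set)
  obtain A where A: "even_set A" "F \<in> A" "A \<subseteq> insert F (facets_at (vb j))" using even_set_vertex[OF vb F'(1)] by blast
  let ?g = "flips False (\<lambda>j'. if j' = j then A else {})"
  have "c' \<in> ?g - vertex_set \<longleftrightarrow> c' = c" for c'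
  proof (cases c')
    case (Base j' G b')
    have "c' = c" if g: "c' \<in> ?g - vertex_set"
    proof -
      have "Base j' G b' \<in> ?g" using g Base by simp
      then have G: "j' = j" "G \<in> A" "G \<in> facets" "G \<noteq> F0 j" "b' \<in> Basis" unfolding single_flip(2)[OF A(1)] by auto
      then have "G = F" using A(3) facets_at_vb[of G j] g Base by (auto simp: mem_vertex_set)
      then show ?thesis using G g F' Base \<open>c = _\<close> by (auto simp: mem_vertex_set)
    qed
    moreover have "c \<in> ?g" unfolding \<open>c = _\<close> single_flip(2)[OF A(1)] using A(2) F by simp
    ultimately show ?thesis using c by blast
  next
    case (Dir j' G b')
    then have "c' \<notin> ?g - vertex_set" by (auto simp: mem_flips mem_vertex_set)
    then show ?thesis using Dir Base by simp
  next
    case Time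
    then show ?thesis using single_flip(3)[OF A(1)] Base by auto
  qed
  then show ?thesis using single_flip(1)[OF A(1)] by blast
next
  case (Dir j F b)
  then show ?thesis using c by (auto simp: mem_vertex_set)
next
  case Time
  have "c' \<in> flips True (\<lambda>_. {}) - vertex_set \<longleftrightarrow> c' = Time" for c'
    by (cases c') (auto simp: mem_flips mem_vertex_set)
  then show ?thesis unfolding Time using even_set_empty
    by (intro bexI[of _ "flips True (\<lambda>_. {})"]) (auto simp: Gam_def)
qed

end

section \<open>The top power of the class of the antipode\<close>

locale skew_chain = skew_pair P h H N f V V' F'
  for P :: "'a::euclidean_space set" and h :: "'a set \<Rightarrow> 'n::{finite,linorder}" and H :: "'n \<Rightarrow> 'a set" and N :: nat
    and f :: "(('k::{real_normed_field,euclidean_space}, 'n) vec \<times> 'a) set \<Rightarrow> nat \<Rightarrow> real" and V V' F' +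
  fixes k :: nat and \<epsilon> :: real and z :: "('a set, 'k) coord set \<Rightarrow> ((('a set, 'k) coord \<Rightarrow> real) list \<Rightarrow> bit) \<Rightarrow> bit"
  assumes card_n: "CARD('n) = 2 ^ k" and dim: "DIM('k) \<in> {1, 2}" and chain: "G.chain_system \<epsilon> z"
begin

sublocale C: gauge_chain Co Om Dm Gam \<epsilon> z
  by unfold_locales (rule chain)

abbreviation eqv :: "(('a set, 'k) coord set \<Rightarrow> bit) mpoly2 \<Rightarrow> (('a set, 'k) coord set \<Rightarrow> bit) mpoly2 \<Rightarrow> bool"
  (infix "\<simeq>" 50) where "p \<simeq> q \<equiv> lin_eqv C.Em p q"

abbreviation vc :: "('a set, 'k) coord \<Rightarrow> (('a set, 'k) coord set \<Rightarrow> bit) mpoly2" where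
  "vc c \<equiv> Var (coord_char c)"

text \<open>A direction feels the antipode as well; adding the character of \<open>Time\<close>
  removes this and leaves membership of \<open>F\<close> in \<open>A j\<close>. Unlike the base
  coordinates this is available also for the facet \<open>F0 j\<close>.\<close>

definition chi :: "bool \<Rightarrow> 'a set \<Rightarrow> ('a set, 'k) coord set \<Rightarrow> bit" where
  "chi j F = (\<lambda>g. coord_char (Dir j F 1) g + coord_char Time g)"

abbreviation va :: "bool \<Rightarrow> 'a set \<Rightarrow> (('a set, 'k) coord set \<Rightarrow> bit) mpoly2" where
  "va j F \<equiv> Var (chi j F)"

lemma coord_char_fun: "coord_char c = (\<lambda>g. of_bool (c \<in> g))"
  by (intro ext) (simp add: coord_char_def)

lemma character_chi: "G.character (chi j F)"
  unfolding chi_def by (intro C.character_add character_coord_char)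

lemma chi_flips: "F \<in> facets \<Longrightarrow> chi j F (flips s A) = of_bool (F \<in> A j)"
  using one by (auto simp: chi_def coord_char_def mem_flips)

lemma va_Base:
  assumes "F \<in> facets - {F0 j}" "b \<in> Basis"
  shows "va j F \<simeq> vc (Base j F b)"
proof (rule C.Var_cong[OF character_chi character_coord_char])
  fix g assume "g \<in> Gam"
  then obtain s A where "g = flips s A" unfolding Gam_def by blast
  then show "chi j F g = coord_char (Base j F b) g"
    using assms by (simp add: chi_flips) (simp add: coord_char_def mem_flips)
qed

lemma va_Dir:
  assumes "F \<in> facets" "b \<in> Basis"
  shows "vc Time + va j F \<simeq> vc (Dir j F b)"
proof (rule lin_eqv.eqv_trans)
  show "vc Time + va j F \<simeq> Var (\<lambda>g. coord_char Time g + chi j F g)"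
    by (rule lin_eqv.eqv_sym[OF C.Var_add[OF character_coord_char character_chi]])
  show "Var (\<lambda>g. coord_char Time g + chi j F g) \<simeq> vc (Dir j F b)"
  proof (rule C.Var_cong)
    show "G.character (\<lambda>g. coord_char Time g + chi j F g)"
      by (intro C.character_add character_coord_char character_chi)
    fix g assume "g \<in> Gam"
    then obtain s A where "g = flips s A" unfolding Gam_def by blast
    then show "coord_char Time g + chi j F g = coord_char (Dir j F b) g"
      using assms by (simp add: chi_flips) (auto simp: coord_char_def mem_flips)
  qed (rule character_coord_char)
qed

lemma power_Basis: "(\<And>b::'k. b \<in> Basis \<Longrightarrow> p \<simeq> g b) \<Longrightarrow> p ^ DIM('k) \<simeq> (\<Prod>b\<in>(Basis::'k set). g b)"
  using lin_eqv.eqv_prod[of "Basis :: 'k set" C.Em "\<lambda>_. p" g] by simp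

lemma va_power: "F \<in> facets - {F0 j} \<Longrightarrow> va j F ^ DIM('k) \<simeq> (\<Prod>b\<in>(Basis::'k set). vc (Base j F b))"
  by (intro power_Basis va_Base)

lemma prod_vc_eqv_0:
  assumes "S \<subseteq> Co" "face Om S = {}"
  shows "(\<Prod>c\<in>S. vc c) \<simeq> 0"
  unfolding coord_char_fun by (rule C.prod_coords_eqv_0[OF assms])

text \<open>No base coordinate belongs to \<open>F0 j\<close>, so its class is not cut out by
  coordinates. But the other facets of its color do not meet it, and their powers vanish by
  themselves.\<close>

lemma va_orth:
  assumes F: "F \<in> facets" "G \<in> facets" "F \<noteq> G" "h F = h G"
  shows "va j F ^ DIM('k) * va j G ^ DIM('k) \<simeq> 0"
proof -
  let ?B = "\<lambda>F. Base j F ` (Basis::'k set)"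
  have prod: "(\<Prod>c\<in>?B F. vc c) = (\<Prod>b\<in>Basis. vc (Base j F b))" for F
    by (simp add: prod.reindex inj_on_def)
  have F0: "va j F ^ DIM('k) \<simeq> 0" if "F \<in> facets" "F \<noteq> F0 j" "h F = h (F0 j)" for F
  proof -
    have "face Om (?B F) = {}"
    proof (rule ccontr)
      assume "face Om (?B F) \<noteq> {}"
      then obtain p where p: "F0 j \<in> facets_at p" "\<forall>F'\<in>facets - {F0 j}. (\<forall>b\<in>Basis. Base j F' b \<in> ?B F) \<longrightarrow> F' \<in> facets_at p"
        unfolding face_Om by blast
      then have "F \<in> facets_at p" using that by auto
      then show False using color_inj p(1) that by metis
    qed
    then have "(\<Prod>c\<in>?B F. vc c) \<simeq> 0" using that by (intro prod_vc_eqv_0) auto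
    moreover have "va j F ^ DIM('k) \<simeq> (\<Prod>c\<in>?B F. vc c)" unfolding prod using that by (intro va_power) auto
    ultimately show ?thesis using lin_eqv.eqv_trans by blast
  qed
  show ?thesis
  proof (cases "F = F0 j \<or> G = F0 j")
    case True
    then show ?thesis using F0[of F] F0[of G] F lin_eqv.eqv_0_mult by metis
  next
    case False
    have "face Om (?B F \<union> ?B G) = {}"
    proof (rule ccontr)
      assume "face Om (?B F \<union> ?B G) \<noteq> {}"
      then obtain p where p: "\<forall>F'\<in>facets - {F0 j}. (\<forall>b\<in>Basis. Base j F' b \<in> ?B F \<union> ?B G) \<longrightarrow> F' \<in> facets_at p"
        unfolding face_Om by blast
      then have "F \<in> facets_at p" "G \<in> facets_at p" using F False by auto
      then show False using color_inj F by metis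
    qed
    then have "(\<Prod>c\<in>?B F \<union> ?B G. vc c) \<simeq> 0" using F False by (intro prod_vc_eqv_0) auto
    moreover have "(\<Prod>c\<in>?B F \<union> ?B G. vc c) = (\<Prod>c\<in>?B F. vc c) * (\<Prod>c\<in>?B G. vc c)"
      using F(3) by (intro prod.union_disjoint) auto
    moreover have "va j F ^ DIM('k) * va j G ^ DIM('k) \<simeq> (\<Prod>c\<in>?B F. vc c) * (\<Prod>c\<in>?B G. vc c)"
      unfolding prod using F False by (intro lin_eqv.eqv_mult va_power) auto
    ultimately show ?thesis using lin_eqv.eqv_trans by (simp only:) blast
  qed
qed

text \<open>An even set contains an even number of the facets with a one in row \<open>i\<close>, so
  the sum of their characters is trivial.\<close>

lemma va_row:
  assumes i: "i < CARD('n)"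
  shows "(\<Sum>F\<in>{F\<in>facets. rank (h F) = i}. va j F) + (\<Sum>l<i. va j (H (unrank l))) \<simeq> 0"
proof -
  define c where "c = unrank i"
  have rc: "rank c = i" unfolding c_def by (rule rank_unrank[OF i])
  let ?A = "{F\<in>facets. h F = c}" and ?B = "H ` {c'. c' < c}"
  have "rank (h F) = i \<longleftrightarrow> h F = c" for F using rc rank_iff(2) by metis
  then have s1: "(\<Sum>F\<in>{F\<in>facets. rank (h F) = i}. va j F) = (\<Sum>F\<in>?A. va j F)" by simp
  have inj: "inj_on H {c'. c' < c}" using h_H by (metis inj_onI)
  have "(\<Sum>l<i. va j (H (unrank l))) = (\<Sum>c'\<in>{c'. c' < c}. va j (H c'))"
    using sum.reindex_bij_betw[OF below_bij[of c], of "\<lambda>c'. va j (H c')"] by (simp add: rc)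
  also have "\<dots> = (\<Sum>F\<in>?B. va j F)" by (simp add: sum.reindex[OF inj])
  finally have s2: "(\<Sum>l<i. va j (H (unrank l))) = (\<Sum>F\<in>?B. va j F)" .
  have sub: "?A \<union> ?B \<subseteq> facets" using H_facet by (auto simp: facets_def)
  have fin: "finite (?A \<union> ?B)" using sub finite_facets finite_subset by blast
  have "(\<Sum>F\<in>?A. va j F) + (\<Sum>F\<in>?B. va j F) = (\<Sum>F\<in>?A \<union> ?B. va j F)"
    using fin h_H by (intro sum.union_disjoint[symmetric]) auto
  moreover have "(\<Sum>F\<in>?A \<union> ?B. va j F) \<simeq> 0"
  proof (rule C.Var_sum_trivial[OF fin character_chi])
    fix g assume "g \<in> Gam"
    then obtain s A where g: "g = flips s A" and A: "even_set (A j)" unfolding Gam_def by blast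
    have "(\<Sum>F\<in>?A \<union> ?B. chi j F g) = (\<Sum>F\<in>?A \<union> ?B. of_bool (F \<in> A j))"
      unfolding g using sub chi_flips by (intro sum.cong) auto
    also have "\<dots> = 0" by (rule bit_sum_of_bool[OF fin even_set_row[OF A]])
    finally show "(\<Sum>F\<in>?A \<union> ?B. chi j F g) = 0" .
  qed
  ultimately show ?thesis unfolding s1 s2 by simp
qed

lemma facet_ring_va:
  "facet_ring eqv facets (\<lambda>F. rank (h F)) (\<lambda>i. H (unrank i)) CARD('n) DIM('k) k (va j)"
proof (intro facet_ring.intro facet_ring_axioms.intro)
  show "ring_cong eqv" by (rule lin_eqv.ring_cong_axioms)
  show "rank (h F) < CARD('n)" for F using rank_bij by (auto simp: bij_betw_def)
  show "va j F ^ DIM('k) * va j G ^ DIM('k) \<simeq> 0" if "F \<in> facets" "G \<in> facets" "F \<noteq> G" "rank (h F) = rank (h G)" for F G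
    using that rank_iff(2) by (intro va_orth) auto
qed (use dim card_n finite_facets H_facet h_H rank_unrank va_row in \<open>auto simp: facets_def\<close>)

lemma W_eqv: "facet_ring.W facets DIM('k) (va j) (vc Time) \<simeq> (\<Prod>c\<in>dir_set j. vc c)"
proof -
  have "(\<Prod>c\<in>dir_set j. vc c) = (\<Prod>F\<in>facets. \<Prod>b\<in>Basis. vc (Dir j F b))"
    unfolding dir_set_def by (subst prod.reindex) (auto simp: inj_on_def comp_def case_prod_unfold prod.cartesian_product)
  then show ?thesis unfolding facet_ring.W_def[OF facet_ring_va]
    by (simp only:) (intro lin_eqv.eqv_prod power_Basis va_Dir)
qed

lemma Theta_eqv: "(\<Prod>i<CARD('n) - 1. va j (H (unrank i)) ^ DIM('k)) \<simeq> (\<Prod>c\<in>pole_set j. vc c)"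
proof -
  have "inj_on H A" for A using h_H by (metis inj_onI)
  then have "(\<Prod>c\<in>pole_set j. vc c) = (\<Prod>i\<in>UNIV - {top}. \<Prod>b\<in>Basis. vc (Base j (H i) b))"
    using h_H unfolding pole_set_def by (subst prod.reindex)
      (auto simp: inj_on_def comp_def case_prod_unfold prod.cartesian_product)
  moreover have "{c'. c' < top} = UNIV - {top}" using Max_ge[OF finite, of _ UNIV] by (auto simp: less_le)
  then have "(\<Prod>i<CARD('n) - 1. va j (H (unrank i)) ^ DIM('k)) = (\<Prod>i\<in>UNIV - {top}. va j (H i) ^ DIM('k))"
    using prod.reindex_bij_betw[OF below_bij[of top], of "\<lambda>i. va j (H i) ^ DIM('k)"] by (simp add: rank_Max)
  moreover have "(\<Prod>i\<in>UNIV - {top}. va j (H i) ^ DIM('k)) \<simeq> (\<Prod>i\<in>UNIV - {top}. \<Prod>b\<in>Basis. vc (Base j (H i) b))"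
    using H_not_F0 by (intro lin_eqv.eqv_prod va_power) auto
  ultimately show ?thesis by simp
qed

text \<open>The directions and the time lie on a sphere and do not vanish together.\<close>

lemma W_relation:
  "facet_ring.W facets DIM('k) (va True) (vc Time) * facet_ring.W facets DIM('k) (va False) (vc Time) * vc Time \<simeq> 0"
proof -
  have "face Om (insert Time (dir_set True \<union> dir_set False)) = {}"
  proof -
    have "\<forall>j. \<forall>F\<in>facets. \<forall>b\<in>Basis. Dir j F b \<in> insert Time (dir_set True \<union> dir_set False)"
      by (auto simp: all_bool_eq dir_set_def image_iff)
    then show ?thesis using face_Om[of "insert Time (dir_set True \<union> dir_set False)"] by blast
  qed
  then have "(\<Prod>c\<in>insert Time (dir_set True \<union> dir_set False). vc c) \<simeq> 0" by (intro prod_vc_eqv_0) (auto simp: dir_set_def)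
  moreover have "(\<Prod>c\<in>insert Time (dir_set True \<union> dir_set False). vc c) = (\<Prod>c\<in>dir_set True. vc c) * (\<Prod>c\<in>dir_set False. vc c) * vc Time"
    using finite_sets disjoint_sets(2) mem_vertex_set(3)
    by (subst prod.insert) (auto simp: vertex_set_def prod.union_disjoint mult_ac)
  moreover have "facet_ring.W facets DIM('k) (va True) (vc Time) * facet_ring.W facets DIM('k) (va False) (vc Time) * vc Time \<simeq>
      (\<Prod>c\<in>dir_set True. vc c) * (\<Prod>c\<in>dir_set False. vc c) * vc Time"
    by (intro lin_eqv.eqv_mult W_eqv lin_eqv.eqv_refl)
  ultimately show ?thesis using lin_eqv.eqv_trans by (simp only:) blast
qed

text \<open>\<open>top_power\<close> turns the power of the class of \<open>Time\<close> into the
  product of all direction coordinates and of the base coordinates of the \<open>H i\<close> of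
  smaller color. With the imaginary coordinates \<open>rs\<close> this is the product over
  \<open>vertex_set\<close>, whose evaluation is one.\<close>

lemma vertex_class:
  assumes rs: "set rs = rest_set True \<union> rest_set False" "distinct rs"
    and K: "K = DIM('k) * (card facets + CARD('n) - 1 + (card facets + CARD('n) - 1))"
  shows "C.E {} (replicate K (coord_char Time) @ map coord_char rs) = 1"
proof -
  let ?W = "\<lambda>j. facet_ring.W facets DIM('k) (va j) (vc Time)"
  let ?T = "\<lambda>j. \<Prod>i<CARD('n) - 1. va j (H (unrank i)) ^ DIM('k)"
  let ?Q = "\<Prod>c\<in>rest_set True \<union> rest_set False. vc c"
  have "vc Time ^ K \<simeq> ?W True * ?W False * ?T True * ?T False"
    unfolding K by (rule top_power[OF facet_ring_va facet_ring_va W_relation])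
  also have "?W True * ?W False * ?T True * ?T False \<simeq>
      (\<Prod>c\<in>dir_set True. vc c) * (\<Prod>c\<in>dir_set False. vc c) * (\<Prod>c\<in>pole_set True. vc c) * (\<Prod>c\<in>pole_set False. vc c)"
    by (intro lin_eqv.eqv_mult W_eqv Theta_eqv)
  finally have "vc Time ^ K * ?Q \<simeq>
      (\<Prod>c\<in>dir_set True. vc c) * (\<Prod>c\<in>dir_set False. vc c) * (\<Prod>c\<in>pole_set True. vc c) * (\<Prod>c\<in>pole_set False. vc c) * ?Q"
    by (intro lin_eqv.eqv_mult lin_eqv.eqv_refl)
  also have "\<dots> = (\<Prod>c\<in>vertex_set. vc c)"
    using finite_sets disjoint_sets unfolding vertex_set_def by (simp add: prod.union_disjoint mult.assoc)
  finally have "lin C.Em (vc Time ^ K * ?Q) = lin C.Em (\<Prod>c\<in>vertex_set. vc c)" by (rule lin_eqv_lin)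
  also have "\<dots> = 1"
    unfolding coord_char_fun using dim
    by (intro C.lin_prod_coords vertex_set_sub card_vertex_set face_vertex_set vertex_set_cut vertex_set_generator)
  finally have one: "lin C.Em (vc Time ^ K * ?Q) = 1" .
  let ?\<kappa>s = "replicate K (coord_char Time) @ map coord_char rs"
  have "vc Time ^ K * ?Q = prod_list (map Var ?\<kappa>s)"
    unfolding rs(1)[symmetric] C.prod_coords[OF rs(2)] by simp
  then have "C.Em (mset ?\<kappa>s) = 1" using one unfolding prod_Var by (simp only: C.lin_single)
  \<comment> \<open>A nonzero value of the functional forces the right degree.\<close>
  moreover from this have "length ?\<kappa>s = Dm" unfolding C.Em_def by (simp split: if_splits)
  then have "C.Em (mset ?\<kappa>s) = C.E {} ?\<kappa>s"
    by (rule C.Em_mset) (use character_coord_char in auto)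
  ultimately show ?thesis by (simp only:)
qed

end

section \<open>The lower bound for the dimension\<close>

context skew_pair
begin

lemma dimension_bound:
  assumes card_n: "CARD('n) = 2 ^ k" and dim: "DIM('k) \<in> {1, 2}"
  shows "4 * DIM('k) * CARD('n) < N + 2 * DIM('k)"
proof (rule ccontr)
  assume neg: "\<not> ?thesis"
  \<comment> \<open>The dimension m of the projectivized bundle; it is to be shown that
    \<open>N \<le> L\<close> is impossible.\<close>
  define L where "L = 4 * DIM('k) * CARD('n) - 2 * DIM('k)"
  have NL: "N \<le> L" using neg by (simp add: L_def)
  let ?U = "SIGMA j:UNIV. (facets - facets_at (vb j)) \<times> (Basis :: 'k set)"
  have "finite ?U" using finite_facets by (intro finite_SigmaI) auto
  then obtain us where us: "set us = ?U" "distinct us" using finite_distinct_list by blast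
  obtain rs where rs: "set rs = rest_set True \<union> rest_set False" "distinct rs"
    using finite_distinct_list[of "rest_set True \<union> rest_set False"] finite_sets by blast
  have "card (facets - facets_at (vb j)) = card facets - CARD('n)" for j
    using card_Diff_subset[of "facets_at (vb j)" facets] finite_facets_at card_facets_at[OF vb] by (simp add: facets_at_def)
  then have len_us: "length us = 2 * ((card facets - CARD('n)) * DIM('k))"
    using distinct_card[OF us(2)] us(1) finite_facets by (simp add: card_SigmaI UNIV_bool card_cartesian_product)
  have len_rs: "length rs = 2 * ((card facets - CARD('n)) * (DIM('k) - 1))"
    using distinct_card[OF rs(2)] rs(1) finite_sets disjoint_sets by (simp add: card_Un_disjoint card_sets)
  have arith: "4 * d * n - 2 * d + 2 * ((r - n) * d) = d * (r + n - 1 + (r + n - 1))"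
    "d * (r + n - 1 + (r + n - 1)) + 2 * ((r - n) * (d - 1)) =
      2 * (n - 1) + 2 * ((r - 1) * d) + 2 * (r * d) - 2 * (r - 1)"
    if "n \<le> r" "0 < n" "d \<in> {1, 2}" for r n d :: nat
    using that by auto
  define K where "K = L + length us"
  have K: "K = DIM('k) * (card facets + CARD('n) - 1 + (card facets + CARD('n) - 1))"
    unfolding K_def L_def len_us by (rule arith(1)[OF card_facets_ge dim])
  \<comment> \<open>The \<open>tf\<close> and the \<open>nf\<close> have the character of
    \<open>Time\<close> and account for its power \<open>K\<close>; the coordinates
    \<open>rs\<close> complete the number to \<open>Dm\<close>.\<close>
  define fs where "fs = map (\<lambda>i. (coord_char Time, tf i)) [0..<L] @ map (\<lambda>t. (coord_char Time, nf t)) us @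
    map (\<lambda>c. (coord_char c, \<lambda>x. x c)) rs"
  have fst_fs: "map fst fs = replicate K (coord_char Time) @ map coord_char rs"
    by (simp add: fs_def K_def comp_def map_replicate_const replicate_add)
  have len: "length fs = Dm"
  proof -
    have "length fs = K + length rs" by (simp add: fs_def K_def)
    then show ?thesis unfolding K len_rs Dm_eq using arith(2)[OF card_facets_ge dim] by simp
  qed
  have "\<exists>\<epsilon>>0. \<forall>z. G.chain_system \<epsilon> z \<longrightarrow> gauge_chain.E Co Om Gam z {} (map fst fs) = 0"
  proof (rule G.equivariant_no_zero[OF len])
    show "G.character \<kappa> \<and> G.equivariant \<kappa> u" if "(\<kappa>, u) \<in> set fs" for \<kappa> u
      using that equivariant_tf equivariant_nf equivariant_coord character_coord_char by (auto simp: fs_def)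
    fix x assume x: "x \<in> G.X"
    have "\<exists>u\<in>snd ` set fs. stable_sign u x"
      using no_common_zero[OF x]
    proof (elim disjE exE conjE)
      fix j F b assume "F \<in> facets - facets_at (vb j)" "b \<in> (Basis :: 'k set)" "stable_sign (nf (j, F, b)) x"
      moreover from this have "(coord_char Time, nf (j, F, b)) \<in> set fs" unfolding fs_def using us(1) by auto
      ultimately show ?thesis by force
    next
      fix i assume "i < N" "stable_sign (tf i) x"
      moreover from this have "(coord_char Time, tf i) \<in> set fs" unfolding fs_def using NL by auto
      ultimately show ?thesis by force
    qed
    then obtain j where "j < Dm" "stable_sign (snd (fs ! j)) x" by (auto simp: in_set_conv_nth len)
    then show "\<exists>j<Dm. \<exists>\<sigma>\<in>{1, - 1}. \<forall>a. (\<forall>m. a m \<in> G.X) \<longrightarrow> G.converges a x \<longrightarrow>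
        (\<exists>r. strict_mono (r :: nat \<Rightarrow> nat) \<and> (\<forall>m. \<sigma> * snd (fs ! j) (a (r m)) > 0))"
      unfolding stable_sign_def by blast
  qed
  then obtain \<epsilon> where \<epsilon>: "\<epsilon> > 0" "\<And>z. G.chain_system \<epsilon> z \<Longrightarrow> gauge_chain.E Co Om Gam z {} (map fst fs) = 0" by blast
  obtain z where z: "G.chain_system \<epsilon> z" using G.chain_system_exists[OF \<epsilon>(1)] by blast
  interpret skew_chain P h H N f V V' F' k \<epsilon> z by unfold_locales (rule card_n dim z)+
  show False using vertex_class[OF rs K] \<epsilon>(2)[OF z] unfolding fst_fs by simp
qed

end

lemma totally_skew_bound:
  fixes f :: "(('k::{real_normed_field,euclidean_space}, 'n::{finite,linorder}) vec \<times> 'a::euclidean_space) set \<Rightarrow> nat \<Rightarrow> real"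
  assumes "CARD('n) = 2 ^ k" "DIM('k) \<in> {1, 2}" "(1::'k) \<in> Basis"
    and "simple_polytope CARD('n) P" "proper_coloring P h" and V: "V extreme_point_of P"
    and H: "\<And>i. H i facet_of P" "\<And>i. h (H i) = i" "(\<Inter>i. H i) = {V}"
    and "totally_skew_embedding (torus_quotient P (char_vector h H))
      (standard_atlas P h (char_vector h H) :: ((('k, 'n) vec \<times> 'a) set, ('k, 'n) vec) chart set) N f"
  shows "4 * DIM('k) * CARD('n) < N + 2 * DIM('k)"
proof -
  interpret skew_embedding P h H N f by unfold_locales (rule assms)+
  have "range H \<subseteq> facets_at V" using H(1,3) by (auto simp: facets_at_def facets_def)
  moreover have "inj H" using H(2) by (metis injI)
  then have "card (range H) = card (facets_at V)" by (simp add: card_image card_facets_at[OF V])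
  ultimately have VH: "facets_at V = range H" using card_subset_eq[OF finite_facets_at] by blast
  then obtain V' F' where "V' extreme_point_of P" "F' \<notin> facets_at V" "facets_at V' = insert F' (facets_at V - {H (Max UNIV)})"
    using opposite_vertex[OF V, of "H (Max UNIV)"] by blast
  then interpret skew_pair P h H N f V V' F' by unfold_locales (use assms VH in auto)
  show ?thesis by (rule dimension_bound[OF assms(1,2)])
qed

lemma enat_le_skew_dim:
  assumes "\<And>N f. totally_skew_embedding X \<A> N f \<Longrightarrow> n \<le> N"
  shows "enat n \<le> skew_dim X \<A>"
  unfolding skew_dim_def by (rule Inf_greatest) (use assms in auto)

theorem corollary1p1:
  fixes P :: "'a::euclidean_space set"
    and h :: "'a set \<Rightarrow> 'n::{finite,linorder}"
    and H :: "'n \<Rightarrow> 'a set"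
    and V :: 'a
    and k :: nat
  assumes "CARD('n) = 2 ^ k"
    and "simple_polytope CARD('n) P"
    and "proper_coloring P h"
    and "V extreme_point_of P"
    and "\<And>i. H i facet_of P"
    and "\<And>i. h (H i) = i"
    and "(\<Inter>i. H i) = {V}"
  shows "skew_dim (torus_quotient P (char_vector h H))
           (standard_atlas P h (char_vector h H) :: (((real ^ 'n::{finite,linorder}) \<times> 'a) set, real ^ 'n::{finite,linorder}) chart set)
         \<ge> enat (4 * CARD('n) - 1) \<and>
         skew_dim (torus_quotient P (char_vector h H))
           (standard_atlas P h (char_vector h H) :: (((complex ^ 'n::{finite,linorder}) \<times> 'a) set, complex ^ 'n::{finite,linorder}) chart set)
         \<ge> enat (8 * CARD('n) - 3)"
proof (intro conjI enat_le_skew_dim)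
  fix N and f :: "((real, 'n) vec \<times> 'a) set \<Rightarrow> nat \<Rightarrow> real"
  assume "totally_skew_embedding (torus_quotient P (char_vector h H)) (standard_atlas P h (char_vector h H)) N f"
  from totally_skew_bound[OF assms(1) _ _ assms(2-7) this] show "4 * CARD('n) - 1 \<le> N" by simp
next
  fix N and f :: "((complex, 'n) vec \<times> 'a) set \<Rightarrow> nat \<Rightarrow> real"
  assume "totally_skew_embedding (torus_quotient P (char_vector h H)) (standard_atlas P h (char_vector h H)) N f"
  from totally_skew_bound[OF assms(1) _ _ assms(2-7) this] show "8 * CARD('n) - 3 \<le> N"
    by (simp add: Basis_complex_def)
qed

end
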